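(* Suppose that $k\ge2$ and $\Omega$ is a bounded domain in $\mathbb R^{kn}$ with smooth boundary such that $\mathbb R^{kn}\setminus\overline\Omega$ is connected. If $f$ is a smooth ($\mathbb S^+$-valued) tangentially monogenic function on $\partial\Omega$, then there exists a monogenic function $\tilde f\in\mathcal O(\Omega)$, smooth up to the boundary, such that $\tilde f=f$ on $\partial\Omega$.
   Context: Spinors. $\mathbb S^\pm$ are the two spinor modules of the real Clifford algebra generated by $e_1,\dots,e_n$ with $e_ie_j+e_je_i=-2\delta_{ij}$ when $n$ is even; for $n$ odd the same symbols are used with the convention that $\mathbb S^+$ and $\mathbb S^-$ are isomorphic (copies of the spinor module). $\gamma_j:\mathbb S^\pm\to\mathbb S^\mp$ denotes the action of $e_j$, so $\gamma_i\gamma_j+\gamma_j\gamma_i=-2\delta_{ij}\mathrm{Id}$; $\mathbb S^\pm$ carry the standard inner products, for which $\gamma_j^*=-\gamma_j$. Operators. Points of $\mathbb R^{kn}$ are $(\mathbf x_0,\dots,\mathbf x_{k-1})$, $\mathbf x_A=(x_{A1},\dots,x_{An})$; $\partial_{Aj}=\partial/\partial x_{Aj}$; $\nabla_A=\sum_{j=1}^n\gamma_j\partial_{Aj}$, and for a scalar function $\phi$, $\nabla_A\phi=\sum_j\gamma_j\partial_{Aj}\phi$ (an endomorphism $\mathbb S^\pm\to\mathbb S^\mp$). $\Gamma(U,E)$ denotes smooth $E$-valued functions and $\Gamma_c$ those with compact support. $\mathcal D_0f=(\nabla_Af)_{A=0}^{k-1}$ for $\mathbb S^+$-valued $f$. A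 function $f\in\Gamma(\Omega,\mathbb S^+)$ is monogenic on $\Omega$ if $\mathcal D_0f=0$ on $\Omega$; $\mathcal O(\Omega)$ is the space of monogenic functions. Let $\mathcal V_1=\mathbb C^k\otimes\mathbb S^-$ and let $\mathcal V_2=V_{210\dots}\otimes\mathbb S^-$, where $V_{210\dots}\subset\otimes^3\mathbb C^k$ is the image of $C_{21}(h)_{ABC}=\frac13(h_{ABC}+h_{ACB}-h_{CBA}-h_{BCA})$. For $F=(F_A)\in\Gamma(U,\mathcal V_1)$ put $(\mathcal D_1F)_{ABC}=\frac12\big(\nabla_A\nabla_BF_C+\nabla_A\nabla_CF_B-(\nabla_B\nabla_C+\nabla_C\nabla_B)F_A\big)$, which is $\mathcal V_2$-valued. $\mathcal D_1^*$ is the formal adjoint of $\mathcal D_1$ for the $L^2$ inner products given by $\langle f,G\rangle=\sum_{A_1,\dots,A_m}\langle f_{A_1\dots A_m},G_{A_1\dots A_m}\rangle_{\mathbb S^\pm}$ and Lebesgue measure. Tangential monogenicity. For an open set $U$, $\mathcal J_1(U)$ is the space of all $g\in\Gamma(U,\mathcal V_1)$ with zero Cauchy data on $\partial\Omega$ for $\mathcal D_1$, i.e. $\int_\Omega\langle\mathcal D_1g,h\rangle dV=\int_\Omega\langle g,\mathcal D_1^*h\rangle dV$ for all $h\in\Gamma_c(U,\mathcal V_2)$. The tangential several Dirac operator $\mathscr D_0$ is the operator induced on $\partial\Omega$ by $\mathcal D_0$ with values modulo $\mathcal J_1$, and a smooth $\hat f:\partial\Omega\to\mathbb S^+$ is tangentially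 monogenic if $\mathscr D_0\hat f=0$, i.e. if $\mathcal D_0\tilde f\in\mathcal J_1(U)$ for a (equivalently any) smooth extension $\tilde f$ of $\hat f$ to an open neighbourhood $U$ of $\partial\Omega$. Explicitly: near a boundary point, after relabelling coordinates, $\partial\Omega=\{\phi=0\}$ with $\phi(\mathbf x)=x_{01}-\rho(x_{02},\dots,x_{(k-1)n})$, $\rho$ smooth; put $Z_\mu=\nabla_\mu-\nabla_\mu\phi(\nabla_0\phi)^{-1}\nabla_0$ for $\mu=1,\dots,k-1$, and $T=(\nabla_0\phi)^{-1}\nabla_0-\partial_{01}$; these are tangential to the level sets of $\phi$, and, $\hat f$ being regarded as a function independent of $x_{01}$, the condition is $Z_\mu\hat f=0$ and $Z_\mu T\hat f=0$ for $\mu=1,\dots,k-1$. *)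

theory Defs
  imports "HOL-Analysis.Analysis"
begin

section \<open>Smooth functions\<close>

text \<open>Only used for open \<open>U\<close>.\<close>

primrec Cm_on :: "nat \<Rightarrow> 'a::real_normed_vector set \<Rightarrow> ('a \<Rightarrow> 'b::real_normed_vector) \<Rightarrow> bool" where
  "Cm_on 0 U f \<longleftrightarrow> continuous_on U f"
| "Cm_on (Suc m) U f \<longleftrightarrow>
     (\<forall>x\<in>U. f differentiable (at x)) \<and>
     (\<forall>v. Cm_on m U (\<lambda>x. frechet_derivative f (at x) v))"

definition smooth_on :: "'a::real_normed_vector set \<Rightarrow> ('a \<Rightarrow> 'b::real_normed_vector) \<Rightarrow> bool" where
  "smooth_on U f \<longleftrightarrow> (\<forall>m. Cm_on m U f)"

definition iterated_deriv ::
    "'a::real_normed_vector list \<Rightarrow> ('a \<Rightarrow> 'b::real_normed_vector) \<Rightarrow> 'a \<Rightarrow> 'b" where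
  "iterated_deriv vs f = foldr (\<lambda>v g x. frechet_derivative g (at x) v) vs f"

text \<open>Smoothness up to the boundary of an open set: every iterated derivative extends
  continuously to the closure, and the function itself attains its boundary values.\<close>

definition smooth_up_to_boundary ::
    "'a::real_normed_vector set \<Rightarrow> ('a \<Rightarrow> 'b::real_normed_vector) \<Rightarrow> bool" where
  "smooth_up_to_boundary \<Omega> f \<longleftrightarrow>
     smooth_on \<Omega> f \<and> continuous_on (closure \<Omega>) f \<and>
     (\<forall>vs. \<exists>G. continuous_on (closure \<Omega>) G \<and> (\<forall>x\<in>\<Omega>. G x = iterated_deriv vs f x))"

definition smooth_boundary :: "'a::real_normed_vector set \<Rightarrow> bool" where
  "smooth_boundary \<Omega> \<longleftrightarrow>
     (\<forall>p\<in>frontier \<Omega>. \<exists>W \<phi>. open W \<and> p \<in> W \<and> smooth_on W (\<phi> :: 'a \<Rightarrow> real) \<and>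
        (\<forall>x\<in>W. \<exists>v. frechet_derivative \<phi> (at x) v \<noteq> 0) \<and>
        \<Omega> \<inter> W = {x\<in>W. \<phi> x < 0} \<and> frontier \<Omega> \<inter> W = {x\<in>W. \<phi> x = 0})"

text \<open>Values of the following total functions outside \<open>U\<close> are irrelevant. A compactly
  supported section over \<open>U\<close> is represented by its extension by zero, which is smooth on
  the whole space.\<close>

definition sections ::
    "'a::real_normed_vector set \<Rightarrow> 'b::real_normed_vector set \<Rightarrow> ('a \<Rightarrow> 'b) set" where
  "sections U E = {f. smooth_on U f \<and> (\<forall>x\<in>U. f x \<in> E)}"

definition compact_sections ::
    "'a::real_normed_vector set \<Rightarrow> 'b::real_normed_vector set \<Rightarrow> ('a \<Rightarrow> 'b) set" where
  "compact_sections U E =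
     {f \<in> sections UNIV E. compact (closure {x. f x \<noteq> 0}) \<and> closure {x. f x \<noteq> 0} \<subseteq> U}"

text \<open>Smooth functions on a hypersurface \<open>S\<close>, i.e. local restrictions of smooth functions of
  the ambient space.\<close>

definition hypersurface_sections ::
    "'a::real_normed_vector set \<Rightarrow> 'b::real_normed_vector set \<Rightarrow> ('a \<Rightarrow> 'b) set" where
  "hypersurface_sections S E =
     {f. (\<forall>x\<in>S. f x \<in> E) \<and>
         (\<forall>p\<in>S. \<exists>W g. open W \<and> p \<in> W \<and> smooth_on W g \<and> (\<forall>x\<in>W \<inter> S. g x = f x))}"


section \<open>Spinor modules\<close>

definition cinner :: "complex^'s \<Rightarrow> complex^'s \<Rightarrow> complex" where
  "cinner u v = (\<Sum>i\<in>UNIV. u $ i * cnj (v $ i))"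

text \<open>An irreducible complex module of the real Clifford algebra of \<open>\<real>\<^sup>n\<close>, realised on
  \<open>complex^'s\<close> in an orthonormal basis of its inner product; \<open>\<gamma> j\<close> is the action of
  \<open>e\<^sub>j\<close>. Note that \<open>vec.subspace\<close> refers to complex subspaces.\<close>

definition spinor_module :: "('n::finite \<Rightarrow> complex^'s^'s) \<Rightarrow> bool" where
  "spinor_module \<gamma> \<longleftrightarrow>
     (\<forall>i j. \<gamma> i ** \<gamma> j + \<gamma> j ** \<gamma> i = (if i = j then - 2 else 0) *\<^sub>R mat 1) \<and>
     (\<forall>j u v. cinner (\<gamma> j *v u) v = - cinner u (\<gamma> j *v v)) \<and>
     (\<forall>V. vec.subspace V \<and> (\<forall>j. \<forall>v\<in>V. \<gamma> j *v v \<in> V) \<longrightarrow> V = {0} \<or> V = UNIV)"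

text \<open>For \<open>n\<close> even the complex volume element \<open>\<i>\<^bsup>n/2\<^esup> e\<^sub>1 \<cdots> e\<^sub>n\<close> squares to \<open>1\<close> and
  anticommutes with every \<open>e\<^sub>j\<close>; the two half-spinor modules are its eigenspaces for \<open>1\<close>
  and \<open>-1\<close>. For \<open>n\<close> odd both symbols stand for the whole spinor module. In all cases
  \<open>\<gamma> j\<close> exchanges the two spaces, so one operator \<open>\<gamma> j *v _\<close> serves both.\<close>

definition chirality :: "('n::{finite,linorder} \<Rightarrow> complex^'s^'s) \<Rightarrow> complex^'s \<Rightarrow> complex^'s" where
  "chirality \<gamma> u =
     (\<i> ^ (CARD('n) div 2)) *s
       (foldr (\<lambda>j M. \<gamma> j ** M) (sorted_list_of_set (UNIV :: 'n set)) (mat 1) *v u)"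

definition spinor_plus :: "('n::{finite,linorder} \<Rightarrow> complex^'s^'s) \<Rightarrow> (complex^'s) set" where
  "spinor_plus \<gamma> = (if even CARD('n) then {u. chirality \<gamma> u = u} else UNIV)"

definition spinor_minus :: "('n::{finite,linorder} \<Rightarrow> complex^'s^'s) \<Rightarrow> (complex^'s) set" where
  "spinor_minus \<gamma> = (if even CARD('n) then {u. chirality \<gamma> u = - u} else UNIV)"


section \<open>The operators\<close>

text \<open>A point of \<open>\<real>\<^bsup>kn\<^esup>\<close> is \<open>x :: real^'n^'k\<close> with coordinates \<open>x $ A $ j\<close>.\<close>

definition pd :: "'k::finite \<Rightarrow> 'n::finite \<Rightarrow> (real^'n^'k \<Rightarrow> 'b::real_normed_vector) \<Rightarrow> real^'n^'k \<Rightarrow> 'b" where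
  "pd A j f x = frechet_derivative f (at x) (axis A (axis j 1))"

definition nabla ::
    "('n::finite \<Rightarrow> complex^'s^'s) \<Rightarrow> 'k::finite \<Rightarrow>
     (real^'n^'k \<Rightarrow> complex^'s) \<Rightarrow> real^'n^'k \<Rightarrow> complex^'s" where
  "nabla \<gamma> A f x = (\<Sum>j\<in>UNIV. \<gamma> j *v pd A j f x)"

definition D0 ::
    "('n::finite \<Rightarrow> complex^'s^'s) \<Rightarrow>
     (real^'n^'k::finite \<Rightarrow> complex^'s) \<Rightarrow> real^'n^'k \<Rightarrow> complex^'s^'k" where
  "D0 \<gamma> f x = (\<chi> A. nabla \<gamma> A f x)"

definition D1 ::
    "('n::finite \<Rightarrow> complex^'s^'s) \<Rightarrow>
     (real^'n^'k::finite \<Rightarrow> complex^'s^'k) \<Rightarrow> real^'n^'k \<Rightarrow> complex^'s^'k^'k^'k" where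
  "D1 \<gamma> F x = (\<chi> A B C. (1/2) *\<^sub>R
      (nabla \<gamma> A (nabla \<gamma> B (\<lambda>y. F y $ C)) x
     + nabla \<gamma> A (nabla \<gamma> C (\<lambda>y. F y $ B)) x
     - (nabla \<gamma> B (nabla \<gamma> C (\<lambda>y. F y $ A)) x
      + nabla \<gamma> C (nabla \<gamma> B (\<lambda>y. F y $ A)) x)))"

text \<open>A tensor in \<open>\<complex>\<^sup>k \<otimes> S\<close> or \<open>(\<Otimes>\<^sup>3 \<complex>\<^sup>k) \<otimes> S\<close> is the array of its \<open>S\<close>-valued
  components; \<open>C21\<close> is the projector on \<open>\<Otimes>\<^sup>3 \<complex>\<^sup>k\<close> tensored with the identity of \<open>S\<close>, so that
  its image is \<open>V\<^sub>2\<^sub>1\<^sub>0 \<otimes> S\<close>.\<close>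

definition C21 :: "complex^'s^'k^'k^'k \<Rightarrow> complex^'s^'k^'k^'k" where
  "C21 h = (\<chi> A B C. (1/3) *\<^sub>R (h$A$B$C + h$A$C$B - h$C$B$A - h$B$C$A))"

definition V1 :: "('n::{finite,linorder} \<Rightarrow> complex^'s^'s) \<Rightarrow> (complex^'s^'k) set" where
  "V1 \<gamma> = {F. \<forall>A. F$A \<in> spinor_minus \<gamma>}"

definition V2 :: "('n::{finite,linorder} \<Rightarrow> complex^'s^'s) \<Rightarrow> (complex^'s^'k^'k^'k) set" where
  "V2 \<gamma> = C21 ` {h. \<forall>A B C. h$A$B$C \<in> spinor_minus \<gamma>}"

definition cinner1 :: "complex^'s^'k \<Rightarrow> complex^'s^'k \<Rightarrow> complex" where
  "cinner1 F G = (\<Sum>A\<in>UNIV. cinner (F$A) (G$A))"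

definition cinner3 :: "complex^'s^'k^'k^'k \<Rightarrow> complex^'s^'k^'k^'k \<Rightarrow> complex" where
  "cinner3 g h = (\<Sum>A\<in>UNIV. \<Sum>B\<in>UNIV. \<Sum>C\<in>UNIV. cinner (g$A$B$C) (h$A$B$C))"

text \<open>The formal adjoint of \<open>D1\<close>. The smooth \<open>V1\<close>-valued function \<open>g\<close> below exists (integrate
  by parts, using \<open>\<gamma>\<^sub>j\<^sup>* = - \<gamma>\<^sub>j\<close>) and is unique, for smooth \<open>V2\<close>-valued \<open>h\<close>.\<close>

definition D1_adjoint ::
    "('n::{finite,linorder} \<Rightarrow> complex^'s^'s) \<Rightarrow>
     (real^'n::{finite,linorder}^'k::finite \<Rightarrow> complex^'s^'k^'k^'k) \<Rightarrow> real^'n::{finite,linorder}^'k \<Rightarrow> complex^'s^'k" where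
  "D1_adjoint \<gamma> h = (THE g. g \<in> sections UNIV (V1 \<gamma>) \<and>
     (\<forall>F \<in> compact_sections UNIV (V1 \<gamma>).
        (LINT x|lborel. cinner3 (D1 \<gamma> F x) (h x)) = (LINT x|lborel. cinner1 (F x) (g x))))"


section \<open>Monogenic and tangentially monogenic functions\<close>

definition monogenic ::
    "('n::{finite,linorder} \<Rightarrow> complex^'s^'s) \<Rightarrow> (real^'n::{finite,linorder}^'k::finite) set \<Rightarrow>
     (real^'n::{finite,linorder}^'k \<Rightarrow> complex^'s) set" where
  "monogenic \<gamma> \<Omega> = {f \<in> sections \<Omega> (spinor_plus \<gamma>). \<forall>x\<in>\<Omega>. D0 \<gamma> f x = 0}"

text \<open>Zero Cauchy data on the boundary of \<open>\<Omega>\<close> for \<open>D1\<close>. As \<open>h\<close> and \<open>D1_adjoint \<gamma> h\<close> vanish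
  outside \<open>U\<close>, so do the integrands, whatever the values of \<open>g\<close> there.\<close>

definition J1 ::
    "('n::{finite,linorder} \<Rightarrow> complex^'s^'s) \<Rightarrow> (real^'n::{finite,linorder}^'k::finite) set \<Rightarrow> (real^'n::{finite,linorder}^'k) set \<Rightarrow>
     (real^'n::{finite,linorder}^'k \<Rightarrow> complex^'s^'k) set" where
  "J1 \<gamma> \<Omega> U = {g \<in> sections U (V1 \<gamma>).
     \<forall>h \<in> compact_sections U (V2 \<gamma>).
       (LINT x:\<Omega>|lborel. cinner3 (D1 \<gamma> g x) (h x)) =
       (LINT x:\<Omega>|lborel. cinner1 (g x) (D1_adjoint \<gamma> h x))}"

definition tangentially_monogenic ::
    "('n::{finite,linorder} \<Rightarrow> complex^'s^'s) \<Rightarrow> (real^'n::{finite,linorder}^'k::finite) set \<Rightarrow>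
     (real^'n::{finite,linorder}^'k \<Rightarrow> complex^'s) \<Rightarrow> bool" where
  "tangentially_monogenic \<gamma> \<Omega> f \<longleftrightarrow>
     (\<exists>U F. open U \<and> frontier \<Omega> \<subseteq> U \<and> F \<in> sections U (spinor_plus \<gamma>) \<and>
        (\<forall>x\<in>frontier \<Omega>. F x = f x) \<and> D0 \<gamma> F \<in> J1 \<gamma> \<Omega> U)"

end

theory Submission
  imports Defs "HOL-Complex_Analysis.Conformal_Mappings"
begin

text \<open>
  The extension is produced by Hartogs' argument. Extend \<open>f\<close> to a smooth \<open>F\<close> near the boundary
  with \<open>D0 F\<close> in \<open>J1\<close>, cut it off to a compactly supported function on the whole space, and let
  \<open>g\<close> be \<open>D0 F\<close> on \<open>\<Omega>\<close> and zero elsewhere. If \<open>u\<close> solves \<open>D0 u = g\<close> and vanishes outside \<open>\<Omega>\<close>,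
  then \<open>F - u\<close> is monogenic on \<open>\<Omega>\<close> and has the boundary values of \<open>F\<close>, that is, of \<open>f\<close>.

  Tangential monogenicity says that \<open>D1 g = 0\<close> holds in the sense of distributions across the
  boundary, where \<open>g\<close> jumps. Tested against suitable sections it becomes
  \<open>\<Delta>\<^sub>B g\<^sub>A + \<nabla>\<^sub>A \<nabla>\<^sub>B g\<^sub>B = 0\<close> for all \<open>A\<close> and \<open>B\<close> (\<open>weak_compat\<close>; for \<open>A = B\<close> this is just
  \<open>\<nabla>\<^sub>A\<^sup>2 = - \<Delta>\<^sub>A\<close>). Let \<open>E\<close> be the Newton potential of the full space, \<open>\<Delta> E = c \<delta>\<close>. Then
  \<open>u = - (1/c) \<Sum>\<^sub>B \<nabla>\<^sub>B (E * g\<^sub>B)\<close> satisfies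
  \<open>\<nabla>\<^sub>A u = - (1/c) E * \<Sum>\<^sub>B \<nabla>\<^sub>A \<nabla>\<^sub>B g\<^sub>B = (1/c) E * \<Sum>\<^sub>B \<Delta>\<^sub>B g\<^sub>A = g\<^sub>A\<close>. To make this classical, \<open>E\<close> is
  replaced by the smooth function \<open>pot t\<close> obtained by writing \<open>|x|\<^sup>2 + t\<close> for \<open>|x|\<^sup>2\<close>: a
  cut-off translate of it is an admissible test function, the computation yields
  \<open>\<nabla>\<^sub>A u\<^sub>t = (1/c) rho t * g\<^sub>A\<close> with the approximate identity \<open>rho t = \<Delta> (pot t)\<close>
  (\<open>nabla_potential_pos\<close>), and \<open>t\<close> tends to zero off the boundary (\<open>nabla_potential\<close>).

  Since \<open>k \<ge> 2\<close>, a point with a very long component \<open>x\<^sub>A\<close> lies on a slice in a direction \<open>x\<^sub>B\<close>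
  that misses \<open>\<Omega>\<close>. There \<open>u\<close> is harmonic in \<open>x\<^sub>B\<close> and decays at infinity, so it is zero by the
  maximum principle (\<open>potential_far\<close>). Along segments outside \<open>closure \<Omega>\<close> the kernel extends
  holomorphically, hence \<open>u\<close> vanishes on the whole connected exterior, and on the boundary by
  continuity (\<open>potential_exterior\<close>).

  Regularity up to the boundary is a statement about the derivatives \<open>\<partial>\<^sub>e E * (1\<^sub>\<Omega> h)\<close> of scalar
  potentials of smooth densities. Let \<open>\<phi>\<close> be a local defining function. The equation \<open>\<Delta> w = h\<close>
  can be solved to any finite order at the boundary with \<open>w\<close> divisible by \<open>\<phi>\<^sup>2\<close>
  (\<open>solve_laplacian_to_order\<close>). The part \<open>\<Delta> w\<close> of the density contributes \<open>c 1\<^sub>\<Omega> \<partial>\<^sub>e w\<close>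
  (\<open>conv_laplacian_flat\<close>), and the remaining density \<open>1\<^sub>\<Omega> \<phi>\<^sup>m r\<close> is as often differentiable as
  one likes, so that its potential is too.
\<close>

section \<open>Calculus of differentiable and smooth functions\<close>

text \<open>The derivative of the point-free calculus below: fixing the direction first turns
  differentiation into an operator on functions that can be iterated.\<close>

definition dderiv :: "'a::real_normed_vector \<Rightarrow> ('a \<Rightarrow> 'b::real_normed_vector) \<Rightarrow> 'a \<Rightarrow> 'b" where
  "dderiv v f x = frechet_derivative f (at x) v"

lemma dderiv_eqI: "(f has_derivative f') (at x) \<Longrightarrow> dderiv v f x = f' v"
  unfolding dderiv_def using frechet_derivative_at by metis

lemma has_derivative_dderiv:
  "f differentiable (at x) \<Longrightarrow> (f has_derivative (\<lambda>v. dderiv v f x)) (at x)"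
  unfolding dderiv_def frechet_derivative_works by simp

lemma Cm_on_Suc_iff:
  "Cm_on (Suc m) U f \<longleftrightarrow> (\<forall>x\<in>U. f differentiable (at x)) \<and> (\<forall>v. Cm_on m U (dderiv v f))"
  unfolding dderiv_def[abs_def] by simp

declare Cm_on.simps(2) [simp del]

lemma dderiv_transform_open:
  assumes "open U" "x \<in> U" "\<And>y. y \<in> U \<Longrightarrow> f y = g y"
  shows "dderiv v f x = dderiv v g x"
proof (cases "f differentiable (at x)")
  case True
  then have "(f has_derivative (\<lambda>v. dderiv v f x)) (at x)" by (rule has_derivative_dderiv)
  then have "(g has_derivative (\<lambda>v. dderiv v f x)) (at x)"
    using has_derivative_transform_within_open assms by blast
  then show ?thesis using dderiv_eqI by metis
next
  case False
  have "(f has_derivative f') (at x) \<longleftrightarrow> (g has_derivative f') (at x)" for f'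
    using has_derivative_transform_within_open[OF _ assms(1,2)] assms(3) by metis
  then show ?thesis unfolding dderiv_def frechet_derivative_def by simp
qed

lemma differentiable_transform_open:
  assumes "open U" "x \<in> U" "\<And>y. y \<in> U \<Longrightarrow> f y = g y" "f differentiable (at x)"
  shows "g differentiable (at x)"
  using assms has_derivative_transform_within_open unfolding differentiable_def by blast

lemma Cm_on_cong:
  assumes "open U" "\<And>x. x \<in> U \<Longrightarrow> f x = g x" "Cm_on m U f"
  shows "Cm_on m U g"
  using assms(2,3)
proof (induction m arbitrary: f g)
  case 0
  then show ?case using continuous_on_cong by force
next
  case (Suc m)
  have "Cm_on m U (dderiv v g)" for v
    using Suc.IH[of "dderiv v f" "dderiv v g"] Suc.prems
      dderiv_transform_open[OF assms(1), of _ f g]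
    unfolding Cm_on_Suc_iff by blast
  moreover have "g differentiable (at x)" if "x \<in> U" for x
    using differentiable_transform_open[OF assms(1) that, of f g] Suc.prems that
    unfolding Cm_on_Suc_iff by blast
  ultimately show ?case unfolding Cm_on_Suc_iff by blast
qed

lemma Cm_on_subset: "Cm_on m U f \<Longrightarrow> V \<subseteq> U \<Longrightarrow> Cm_on m V f"
proof (induction m arbitrary: f)
  case 0
  then show ?case using continuous_on_subset by auto
next
  case (Suc m)
  then show ?case unfolding Cm_on_Suc_iff by blast
qed

lemma Cm_on_local:
  assumes "\<And>p. p \<in> U \<Longrightarrow> \<exists>W. open W \<and> p \<in> W \<and> Cm_on m W f"
  shows "Cm_on m U f"
  using assms
proof (induction m arbitrary: f)
  case 0
  have "continuous (at x within U) f" if "x \<in> U" for x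
    using 0[OF that] continuous_on_eq_continuous_at continuous_at_imp_continuous_at_within
    by (metis Cm_on.simps(1))
  then show ?case unfolding Cm_on.simps continuous_on_eq_continuous_within by blast
next
  case (Suc m)
  have "f differentiable (at x)" if "x \<in> U" for x
    using Suc.prems[OF that] unfolding Cm_on_Suc_iff by blast
  moreover have "Cm_on m U (dderiv v f)" for v
    by (rule Suc.IH) (use Suc.prems in \<open>unfold Cm_on_Suc_iff, blast\<close>)
  ultimately show ?case unfolding Cm_on_Suc_iff by blast
qed

lemma Cm_on_SucD: "Cm_on (Suc m) U f \<Longrightarrow> Cm_on m U f"
proof (induction m arbitrary: f)
  case 0
  then show ?case
    by (auto simp: Cm_on_Suc_iff intro!: continuous_at_imp_continuous_on differentiable_imp_continuous_within)
next
  case (Suc m)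
  then show ?case by (simp add: Cm_on_Suc_iff)
qed

lemma Cm_on_le: "Cm_on n U f \<Longrightarrow> m \<le> n \<Longrightarrow> Cm_on m U f"
proof (induction n)
  case (Suc n)
  then show ?case using Cm_on_SucD le_Suc_eq by metis
qed auto

lemma Cm_on_continuous: "Cm_on m U f \<Longrightarrow> continuous_on U f"
  using Cm_on_le[of m U f 0] by simp

text \<open>The form in which smoothness is always established: the derivative is known in closed
  form on an open set, so that no choice operator has to be unfolded.\<close>

lemma Cm_on_SucI:
  assumes "open U" "\<And>x. x \<in> U \<Longrightarrow> (f has_derivative f' x) (at x)"
    and "\<And>v. Cm_on m U (\<lambda>x. f' x v)"
  shows "Cm_on (Suc m) U f"
proof -
  have "Cm_on m U (dderiv v f)" for v
    by (rule Cm_on_cong[OF assms(1) _ assms(3)[of v]]) (simp add: dderiv_eqI[OF assms(2)])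
  then show ?thesis
    using assms(2) unfolding Cm_on_Suc_iff differentiable_def by blast
qed

lemma Cm_on_const: "Cm_on m U (\<lambda>x. c)"
proof (induction m arbitrary: c)
  case (Suc m)
  have "dderiv v (\<lambda>x::'a. c) = (\<lambda>x. 0)" for v by (rule ext) (rule dderiv_eqI, simp)
  then show ?case using Suc by (simp add: Cm_on_Suc_iff)
qed simp

lemma Cm_on_bounded_linear_compose:
  assumes "bounded_linear L" "open U" "Cm_on m U f"
  shows "Cm_on m U (\<lambda>x. L (f x))"
  using assms(3)
proof (induction m arbitrary: f)
  case 0
  then show ?case
    using assms(1) by (auto intro: bounded_linear.continuous_on)
next
  case (Suc m)
  have d: "f differentiable (at x)" if "x \<in> U" for x using Suc.prems that unfolding Cm_on_Suc_iff by blast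
  show ?case
  proof (rule Cm_on_SucI[OF assms(2)])
    show "((\<lambda>x. L (f x)) has_derivative (\<lambda>v. L (dderiv v f x))) (at x)" if "x \<in> U" for x
      by (rule bounded_linear.has_derivative[OF assms(1) has_derivative_dderiv[OF d[OF that]]])
    show "Cm_on m U (\<lambda>x. L (dderiv v f x))" for v
      by (rule Suc.IH) (use Suc.prems in \<open>unfold Cm_on_Suc_iff, blast\<close>)
  qed
qed

lemma Cm_on_affine_compose:
  assumes "bounded_linear L" "open V" "Cm_on m U f" "\<And>x. x \<in> V \<Longrightarrow> L x + a \<in> U"
  shows "Cm_on m V (\<lambda>x. f (L x + a))"
  using assms(3)
proof (induction m arbitrary: f)
  case 0
  have "continuous_on V (\<lambda>x. L x + a)"
    using assms(1) by (intro continuous_intros bounded_linear.continuous_on[OF assms(1)])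
  then show ?case using 0 assms(4) by (auto intro!: continuous_on_compose2[of U f V])
next
  case (Suc m)
  have d: "((\<lambda>x. f (L x + a)) has_derivative (\<lambda>v. dderiv (L v) f (L x + a))) (at x)" if "x \<in> V" for x
  proof -
    have 1: "((\<lambda>x. L x + a) has_derivative L) (at x)"
      using bounded_linear_imp_has_derivative[OF assms(1)] by (auto intro!: derivative_eq_intros)
    have 2: "(f has_derivative (\<lambda>v. dderiv v f (L x + a))) (at (L x + a))"
      using Suc.prems assms(4)[OF that] by (auto simp: Cm_on_Suc_iff intro: has_derivative_dderiv)
    show ?thesis by (rule has_derivative_compose[OF 1 2])
  qed
  show ?case
  proof (rule Cm_on_SucI[OF assms(2) d])
    show "Cm_on m V (\<lambda>x. dderiv (L v) f (L x + a))" for v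
      by (rule Suc.IH) (use Suc.prems in \<open>unfold Cm_on_Suc_iff, blast\<close>)
  qed
qed

lemma Cm_on_add:
  assumes "open U" "Cm_on m U f" "Cm_on m U g"
  shows "Cm_on m U (\<lambda>x. f x + g x)"
  using assms(2,3)
proof (induction m arbitrary: f g)
  case 0
  then show ?case by (auto intro: continuous_intros)
next
  case (Suc m)
  have d: "f differentiable (at x)" "g differentiable (at x)" if "x \<in> U" for x
    using Suc.prems that unfolding Cm_on_Suc_iff by blast+
  show ?case
  proof (rule Cm_on_SucI[OF assms(1)])
    show "((\<lambda>x. f x + g x) has_derivative (\<lambda>v. dderiv v f x + dderiv v g x)) (at x)" if "x \<in> U" for x
      by (intro has_derivative_add has_derivative_dderiv d that)
    show "Cm_on m U (\<lambda>x. dderiv v f x + dderiv v g x)" for v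
      by (rule Suc.IH) (use Suc.prems in \<open>unfold Cm_on_Suc_iff, blast\<close>)+
  qed
qed

lemma Cm_on_bilinear:
  assumes "bounded_bilinear B" "open U" "Cm_on m U f" "Cm_on m U g"
  shows "Cm_on m U (\<lambda>x. B (f x) (g x))"
  using assms(3,4)
proof (induction m arbitrary: f g)
  case 0
  then show ?case using bounded_bilinear.continuous_on[OF assms(1)] by auto
next
  case (Suc m)
  have m: "Cm_on m U f" "Cm_on m U g" using Suc.prems Cm_on_SucD by auto
  show ?case
  proof (rule Cm_on_SucI[OF assms(2), where f' = "\<lambda>x v. B (f x) (dderiv v g x) + B (dderiv v f x) (g x)"])
    fix x assume "x \<in> U"
    then show "((\<lambda>x. B (f x) (g x)) has_derivative
         (\<lambda>v. B (f x) (dderiv v g x) + B (dderiv v f x) (g x))) (at x)"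
      by (intro bounded_bilinear.FDERIV[OF assms(1)] has_derivative_dderiv)
        (use Suc.prems in \<open>unfold Cm_on_Suc_iff, blast\<close>)+
  next
    fix v
    show "Cm_on m U (\<lambda>x. B (f x) (dderiv v g x) + B (dderiv v f x) (g x))"
      by (intro Cm_on_add assms(2) Suc.IH m) (use Suc.prems in \<open>unfold Cm_on_Suc_iff, blast\<close>)+
  qed
qed

lemma Cm_on_real_compose:
  fixes f :: "'a::real_normed_vector \<Rightarrow> real" and g :: "real \<Rightarrow> 'b::real_normed_vector"
  assumes "open U" "open S" "\<And>x. x \<in> U \<Longrightarrow> f x \<in> S" "Cm_on m U f" "Cm_on m S g"
  shows "Cm_on m U (\<lambda>x. g (f x))"
  using assms(4,5)
proof (induction m arbitrary: g)
  case 0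
  then show ?case using assms(3) by (auto intro!: continuous_on_compose2[of S g U f])
next
  case (Suc m)
  have d: "((\<lambda>x. g (f x)) has_derivative (\<lambda>v. dderiv v f x *\<^sub>R dderiv 1 g (f x))) (at x)" if "x \<in> U" for x
  proof -
    have g: "(g has_derivative (\<lambda>v. dderiv v g (f x))) (at (f x))"
      using Suc.prems assms(3)[OF that] by (auto simp: Cm_on_Suc_iff intro: has_derivative_dderiv)
    have "dderiv v g (f x) = v *\<^sub>R dderiv 1 g (f x)" for v
      using linear_scale[OF has_derivative_linear[OF g], of v 1] by simp
    note sc = this
    have "(f has_derivative (\<lambda>v. dderiv v f x)) (at x)"
      using Suc.prems that by (auto simp: Cm_on_Suc_iff intro: has_derivative_dderiv)
    from has_derivative_compose[OF this g]
    show ?thesis by (subst (asm) sc)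
  qed
  show ?case
  proof (rule Cm_on_SucI[OF assms(1) d])
    fix v
    have "Cm_on m U (\<lambda>x. dderiv 1 g (f x))"
      using Suc.IH[OF Cm_on_SucD[OF Suc.prems(1)]] Suc.prems(2) by (auto simp: Cm_on_Suc_iff)
    then show "Cm_on m U (\<lambda>x. dderiv v f x *\<^sub>R dderiv 1 g (f x))"
      using Suc.prems(1) by (intro Cm_on_bilinear[OF bounded_bilinear_scaleR assms(1)]) (auto simp: Cm_on_Suc_iff)
  qed
qed

lemma smooth_onD: "smooth_on U f \<Longrightarrow> Cm_on m U f" by (simp add: smooth_on_def)

lemma smooth_on_dderiv: "smooth_on U f \<Longrightarrow> smooth_on U (dderiv v f)"
  unfolding smooth_on_def by (metis Cm_on_Suc_iff)

lemma smooth_on_differentiable: "smooth_on U f \<Longrightarrow> x \<in> U \<Longrightarrow> f differentiable (at x)"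
  unfolding smooth_on_def by (metis Cm_on_Suc_iff)

lemma smooth_on_has_derivative:
  "smooth_on U f \<Longrightarrow> x \<in> U \<Longrightarrow> (f has_derivative (\<lambda>v. dderiv v f x)) (at x)"
  by (intro has_derivative_dderiv smooth_on_differentiable)

lemma smooth_on_continuous: "smooth_on U f \<Longrightarrow> continuous_on U f"
  unfolding smooth_on_def by (metis Cm_on_continuous)

lemma smooth_on_cong: "open U \<Longrightarrow> (\<And>x. x \<in> U \<Longrightarrow> f x = g x) \<Longrightarrow> smooth_on U f \<Longrightarrow> smooth_on U g"
  unfolding smooth_on_def using Cm_on_cong[of U f g] by blast

lemma smooth_on_subset: "smooth_on U f \<Longrightarrow> V \<subseteq> U \<Longrightarrow> smooth_on V f"
  unfolding smooth_on_def by (metis Cm_on_subset)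

lemma smooth_on_local:
  assumes "\<And>p. p \<in> U \<Longrightarrow> \<exists>W. open W \<and> p \<in> W \<and> smooth_on W f"
  shows "smooth_on U f"
  unfolding smooth_on_def
  by (intro allI Cm_on_local) (use assms smooth_onD in blast)

lemma smooth_onI:
  assumes "open U" "\<And>x. x \<in> U \<Longrightarrow> (f has_derivative f' x) (at x)"
    and "\<And>v. smooth_on U (\<lambda>x. f' x v)"
  shows "smooth_on U f"
proof -
  have "Cm_on (Suc m) U f" for m
    using Cm_on_SucI[OF assms(1,2)] assms(3) smooth_onD by blast
  then show ?thesis unfolding smooth_on_def by (metis Cm_on_SucD)
qed

lemma smooth_on_const [intro, simp]: "smooth_on U (\<lambda>x. c)"
  by (simp add: smooth_on_def Cm_on_const)

lemma smooth_on_bounded_linear_compose: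
  "bounded_linear L \<Longrightarrow> open U \<Longrightarrow> smooth_on U f \<Longrightarrow> smooth_on U (\<lambda>x. L (f x))"
  unfolding smooth_on_def using Cm_on_bounded_linear_compose[of L U _ f] by blast

lemma smooth_on_id: "open U \<Longrightarrow> smooth_on U (\<lambda>x. x)"
  by (rule smooth_onI[where f' = "\<lambda>x v. v"]) auto

lemma smooth_on_affine_compose:
  "bounded_linear L \<Longrightarrow> open V \<Longrightarrow> smooth_on U f \<Longrightarrow> (\<And>x. x \<in> V \<Longrightarrow> L x + a \<in> U)
    \<Longrightarrow> smooth_on V (\<lambda>x. f (L x + a))"
  unfolding smooth_on_def using Cm_on_affine_compose[of L V _ U f a] by blast

lemma smooth_on_add: "open U \<Longrightarrow> smooth_on U f \<Longrightarrow> smooth_on U g \<Longrightarrow> smooth_on U (\<lambda>x. f x + g x)"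
  by (simp add: smooth_on_def Cm_on_add)

lemma smooth_on_bilinear:
  "bounded_bilinear B \<Longrightarrow> open U \<Longrightarrow> smooth_on U f \<Longrightarrow> smooth_on U g \<Longrightarrow> smooth_on U (\<lambda>x. B (f x) (g x))"
  unfolding smooth_on_def using Cm_on_bilinear[of B U _ f g] by blast

lemmas smooth_on_scaleR = smooth_on_bilinear[OF bounded_bilinear_scaleR]
lemmas smooth_on_mult = smooth_on_bilinear[OF bounded_bilinear_mult]
lemmas smooth_on_inner = smooth_on_bilinear[OF bounded_bilinear_inner]

lemma smooth_on_uminus: "open U \<Longrightarrow> smooth_on U f \<Longrightarrow> smooth_on U (\<lambda>x. - f x)"
  by (rule smooth_on_bounded_linear_compose[of uminus]) (auto intro: bounded_linear_minus bounded_linear_ident)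

lemma smooth_on_diff: "open U \<Longrightarrow> smooth_on U f \<Longrightarrow> smooth_on U g \<Longrightarrow> smooth_on U (\<lambda>x. f x - g x)"
  by (simp only: diff_conv_add_uminus) (intro smooth_on_add smooth_on_uminus)

lemma Cm_on_sum: "open U \<Longrightarrow> (\<And>i. i \<in> I \<Longrightarrow> Cm_on m U (f i)) \<Longrightarrow> Cm_on m U (\<lambda>x. \<Sum>i\<in>I. f i x)"
  by (induction I rule: infinite_finite_induct) (auto intro: Cm_on_add Cm_on_const)

lemma smooth_on_sum: "open U \<Longrightarrow> (\<And>i. i \<in> I \<Longrightarrow> smooth_on U (f i)) \<Longrightarrow> smooth_on U (\<lambda>x. \<Sum>i\<in>I. f i x)"
  by (simp add: smooth_on_def Cm_on_sum)

lemma smooth_on_real_compose: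
  fixes f :: "'a::real_normed_vector \<Rightarrow> real" and g :: "real \<Rightarrow> 'b::real_normed_vector"
  assumes "open U" "open S" "\<And>x. x \<in> U \<Longrightarrow> f x \<in> S" "smooth_on U f" "smooth_on S g"
  shows "smooth_on U (\<lambda>x. g (f x))"
  using Cm_on_real_compose[where f = f and g = g, OF assms(1-3)] assms(4,5) unfolding smooth_on_def by blast

lemma smooth_on_power: 
  fixes f :: "'a::real_normed_vector \<Rightarrow> real"
  shows "open U \<Longrightarrow> smooth_on U f \<Longrightarrow> smooth_on U (\<lambda>x. f x ^ n)"
  by (induction n) (auto intro: smooth_on_mult)

lemma smooth_on_powr_real: "smooth_on {0<..} (\<lambda>s::real. s powr a)"
proof -
  have "Cm_on m {0<..} (\<lambda>s::real. c * s powr a)" for m a c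
  proof (induction m arbitrary: a c)
    case 0
    then show ?case by (auto intro!: continuous_intros)
  next
    case (Suc m)
    show ?case
    proof (rule Cm_on_SucI[where f' = "\<lambda>s v. (v * c * a) * s powr (a - 1)"])
      fix x :: real assume "x \<in> {0<..}"
      then show "((\<lambda>s. c * s powr a) has_derivative (\<lambda>v. v * c * a * x powr (a - 1))) (at x)"
        by (auto intro!: derivative_eq_intros simp: powr_diff)
    qed (use Suc in auto)
  qed
  from this[of _ 1 a] show ?thesis by (simp add: smooth_on_def)
qed

lemma smooth_on_powr:
  fixes f :: "'a::real_normed_vector \<Rightarrow> real"
  assumes "open U" "smooth_on U f" "\<And>x. x \<in> U \<Longrightarrow> f x > 0"
  shows "smooth_on U (\<lambda>x. f x powr a)"
  by (rule smooth_on_real_compose[OF assms(1) _ _ assms(2) smooth_on_powr_real]) (use assms(3) in auto)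

lemma smooth_on_divide:
  fixes f g :: "'a::real_normed_vector \<Rightarrow> real"
  assumes "open U" "smooth_on U f" "smooth_on U g" "\<And>x. x \<in> U \<Longrightarrow> g x > 0"
  shows "smooth_on U (\<lambda>x. f x / g x)"
proof (rule smooth_on_cong[OF assms(1)])
  show "smooth_on U (\<lambda>x. f x * g x powr (- 1))"
    by (intro smooth_on_mult assms smooth_on_powr)
  show "f x * g x powr (- 1) = f x / g x" if "x \<in> U" for x
    using assms(4)[OF that] by (simp add: powr_minus divide_inverse)
qed

text \<open>Schwarz: the second difference of \<open>f\<close> over a small parallelogram is
  symmetric in the two directions, and by the mean value theorem it equals a mixed derivative, in
  either order, at some nearby point.\<close>

lemma dderiv_symmetric_real:
  fixes f :: "'a::real_normed_vector \<Rightarrow> real"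
  assumes "open U" "Cm_on 2 U f" "x \<in> U"
  shows "dderiv v (dderiv w f) x = dderiv w (dderiv v f) x"
proof -
  have C: "\<forall>y\<in>U. f differentiable (at y)" "\<And>v. \<forall>y\<in>U. dderiv v f differentiable (at y)"
    "\<And>v w. continuous_on U (dderiv v (dderiv w f))"
    using assms(2) unfolding numeral_2_eq_2 Cm_on_Suc_iff by auto
  \<comment> \<open>the second difference quotient is a second derivative at an intermediate point\<close>
  have key: "\<exists>\<xi> \<eta>. 0 < \<xi> \<and> \<xi> < s \<and> 0 < \<eta> \<and> \<eta> < s \<and>
      f (x + s *\<^sub>R v + s *\<^sub>R w) - f (x + s *\<^sub>R v) - f (x + s *\<^sub>R w) + f x
        = s * s * dderiv w (dderiv v f) (x + \<xi> *\<^sub>R v + \<eta> *\<^sub>R w)"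
    if s: "s > 0" "\<And>a b. 0 \<le> a \<Longrightarrow> a \<le> s \<Longrightarrow> 0 \<le> b \<Longrightarrow> b \<le> s \<Longrightarrow> x + a *\<^sub>R v + b *\<^sub>R w \<in> U" for s v w
  proof -
    define p where "p a = f (x + a *\<^sub>R v + s *\<^sub>R w) - f (x + a *\<^sub>R v)" for a
    have dp: "(p has_real_derivative (dderiv v f (x + a *\<^sub>R v + s *\<^sub>R w) - dderiv v f (x + a *\<^sub>R v))) (at a)"
      if "0 \<le> a" "a \<le> s" for a
    proof -
      have "((\<lambda>a. f (x + a *\<^sub>R v + b *\<^sub>R w)) has_derivative (\<lambda>t. dderiv (t *\<^sub>R v) f (x + a *\<^sub>R v + b *\<^sub>R w))) (at a)"
        if "0 \<le> b" "b \<le> s" for b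
      proof -
        have 1: "(f has_derivative (\<lambda>t. dderiv t f (x + a *\<^sub>R v + b *\<^sub>R w))) (at (x + a *\<^sub>R v + b *\<^sub>R w))"
          using C(1) s(2)[of a b] that \<open>0 \<le> a\<close> \<open>a \<le> s\<close> by (auto intro: has_derivative_dderiv)
        show ?thesis
          by (rule has_derivative_compose[where f = "\<lambda>a. x + a *\<^sub>R v + b *\<^sub>R w" and g = f, OF _ 1]) (auto intro!: derivative_eq_intros)
      qed
      from this[of s] this[of 0] s(1)
      have d: "(p has_derivative (\<lambda>t. dderiv (t *\<^sub>R v) f (x + a *\<^sub>R v + s *\<^sub>R w) - dderiv (t *\<^sub>R v) f (x + a *\<^sub>R v))) (at a)"
        unfolding p_def by (auto intro!: has_derivative_diff)
      have l: "dderiv (t *\<^sub>R v) f y = t * dderiv v f y" if "y \<in> U" for y t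
        using linear_scale[OF has_derivative_linear[OF has_derivative_dderiv[of f y]], of t v] C(1) that by auto
      have U: "x + a *\<^sub>R v + s *\<^sub>R w \<in> U" "x + a *\<^sub>R v \<in> U"
        using s(2)[of a s] s(2)[of a 0] that s(1) by auto
      show ?thesis
        by (rule has_derivative_imp_has_field_derivative[OF d]) (simp add: l U right_diff_distrib mult.commute)
    qed
    obtain \<xi> where xi: "0 < \<xi>" "\<xi> < s"
      "p s - p 0 = s * (dderiv v f (x + \<xi> *\<^sub>R v + s *\<^sub>R w) - dderiv v f (x + \<xi> *\<^sub>R v))"
      using MVT2[of 0 s p, OF s(1) dp] by auto
    have dq: "((\<lambda>b. dderiv v f (x + \<xi> *\<^sub>R v + b *\<^sub>R w)) has_real_derivative
        dderiv w (dderiv v f) (x + \<xi> *\<^sub>R v + b *\<^sub>R w)) (at b)" if "0 \<le> b" "b \<le> s" for b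
    proof -
      let ?y = "x + \<xi> *\<^sub>R v + b *\<^sub>R w"
      have 1: "(dderiv v f has_derivative (\<lambda>t. dderiv t (dderiv v f) ?y)) (at ?y)"
        using C(2) s(2)[of \<xi> b] that xi by (auto intro: has_derivative_dderiv)
      have "((\<lambda>b. dderiv v f (x + \<xi> *\<^sub>R v + b *\<^sub>R w)) has_derivative (\<lambda>t. dderiv (t *\<^sub>R w) (dderiv v f) ?y)) (at b)"
        by (rule has_derivative_compose[where f = "\<lambda>b. x + \<xi> *\<^sub>R v + b *\<^sub>R w" and g = "dderiv v f", OF _ 1]) (auto intro!: derivative_eq_intros)
      then show ?thesis
        by (rule has_derivative_imp_has_field_derivative)
          (use linear_scale[OF has_derivative_linear[OF 1]] in \<open>simp add: mult.commute\<close>)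
    qed
    obtain \<eta> where "0 < \<eta>" "\<eta> < s" "dderiv v f (x + \<xi> *\<^sub>R v + s *\<^sub>R w) - dderiv v f (x + \<xi> *\<^sub>R v + 0 *\<^sub>R w)
        = (s - 0) * dderiv w (dderiv v f) (x + \<xi> *\<^sub>R v + \<eta> *\<^sub>R w)"
      using MVT2[OF s(1) dq] by blast
    with xi show ?thesis unfolding p_def
      by (intro exI[of _ \<xi>] exI[of _ \<eta>]) (simp add: algebra_simps)
  qed
  have close: "\<exists>d>0. \<forall>a b. 0 \<le> a \<longrightarrow> a \<le> d \<longrightarrow> 0 \<le> b \<longrightarrow> b \<le> d \<longrightarrow> x + a *\<^sub>R v + b *\<^sub>R w \<in> U \<and>
      \<bar>dderiv w (dderiv v f) (x + a *\<^sub>R v + b *\<^sub>R w) - dderiv w (dderiv v f) x\<bar> < e" if "e > 0" for e v w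
  proof -
    obtain d0 where d0: "d0 > 0" "ball x d0 \<subseteq> U"
      using assms(1,3) open_contains_ball by metis
    obtain d1 where d1: "d1 > 0" "\<And>y. y \<in> U \<Longrightarrow> dist y x < d1 \<Longrightarrow> \<bar>dderiv w (dderiv v f) y - dderiv w (dderiv v f) x\<bar> < e"
      using C(3)[of w v, unfolded continuous_on_iff, rule_format, OF assms(3) \<open>e > 0\<close>]
      unfolding dist_real_def by blast
    define d where "d = min d0 d1 / (2 * (norm v + norm w + 1))"
    have pos: "norm v + norm w + 1 > 0" by (smt (verit) norm_ge_zero)
    have d: "d > 0" "d * (norm v + norm w) < min d0 d1"
    proof -
      show "d > 0" unfolding d_def using d0 d1 pos by auto
      then have "d * (norm v + norm w) \<le> d * (norm v + norm w + 1)" by simp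
      also have "\<dots> = min d0 d1 / 2" unfolding d_def using pos by (simp add: field_simps)
      also have "\<dots> < min d0 d1" using d0 d1 by auto
      finally show "d * (norm v + norm w) < min d0 d1" .
    qed
    have "dist (x + a *\<^sub>R v + b *\<^sub>R w) x < min d0 d1" if "0 \<le> a" "a \<le> d" "0 \<le> b" "b \<le> d" for a b
    proof -
      have "dist (x + a *\<^sub>R v + b *\<^sub>R w) x = norm (a *\<^sub>R v + b *\<^sub>R w)" by (simp add: dist_norm)
      also have "\<dots> \<le> a * norm v + b * norm w"
        using norm_triangle_ineq[of "a *\<^sub>R v" "b *\<^sub>R w"] that by simp
      also have "\<dots> \<le> d * norm v + d * norm w"
        using that by (intro add_mono mult_right_mono) auto
      finally show ?thesis using d(2) by (simp add: algebra_simps)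
    qed
    note lt = this
    have "y \<in> U \<and> \<bar>dderiv w (dderiv v f) y - dderiv w (dderiv v f) x\<bar> < e" if "dist y x < min d0 d1" for y
      using that d0(2) d1(2)[of y] by (auto simp: dist_commute subset_iff)
    then show ?thesis using d(1) lt by (intro exI[of _ d]) simp
  qed
  show ?thesis
  proof (rule ccontr)
    assume ne: "\<not> ?thesis"
    define e where "e = \<bar>dderiv v (dderiv w f) x - dderiv w (dderiv v f) x\<bar> / 2"
    have e: "e > 0" using ne by (simp add: e_def)
    obtain d1 where d1: "d1 > 0" "\<And>a b. 0 \<le> a \<Longrightarrow> a \<le> d1 \<Longrightarrow> 0 \<le> b \<Longrightarrow> b \<le> d1 \<Longrightarrow> x + a *\<^sub>R v + b *\<^sub>R w \<in> U \<and>
      \<bar>dderiv w (dderiv v f) (x + a *\<^sub>R v + b *\<^sub>R w) - dderiv w (dderiv v f) x\<bar> < e"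
      using close[OF e, of v w] by meson
    obtain d2 where d2: "d2 > 0" "\<And>a b. 0 \<le> a \<Longrightarrow> a \<le> d2 \<Longrightarrow> 0 \<le> b \<Longrightarrow> b \<le> d2 \<Longrightarrow> x + a *\<^sub>R w + b *\<^sub>R v \<in> U \<and>
      \<bar>dderiv v (dderiv w f) (x + a *\<^sub>R w + b *\<^sub>R v) - dderiv v (dderiv w f) x\<bar> < e"
      using close[OF e, of w v] by meson
    define s where "s = min d1 d2"
    have s: "s > 0" "s \<le> d1" "s \<le> d2" using d1 d2 by (auto simp: s_def)
    have U1: "x + a *\<^sub>R v + b *\<^sub>R w \<in> U" and U2: "x + a *\<^sub>R w + b *\<^sub>R v \<in> U"
      if "0 \<le> a" "a \<le> s" "0 \<le> b" "b \<le> s" for a b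
      using d1(2)[of a b] d2(2)[of a b] that s(2,3) by linarith+
    obtain a b where ab: "0 < a" "a < s" "0 < b" "b < s"
      "f (x + s *\<^sub>R v + s *\<^sub>R w) - f (x + s *\<^sub>R v) - f (x + s *\<^sub>R w) + f x
        = s * s * dderiv w (dderiv v f) (x + a *\<^sub>R v + b *\<^sub>R w)"
      using key[OF s(1) U1] by blast
    obtain a' b' where ab': "0 < a'" "a' < s" "0 < b'" "b' < s"
      "f (x + s *\<^sub>R w + s *\<^sub>R v) - f (x + s *\<^sub>R w) - f (x + s *\<^sub>R v) + f x
        = s * s * dderiv v (dderiv w f) (x + a' *\<^sub>R w + b' *\<^sub>R v)"
      using key[OF s(1) U2] by blast
    have "x + s *\<^sub>R w + s *\<^sub>R v = x + s *\<^sub>R v + s *\<^sub>R w" by simp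
    then have "dderiv v (dderiv w f) (x + a' *\<^sub>R w + b' *\<^sub>R v) = dderiv w (dderiv v f) (x + a *\<^sub>R v + b *\<^sub>R w)"
      using ab(5) ab'(5) s(1) by (simp add: algebra_simps)
    moreover have "\<bar>dderiv w (dderiv v f) (x + a *\<^sub>R v + b *\<^sub>R w) - dderiv w (dderiv v f) x\<bar> < e"
      using d1(2)[of a b] ab s by auto
    moreover have "\<bar>dderiv v (dderiv w f) (x + a' *\<^sub>R w + b' *\<^sub>R v) - dderiv v (dderiv w f) x\<bar> < e"
      using d2(2)[of a' b'] ab' s by auto
    ultimately have "\<bar>dderiv v (dderiv w f) x - dderiv w (dderiv v f) x\<bar> < e + e" by linarith
    then show False by (simp add: e_def)
  qed
qed

lemma dderiv_bounded_linear:
  "bounded_linear L \<Longrightarrow> f differentiable (at x) \<Longrightarrow> dderiv v (\<lambda>y. L (f y)) x = L (dderiv v f x)"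
  by (rule dderiv_eqI) (auto intro: bounded_linear.has_derivative has_derivative_dderiv)

lemma dderiv_symmetric:
  fixes f :: "'a::real_normed_vector \<Rightarrow> 'b::euclidean_space"
  assumes "open U" "Cm_on 2 U f" "x \<in> U"
  shows "dderiv v (dderiv w f) x = dderiv w (dderiv v f) x"
proof (rule euclidean_eqI)
  fix b :: 'b
  have bl: "bounded_linear (\<lambda>z. z \<bullet> b)" by (rule bounded_linear_inner_left)
  have C: "\<And>y. y \<in> U \<Longrightarrow> f differentiable (at y)" "\<And>v y. y \<in> U \<Longrightarrow> dderiv v f differentiable (at y)"
    using assms(2) unfolding numeral_2_eq_2 Cm_on_Suc_iff by auto
  have "dderiv v (dderiv w f) x \<bullet> b = dderiv v (dderiv w (\<lambda>y. f y \<bullet> b)) x" for v w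
    using dderiv_bounded_linear[OF bl C(2)[OF assms(3)], of v w]
      dderiv_transform_open[OF assms(1,3), of "dderiv w (\<lambda>y. f y \<bullet> b)" "\<lambda>y. dderiv w f y \<bullet> b" v]
      dderiv_bounded_linear[OF bl C(1)] by simp
  then show "dderiv v (dderiv w f) x \<bullet> b = dderiv w (dderiv v f) x \<bullet> b"
    using dderiv_symmetric_real[OF assms(1) Cm_on_bounded_linear_compose[OF bl assms(1,2)] assms(3)] by simp
qed

section \<open>Cut-off functions and test functions\<close>

text \<open>The powers \<open>s\<^sup>-\<^sup>j\<close> are carried along because the derivatives of
  \<open>exp (- 1 / s)\<close> are combinations of such terms; with them the family is closed under
  differentiation.\<close>

definition flat_exp :: "nat \<Rightarrow> real \<Rightarrow> real" where
  "flat_exp j s = (if s > 0 then exp (- 1 / s) / s ^ j else 0)"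

lemma flat_exp_tendsto_0: "(flat_exp j \<longlongrightarrow> 0) (at_right 0)"
proof -
  have "((\<lambda>s::real. (inverse s) ^ j / exp (inverse s)) \<longlongrightarrow> 0) (at_right 0)"
    using filterlim_compose[OF tendsto_power_div_exp_0 filterlim_inverse_at_top_right] .
  moreover have "\<forall>\<^sub>F s in at_right 0. (inverse s) ^ j / exp (inverse s) = flat_exp j s"
    by (auto simp: eventually_at_filter flat_exp_def exp_minus field_simps)
  ultimately show ?thesis using Lim_transform_eventually by blast
qed

lemma flat_exp_has_derivative:
  "(flat_exp j has_real_derivative (flat_exp (j + 2) s - real j * flat_exp (j + 1) s)) (at s)"
proof -
  consider "s > 0" | "s < 0" | "s = 0" by linarith
  then show ?thesis
  proof cases
    case 1
    have "((\<lambda>s. exp (- 1 / s) / s ^ j) has_real_derivative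
        (exp (- 1 / s) * (1 / s\<^sup>2) * s ^ j - exp (- 1 / s) * (real j * s ^ (j - 1))) / (s ^ j * s ^ j)) (at s)"
      using 1 by (auto intro!: derivative_eq_intros simp: power2_eq_square)
    moreover have "(exp (- 1 / s) * (1 / s\<^sup>2) * s ^ j - exp (- 1 / s) * (real j * s ^ (j - 1))) / (s ^ j * s ^ j)
        = flat_exp (j + 2) s - real j * flat_exp (j + 1) s"
      using 1 by (cases j) (auto simp: flat_exp_def field_simps power2_eq_square)
    ultimately have "((\<lambda>s. exp (- 1 / s) / s ^ j) has_real_derivative flat_exp (j + 2) s - real j * flat_exp (j + 1) s) (at s)"
      by simp
    then show ?thesis
      by (rule has_field_derivative_transform_within_open[where S = "{0<..}"])
        (use 1 in \<open>auto simp: flat_exp_def\<close>)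
  next
    case 2
    have "((\<lambda>s::real. 0) has_real_derivative 0) (at s)" by simp
    then have "(flat_exp j has_real_derivative 0) (at s)"
      by (rule has_field_derivative_transform_within_open[where S = "{..<0}"])
        (use 2 in \<open>auto simp: flat_exp_def\<close>)
    then show ?thesis using 2 by (simp add: flat_exp_def)
  next
    case 3
    have "((\<lambda>h. (flat_exp j h - flat_exp j 0) / (h - 0)) \<longlongrightarrow> 0) (at 0)"
    proof (rule filterlim_split_at_real)
      have "\<forall>\<^sub>F h in at_left 0. 0 = (flat_exp j h - flat_exp j 0) / (h - 0)"
        by (auto simp: eventually_at_filter flat_exp_def)
      then show "((\<lambda>h. (flat_exp j h - flat_exp j 0) / (h - 0)) \<longlongrightarrow> 0) (at_left 0)"
        by (rule Lim_transform_eventually[OF tendsto_const])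
      have "\<forall>\<^sub>F h in at_right 0. flat_exp (j + 1) h = (flat_exp j h - flat_exp j 0) / (h - 0)"
        by (auto simp: eventually_at_filter flat_exp_def)
      then show "((\<lambda>h. (flat_exp j h - flat_exp j 0) / (h - 0)) \<longlongrightarrow> 0) (at_right 0)"
        by (rule Lim_transform_eventually[OF flat_exp_tendsto_0])
    qed
    then show ?thesis using 3 by (simp add: has_field_derivative_iff flat_exp_def)
  qed
qed

lemma smooth_on_flat_exp: "smooth_on UNIV (flat_exp j)"
proof -
  have "Cm_on m UNIV (flat_exp j)" for m
  proof (induction m arbitrary: j)
    case 0
    have "isCont (flat_exp j) s" for s using flat_exp_has_derivative DERIV_isCont by blast
    then show ?case by (simp add: continuous_at_imp_continuous_on)
  next
    case (Suc m)
    show ?case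
    proof (rule Cm_on_SucI)
      fix s
      show "(flat_exp j has_derivative (\<lambda>v. (flat_exp (j + 2) s + (- real j) *\<^sub>R flat_exp (j + 1) s) * v)) (at s)"
        using flat_exp_has_derivative[of j s] unfolding has_field_derivative_def by simp
      show "Cm_on m UNIV (\<lambda>s. (flat_exp (j + 2) s + (- real j) *\<^sub>R flat_exp (j + 1) s) * v)" for v
        by (intro Cm_on_bilinear[OF bounded_bilinear_mult] Cm_on_add
            Cm_on_bilinear[OF bounded_bilinear_scaleR] Cm_on_const Suc.IH open_UNIV)
    qed auto
  qed
  then show ?thesis by (simp add: smooth_on_def)
qed

text \<open>Finitely many bumps on balls have a sum \<open>\<beta>\<close> that is bounded below on
  \<open>K\<close>; composing with a smooth step flattens it to the constant 1.\<close>

lemma exists_smooth_cutoff: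
  fixes K U :: "'a::euclidean_space set"
  assumes "compact K" "open U" "K \<subseteq> U"
  obtains \<kappa> :: "'a \<Rightarrow> real" and V L where "smooth_on UNIV \<kappa>" "open V" "K \<subseteq> V" "\<And>x. x \<in> V \<Longrightarrow> \<kappa> x = 1"
    "compact L" "L \<subseteq> U" "\<And>x. x \<notin> L \<Longrightarrow> \<kappa> x = 0"
proof (cases "K = {}")
  case True
  show ?thesis by (rule that[of "\<lambda>x. 0" "{}" "{}"]) (use True in auto)
next
  case False
  have "\<forall>p\<in>K. \<exists>r>0. cball p r \<subseteq> U" using assms(2,3) open_contains_cball by blast
  then obtain r where r: "\<And>p. p \<in> K \<Longrightarrow> r p > 0 \<and> cball p (r p) \<subseteq> U" by metis
  have "K \<subseteq> (\<Union>p\<in>K. ball p (r p))" using r by fastforce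
  from compactE_image[OF assms(1) _ this] obtain C where C: "C \<subseteq> K" "finite C" "K \<subseteq> (\<Union>p\<in>C. ball p (r p))"
    by blast
  define \<beta> where "\<beta> x = (\<Sum>p\<in>C. flat_exp 0 ((r p)\<^sup>2 - (x - p) \<bullet> (x - p)))" for x
  have smb: "smooth_on UNIV \<beta>"
    unfolding \<beta>_def
  proof (intro smooth_on_sum open_UNIV)
    fix p
    show "smooth_on UNIV (\<lambda>x. flat_exp 0 ((r p)\<^sup>2 - (x - p) \<bullet> (x - p)))"
      by (rule smooth_on_real_compose[OF open_UNIV open_UNIV _ _ smooth_on_flat_exp])
        (auto intro!: smooth_on_diff smooth_on_inner smooth_on_id)
  qed
  have tm: "flat_exp 0 ((r p)\<^sup>2 - (x - p) \<bullet> (x - p)) > 0 \<longleftrightarrow> x \<in> ball p (r p)"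
    "flat_exp 0 ((r p)\<^sup>2 - (x - p) \<bullet> (x - p)) \<ge> 0" if "p \<in> C" for p x
  proof -
    have rp: "0 \<le> r p" using r[of p] that C(1) by (simp add: subset_iff less_imp_le)
    have "(x - p) \<bullet> (x - p) < (r p)\<^sup>2 \<longleftrightarrow> norm (x - p) < r p"
      unfolding power2_norm_eq_inner[symmetric]
      using power2_less_imp_less[OF _ rp] power_strict_mono[of "norm (x - p)" "r p" 2] by auto
    then show "flat_exp 0 ((r p)\<^sup>2 - (x - p) \<bullet> (x - p)) > 0 \<longleftrightarrow> x \<in> ball p (r p)"
      by (auto simp: flat_exp_def dist_norm norm_minus_commute)
  qed (simp add: flat_exp_def)
  have bpos: "\<beta> x > 0 \<longleftrightarrow> x \<in> (\<Union>p\<in>C. ball p (r p))" and bnn: "\<beta> x \<ge> 0" for x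
  proof -
    show "\<beta> x \<ge> 0" unfolding \<beta>_def by (intro sum_nonneg tm(2))
    show "\<beta> x > 0 \<longleftrightarrow> x \<in> (\<Union>p\<in>C. ball p (r p))"
    proof
      assume "\<beta> x > 0"
      then have "\<beta> x \<noteq> 0" by simp
      then obtain p where p: "p \<in> C" "flat_exp 0 ((r p)\<^sup>2 - (x - p) \<bullet> (x - p)) \<noteq> 0"
        unfolding \<beta>_def by (rule sum.not_neutral_contains_not_neutral)
      then have "x \<in> ball p (r p)" using tm[OF p(1), of x] by linarith
      then show "x \<in> (\<Union>p\<in>C. ball p (r p))" using p(1) by blast
    next
      assume "x \<in> (\<Union>p\<in>C. ball p (r p))"
      then obtain p where p: "p \<in> C" "x \<in> ball p (r p)" by auto
      show "\<beta> x > 0" unfolding \<beta>_def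
        by (rule sum_pos2[OF C(2) p(1)]) (use tm(1)[OF p(1)] p(2) tm(2) in blast)+
    qed
  qed
  obtain z where z: "z \<in> K" "\<And>x. x \<in> K \<Longrightarrow> \<beta> z \<le> \<beta> x"
    using continuous_attains_inf[OF assms(1) False continuous_on_subset[OF smooth_on_continuous[OF smb] subset_UNIV]]
    by blast
  define m where "m = \<beta> z"
  have m: "m > 0" using z(1) C(3) bpos m_def by blast
  \<comment> \<open>a smooth step from 0 on the negative to 1 on the numbers above 1\<close>
  define \<theta> where "\<theta> s = flat_exp 0 s / (flat_exp 0 s + flat_exp 0 (1 - s))" for s
  have den: "flat_exp 0 s + flat_exp 0 (1 - s) > 0" for s
    by (auto simp: flat_exp_def add_pos_nonneg)
  have sm\<theta>: "smooth_on UNIV \<theta>"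
  proof -
    have "smooth_on UNIV (\<lambda>s. flat_exp 0 (1 - s))"
      by (rule smooth_on_real_compose[OF open_UNIV open_UNIV _ _ smooth_on_flat_exp])
        (auto intro!: smooth_on_diff smooth_on_id)
    then show ?thesis unfolding \<theta>_def
      by (intro smooth_on_divide smooth_on_add open_UNIV smooth_on_flat_exp den)
  qed
  \<comment> \<open>the factor 2 pushes the argument above 1 on a neighbourhood of \<open>K\<close>,
    not only on \<open>K\<close>\<close>
  define \<kappa> where "\<kappa> x = \<theta> ((2 / m) * \<beta> x)" for x
  show ?thesis
  proof (rule that[of \<kappa> "{x. m / 2 < \<beta> x}" "\<Union>p\<in>C. cball p (r p)"])
    show "smooth_on UNIV \<kappa>" unfolding \<kappa>_def
      by (rule smooth_on_real_compose[OF open_UNIV open_UNIV UNIV_I smooth_on_mult[OF open_UNIV smooth_on_const smb] sm\<theta>])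
    show "open {x. m / 2 < \<beta> x}"
      using smooth_on_continuous[OF smb] by (intro open_Collect_less) (auto intro: continuous_intros)
    show "K \<subseteq> {x. m / 2 < \<beta> x}" using z(2) m unfolding m_def by fastforce
    show "\<kappa> x = 1" if "x \<in> {x. m / 2 < \<beta> x}" for x
    proof -
      have "(2 / m) * \<beta> x > 1" using that m by (simp add: field_simps)
      then show ?thesis unfolding \<kappa>_def \<theta>_def by (simp add: flat_exp_def)
    qed
    show "compact (\<Union>p\<in>C. cball p (r p))" using C(2) by (intro compact_UN) auto
    show "(\<Union>p\<in>C. cball p (r p)) \<subseteq> U" using C(1) r by blast
    show "\<kappa> x = 0" if "x \<notin> (\<Union>p\<in>C. cball p (r p))" for x
    proof -
      have "\<not> \<beta> x > 0" using bpos that by (auto simp: subset_iff)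
      then have "\<beta> x = 0" using bnn[of x] by simp
      then show ?thesis unfolding \<kappa>_def \<theta>_def by (simp add: flat_exp_def)
    qed
  qed
qed

abbreviation test_functions :: "'a::real_normed_vector set \<Rightarrow> ('a \<Rightarrow> 'b::real_normed_vector) set" where
  "test_functions W \<equiv> compact_sections W UNIV"

lemma compact_sectionsI:
  assumes "smooth_on UNIV f" "\<And>x. f x \<in> E" "compact K" "K \<subseteq> W" "\<And>x. x \<notin> K \<Longrightarrow> f x = 0"
  shows "f \<in> compact_sections W E"
proof -
  have "closure {x. f x \<noteq> 0} \<subseteq> K"
    by (rule closure_minimal) (use assms compact_imp_closed in auto)
  then have "compact (closure {x. f x \<noteq> 0})" "closure {x. f x \<noteq> 0} \<subseteq> W"
    using assms(3,4) compact_Int_closed[OF assms(3), of "closure {x. f x \<noteq> 0}"] by (auto simp: Int_absorb1)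
  then show ?thesis using assms(1,2) unfolding compact_sections_def sections_def by auto
qed

lemma compact_sectionsE:
  assumes "f \<in> compact_sections W E"
  obtains K where "smooth_on UNIV f" "\<And>x. f x \<in> E" "compact K" "K \<subseteq> W" "\<And>x. x \<notin> K \<Longrightarrow> f x = 0"
proof (rule that[of "closure {x. f x \<noteq> 0}"])
  show "f x = 0" if "x \<notin> closure {x. f x \<noteq> 0}" for x
    using that closure_subset[of "{x. f x \<noteq> 0}"] by auto
qed (use assms in \<open>auto simp: compact_sections_def sections_def\<close>)

lemma dderiv_zero_outside:
  assumes "closed K" "\<And>x. x \<notin> K \<Longrightarrow> f x = 0" "x \<notin> K"
  shows "dderiv v f x = 0"
proof -
  have "dderiv v f x = dderiv v (\<lambda>x. 0) x"
    by (rule dderiv_transform_open[of "- K"]) (use assms in auto)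
  also have "\<dots> = 0" by (rule dderiv_eqI) simp
  finally show ?thesis .
qed

lemma test_functions_dderiv:
  assumes "f \<in> test_functions W"
  shows "dderiv v f \<in> test_functions W"
proof -
  obtain K where K: "smooth_on UNIV f" "compact K" "K \<subseteq> W" "\<And>x. x \<notin> K \<Longrightarrow> f x = 0"
    using compact_sectionsE[OF assms] by metis
  show ?thesis
    by (rule compact_sectionsI[OF smooth_on_dderiv[OF K(1)] _ K(2,3)])
      (use dderiv_zero_outside[OF compact_imp_closed[OF K(2)] K(4)] in auto)
qed

lemma test_functions_add:
  assumes "f \<in> test_functions W" "g \<in> test_functions W"
  shows "(\<lambda>x. f x + g x) \<in> test_functions W"
proof -
  obtain K where K: "smooth_on UNIV f" "compact K" "K \<subseteq> W" "\<And>x. x \<notin> K \<Longrightarrow> f x = 0"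
    using compact_sectionsE[OF assms(1)] by metis
  obtain L where L: "smooth_on UNIV g" "compact L" "L \<subseteq> W" "\<And>x. x \<notin> L \<Longrightarrow> g x = 0"
    using compact_sectionsE[OF assms(2)] by metis
  show ?thesis
    by (rule compact_sectionsI[where K = "K \<union> L"]) (use K L in \<open>auto intro: smooth_on_add\<close>)
qed

lemma test_functions_sum:
  assumes "\<And>i. i \<in> I \<Longrightarrow> f i \<in> test_functions W"
  shows "(\<lambda>x. \<Sum>i\<in>I. f i x) \<in> test_functions W"
  using assms
proof (induction I rule: infinite_finite_induct)
  case (insert i I)
  then show ?case using test_functions_add[of "f i" W "\<lambda>x. \<Sum>i\<in>I. f i x"] by simp
qed (auto intro!: compact_sectionsI[where K = "{}"])

lemma test_functions_mono: "f \<in> compact_sections V E \<Longrightarrow> V \<subseteq> W \<Longrightarrow> f \<in> compact_sections W E"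
  unfolding compact_sections_def by blast

text \<open>A factor that is smooth only on \<open>W\<close> may be multiplied with a test function
  of \<open>W\<close>: near points outside \<open>W\<close> the product is zero, whatever values the
  factor takes there.\<close>

lemma test_functions_bilinear:
  assumes B: "bounded_bilinear B" and W: "open W" and a: "smooth_on W a" and "b \<in> test_functions W"
  shows "(\<lambda>x. B (a x) (b x)) \<in> test_functions W"
proof -
  interpret B: bounded_bilinear B by fact
  obtain K where K: "smooth_on UNIV b" "compact K" "K \<subseteq> W" "\<And>x. x \<notin> K \<Longrightarrow> b x = 0"
    using compact_sectionsE[OF assms(4)] by metis
  have sm: "smooth_on UNIV (\<lambda>x. B (a x) (b x))"
  proof (rule smooth_on_local)
    fix p
    show "\<exists>V. open V \<and> p \<in> V \<and> smooth_on V (\<lambda>x. B (a x) (b x))"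
    proof (cases "p \<in> W")
      case True
      have "smooth_on W (\<lambda>x. B (a x) (b x))"
        by (intro smooth_on_bilinear[OF B W a] smooth_on_subset[OF K(1)]) auto
      then show ?thesis using True W by blast
    next
      case False
      have "smooth_on (- K) (\<lambda>x. B (a x) (b x))"
        by (rule smooth_on_cong[of _ "\<lambda>x. 0"])
          (use K compact_imp_closed in \<open>auto simp: B.zero_right\<close>)
      then show ?thesis using False K(2,3) compact_imp_closed by (metis ComplI open_Compl subsetD)
    qed
  qed
  show ?thesis
    by (rule compact_sectionsI[OF sm _ K(2,3)]) (auto simp: K(4) B.zero_right)
qed

lemmas test_functions_scaleR = test_functions_bilinear[OF bounded_bilinear_scaleR]

section \<open>Integrals depending on a parameter\<close>

text \<open>Differentiation under the integral sign, by dominated convergence of difference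
  quotients: the mean value inequality bounds them by the same \<open>w\<close> that bounds the
  derivative.\<close>

lemma has_derivative_integral:
  fixes f :: "'x::real_normed_vector \<Rightarrow> 'y \<Rightarrow> 'b::{banach,second_countable_topology}"
  assumes r: "r > 0"
    and int: "\<And>x. x \<in> ball x0 r \<Longrightarrow> integrable M (f x)"
    and der: "\<And>x y. x \<in> ball x0 r \<Longrightarrow> y \<in> space M \<Longrightarrow> ((\<lambda>x. f x y) has_derivative f' x y) (at x)"
    and bnd: "\<And>x y v. x \<in> ball x0 r \<Longrightarrow> y \<in> space M \<Longrightarrow> norm (f' x y v) \<le> w y * norm v"
    and w: "integrable M w"
    and meas: "\<And>v. (\<lambda>y. f' x0 y v) \<in> borel_measurable M"
  shows "((\<lambda>x. \<integral>y. f x y \<partial>M) has_derivative (\<lambda>v. \<integral>y. f' x0 y v \<partial>M)) (at x0)"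
proof -
  have x0: "x0 \<in> ball x0 r" using r by simp
  have int': "integrable M (\<lambda>y. f' x0 y v)" for v
  proof (rule Bochner_Integration.integrable_bound[of M "\<lambda>y. w y * norm v"])
    show "AE y in M. norm (f' x0 y v) \<le> norm (w y * norm v)"
      using bnd[OF x0, of _ v] by (intro AE_I2) (smt (verit) real_norm_def)
  qed (use w meas in auto)
  have lin: "linear (f' x0 y)" if "y \<in> space M" for y
    using has_derivative_linear[OF der[OF x0 that]] .
  have "bounded_linear (\<lambda>v. \<integral>y. f' x0 y v \<partial>M)"
  proof (rule bounded_linear_intro[where K = "\<integral>y. w y \<partial>M"])
    fix u v
    have "(\<integral>y. f' x0 y (u + v) \<partial>M) = (\<integral>y. f' x0 y u + f' x0 y v \<partial>M)"
      by (rule Bochner_Integration.integral_cong) (auto simp: linear_add[OF lin])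
    then show "(\<integral>y. f' x0 y (u + v) \<partial>M) = (\<integral>y. f' x0 y u \<partial>M) + (\<integral>y. f' x0 y v \<partial>M)"
      using int' by simp
  next
    fix c v
    have "(\<integral>y. f' x0 y (c *\<^sub>R v) \<partial>M) = (\<integral>y. c *\<^sub>R f' x0 y v \<partial>M)"
      by (rule Bochner_Integration.integral_cong) (auto simp: linear_scale[OF lin])
    then show "(\<integral>y. f' x0 y (c *\<^sub>R v) \<partial>M) = c *\<^sub>R (\<integral>y. f' x0 y v \<partial>M)"
      using int' by simp
  next
    fix v
    have "norm (\<integral>y. f' x0 y v \<partial>M) \<le> (\<integral>y. norm (f' x0 y v) \<partial>M)" by simp
    also have "\<dots> \<le> (\<integral>y. w y * norm v \<partial>M)"
      using int' w bnd[OF x0] by (intro integral_mono) auto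
    also have "\<dots> = norm v * (\<integral>y. w y \<partial>M)" by (simp add: mult.commute)
    finally show "norm (\<integral>y. f' x0 y v \<partial>M) \<le> norm v * (\<integral>y. w y \<partial>M)" .
  qed
  moreover have "((\<lambda>x. ((\<integral>y. f x y \<partial>M) - (\<integral>y. f x0 y \<partial>M) - (\<integral>y. f' x0 y (x - x0) \<partial>M)) /\<^sub>R norm (x - x0))
      \<longlongrightarrow> 0) (at x0 within ball x0 r)"
    unfolding tendsto_at_iff_sequentially
  proof (intro allI impI)
    fix X assume X: "\<forall>i. X i \<in> ball x0 r - {x0}" "X \<longlonglongrightarrow> x0"
    define Q where "Q i y = (f (X i) y - f x0 y - f' x0 y (X i - x0)) /\<^sub>R norm (X i - x0)" for i y
    have "(\<lambda>i. \<integral>y. Q i y \<partial>M) \<longlonglongrightarrow> (\<integral>y. 0 \<partial>M)"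
    proof (rule integral_dominated_convergence[where w = "\<lambda>y. 2 * w y"])
      show "Q i \<in> borel_measurable M" for i
        unfolding Q_def using int[OF x0] int[of "X i"] int' X(1)
        by (auto intro!: borel_measurable_scaleR borel_measurable_diff)
      show "AE y in M. (\<lambda>i. Q i y) \<longlonglongrightarrow> 0"
      proof (intro AE_I2)
        fix y assume y: "y \<in> space M"
        have "((\<lambda>x. (f x y - f x0 y - f' x0 y (x - x0)) /\<^sub>R norm (x - x0)) \<longlongrightarrow> 0) (at x0)"
          using der[OF x0 y] unfolding has_derivative_at_within by simp
        then show "(\<lambda>i. Q i y) \<longlonglongrightarrow> 0"
          unfolding tendsto_at_iff_sequentially Q_def o_def using X by auto
      qed
      show "AE y in M. norm (Q i y) \<le> 2 * w y" for i
      proof (intro AE_I2)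
        fix y assume y: "y \<in> space M"
        have Xi: "X i \<in> ball x0 r" "X i \<noteq> x0" using X(1) by auto
        have "0 \<le> w y * norm (X i - x0)" using bnd[OF x0 y, of "X i - x0"] norm_ge_zero order_trans by blast
        then have wy: "0 \<le> w y" using Xi(2) by (simp add: zero_le_mult_iff)
        have "norm (f (X i) y - f x0 y) \<le> w y * norm (X i - x0)"
        proof (rule differentiable_bound[where S = "ball x0 r" and f = "\<lambda>x. f x y" and f' = "\<lambda>x. f' x y"])
          show "((\<lambda>x. f x y) has_derivative f' x y) (at x within ball x0 r)" if "x \<in> ball x0 r" for x
            using der[OF that y] has_derivative_at_withinI by blast
          show "onorm (f' x y) \<le> w y" if "x \<in> ball x0 r" for x
            by (rule onorm_bound[OF wy]) (use bnd[OF that y] in simp)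
        qed (use Xi x0 in auto)
        moreover have "norm (f' x0 y (X i - x0)) \<le> w y * norm (X i - x0)" using bnd[OF x0 y] by simp
        ultimately have "norm (f (X i) y - f x0 y - f' x0 y (X i - x0)) \<le> 2 * w y * norm (X i - x0)"
          using norm_triangle_ineq4[of "f (X i) y - f x0 y" "f' x0 y (X i - x0)"] by simp
        then show "norm (Q i y) \<le> 2 * w y"
          unfolding Q_def using Xi by (simp add: divide_inverse_commute[symmetric] divide_le_eq)
      qed
    qed (use w in auto)
    moreover have "(\<integral>y. Q i y \<partial>M) = ((\<integral>y. f (X i) y \<partial>M) - (\<integral>y. f x0 y \<partial>M) - (\<integral>y. f' x0 y (X i - x0) \<partial>M)) /\<^sub>R norm (X i - x0)" for i
      unfolding Q_def using int[OF x0] int[of "X i"] int' X(1) by simp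
    ultimately show "((\<lambda>x. ((\<integral>y. f x y \<partial>M) - (\<integral>y. f x0 y \<partial>M) - (\<integral>y. f' x0 y (x - x0) \<partial>M)) /\<^sub>R norm (x - x0)) \<circ> X) \<longlonglongrightarrow> 0"
      by (simp add: o_def)
  qed
  ultimately have "((\<lambda>x. \<integral>y. f x y \<partial>M) has_derivative (\<lambda>v. \<integral>y. f' x0 y v \<partial>M)) (at x0 within ball x0 r)"
    by (simp add: has_derivative_at_within)
  then show ?thesis using at_within_open[OF x0] by simp
qed

lemma lborel_integral_affine:
  fixes f :: "'a::euclidean_space \<Rightarrow> 'b::{banach,second_countable_topology}"
  assumes "c \<noteq> 0" "f \<in> borel_measurable borel"
  shows "(\<integral>x. f x \<partial>lborel) = \<bar>c\<bar> ^ DIM('a) *\<^sub>R (\<integral>x. f (t + c *\<^sub>R x) \<partial>lborel)"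
  using assms(2)
  by (subst lborel_affine[OF assms(1), of t]) (simp add: integral_density integral_distr)

lemma lborel_integrable_affine:
  fixes f :: "'a::euclidean_space \<Rightarrow> 'b::{banach,second_countable_topology}"
  assumes "c \<noteq> 0" "integrable lborel f"
  shows "integrable lborel (\<lambda>x. f (t + c *\<^sub>R x))"
proof -
  have [measurable]: "f \<in> borel_measurable borel" using borel_measurable_integrable[OF assms(2)] by simp
  have "integrable (density (distr lborel borel (\<lambda>x. t + c *\<^sub>R x)) (\<lambda>_. \<bar>c\<bar>^DIM('a))) f"
    using assms(2) lborel_affine[OF assms(1), of t] by simp
  then have "integrable lborel (\<lambda>x. \<bar>c\<bar> ^ DIM('a) *\<^sub>R f (t + c *\<^sub>R x))"
    by (simp add: integrable_density integrable_distr_eq)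
  from integrable_scaleR_right[OF this, of "1 / \<bar>c\<bar> ^ DIM('a)"] show ?thesis
    using assms(1) by simp
qed

section \<open>Convolution\<close>

definition locally_integrable :: "('a::euclidean_space \<Rightarrow> real) \<Rightarrow> bool" where
  "locally_integrable k \<longleftrightarrow> k \<in> borel_measurable borel \<and>
     (\<forall>R. integrable lborel (\<lambda>z. indicator (cball 0 R) z *\<^sub>R k z))"

text \<open>The densities whose potentials are formed: they may jump across a hypersurface, so that
  only boundedness, measurability and bounded support are asked for.\<close>

definition compact_density :: "('a::euclidean_space \<Rightarrow> 'b::euclidean_space) \<Rightarrow> bool" where
  "compact_density f \<longleftrightarrow> f \<in> borel_measurable borel \<and>
     (\<exists>M. \<forall>x. norm (f x) \<le> M) \<and> (\<exists>R. \<forall>x. x \<notin> cball 0 R \<longrightarrow> f x = 0)"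

definition conv :: "('a::euclidean_space \<Rightarrow> real) \<Rightarrow> ('a \<Rightarrow> 'b::euclidean_space) \<Rightarrow> 'a \<Rightarrow> 'b" where
  "conv k f x = (\<integral>y. k (x - y) *\<^sub>R f y \<partial>lborel)"

lemma compact_densityE:
  assumes "compact_density f"
  obtains M R where "f \<in> borel_measurable borel" "M > 0" "R > 0" "\<And>x. norm (f x) \<le> M"
    "\<And>x. x \<notin> cball 0 R \<Longrightarrow> f x = 0"
proof -
  obtain M R where *: "f \<in> borel_measurable borel" "\<forall>x. norm (f x) \<le> M" "\<forall>x. x \<notin> cball 0 R \<longrightarrow> f x = 0"
    using assms unfolding compact_density_def by blast
  show ?thesis
  proof (rule that[of "\<bar>M\<bar> + 1" "\<bar>R\<bar> + 1"])
    show "norm (f x) \<le> \<bar>M\<bar> + 1" for x using *(2)[rule_format, of x] by linarith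
    show "f x = 0" if "x \<notin> cball 0 (\<bar>R\<bar> + 1)" for x using *(3)[rule_format, of x] that by auto
  qed (use *(1) in auto)
qed

lemma compact_density_integrable:
  assumes "compact_density f" shows "integrable lborel f"
proof -
  obtain M R where f: "f \<in> borel_measurable borel" "M > 0" "R > 0" "\<And>x. norm (f x) \<le> M"
    "\<And>x. x \<notin> cball 0 R \<Longrightarrow> f x = 0" using compact_densityE[OF assms] by metis
  have "integrable lborel (\<lambda>x. indicator (cball (0::'a) R) x *\<^sub>R M)"
    by (rule borel_integrable_compact) auto
  then show ?thesis
  proof (rule Bochner_Integration.integrable_bound)
    show "AE x in lborel. norm (f x) \<le> norm (indicator (cball 0 R) x *\<^sub>R M)"
    proof (intro AE_I2)
      fix x show "norm (f x) \<le> norm (indicator (cball 0 R) x *\<^sub>R M)"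
        using f(2) f(4,5)[of x] by (cases "x \<in> cball 0 R") auto
    qed
  qed (use f in simp)
qed

lemma compact_density_continuous:
  fixes f :: "'a::euclidean_space \<Rightarrow> 'b::euclidean_space"
  assumes "continuous_on UNIV f" "compact K" "\<And>x. x \<notin> K \<Longrightarrow> f x = 0"
  shows "compact_density f"
  unfolding compact_density_def
proof (intro conjI)
  show "f \<in> borel_measurable borel" using assms(1) borel_measurable_continuous_onI by blast
  obtain M where M: "\<And>x. x \<in> K \<Longrightarrow> norm (f x) \<le> M"
    using compact_imp_bounded[OF compact_continuous_image[OF continuous_on_subset[OF assms(1)] assms(2)]]
    unfolding bounded_iff by auto
  have "norm (f x) \<le> \<bar>M\<bar>" for x using M[of x] assms(3)[of x] by (cases "x \<in> K") auto
  then show "\<exists>M. \<forall>x. norm (f x) \<le> M" by blast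
  obtain R where "\<And>x. x \<in> K \<Longrightarrow> norm x \<le> R"
    using compact_imp_bounded[OF assms(2)] unfolding bounded_iff by blast
  then have "f x = 0" if "x \<notin> cball 0 R" for x using assms(3)[of x] that by auto
  then show "\<exists>R. \<forall>x. x \<notin> cball 0 R \<longrightarrow> f x = 0" by blast
qed

lemma test_functions_density:
  fixes f :: "'a::euclidean_space \<Rightarrow> 'b::euclidean_space"
  assumes "f \<in> compact_sections W E" shows "compact_density f"
proof -
  obtain K where K: "smooth_on UNIV f" "compact K" "K \<subseteq> W" "\<And>x. x \<notin> K \<Longrightarrow> f x = 0"
    using compact_sectionsE[OF assms] by metis
  show ?thesis by (rule compact_density_continuous[OF smooth_on_continuous[OF K(1)] K(2,4)])
qed

lemma compact_density_indicator:
  assumes "compact_density f" "A \<in> sets borel"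
  shows "compact_density (\<lambda>x. indicator A x *\<^sub>R f x)"
proof -
  obtain M R where f: "f \<in> borel_measurable borel" "M > 0" "R > 0" "\<And>x. norm (f x) \<le> M"
    "\<And>x. x \<notin> cball 0 R \<Longrightarrow> f x = 0" using compact_densityE[OF assms(1)] by metis
  have "norm (indicator A x *\<^sub>R f x) \<le> M" for x using f(2) f(4)[of x] by (cases "x \<in> A") auto
  moreover have "indicator A x *\<^sub>R f x = 0" if "x \<notin> cball 0 R" for x using f(5)[OF that] by simp
  moreover have "(\<lambda>x. indicator A x *\<^sub>R f x) \<in> borel_measurable borel" using f(1) assms(2) by measurable
  ultimately show ?thesis unfolding compact_density_def by blast
qed

lemma compact_density_bounded_linear:
  assumes "compact_density f" "bounded_linear L"
  shows "compact_density (\<lambda>x. L (f x))"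
proof -
  obtain M R where f: "f \<in> borel_measurable borel" "M > 0" "R > 0" "\<And>x. norm (f x) \<le> M"
    "\<And>x. x \<notin> cball 0 R \<Longrightarrow> f x = 0" using compact_densityE[OF assms(1)] by metis
  obtain C where C: "C > 0" "\<And>x. norm (L x) \<le> norm x * C"
    using bounded_linear.pos_bounded[OF assms(2)] by blast
  have "norm (L (f x)) \<le> M * C" for x
    using C(2)[of "f x"] mult_right_mono[OF f(4)[of x], of C] C(1) by linarith
  moreover have "L \<in> borel_measurable borel"
    using assms(2) by (intro borel_measurable_continuous_onI linear_continuous_on)
  moreover have "L (f x) = 0" if "x \<notin> cball 0 R" for x
    using f(5)[OF that] linear_0[OF bounded_linear.linear[OF assms(2)]] by simp
  ultimately show ?thesis unfolding compact_density_def using measurable_compose[OF f(1)] by blast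
qed

lemma compact_density_add:
  assumes "compact_density f" "compact_density g"
  shows "compact_density (\<lambda>x. f x + g x)"
proof -
  obtain M R where f: "f \<in> borel_measurable borel" "M > 0" "R > 0" "\<And>x. norm (f x) \<le> M"
    "\<And>x. x \<notin> cball 0 R \<Longrightarrow> f x = 0" using compact_densityE[OF assms(1)] by metis
  obtain M' R' where g: "g \<in> borel_measurable borel" "M' > 0" "R' > 0" "\<And>x. norm (g x) \<le> M'"
    "\<And>x. x \<notin> cball 0 R' \<Longrightarrow> g x = 0" using compact_densityE[OF assms(2)] by metis
  have 1: "\<forall>x. norm (f x + g x) \<le> M + M'" using norm_triangle_mono[OF f(4) g(4)] by simp
  have 2: "f x + g x = 0" if "x \<notin> cball 0 (max R R')" for x
  proof -
    have "x \<notin> cball 0 R" "x \<notin> cball 0 R'" using that by auto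
    then show ?thesis using f(5) g(5) by simp
  qed
  show ?thesis unfolding compact_density_def
    using borel_measurable_add[OF f(1) g(1)] exI[of "\<lambda>M. \<forall>x. norm (f x + g x) \<le> M", OF 1] 2 by blast
qed

lemma locally_integrable_continuous:
  assumes "continuous_on UNIV k" shows "locally_integrable k"
  unfolding locally_integrable_def
proof (intro conjI allI)
  show "k \<in> borel_measurable borel" by (rule borel_measurable_continuous_onI[OF assms])
  show "integrable lborel (\<lambda>z. indicator (cball 0 R) z *\<^sub>R k z)" for R
    by (rule borel_integrable_compact[OF compact_cball continuous_on_subset[OF assms subset_UNIV]])
qed

lemma lborel_integral_reflect:
  fixes g :: "'a::euclidean_space \<Rightarrow> 'b::{banach,second_countable_topology}"
  assumes "g \<in> borel_measurable borel"
  shows "(\<integral>y. g (x - y) \<partial>lborel) = (\<integral>z. g z \<partial>lborel)"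
  using lborel_integral_affine[OF _ assms, of "-1" x] by simp

lemma lborel_integrable_reflect:
  fixes g :: "'a::euclidean_space \<Rightarrow> 'b::{banach,second_countable_topology}"
  assumes "integrable lborel g"
  shows "integrable lborel (\<lambda>y. g (x - y))"
  using lborel_integrable_affine[OF _ assms, of "-1" x] by simp

lemma conv_integrable:
  assumes "locally_integrable k" "compact_density f"
  shows "integrable lborel (\<lambda>y. k (x - y) *\<^sub>R f y)"
proof -
  obtain M R where f: "f \<in> borel_measurable borel" "M > 0" "R > 0" "\<And>x. norm (f x) \<le> M"
    "\<And>x. x \<notin> cball 0 R \<Longrightarrow> f x = 0" using compact_densityE[OF assms(2)] by metis
  have k [measurable]: "k \<in> borel_measurable borel" using assms(1) by (simp add: locally_integrable_def)
  define R' where "R' = norm x + R"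
  have "integrable lborel (\<lambda>z. indicator (cball 0 R') z *\<^sub>R k z)"
    using assms(1) by (simp add: locally_integrable_def)
  from integrable_mult_right[OF lborel_integrable_reflect[OF this, of x], of M]
  show ?thesis
  proof (rule Bochner_Integration.integrable_bound)
    show "AE y in lborel. norm (k (x - y) *\<^sub>R f y) \<le> norm (M * indicator (cball 0 R') (x - y) *\<^sub>R k (x - y))"
    proof (intro AE_I2)
      fix y
      show "norm (k (x - y) *\<^sub>R f y) \<le> norm (M * indicator (cball 0 R') (x - y) *\<^sub>R k (x - y))"
      proof (cases "y \<in> cball 0 R")
        case True
        then have "x - y \<in> cball 0 R'" unfolding R'_def using norm_triangle_ineq4[of x y] by simp
        then show ?thesis using f(2) mult_left_mono[OF f(4)[of y], of "\<bar>k (x - y)\<bar>"]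
          by (simp add: abs_mult mult.commute)
      qed (simp add: f(5))
    qed
  qed (use f(1) in measurable)
qed

lemma conv_flip:
  assumes "locally_integrable k" "compact_density f"
  shows "conv k f x = (\<integral>z. k z *\<^sub>R f (x - z) \<partial>lborel)"
proof -
  have [measurable]: "k \<in> borel_measurable borel" "f \<in> borel_measurable borel"
    using assms by (auto simp: locally_integrable_def compact_density_def)
  show ?thesis unfolding conv_def
    using lborel_integral_reflect[of "\<lambda>z. k z *\<^sub>R f (x - z)" x] by simp
qed

lemma conv_add:
  assumes "locally_integrable k" "compact_density f" "compact_density g"
  shows "conv k (\<lambda>y. f y + g y) x = conv k f x + conv k g x"
  unfolding conv_def scaleR_add_right
  by (intro Bochner_Integration.integral_add conv_integrable assms)

lemma conv_bounded_linear:
  assumes "locally_integrable k" "compact_density f" "bounded_linear L"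
  shows "conv k (\<lambda>y. L (f y)) x = L (conv k f x)"
  unfolding conv_def using integral_bounded_linear[OF assms(3) conv_integrable[OF assms(1,2)], of x]
  by (simp add: linear_scale[OF bounded_linear.linear[OF assms(3)]])

lemma conv_sum:
  assumes "locally_integrable k" "\<And>i. i \<in> I \<Longrightarrow> compact_density (f i)"
  shows "conv k (\<lambda>y. \<Sum>i\<in>I. f i y) x = (\<Sum>i\<in>I. conv k (f i) x)"
  unfolding conv_def scaleR_sum_right
  by (rule Bochner_Integration.integral_sum) (intro conv_integrable assms)

lemma conv_sum_kernel:
  assumes "\<And>i. i \<in> I \<Longrightarrow> locally_integrable (k i)" "compact_density f"
  shows "conv (\<lambda>z. \<Sum>i\<in>I. k i z) f x = (\<Sum>i\<in>I. conv (k i) f x)"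
  unfolding conv_def scaleR_sum_left
  by (rule Bochner_Integration.integral_sum) (intro conv_integrable assms)

lemma C1_bound:
  fixes f :: "'a::euclidean_space \<Rightarrow> 'b::real_normed_vector"
  assumes "compact K" "\<And>x. x \<in> K \<Longrightarrow> f differentiable (at x)" "\<And>v. continuous_on K (dderiv v f)"
  obtains C where "C \<ge> 0" "\<And>x v. x \<in> K \<Longrightarrow> norm (dderiv v f x) \<le> C * norm v"
proof -
  have "\<exists>c. \<forall>x\<in>K. norm (dderiv b f x) \<le> c" for b
    using compact_imp_bounded[OF compact_continuous_image[OF assms(3,1), of b]] unfolding bounded_iff by auto
  then obtain c where c: "\<And>b x. x \<in> K \<Longrightarrow> norm (dderiv b f x) \<le> c b" by metis
  show ?thesis
  proof (rule that[of "\<Sum>b\<in>Basis. \<bar>c b\<bar>"])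
    fix x v assume x: "x \<in> K"
    have lin: "linear (\<lambda>v. dderiv v f x)"
      using has_derivative_linear[OF has_derivative_dderiv[OF assms(2)[OF x]]] .
    have "dderiv v f x = dderiv (\<Sum>b\<in>Basis. (v \<bullet> b) *\<^sub>R b) f x" by (simp add: euclidean_representation)
    also have "\<dots> = (\<Sum>b\<in>Basis. (v \<bullet> b) *\<^sub>R dderiv b f x)"
      using linear_sum[OF lin, of "\<lambda>b. (v \<bullet> b) *\<^sub>R b" Basis] linear_scale[OF lin] by simp
    finally have "norm (dderiv v f x) \<le> (\<Sum>b\<in>Basis. norm ((v \<bullet> b) *\<^sub>R dderiv b f x))"
      by (metis norm_sum)
    also have "\<dots> \<le> (\<Sum>b\<in>Basis. norm v * \<bar>c b\<bar>)"
    proof (rule sum_mono)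
      fix b :: 'a assume b: "b \<in> Basis"
      have "norm (dderiv b f x) \<le> \<bar>c b\<bar>" using c[OF x, of b] by simp
      then show "norm ((v \<bullet> b) *\<^sub>R dderiv b f x) \<le> norm v * \<bar>c b\<bar>"
        using Basis_le_norm[OF b, of v] by (simp add: mult_mono)
    qed
    finally show "norm (dderiv v f x) \<le> (\<Sum>b\<in>Basis. \<bar>c b\<bar>) * norm v"
      by (simp add: sum_distrib_left mult.commute)
  qed (simp add: sum_nonneg)
qed

lemma Cm_on_1_differentiable: "Cm_on (Suc m) U f \<Longrightarrow> x \<in> U \<Longrightarrow> f differentiable (at x)"
  by (simp add: Cm_on_Suc_iff)

lemma Cm_on_1_dderiv: "Cm_on (Suc m) U f \<Longrightarrow> Cm_on m U (dderiv v f)"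
  by (simp add: Cm_on_Suc_iff)

text \<open>The derivative falls on the smooth factor \<open>f\<close>, which lets the kernel be
  singular.\<close>

lemma conv_has_derivative_density:
  fixes f :: "'a::euclidean_space \<Rightarrow> 'b::euclidean_space"
  assumes k: "locally_integrable k" and f: "Cm_on 1 UNIV f" and K: "compact K" "\<And>x. x \<notin> K \<Longrightarrow> f x = 0"
  shows "(conv k f has_derivative (\<lambda>v. conv k (dderiv v f) x)) (at x)"
proof -
  have diff: "f differentiable (at y)" for y using f Cm_on_1_differentiable[of 0 UNIV f y] by simp
  have cont: "continuous_on UNIV (dderiv v f)" for v using f Cm_on_1_dderiv[of 0 UNIV f v] by simp
  have zero: "dderiv v f y = 0" if "y \<notin> K" for y v
    by (rule dderiv_zero_outside[OF compact_imp_closed[OF K(1)] K(2) that])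
  obtain C where C: "C \<ge> 0" "\<And>x v. x \<in> K \<Longrightarrow> norm (dderiv v f x) \<le> C * norm v"
    using C1_bound[OF K(1) diff continuous_on_subset[OF cont subset_UNIV]] by metis
  obtain R where R: "\<And>x. x \<in> K \<Longrightarrow> norm x \<le> R"
    using compact_imp_bounded[OF K(1)] unfolding bounded_iff by blast
  have df: "compact_density f"
    by (rule compact_density_continuous[OF _ K]) (use f Cm_on_continuous in auto)
  have ddf: "compact_density (dderiv v f)" for v
    by (rule compact_density_continuous[OF cont K(1) zero])
  have [measurable]: "k \<in> borel_measurable borel" using k by (simp add: locally_integrable_def)
  have [measurable]: "dderiv v f \<in> borel_measurable borel" for v using ddf by (simp add: compact_density_def)
  define R' where "R' = norm x + 1 + R"
  have "((\<lambda>x. \<integral>z. k z *\<^sub>R f (x - z) \<partial>lborel) has_derivative (\<lambda>v. \<integral>z. k z *\<^sub>R dderiv v f (x - z) \<partial>lborel)) (at x)"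
  proof (rule has_derivative_integral[where r = 1 and w = "\<lambda>z. C * \<bar>indicator (cball 0 R') z *\<^sub>R k z\<bar>"
        and f' = "\<lambda>x z v. k z *\<^sub>R dderiv v f (x - z)"])
    fix x' assume "x' \<in> ball x 1"
    show "integrable lborel (\<lambda>z. k z *\<^sub>R f (x' - z))"
      using lborel_integrable_reflect[OF conv_integrable[OF k df, of x'], of x'] by simp
  next
    fix x' z
    have 1: "(f has_derivative (\<lambda>v. dderiv v f (x' - z))) (at (x' - z))" by (rule has_derivative_dderiv[OF diff])
    have "((\<lambda>x. f (x - z)) has_derivative (\<lambda>v. dderiv v f (x' - z))) (at x')"
      by (rule has_derivative_compose[where f = "\<lambda>x. x - z" and g = f, OF _ 1]) (auto intro!: derivative_eq_intros)
    then show "((\<lambda>x. k z *\<^sub>R f (x - z)) has_derivative (\<lambda>v. k z *\<^sub>R dderiv v f (x' - z))) (at x')"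
      by (rule has_derivative_scaleR_right)
  next
    fix x' z v assume x': "x' \<in> ball x 1"
    show "norm (k z *\<^sub>R dderiv v f (x' - z)) \<le> C * \<bar>indicator (cball 0 R') z *\<^sub>R k z\<bar> * norm v"
    proof (cases "x' - z \<in> K")
      case True
      have "norm z \<le> norm x' + norm (x' - z)" using norm_triangle_ineq4[of x' "x' - z"] by simp
      moreover have "norm x' \<le> norm x + 1" using x' norm_triangle_ineq2[of x' x] by (simp add: dist_norm norm_minus_commute)
      ultimately have "z \<in> cball 0 R'" unfolding R'_def using R[OF True] by simp
      then show ?thesis using mult_left_mono[OF C(2)[OF True, of v], of "\<bar>k z\<bar>"] by (simp add: mult_ac)
    next
      case False
      then show ?thesis using zero C(1) by simp
    qed
  next
    show "integrable lborel (\<lambda>z. C * \<bar>indicator (cball 0 R') z *\<^sub>R k z\<bar>)"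
      using k by (intro integrable_mult_right integrable_abs) (simp add: locally_integrable_def)
  qed auto
  moreover have "conv k f = (\<lambda>x. \<integral>z. k z *\<^sub>R f (x - z) \<partial>lborel)" by (rule ext) (rule conv_flip[OF k df])
  ultimately show ?thesis by (simp add: conv_flip[OF k ddf])
qed

text \<open>The derivative falls on the kernel, which lets the density jump. The kernel has to be
  differentiable only on a set \<open>S\<close> that contains all differences between points near
  \<open>x\<close> and points of the support; with \<open>S\<close> the punctured space this covers
  singular kernels away from the support of \<open>f\<close>.\<close>

lemma conv_has_derivative_kernel:
  fixes f :: "'a::euclidean_space \<Rightarrow> 'b::euclidean_space"
  assumes S: "open S" "Cm_on 1 S k" and f: "compact_density f" and K: "compact K" "K \<subseteq> S"
    and r: "r > 0" and sup: "\<And>x' y. x' \<in> ball x r \<Longrightarrow> f y \<noteq> 0 \<Longrightarrow> x' - y \<in> K"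
  shows "(conv k f has_derivative (\<lambda>v. conv (dderiv v k) f x)) (at x)"
proof -
  have diff: "k differentiable (at y)" if "y \<in> S" for y using S(2) Cm_on_1_differentiable[of 0 S k y] that by simp
  have cont: "continuous_on S (dderiv v k)" for v using S(2) Cm_on_1_dderiv[of 0 S k v] by simp
  have diffK: "k differentiable (at y)" if "y \<in> K" for y using diff K(2) that by blast
  have cont0: "continuous_on S k" by (rule Cm_on_continuous[OF S(2)])
  obtain C where C: "C \<ge> 0" "\<And>x v. x \<in> K \<Longrightarrow> norm (dderiv v k x) \<le> C * norm v"
    using C1_bound[OF K(1) diffK continuous_on_subset[OF cont K(2)]] by metis
  obtain M where M: "\<And>x. x \<in> K \<Longrightarrow> norm (k x) \<le> M"
    using compact_imp_bounded[OF compact_continuous_image[OF continuous_on_subset[OF cont0 K(2)] K(1)]]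
    unfolding bounded_iff by auto
  have [measurable]: "f \<in> borel_measurable borel" using f by (simp add: compact_density_def)
  have intf: "integrable lborel (\<lambda>y. norm (f y))" using compact_density_integrable[OF f] by simp
  have Kb: "K \<in> sets borel" by (intro borel_closed compact_imp_closed K(1))
  define k0 where "k0 z = indicator K z *\<^sub>R k z" for z
  define k1 where "k1 v z = indicator K z *\<^sub>R dderiv v k z" for v z
  have [measurable]: "k0 \<in> borel_measurable borel"
    unfolding k0_def[abs_def] by (rule borel_measurable_continuous_on_indicator[OF Kb continuous_on_subset[OF cont0 K(2)]])
  have [measurable]: "k1 v \<in> borel_measurable borel" for v
    unfolding k1_def[abs_def] by (rule borel_measurable_continuous_on_indicator[OF Kb continuous_on_subset[OF cont K(2)]])
  have k0: "k (x' - y) *\<^sub>R f y = k0 (x' - y) *\<^sub>R f y" if "x' \<in> ball x r" for x' y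
    using sup[OF that, of y] by (cases "f y = 0") (auto simp: k0_def)
  have k1: "dderiv v k (x' - y) *\<^sub>R f y = k1 v (x' - y) *\<^sub>R f y" if "x' \<in> ball x r" for x' y v
    using sup[OF that, of y] by (cases "f y = 0") (auto simp: k1_def)
  show ?thesis unfolding conv_def[abs_def]
  proof (rule has_derivative_integral[where r = r and w = "\<lambda>y. C * norm (f y)"
        and f' = "\<lambda>x y v. dderiv v k (x - y) *\<^sub>R f y", OF r])
    fix x' assume x': "x' \<in> ball x r"
    have "integrable lborel (\<lambda>y. k0 (x' - y) *\<^sub>R f y)"
    proof (rule Bochner_Integration.integrable_bound[of _ "\<lambda>y. \<bar>M\<bar> * norm (f y)"])
      show "AE y in lborel. norm (k0 (x' - y) *\<^sub>R f y) \<le> norm (\<bar>M\<bar> * norm (f y))"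
      proof (intro AE_I2)
        fix y
        have "\<bar>k0 (x' - y)\<bar> \<le> \<bar>M\<bar>" unfolding k0_def using M[of "x' - y"] by (cases "x' - y \<in> K") auto
        then show "norm (k0 (x' - y) *\<^sub>R f y) \<le> norm (\<bar>M\<bar> * norm (f y))"
          by (simp add: mult_right_mono)
      qed
    qed (use intf in auto)
    then show "integrable lborel (\<lambda>y. k (x' - y) *\<^sub>R f y)" by (simp only: k0[OF x'])
  next
    fix x' y assume x': "x' \<in> ball x r"
    show "((\<lambda>x. k (x - y) *\<^sub>R f y) has_derivative (\<lambda>v. dderiv v k (x' - y) *\<^sub>R f y)) (at x')"
    proof (cases "f y = 0")
      case False
      then have "x' - y \<in> S" using sup[OF x'] K(2) by blast
      then have 1: "(k has_derivative (\<lambda>v. dderiv v k (x' - y))) (at (x' - y))"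
        using has_derivative_dderiv[OF diff] by blast
      have "((\<lambda>x. k (x - y)) has_derivative (\<lambda>v. dderiv v k (x' - y))) (at x')"
        by (rule has_derivative_compose[where f = "\<lambda>x. x - y" and g = k, OF _ 1]) (auto intro!: derivative_eq_intros)
      then show ?thesis by (rule has_derivative_scaleR_left)
    qed simp
  next
    fix x' y v assume x': "x' \<in> ball x r"
    show "norm (dderiv v k (x' - y) *\<^sub>R f y) \<le> C * norm (f y) * norm v"
    proof (cases "f y = 0")
      case False
      then have "norm (dderiv v k (x' - y)) \<le> C * norm v" using C(2) sup[OF x'] by blast
      from mult_right_mono[OF this, of "norm (f y)"] show ?thesis by (simp add: mult_ac)
    qed simp
  next
    fix v
    show "(\<lambda>y. dderiv v k (x - y) *\<^sub>R f y) \<in> borel_measurable lborel"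
      using r by (simp only: k1[OF centre_in_ball[THEN iffD2]]) measurable
  qed (use intf in auto)
qed

lemma conv_has_derivative_smooth_kernel:
  fixes f :: "'a::euclidean_space \<Rightarrow> 'b::euclidean_space"
  assumes "Cm_on 1 UNIV k" "compact_density f"
  shows "(conv k f has_derivative (\<lambda>v. conv (dderiv v k) f x)) (at x)"
proof -
  obtain R where R: "\<And>y. y \<notin> cball 0 R \<Longrightarrow> f y = 0"
    using compact_densityE[OF assms(2)] by metis
  show ?thesis
  proof (rule conv_has_derivative_kernel[OF open_UNIV assms(1,2)])
    show "compact {a - b |a b. a \<in> cball x 1 \<and> b \<in> cball 0 R}" by (intro compact_differences) auto
    show "x' - y \<in> {a - b |a b. a \<in> cball x 1 \<and> b \<in> cball 0 R}" if "x' \<in> ball x 1" "f y \<noteq> 0" for x' y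
      using that R[of y] ball_subset_cball by blast
  qed auto
qed

lemma Cm_on_conv_kernel:
  assumes "Cm_on m UNIV k" "compact_density f"
  shows "Cm_on m UNIV (conv k f)"
  using assms(1)
proof (induction m arbitrary: k)
  case 0
  then have ck: "continuous_on UNIV k" by simp
  have lk: "locally_integrable k" by (rule locally_integrable_continuous[OF ck])
  obtain M R where f: "f \<in> borel_measurable borel" "M > 0" "R > 0" "\<And>x. norm (f x) \<le> M"
    "\<And>x. x \<notin> cball 0 R \<Longrightarrow> f x = 0" using compact_densityE[OF assms(2)] by metis
  have "isCont (conv k f) x" for x
    unfolding continuous_at_sequentially o_def conv_def
  proof (intro allI impI)
    fix X assume X: "X \<longlonglongrightarrow> x"
    obtain B where B: "B > 0" "\<And>n. norm (X n) \<le> B"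
      using convergent_imp_Bseq[of X] X unfolding convergent_def Bseq_def by blast
    obtain C where C: "\<And>z. z \<in> cball 0 (B + R) \<Longrightarrow> norm (k z) \<le> C"
      using compact_imp_bounded[OF compact_continuous_image[OF continuous_on_subset[OF ck subset_UNIV] compact_cball[of 0 "B + R"]]]
      unfolding bounded_iff by (meson imageI)
    show "(\<lambda>n. \<integral>y. k (X n - y) *\<^sub>R f y \<partial>lborel) \<longlonglongrightarrow> (\<integral>y. k (x - y) *\<^sub>R f y \<partial>lborel)"
    proof (rule integral_dominated_convergence[where w = "\<lambda>y. C * norm (f y)"])
      show "AE y in lborel. (\<lambda>n. k (X n - y) *\<^sub>R f y) \<longlonglongrightarrow> k (x - y) *\<^sub>R f y"
      proof (intro AE_I2 tendsto_scaleR tendsto_const)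
        fix y
        have "isCont k (x - y)" using ck continuous_on_eq_continuous_at by blast
        moreover have "(\<lambda>n. X n - y) \<longlonglongrightarrow> x - y" using X by (intro tendsto_intros)
        ultimately show "(\<lambda>n. k (X n - y)) \<longlonglongrightarrow> k (x - y)" by (rule isCont_tendsto_compose)
      qed
      show "AE y in lborel. norm (k (X n - y) *\<^sub>R f y) \<le> C * norm (f y)" for n
      proof (intro AE_I2)
        fix y
        show "norm (k (X n - y) *\<^sub>R f y) \<le> C * norm (f y)"
        proof (cases "y \<in> cball 0 R")
          case True
          then have "X n - y \<in> cball 0 (B + R)" using norm_triangle_ineq4[of "X n" y] B(2)[of n] by simp
          then show ?thesis using C by (auto intro: mult_right_mono)
        qed (simp add: f(5))
      qed
    qed (use conv_integrable[OF lk assms(2)] compact_density_integrable[OF assms(2)] in auto)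
  qed
  then show ?case by (simp add: continuous_at_imp_continuous_on)
next
  case (Suc m)
  show ?case
    by (rule Cm_on_SucI[OF open_UNIV conv_has_derivative_smooth_kernel])
      (use Suc assms(2) Cm_on_le[OF Suc.prems, of 1] in \<open>auto simp: Cm_on_Suc_iff\<close>)
qed

lemma smooth_on_conv_kernel: "smooth_on UNIV k \<Longrightarrow> compact_density f \<Longrightarrow> smooth_on UNIV (conv k f)"
  unfolding smooth_on_def using Cm_on_conv_kernel by blast

lemma Cm_on_conv_density:
  fixes f :: "'a::euclidean_space \<Rightarrow> 'b::euclidean_space"
  assumes k: "locally_integrable k" and f: "Cm_on m UNIV f" and K: "compact K" "\<And>x. x \<notin> K \<Longrightarrow> f x = 0"
  shows "Cm_on m UNIV (conv k f)"
  using f K(2)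
proof (induction m arbitrary: f)
  case 0
  then have cf: "continuous_on UNIV f" by simp
  have df: "compact_density f" by (rule compact_density_continuous[OF cf K(1) 0(2)])
  obtain M R where f: "f \<in> borel_measurable borel" "M > 0" "R > 0" "\<And>x. norm (f x) \<le> M"
    "\<And>x. x \<notin> cball 0 R \<Longrightarrow> f x = 0" using compact_densityE[OF df] by metis
  have "isCont (conv k f) x" for x
    unfolding continuous_at_sequentially o_def conv_flip[OF k df]
  proof (intro allI impI)
    fix X assume X: "X \<longlonglongrightarrow> x"
    obtain B where B: "B > 0" "\<And>n. norm (X n) \<le> B"
      using convergent_imp_Bseq[of X] X unfolding convergent_def Bseq_def by blast
    show "(\<lambda>n. \<integral>z. k z *\<^sub>R f (X n - z) \<partial>lborel) \<longlonglongrightarrow> (\<integral>z. k z *\<^sub>R f (x - z) \<partial>lborel)"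
    proof (rule integral_dominated_convergence[where w = "\<lambda>z. M * \<bar>indicator (cball 0 (B + R)) z *\<^sub>R k z\<bar>"])
      show "AE z in lborel. (\<lambda>n. k z *\<^sub>R f (X n - z)) \<longlonglongrightarrow> k z *\<^sub>R f (x - z)"
      proof (intro AE_I2 tendsto_scaleR tendsto_const)
        fix z
        have "isCont f (x - z)" using cf continuous_on_eq_continuous_at by blast
        moreover have "(\<lambda>n. X n - z) \<longlonglongrightarrow> x - z" using X by (intro tendsto_intros)
        ultimately show "(\<lambda>n. f (X n - z)) \<longlonglongrightarrow> f (x - z)" by (rule isCont_tendsto_compose)
      qed
      show "AE z in lborel. norm (k z *\<^sub>R f (X n - z)) \<le> M * \<bar>indicator (cball 0 (B + R)) z *\<^sub>R k z\<bar>" for n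
      proof (intro AE_I2)
        fix z
        show "norm (k z *\<^sub>R f (X n - z)) \<le> M * \<bar>indicator (cball 0 (B + R)) z *\<^sub>R k z\<bar>"
        proof (cases "X n - z \<in> cball 0 R")
          case True
          then have "z \<in> cball 0 (B + R)" using norm_triangle_ineq4[of "X n" "X n - z"] B(2)[of n] by simp
          then show ?thesis using mult_left_mono[OF f(4)[of "X n - z"], of "\<bar>k z\<bar>"] by (simp add: mult_ac)
        qed (use f(2) in \<open>simp add: f(5)\<close>)
      qed
      show "integrable lborel (\<lambda>z. M * \<bar>indicator (cball 0 (B + R)) z *\<^sub>R k z\<bar>)"
        using k by (intro integrable_mult_right integrable_abs) (simp add: locally_integrable_def)
      have "(\<lambda>z. k z *\<^sub>R f (x - z)) \<in> borel_measurable lborel" for x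
        using f(1) k by (auto simp: locally_integrable_def)
      then show "(\<lambda>z. k z *\<^sub>R f (x - z)) \<in> borel_measurable lborel"
        "\<And>n. (\<lambda>z. k z *\<^sub>R f (X n - z)) \<in> borel_measurable lborel" by blast+
    qed
  qed
  then show ?case by (simp add: continuous_at_imp_continuous_on)
next
  case (Suc m)
  show ?case
  proof (rule Cm_on_SucI[OF open_UNIV conv_has_derivative_density[OF k _ K(1)]])
    show "Cm_on 1 UNIV f" using Cm_on_le[OF Suc.prems(1), of 1] by simp
    show "Cm_on m UNIV (\<lambda>x. conv k (dderiv v f) x)" for v
      by (rule Suc.IH[OF Cm_on_1_dderiv[OF Suc.prems(1)] dderiv_zero_outside[OF compact_imp_closed[OF K(1)] Suc.prems(2)]])
  qed (use Suc.prems(2) in auto)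
qed

text \<open>Both sides are the derivative of the same convolution, computed on one or the other
  factor.\<close>

lemma conv_integration_by_parts:
  fixes f :: "'a::euclidean_space \<Rightarrow> 'b::euclidean_space"
  assumes k: "Cm_on 1 UNIV k" and f: "Cm_on 1 UNIV f" and K: "compact K" "\<And>x. x \<notin> K \<Longrightarrow> f x = 0"
  shows "conv k (dderiv v f) x = conv (dderiv v k) f x"
proof -
  have lk: "locally_integrable k" using Cm_on_continuous[OF k] by (rule locally_integrable_continuous)
  have df: "compact_density f"
    by (rule compact_density_continuous[OF Cm_on_continuous[OF f] K])
  have "(\<lambda>v. conv k (dderiv v f) x) = (\<lambda>v. conv (dderiv v k) f x)"
    by (rule has_derivative_unique[OF conv_has_derivative_density[OF lk f K] conv_has_derivative_smooth_kernel[OF k df]])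
  then show ?thesis by meson
qed

text \<open>Convolution with the constant kernel 1 is the integral, and the derivative of that
  kernel is zero.\<close>

lemma integral_dderiv_eq_0:
  fixes f :: "'a::euclidean_space \<Rightarrow> 'b::euclidean_space"
  assumes f: "Cm_on 1 UNIV f" and K: "compact K" "\<And>x. x \<notin> K \<Longrightarrow> f x = 0"
  shows "(\<integral>y. dderiv v f y \<partial>lborel) = 0"
proof -
  have "dderiv v (\<lambda>y::'a. 1::real) = (\<lambda>y. 0)" by (rule ext) (rule dderiv_eqI, simp)
  then show ?thesis
    using conv_integration_by_parts[OF Cm_on_const[of 1 UNIV 1] f K, of v 0] by (simp add: conv_def)
qed

lemma integral_by_parts_bilinear:
  fixes f :: "'a::euclidean_space \<Rightarrow> 'b::euclidean_space" and g :: "'a \<Rightarrow> 'c::euclidean_space"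
    and B :: "'b \<Rightarrow> 'c \<Rightarrow> 'd::euclidean_space"
  assumes B: "bounded_bilinear B" and f: "smooth_on UNIV f" and g: "smooth_on UNIV g"
    and K: "compact K" "\<And>x. x \<notin> K \<Longrightarrow> f x = 0 \<or> g x = 0"
  shows "(\<integral>y. B (dderiv v f y) (g y) \<partial>lborel) = - (\<integral>y. B (f y) (dderiv v g y) \<partial>lborel)"
proof -
  interpret B: bounded_bilinear B by fact
  have d: "dderiv v (\<lambda>y. B (f y) (g y)) y = B (f y) (dderiv v g y) + B (dderiv v f y) (g y)" for y
    by (rule dderiv_eqI[OF B.FDERIV]) (use f g smooth_on_has_derivative in auto)
  have z: "B (f y) (g y) = 0" if "y \<notin> K" for y using K(2)[OF that] by (auto simp: B.zero_left B.zero_right)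
  have sm: "smooth_on UNIV (\<lambda>y. B (f y) (g y))" by (rule smooth_on_bilinear[OF B open_UNIV f g])
  have i: "integrable lborel (\<lambda>y. B (p y) (q y))"
    if "continuous_on UNIV p" "continuous_on UNIV q" "\<And>y. y \<notin> K \<Longrightarrow> B (p y) (q y) = 0" for p q
    by (rule compact_density_integrable[OF compact_density_continuous[OF _ K(1)]])
      (use that in \<open>auto intro: B.continuous_on\<close>)
  have zd: "B (f y) (dderiv v g y) = 0 \<and> B (dderiv v f y) (g y) = 0" if "y \<notin> K" for y
  proof -
    have o: "open (- K)" using K(1) compact_imp_closed by blast
    have *: "f y \<noteq> 0 \<Longrightarrow> dderiv v g y = 0"
    proof -
      assume "f y \<noteq> 0"
      have "open {y. f y \<noteq> 0}" using smooth_on_continuous[OF f] by (intro open_Collect_neq) auto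
      then have "dderiv v g y = dderiv v (\<lambda>y. 0) y"
        using K(2) that \<open>f y \<noteq> 0\<close> by (intro dderiv_transform_open[OF open_Int[OF o, of "{y. f y \<noteq> 0}"]]) auto
      then show ?thesis using dderiv_eqI[OF has_derivative_const] by metis
    qed
    have **: "g y \<noteq> 0 \<Longrightarrow> dderiv v f y = 0"
    proof -
      assume "g y \<noteq> 0"
      have "open {y. g y \<noteq> 0}" using smooth_on_continuous[OF g] by (intro open_Collect_neq) auto
      then have "dderiv v f y = dderiv v (\<lambda>y. 0) y"
        using K(2) that \<open>g y \<noteq> 0\<close> by (intro dderiv_transform_open[OF open_Int[OF o, of "{y. g y \<noteq> 0}"]]) auto
      then show ?thesis using dderiv_eqI[OF has_derivative_const] by metis
    qed
    show ?thesis using * ** by (cases "f y = 0"; cases "g y = 0") (auto simp: B.zero_left B.zero_right)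
  qed
  have cf: "continuous_on UNIV f" "continuous_on UNIV g" "continuous_on UNIV (dderiv v f)" "continuous_on UNIV (dderiv v g)"
    using f g smooth_on_continuous smooth_on_dderiv by blast+
  have "0 = (\<integral>y. B (f y) (dderiv v g y) + B (dderiv v f y) (g y) \<partial>lborel)"
    using integral_dderiv_eq_0[OF smooth_onD[OF sm] K(1) z, of v] by (simp add: d)
  also have "\<dots> = (\<integral>y. B (f y) (dderiv v g y) \<partial>lborel) + (\<integral>y. B (dderiv v f y) (g y) \<partial>lborel)"
    by (rule Bochner_Integration.integral_add) (use i cf zd in blast)+
  finally show ?thesis by (simp add: eq_neg_iff_add_eq_0 add.commute)
qed

section \<open>The Newton kernel and its regularisation\<close>

lemma sets_borel_cball [measurable]: "cball a r \<in> sets borel"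
  by simp

text \<open>A radial function is integrable as soon as its values on concentric balls decay faster
  than the volumes grow.\<close>

lemma integrable_of_ball_cover:
  fixes f :: "'a::euclidean_space \<Rightarrow> real"
  assumes [measurable]: "f \<in> borel_measurable borel" and nn: "\<And>x. f x \<ge> 0"
    and a: "\<And>i. a i \<ge> 0" and r: "\<And>i. r i \<ge> 0"
    and cover: "\<And>x. f x \<noteq> 0 \<Longrightarrow> \<exists>i::nat. norm x \<le> r i \<and> f x \<le> a i"
    and sm: "summable (\<lambda>i. a i * r i ^ DIM('a))"
  shows "integrable lborel f"
proof -
  have [measurable]: "cball 0 (r i) \<in> sets (borel :: 'a measure)" for i by simp
  define \<omega> where "\<omega> = unit_ball_vol (real DIM('a))"
  have w: "\<omega> \<ge> 0" unfolding \<omega>_def by simp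
  have "(\<integral>\<^sup>+x. ennreal (f x) \<partial>lborel) \<le> (\<integral>\<^sup>+(x::'a). (\<Sum>i. ennreal (a i) * indicator (cball 0 (r i)) x) \<partial>lborel)"
  proof (rule nn_integral_mono)
    fix x :: 'a
    show "ennreal (f x) \<le> (\<Sum>i. ennreal (a i) * indicator (cball 0 (r i)) x)"
    proof (cases "f x = 0")
      case False
      then obtain i where i: "norm x \<le> r i" "f x \<le> a i" using cover by blast
      define F where "F j = ennreal (a j) * indicator (cball 0 (r j)) x" for j
      have "ennreal (f x) \<le> F i"
        using i by (simp add: F_def ennreal_leI)
      also have "\<dots> \<le> suminf F"
        using sum_le_suminf[of F "{i}"] by simp
      finally show ?thesis by (simp add: F_def[abs_def])
    qed simp
  qed
  also have "\<dots> = (\<Sum>i. \<integral>\<^sup>+(x::'a). ennreal (a i) * indicator (cball 0 (r i)) x \<partial>lborel)"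
    by (rule nn_integral_suminf) measurable
  also have "\<dots> = (\<Sum>i. ennreal (\<omega> * (a i * r i ^ DIM('a))))"
  proof (rule suminf_cong)
    fix i
    have "(\<integral>\<^sup>+(x::'a). ennreal (a i) * indicator (cball 0 (r i)) x \<partial>lborel) = ennreal (a i) * emeasure lborel (cball (0::'a) (r i))"
      by (subst nn_integral_cmult_indicator) auto
    also have "\<dots> = ennreal (\<omega> * (a i * r i ^ DIM('a)))"
      unfolding emeasure_cball[OF r] \<omega>_def[symmetric] using a[of i] w r[of i]
      by (simp add: ennreal_mult'[symmetric] mult_ac)
    finally show "(\<integral>\<^sup>+(x::'a). ennreal (a i) * indicator (cball 0 (r i)) x \<partial>lborel) = ennreal (\<omega> * (a i * r i ^ DIM('a)))" .
  qed
  also have "\<dots> = ennreal (\<Sum>i. \<omega> * (a i * r i ^ DIM('a)))"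
    using a r w sm by (intro suminf_ennreal2 summable_mult) auto
  finally have "(\<integral>\<^sup>+x. ennreal (f x) \<partial>lborel) < \<infinity>"
    by (simp add: le_less_trans)
  then show ?thesis using nn by (intro integrableI_nonneg) auto
qed

text \<open>On the shell between the radii \<open>R / 2\<^sup>i\<^sup>+\<^sup>1\<close> and \<open>R
  / 2\<^sup>i\<close> the function times the volume is of size \<open>R / 2\<^sup>i\<close>.\<close>

lemma locally_integrable_norm_powr:
  "locally_integrable (\<lambda>z::'a::euclidean_space. norm z powr (1 - real DIM('a)))"
  unfolding locally_integrable_def
proof (intro conjI allI)
  show m: "(\<lambda>z::'a. norm z powr (1 - real DIM('a))) \<in> borel_measurable borel" by measurable
  fix R :: real
  have m2: "(\<lambda>z::'a. indicator (cball 0 R) z *\<^sub>R norm z powr (1 - real DIM('a))) \<in> borel_measurable borel"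
    by (intro borel_measurable_scaleR borel_measurable_indicator m) simp
  define N where "N = real DIM('a)"
  have N: "N \<ge> 1" unfolding N_def using DIM_positive[where 'a='a] by linarith
  show "integrable lborel (\<lambda>z::'a. indicator (cball 0 R) z *\<^sub>R norm z powr (1 - real DIM('a)))"
  proof (cases "R > 0")
    case R: True
    show ?thesis
    proof (rule integrable_of_ball_cover[where r = "\<lambda>i. R / 2 ^ i" and a = "\<lambda>i. (R / 2 ^ Suc i) powr (1 - N)"])
      fix x :: 'a assume "indicator (cball 0 R) x *\<^sub>R norm x powr (1 - real DIM('a)) \<noteq> 0"
      then have x: "norm x \<le> R" "x \<noteq> 0" by (auto split: split_indicator_asm)
      have "\<exists>n. R / 2 ^ n < norm x"
      proof -
        obtain n where "R / norm x < 2 ^ n" using real_arch_pow[of 2 "R / norm x"] by auto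
        then show ?thesis using x by (auto simp: field_simps)
      qed
      then obtain n where n: "R / 2 ^ n < norm x" "\<And>m. m < n \<Longrightarrow> \<not> R / 2 ^ m < norm x"
        using exists_least_iff[of "\<lambda>n. R / 2 ^ n < norm x"] by blast
      have "n \<noteq> 0" using n(1) x(1) by (intro notI) simp
      then obtain i where i: "n = Suc i" using not0_implies_Suc by blast
      have "norm x powr (1 - N) \<le> (R / 2 ^ Suc i) powr (1 - N)"
        using n(1) i R N by (intro powr_mono2') auto
      then show "\<exists>i. norm x \<le> R / 2 ^ i \<and> indicator (cball 0 R) x *\<^sub>R norm x powr (1 - real DIM('a)) \<le> (R / 2 ^ Suc i) powr (1 - N)"
        using n(2)[of i] i x(1) by (intro exI[of _ i]) (auto simp: N_def)
    next
      have "(R / 2 ^ Suc i) powr (1 - N) * (R / 2 ^ i) ^ DIM('a) = (R / 2 powr (1 - N)) * (1 / 2) ^ i" for i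
      proof -
        have p: "R / 2 ^ i > 0" using R by simp
        have "(R / 2 ^ Suc i) powr (1 - N) = (R / 2 ^ i) powr (1 - N) / 2 powr (1 - N)"
          by (simp only: power_Suc2 powr_divide powr_mult divide_divide_eq_left)
        moreover have "(R / 2 ^ i) ^ DIM('a) = (R / 2 ^ i) powr N"
          using p by (simp add: N_def powr_realpow)
        moreover have "s powr (1 - N) * s powr N = s" if "s > 0" for s
          using that by (simp add: powr_add[symmetric])
        note this[OF p]
        ultimately show ?thesis by (simp add: power_divide)
      qed
      then show "summable (\<lambda>i. (R / 2 ^ Suc i) powr (1 - N) * (R / 2 ^ i) ^ DIM('a))"
        by (simp add: summable_mult summable_geometric)
    qed (use R m2 in auto)
  next
    case False
    then have "indicator (cball 0 R) z *\<^sub>R norm z powr (1 - real DIM('a)) = 0" for z :: 'a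
      using zero_less_norm_iff[of z] by (cases "z = 0") (auto simp: indicator_def simp del: zero_less_norm_iff)
    then show ?thesis by (simp only: integrable_zero)
  qed
qed

text \<open>For \<open>t = 0\<close> the derivative in direction \<open>e\<close> of the Newton
  potential, up to normalisation; for \<open>t > 0\<close> the same derivative of its regularisation
  \<open>pot t\<close>, which is smooth everywhere.\<close>

definition kern :: "real \<Rightarrow> 'a::euclidean_space \<Rightarrow> 'a \<Rightarrow> real" where
  "kern t e x = (x \<bullet> e) * (x \<bullet> x + t) powr (- real DIM('a) / 2)"

text \<open>An antiderivative of \<open>kern t\<close>; in two dimensions the power becomes a
  logarithm.\<close>

definition pot :: "real \<Rightarrow> 'a::euclidean_space \<Rightarrow> real" where
  "pot t x = (if DIM('a) = 2 then ln (x \<bullet> x + t) / 2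
     else (x \<bullet> x + t) powr (1 - real DIM('a) / 2) / (2 - real DIM('a)))"

text \<open>The Laplacian of \<open>pot t\<close>. It is positive and \<open>rho t\<close> arises
  from \<open>rho 1\<close> by scaling with \<open>sqrt t\<close>, so that the family is an
  approximate identity.\<close>

definition rho :: "real \<Rightarrow> 'a::euclidean_space \<Rightarrow> real" where
  "rho t x = real DIM('a) * t * (x \<bullet> x + t) powr (- real DIM('a) / 2 - 1)"

lemma has_derivative_shifted_square_powr:
  fixes x :: "'a::euclidean_space"
  assumes "x \<bullet> x + t > 0"
  shows "((\<lambda>x. (x \<bullet> x + t) powr a) has_derivative (\<lambda>v. 2 * a * (x \<bullet> v) * (x \<bullet> x + t) powr (a - 1))) (at x)"
proof -
  have 1: "((\<lambda>s. s powr a) has_derivative (*) (a * (x \<bullet> x + t) powr (a - 1))) (at (x \<bullet> x + t))"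
    using has_real_derivative_powr[OF assms, of a] unfolding has_field_derivative_def .
  have 2: "((\<lambda>x. x \<bullet> x + t) has_derivative (\<lambda>v. 2 * (x \<bullet> v))) (at x)"
    by (auto intro!: derivative_eq_intros simp: inner_commute)
  have "((\<lambda>x. (x \<bullet> x + t) powr a) has_derivative (\<lambda>v. a * (x \<bullet> x + t) powr (a - 1) * (2 * (x \<bullet> v)))) (at x)"
    using has_derivative_compose[where g = "\<lambda>s. s powr a", OF 2 1] .
  then show ?thesis by (simp only: mult.commute mult.left_commute mult.assoc)
qed

lemma has_derivative_kern:
  fixes x :: "'a::euclidean_space"
  assumes "x \<bullet> x + t > 0"
  shows "(kern t e has_derivative (\<lambda>v. (v \<bullet> e) * (x \<bullet> x + t) powr (- real DIM('a) / 2)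
     - real DIM('a) * (x \<bullet> e) * (x \<bullet> v) * (x \<bullet> x + t) powr (- real DIM('a) / 2 - 1))) (at x)"
  unfolding kern_def[abs_def]
  by (rule has_derivative_eq_rhs, rule has_derivative_mult[OF _ has_derivative_shifted_square_powr[OF assms]])
    (auto intro!: derivative_eq_intros simp: fun_eq_iff field_simps)

lemma dderiv_kern:
  fixes x :: "'a::euclidean_space"
  assumes "x \<bullet> x + t > 0"
  shows "dderiv v (kern t e) x = (v \<bullet> e) * (x \<bullet> x + t) powr (- real DIM('a) / 2)
     - real DIM('a) * (x \<bullet> e) * (x \<bullet> v) * (x \<bullet> x + t) powr (- real DIM('a) / 2 - 1)"
  using dderiv_eqI[OF has_derivative_kern[OF assms]] .

lemma dderiv_kern_symmetric:
  fixes x :: "'a::euclidean_space"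
  assumes "x \<bullet> x + t > 0"
  shows "dderiv v (kern t e) x = dderiv e (kern t v) x"
  by (simp add: dderiv_kern[OF assms] inner_commute)

lemma smooth_on_kern:
  fixes S :: "'a::euclidean_space set"
  assumes "open S" "\<And>x. x \<in> S \<Longrightarrow> x \<bullet> x + t > 0"
  shows "smooth_on S (kern t e)"
  unfolding kern_def[abs_def]
  by (intro smooth_on_mult smooth_on_powr smooth_on_inner smooth_on_add smooth_on_id smooth_on_const assms)

lemma inner_self_plus_pos: "t > 0 \<Longrightarrow> x \<bullet> x + t > 0"
  by (simp add: add_nonneg_pos)

lemma has_derivative_pot:
  fixes x :: "'a::euclidean_space"
  assumes "x \<bullet> x + t > 0"
  shows "(pot t has_derivative (\<lambda>v. kern t v x)) (at x)"
proof (cases "DIM('a) = 2")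
  case True
  have 2: "((\<lambda>x. x \<bullet> x + t) has_derivative (\<lambda>v. 2 * (x \<bullet> v))) (at x)"
    by (auto intro!: derivative_eq_intros simp: inner_commute)
  have "((\<lambda>x. ln (x \<bullet> x + t) * (1 / 2)) has_derivative (\<lambda>v. 2 * (x \<bullet> v) * inverse (x \<bullet> x + t) * (1 / 2))) (at x)"
    by (rule has_derivative_mult_left[OF has_derivative_ln[OF assms 2]])
  moreover have "pot t = (\<lambda>x::'a. ln (x \<bullet> x + t) * (1 / 2))" using True by (simp add: pot_def fun_eq_iff)
  moreover have "2 * (x \<bullet> v) * inverse (x \<bullet> x + t) * (1 / 2) = kern t v x" for v
    using True assms by (simp add: kern_def powr_minus)
  ultimately show ?thesis by simp
next
  case False
  let ?N = "real DIM('a)"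
  have "((\<lambda>x::'a. (x \<bullet> x + t) powr (1 - ?N / 2) * (1 / (2 - ?N))) has_derivative
     (\<lambda>v. 2 * (1 - ?N / 2) * (x \<bullet> v) * (x \<bullet> x + t) powr (1 - ?N / 2 - 1) * (1 / (2 - ?N)))) (at x)"
    by (rule has_derivative_mult_left[OF has_derivative_shifted_square_powr[OF assms]])
  moreover have "pot t = (\<lambda>x::'a. (x \<bullet> x + t) powr (1 - ?N / 2) * (1 / (2 - ?N)))"
    using False by (simp add: pot_def fun_eq_iff)
  moreover have "2 * (1 - ?N / 2) * (x \<bullet> v) * (x \<bullet> x + t) powr (1 - ?N / 2 - 1) * (1 / (2 - ?N)) = kern t v x" for v
  proof -
    have "2 - ?N \<noteq> 0" using False by linarith
    moreover have "2 * (1 - ?N / 2) = 2 - ?N" "1 - ?N / 2 - 1 = - ?N / 2" by auto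
    ultimately show ?thesis unfolding kern_def by (simp only:) (simp add: field_simps)
  qed
  ultimately show ?thesis by simp
qed

lemma dderiv_pot: "t > 0 \<Longrightarrow> dderiv v (pot t) = kern t v"
  by (rule ext) (rule dderiv_eqI[OF has_derivative_pot[OF inner_self_plus_pos]])

lemma smooth_on_pot: "t > 0 \<Longrightarrow> smooth_on UNIV (pot t)"
  by (rule smooth_onI[OF open_UNIV has_derivative_pot]) (auto intro: inner_self_plus_pos smooth_on_kern)

text \<open>The Laplacian of \<open>|x|\<^sup>2\<^sup>-\<^sup>N\<close> vanishes off the origin;
  after the shift by \<open>t\<close> the two terms differ by exactly one factor
  \<open>t\<close>.\<close>

lemma sum_dderiv_kern:
  fixes x :: "'a::euclidean_space"
  assumes "x \<bullet> x + t > 0"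
  shows "(\<Sum>e\<in>Basis. dderiv e (kern t e) x) = rho t x"
proof -
  let ?Q = "x \<bullet> x + t" and ?N = "real DIM('a)"
  have "(\<Sum>e\<in>Basis. dderiv e (kern t e) x)
      = (\<Sum>e\<in>(Basis::'a set). ?Q powr (- ?N / 2)) - (\<Sum>e\<in>Basis. ?N * ?Q powr (- ?N / 2 - 1) * ((x \<bullet> e) * (x \<bullet> e)))"
    unfolding sum_subtractf[symmetric]
    by (rule sum.cong[OF refl]) (simp add: dderiv_kern[OF assms])
  also have "\<dots> = ?N * ?Q powr (- ?N / 2) - ?N * ?Q powr (- ?N / 2 - 1) * (x \<bullet> x)"
    by (simp add: sum_distrib_left[symmetric] euclidean_inner[of x x])
  also have "?Q powr (- ?N / 2) = ?Q powr (- ?N / 2 - 1) * ?Q"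
    using assms by (simp add: powr_diff)
  finally show ?thesis by (simp add: rho_def algebra_simps)
qed

text \<open>Regularising only makes the kernels smaller, which yields majorants that do not depend
  on \<open>t\<close>.\<close>

lemma shifted_powr_le:
  fixes x :: "'a::euclidean_space"
  assumes "t \<ge> 0" "x \<noteq> 0" "a \<ge> 0"
  shows "(x \<bullet> x + t) powr (- a) \<le> norm x powr (- 2 * a)"
proof -
  have "(x \<bullet> x + t) powr (- a) \<le> (x \<bullet> x) powr (- a)"
    using assms by (intro powr_mono2') auto
  also have "(x \<bullet> x) powr (- a) = norm x powr (- 2 * a)"
  proof -
    have "x \<bullet> x = norm x powr 2" using assms(2) by (simp add: dot_square_norm powr_realpow)
    moreover have "2 * (- a) = - 2 * a" by simp
    ultimately show ?thesis by (simp only: powr_powr)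
  qed
  finally show ?thesis .
qed

lemma kern_bound:
  fixes x :: "'a::euclidean_space"
  assumes "t \<ge> 0"
  shows "\<bar>kern t e x\<bar> \<le> norm e * norm x powr (1 - real DIM('a))"
proof (cases "x = 0")
  case False
  let ?N = "real DIM('a)"
  have "\<bar>kern t e x\<bar> = \<bar>x \<bullet> e\<bar> * (x \<bullet> x + t) powr (- (?N / 2))" by (simp add: kern_def abs_mult)
  also have "\<dots> \<le> (norm x * norm e) * norm x powr (- 2 * (?N / 2))"
    by (intro mult_mono Cauchy_Schwarz_ineq2 shifted_powr_le assms False) auto
  also have "\<dots> = norm e * (norm x * norm x powr (- ?N))" by simp
  also have "norm x * norm x powr (- ?N) = norm x powr (1 - ?N)"
    using False powr_add[of "norm x" 1 "- ?N"] by simp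
  finally show ?thesis .
qed (simp add: kern_def)

lemma dderiv_kern_bound:
  fixes x :: "'a::euclidean_space"
  assumes "t \<ge> 0" "x \<noteq> 0"
  shows "\<bar>dderiv v (kern t e) x\<bar> \<le> (1 + real DIM('a)) * norm v * norm e * norm x powr (- real DIM('a))"
proof -
  let ?N = "real DIM('a)"
  have Q: "x \<bullet> x + t > 0" using assms by (simp add: add_pos_nonneg)
  have "\<bar>(v \<bullet> e) * (x \<bullet> x + t) powr (- (?N / 2))\<bar> \<le> norm v * norm e * norm x powr (- 2 * (?N / 2))"
    unfolding abs_mult by (intro mult_mono Cauchy_Schwarz_ineq2) (use shifted_powr_le[OF assms, of "?N / 2"] in auto)
  moreover have "\<bar>?N * (x \<bullet> e) * (x \<bullet> v) * (x \<bullet> x + t) powr (- (?N / 2 + 1))\<bar>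
      \<le> ?N * (norm x * norm e) * (norm x * norm v) * norm x powr (- 2 * (?N / 2 + 1))"
    unfolding abs_mult by (intro mult_mono Cauchy_Schwarz_ineq2) (use shifted_powr_le[OF assms, of "?N / 2 + 1"] in auto)
  moreover have "norm x powr (- 2 * (?N / 2 + 1)) * norm x * norm x = norm x powr (- ?N)"
  proof -
    have "norm x powr (- 2 * (?N / 2 + 1)) * norm x powr 2 = norm x powr (- ?N)"
      by (simp only: powr_add[symmetric]) simp
    then show ?thesis using assms(2) by (simp add: power2_eq_square mult.assoc)
  qed
  then have "?N * norm e * norm v * (norm x powr (- 2 * (?N / 2 + 1)) * norm x * norm x) = ?N * norm e * norm v * norm x powr (- ?N)"
    by (simp only:)
  then have "?N * (norm x * norm e) * (norm x * norm v) * norm x powr (- 2 * (?N / 2 + 1))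
      = ?N * norm e * norm v * norm x powr (- ?N)"
    by (simp only: mult.assoc mult.left_commute mult.commute)
  moreover have "dderiv v (kern t e) x = (v \<bullet> e) * (x \<bullet> x + t) powr (- (?N / 2))
     - ?N * (x \<bullet> e) * (x \<bullet> v) * (x \<bullet> x + t) powr (- (?N / 2 + 1))"
  proof -
    have "- ?N / 2 - 1 = - (?N / 2 + 1)" "- ?N / 2 = - (?N / 2)" by auto
    then show ?thesis unfolding dderiv_kern[OF Q] by (simp only:)
  qed
  moreover have "norm v * norm e * norm x powr (- 2 * (?N / 2)) + ?N * norm e * norm v * norm x powr (- ?N)
      = (1 + ?N) * norm v * norm e * norm x powr (- ?N)" by (simp add: algebra_simps)
  ultimately show ?thesis by linarith
qed

lemma kern_borel: "kern t e \<in> borel_measurable borel"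
  unfolding kern_def[abs_def] by measurable

lemmas kern_measurable [measurable (raw)] = measurable_compose[OF _ kern_borel]

lemma locally_integrable_kern:
  assumes "t \<ge> 0"
  shows "locally_integrable (kern t (e::'a::euclidean_space))"
  unfolding locally_integrable_def
proof (intro conjI allI)
  fix R :: real
  have "integrable lborel (\<lambda>z::'a. norm e * (indicator (cball 0 R) z *\<^sub>R norm z powr (1 - real DIM('a))))"
    using locally_integrable_norm_powr[where 'a='a] by (intro integrable_mult_right) (simp add: locally_integrable_def)
  then show "integrable lborel (\<lambda>z::'a. indicator (cball 0 R) z *\<^sub>R kern t e z)"
  proof (rule Bochner_Integration.integrable_bound)
    show "AE z in lborel. norm (indicator (cball 0 R) z *\<^sub>R kern t e z)
        \<le> norm (norm e * (indicator (cball 0 R) z *\<^sub>R norm z powr (1 - real DIM('a))))"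
      using kern_bound[OF assms, of e] by (intro AE_I2) (simp add: abs_mult split: split_indicator)
  qed measurable
qed measurable

lemma kern_tendsto:
  fixes x :: "'a::euclidean_space"
  assumes "T \<longlonglongrightarrow> 0" "\<And>n. T n > (0::real)"
  shows "(\<lambda>n. kern (T n) e x) \<longlonglongrightarrow> kern 0 e x"
proof (cases "x = 0")
  case False
  then show ?thesis unfolding kern_def
    by (intro tendsto_mult tendsto_const tendsto_powr) (use tendsto_add[OF tendsto_const assms(1), of "x \<bullet> x"] in auto)
qed (simp add: kern_def)

lemma dderiv_kern_tendsto:
  fixes x :: "'a::euclidean_space"
  assumes "T \<longlonglongrightarrow> 0" "\<And>n. T n > (0::real)" "x \<noteq> 0"
  shows "(\<lambda>n. dderiv v (kern (T n) e) x) \<longlonglongrightarrow> dderiv v (kern 0 e) x"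
proof -
  have Q: "(\<lambda>n. x \<bullet> x + T n) \<longlonglongrightarrow> x \<bullet> x" using tendsto_add[OF tendsto_const assms(1), of "x \<bullet> x"] by simp
  have p: "x \<bullet> x + T n > 0" for n using assms(2) by (rule inner_self_plus_pos)
  have p0: "x \<bullet> x + 0 > 0" using assms(3) by simp
  show ?thesis unfolding dderiv_kern[OF p] dderiv_kern[OF p0]
    by (intro tendsto_diff tendsto_mult tendsto_const tendsto_powr) (use Q assms(3) in auto)
qed

lemma conv_kern_tendsto:
  fixes f :: "'a::euclidean_space \<Rightarrow> 'b::euclidean_space"
  assumes "T \<longlonglongrightarrow> 0" "\<And>n. T n > (0::real)" "compact_density f"
  shows "(\<lambda>n. conv (kern (T n) e) f x) \<longlonglongrightarrow> conv (kern 0 e) f x"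
  unfolding conv_def
proof (rule integral_dominated_convergence[where w = "\<lambda>y. norm e * norm (norm (x - y) powr (1 - real DIM('a)) *\<^sub>R f y)"])
  show "integrable lborel (\<lambda>y. norm e * norm (norm (x - y) powr (1 - real DIM('a)) *\<^sub>R f y))"
    by (intro integrable_mult_right integrable_norm conv_integrable[OF locally_integrable_norm_powr assms(3)])
  show "AE y in lborel. (\<lambda>n. kern (T n) e (x - y) *\<^sub>R f y) \<longlonglongrightarrow> kern 0 e (x - y) *\<^sub>R f y"
    by (intro AE_I2 tendsto_scaleR tendsto_const kern_tendsto assms)
  show "AE y in lborel. norm (kern (T n) e (x - y) *\<^sub>R f y) \<le> norm e * norm (norm (x - y) powr (1 - real DIM('a)) *\<^sub>R f y)" for n
  proof (intro AE_I2)
    fix y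
    show "norm (kern (T n) e (x - y) *\<^sub>R f y) \<le> norm e * norm (norm (x - y) powr (1 - real DIM('a)) *\<^sub>R f y)"
      using mult_right_mono[OF kern_bound[OF less_imp_le[OF assms(2)[of n]], of e "x - y"], of "norm (f y)"] by simp
  qed
  have [measurable]: "f \<in> borel_measurable borel" using assms(3) by (simp add: compact_density_def)
  show "(\<lambda>y. kern 0 e (x - y) *\<^sub>R f y) \<in> borel_measurable lborel"
    "\<And>n. (\<lambda>y. kern (T n) e (x - y) *\<^sub>R f y) \<in> borel_measurable lborel" by measurable
qed

text \<open>The density is bounded, hence the difference is controlled by the norm of \<open>kern t
  - kern 0\<close> in \<open>L\<^sup>1\<close> of a ball, independently of \<open>x\<close>.\<close>

lemma conv_kern_uniform:
  fixes f :: "'a::euclidean_space \<Rightarrow> 'b::euclidean_space"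
  assumes "T \<longlonglongrightarrow> 0" "\<And>n. T n > (0::real)" "compact_density f"
  shows "uniform_limit (ball 0 B) (\<lambda>n. conv (kern (T n) e) f) (conv (kern 0 e) f) sequentially"
proof -
  obtain M R where f: "f \<in> borel_measurable borel" "M > 0" "R > 0" "\<And>x. norm (f x) \<le> M"
    "\<And>x. x \<notin> cball 0 R \<Longrightarrow> f x = 0" using compact_densityE[OF assms(3)] by metis
  note [measurable] = f(1)
  define D where "D n z = indicator (cball 0 (B + R)) z *\<^sub>R (kern (T n) e z - kern 0 e z)" for n and z :: 'a
  have li: "integrable lborel (\<lambda>z::'a. indicator (cball 0 (B + R)) z *\<^sub>R norm z powr (1 - real DIM('a)))"
    using locally_integrable_norm_powr[where 'a='a] by (simp add: locally_integrable_def)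
  have Dm [measurable]: "D n \<in> borel_measurable borel" for n unfolding D_def[abs_def] by measurable
  have Dle: "\<bar>D n z\<bar> \<le> 2 * norm e * (indicator (cball 0 (B + R)) z *\<^sub>R norm z powr (1 - real DIM('a)))" for n z
  proof (cases "z \<in> cball 0 (B + R)")
    case True
    then show ?thesis unfolding D_def
      using kern_bound[OF less_imp_le[OF assms(2)[of n]], of e z] kern_bound[of 0 e z] by simp
  qed (simp add: D_def)
  have lim: "(\<lambda>n. \<integral>z. \<bar>D n z\<bar> \<partial>lborel) \<longlonglongrightarrow> (\<integral>(z::'a). 0 \<partial>lborel)"
  proof (rule integral_dominated_convergence[where w = "\<lambda>z. 2 * norm e * (indicator (cball 0 (B + R)) z *\<^sub>R norm z powr (1 - real DIM('a)))"])
    show "AE z in lborel. (\<lambda>n. \<bar>D n z\<bar>) \<longlonglongrightarrow> 0"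
    proof (intro AE_I2 tendsto_rabs_zero)
      fix z
      have "(\<lambda>n. kern (T n) e z - kern 0 e z) \<longlonglongrightarrow> 0"
        using kern_tendsto[OF assms(1,2), of e z] by (simp add: LIM_zero)
      then show "(\<lambda>n. D n z) \<longlonglongrightarrow> 0" unfolding D_def using tendsto_scaleR[OF tendsto_const] by fastforce
    qed
  qed (use Dle li in auto)
  have int: "integrable lborel (\<lambda>z. \<bar>D n z\<bar>)" for n
    by (rule Bochner_Integration.integrable_bound[OF integrable_mult_right[OF li, of "2 * norm e"]])
      (use Dle[of n] in \<open>auto simp: abs_mult\<close>)
  have bd: "norm (conv (kern (T n) e) f x - conv (kern 0 e) f x) \<le> M * (\<integral>z. \<bar>D n z\<bar> \<partial>lborel)" if "x \<in> ball 0 B" for n x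
  proof -
    have i: "integrable lborel (\<lambda>y. kern (T n) e (x - y) *\<^sub>R f y)" "integrable lborel (\<lambda>y. kern 0 e (x - y) *\<^sub>R f y)"
      by (intro conv_integrable locally_integrable_kern assms(3) less_imp_le[OF assms(2)] order_refl)+
    have "conv (kern (T n) e) f x - conv (kern 0 e) f x = (\<integral>y. kern (T n) e (x - y) *\<^sub>R f y - kern 0 e (x - y) *\<^sub>R f y \<partial>lborel)"
      unfolding conv_def using i by simp
    also have "norm \<dots> \<le> (\<integral>y. M * \<bar>D n (x - y)\<bar> \<partial>lborel)"
    proof (rule Bochner_Integration.integral_norm_bound_integral)
      show "integrable lborel (\<lambda>y. M * \<bar>D n (x - y)\<bar>)"
        using lborel_integrable_reflect[OF int, of n x] by (intro integrable_mult_right)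
      fix y
      show "norm (kern (T n) e (x - y) *\<^sub>R f y - kern 0 e (x - y) *\<^sub>R f y) \<le> M * \<bar>D n (x - y)\<bar>"
      proof (cases "y \<in> cball 0 R")
        case True
        then have "x - y \<in> cball 0 (B + R)" using that norm_triangle_ineq4[of x y] by simp
        then have "D n (x - y) = kern (T n) e (x - y) - kern 0 e (x - y)" by (simp add: D_def)
        then show ?thesis using mult_right_mono[OF f(4)[of y], of "\<bar>D n (x - y)\<bar>"]
          by (simp add: scaleR_diff_left[symmetric] mult.commute)
      qed (use f(2,5) in auto)
    qed (use i in auto)
    also have "\<dots> = M * (\<integral>z. \<bar>D n z\<bar> \<partial>lborel)"
      using lborel_integral_reflect[of "\<lambda>z. \<bar>D n z\<bar>" x] by simp
    finally show ?thesis .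
  qed
  show ?thesis
  proof (rule uniform_limitI)
    fix \<epsilon> :: real assume "\<epsilon> > 0"
    have "(\<lambda>n. M * (\<integral>z. \<bar>D n z\<bar> \<partial>lborel)) \<longlonglongrightarrow> 0" using tendsto_mult[OF tendsto_const lim, of M] by simp
    then have "\<forall>\<^sub>F n in sequentially. M * (\<integral>z. \<bar>D n z\<bar> \<partial>lborel) < \<epsilon>" using \<open>\<epsilon> > 0\<close> by (rule order_tendstoD(2))
    then show "\<forall>\<^sub>F n in sequentially. \<forall>x\<in>ball 0 B. dist (conv (kern (T n) e) f x) (conv (kern 0 e) f x) < \<epsilon>"
    proof (rule eventually_mono)
      fix n assume "M * (\<integral>z. \<bar>D n z\<bar> \<partial>lborel) < \<epsilon>"
      then show "\<forall>x\<in>ball 0 B. dist (conv (kern (T n) e) f x) (conv (kern 0 e) f x) < \<epsilon>"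
        using bd[of _ n] le_less_trans unfolding dist_norm by blast
    qed
  qed
qed

lemma smooth_on_conv_kern_pos:
  "t > 0 \<Longrightarrow> compact_density f \<Longrightarrow> smooth_on UNIV (conv (kern t e) f)"
  by (intro smooth_on_conv_kernel smooth_on_kern inner_self_plus_pos open_UNIV)

lemma inverse_Suc_seq: "(\<lambda>n. inverse (real (Suc n))) \<longlonglongrightarrow> 0" "\<And>n. inverse (real (Suc n)) > 0"
  using LIMSEQ_inverse_real_of_nat by auto

lemma continuous_on_conv_kern:
  fixes f :: "'a::euclidean_space \<Rightarrow> 'b::euclidean_space"
  assumes "compact_density f"
  shows "continuous_on UNIV (conv (kern 0 e) f)"
proof -
  have "continuous_on (ball 0 B) (conv (kern 0 e) f)" for B
    by (rule uniform_limit_theorem[OF _ conv_kern_uniform[OF inverse_Suc_seq assms]])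
      (auto intro!: always_eventually continuous_on_subset[OF smooth_on_continuous[OF smooth_on_conv_kern_pos]] assms)
  then have "isCont (conv (kern 0 e) f) x" for x
    by (meson centre_in_ball continuous_on_eq_continuous_at dual_order.strict_trans gt_ex lt_ex mem_ball_0 open_ball)
  then show ?thesis by (simp add: continuous_at_imp_continuous_on)
qed

lemma conv_kern_decay:
  fixes f :: "'a::euclidean_space \<Rightarrow> 'b::euclidean_space"
  assumes "compact_density f" "DIM('a) \<ge> 2"
  shows "(conv (kern 0 e) f \<longlongrightarrow> 0) at_infinity"
proof -
  let ?N = "real DIM('a)"
  obtain M R where f: "f \<in> borel_measurable borel" "M > 0" "R > 0" "\<And>x. norm (f x) \<le> M"
    "\<And>x. x \<notin> cball 0 R \<Longrightarrow> f x = 0" using compact_densityE[OF assms(1)] by metis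
  define C where "C = norm e * (\<integral>y. norm (f y) \<partial>lborel)"
  have fi: "integrable lborel f" by (rule compact_density_integrable[OF assms(1)])
  have bd: "norm (conv (kern 0 e) f x) \<le> C * (norm x - R) powr (1 - ?N)" if "norm x > R" for x
  proof -
    have "norm (conv (kern 0 e) f x) \<le> (\<integral>y. (norm e * (norm x - R) powr (1 - ?N)) * norm (f y) \<partial>lborel)"
      unfolding conv_def
    proof (rule Bochner_Integration.integral_norm_bound_integral)
      show "integrable lborel (\<lambda>y. kern 0 e (x - y) *\<^sub>R f y)"
        by (intro conv_integrable locally_integrable_kern assms(1)) simp
      fix y
      show "norm (kern 0 e (x - y) *\<^sub>R f y) \<le> norm e * (norm x - R) powr (1 - ?N) * norm (f y)"
      proof (cases "y \<in> cball 0 R")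
        case True
        then have "norm x - R \<le> norm (x - y)" using norm_triangle_ineq2[of x y] by simp
        then have "norm (x - y) powr (1 - ?N) \<le> (norm x - R) powr (1 - ?N)"
          using that assms(2) by (intro powr_mono2') auto
        then have "\<bar>kern 0 e (x - y)\<bar> \<le> norm e * (norm x - R) powr (1 - ?N)"
          using kern_bound[of 0 e "x - y"] by (meson mult_left_mono norm_ge_zero order_refl order_trans)
        then show ?thesis by (simp add: mult_right_mono)
      qed (simp add: f(5))
    qed (use fi in auto)
    then show ?thesis by (simp add: C_def mult_ac)
  qed
  have "((\<lambda>x::'a. C * (norm x - R) powr (1 - ?N)) \<longlongrightarrow> C * 0) at_infinity"
  proof (intro tendsto_mult tendsto_const)
    have "filterlim (\<lambda>x::'a. - R + norm x) at_top at_infinity"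
      by (rule filterlim_tendsto_add_at_top[OF tendsto_const filterlim_norm_at_top])
    then have "filterlim (\<lambda>x::'a. norm x - R) at_top at_infinity" by simp
    then show "((\<lambda>x::'a. (norm x - R) powr (1 - ?N)) \<longlongrightarrow> 0) at_infinity"
      using assms(2) by (intro tendsto_neg_powr) auto
  qed
  moreover have "\<forall>\<^sub>F x in at_infinity. norm (conv (kern 0 e) f x) \<le> C * (norm x - R) powr (1 - ?N)"
    unfolding eventually_at_infinity using bd by (intro exI[of _ "R + 1"]) auto
  ultimately show ?thesis using Lim_null_comparison by fastforce
qed

lemma rho_borel: "rho t \<in> borel_measurable borel"
  unfolding rho_def[abs_def] by measurable

lemmas rho_measurable [measurable (raw)] = measurable_compose[OF _ rho_borel]

lemma rho_nonneg: "t \<ge> 0 \<Longrightarrow> rho t x \<ge> 0"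
  by (simp add: rho_def)

lemma integrable_rho: "integrable lborel (rho 1 :: 'a::euclidean_space \<Rightarrow> real)"
proof -
  let ?N = "real DIM('a)"
  have "integrable lborel (\<lambda>x::'a. (x \<bullet> x + 1) powr (- ?N / 2 - 1))"
  proof (rule integrable_of_ball_cover[where r = "\<lambda>i. 2 ^ i" and a = "\<lambda>i. (2 ^ i / 2) powr (- ?N - 2)"])
    fix x :: 'a
    show "\<exists>i. norm x \<le> 2 ^ i \<and> (x \<bullet> x + 1) powr (- ?N / 2 - 1) \<le> (2 ^ i / 2) powr (- ?N - 2)"
    proof (cases "norm x \<le> 1")
      case True
      have "(x \<bullet> x + 1) powr (- ?N / 2 - 1) \<le> 1 powr (- ?N / 2 - 1)" by (rule powr_mono2') auto
      also have "\<dots> \<le> (2 ^ 0 / 2) powr (- ?N - 2)"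
      proof -
        have "1 powr (- ?N - 2) \<le> (1 / 2) powr (- ?N - 2)" by (rule powr_mono2') auto
        then show ?thesis by simp
      qed
      finally show ?thesis using True by (intro exI[of _ 0]) simp
    next
      case False
      obtain n where n: "norm x < 2 ^ n" using real_arch_pow[of 2 "norm x"] by auto
      then obtain n where n: "norm x \<le> 2 ^ n" "\<And>m. m < n \<Longrightarrow> \<not> norm x \<le> 2 ^ m"
        using exists_least_iff[of "\<lambda>n. norm x \<le> 2 ^ n"] by (meson less_imp_le)
      have "n \<noteq> 0" using n(1) False by (intro notI) simp
      then obtain i where i: "n = Suc i" using not0_implies_Suc by blast
      have "(x \<bullet> x + 1) powr (- (?N / 2 + 1)) \<le> norm x powr (- 2 * (?N / 2 + 1))"
        using False by (intro shifted_powr_le) auto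
      also have "\<dots> = norm x powr (- ?N - 2)" by simp
      also have "\<dots> \<le> (2 ^ n / 2) powr (- ?N - 2)" using n(2)[of i] i by (intro powr_mono2') auto
      finally have "(x \<bullet> x + 1) powr (- (?N / 2 + 1)) \<le> (2 ^ n / 2) powr (- ?N - 2)" .
      moreover have "- (?N / 2 + 1) = - ?N / 2 - 1" by simp
      ultimately show ?thesis using n(1) by (intro exI[of _ n]) (simp only: simp_thms)
    qed
  next
    have "(2 ^ i / 2) powr (- ?N - 2) * (2 ^ i) ^ DIM('a) = (1 / 2) powr (- ?N - 2) * (1 / 4) ^ i" for i :: nat
    proof -
      define s :: real where "s = 2 ^ i"
      have s: "s > 0" by (simp add: s_def)
      have "(s / 2) powr (- ?N - 2) = s powr (- ?N - 2) * (1 / 2) powr (- ?N - 2)"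
        using powr_mult[of s "1 / 2" "- ?N - 2"] s by simp
      moreover have "s ^ DIM('a) = s powr ?N" using s by (simp add: powr_realpow)
      moreover have "s powr (- ?N - 2) * s powr ?N = s powr (- 2)"
        using s by (simp add: powr_add[symmetric])
      moreover have "s powr (- 2) = (1 / 4) ^ i"
        using s by (simp add: powr_minus s_def power2_eq_square power_mult_distrib[symmetric] power_one_over inverse_eq_divide)
      ultimately show ?thesis unfolding s_def[symmetric] by (simp add: mult_ac)
    qed
    then show "summable (\<lambda>i. (2 ^ i / 2) powr (- ?N - 2) * (2 ^ i) ^ DIM('a))"
      by (simp add: summable_mult summable_geometric)
  qed auto
  then show ?thesis unfolding rho_def[abs_def] by simp
qed

text \<open>The total flux of the kernel, that is, the area of the unit sphere.\<close>

definition sphere_const :: "'a::euclidean_space itself \<Rightarrow> real" where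
  "sphere_const (T :: 'a itself) = (\<integral>(z::'a). rho 1 z \<partial>lborel)"

lemma sphere_const_pos: "sphere_const TYPE('a::euclidean_space) > 0"
proof -
  have "\<not> (AE z::'a in lborel. rho 1 z = 0)"
  proof
    assume "AE z::'a in lborel. rho 1 z = 0"
    moreover have "rho 1 z > 0" for z :: 'a
      unfolding rho_def using DIM_positive[where 'a='a] inner_self_plus_pos[of 1 z] by simp
    ultimately have "AE z::'a in lborel. False" by (simp add: less_imp_neq[THEN not_sym])
    then obtain A where "A \<in> null_sets lborel" "{x \<in> space lborel. \<not> False} \<subseteq> (A :: 'a set)"
      unfolding eventually_ae_filter by blast
    then show False by (auto simp: top_unique)
  qed
  then have "sphere_const TYPE('a) \<noteq> 0"
    unfolding sphere_const_def using integral_nonneg_eq_0_iff_AE[OF integrable_rho[where 'a='a] AE_I2[OF rho_nonneg]] by simp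
  moreover have "sphere_const TYPE('a) \<ge> 0" unfolding sphere_const_def by (simp add: rho_nonneg)
  ultimately show ?thesis by simp
qed

lemma rho_scaled:
  fixes z :: "'a::euclidean_space"
  assumes "t > 0"
  shows "\<bar>- sqrt t\<bar> ^ DIM('a) * rho t ((- sqrt t) *\<^sub>R z) = rho 1 z"
proof -
  let ?N = "real DIM('a)"
  have 1: "(- sqrt t *\<^sub>R z) \<bullet> (- sqrt t *\<^sub>R z) + t = t * (z \<bullet> z + 1)"
    using assms by (simp add: algebra_simps)
  have 2: "\<bar>- sqrt t\<bar> ^ DIM('a) = t powr (?N / 2)"
    using assms by (simp add: powr_half_sqrt[symmetric] powr_realpow[symmetric] powr_powr)
  have "t powr (?N / 2) * (t * t powr (- ?N / 2 - 1)) = 1"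
  proof -
    have "t * t powr (- ?N / 2 - 1) = t powr (- ?N / 2)" using assms by (simp add: powr_diff)
    then show ?thesis using assms by (simp add: powr_add[symmetric])
  qed
  then show ?thesis unfolding rho_def 1 2
    using assms inner_self_plus_pos[of 1 z] by (simp add: powr_mult mult_ac)
qed

text \<open>After the substitution \<open>y = x - sqrt t z\<close> the kernel is the fixed
  integrable function \<open>rho 1\<close>.\<close>

lemma conv_rho_tendsto:
  fixes f :: "'a::euclidean_space \<Rightarrow> 'b::euclidean_space"
  assumes T: "T \<longlonglongrightarrow> 0" "\<And>n. T n > (0::real)" and f: "compact_density f" and x: "isCont f x"
  shows "(\<lambda>n. conv (rho (T n)) f x) \<longlonglongrightarrow> sphere_const TYPE('a) *\<^sub>R f x"
proof -
  obtain M R where f: "f \<in> borel_measurable borel" "M > 0" "\<And>x. norm (f x) \<le> M" using compact_densityE[OF f] by metis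
  note [measurable] = f(1)
  have eq: "conv (rho t) f x = (\<integral>z. rho 1 z *\<^sub>R f (x - sqrt t *\<^sub>R z) \<partial>lborel)" if "t > 0" for t
  proof -
    have "conv (rho t) f x = \<bar>- sqrt t\<bar> ^ DIM('a) *\<^sub>R
        (\<integral>z. rho t (x - (x + (- sqrt t) *\<^sub>R z)) *\<^sub>R f (x + (- sqrt t) *\<^sub>R z) \<partial>lborel)"
      unfolding conv_def by (rule lborel_integral_affine) (use that in auto)
    also have "\<dots> = (\<integral>z. \<bar>- sqrt t\<bar> ^ DIM('a) *\<^sub>R (rho t (x - (x + (- sqrt t) *\<^sub>R z)) *\<^sub>R f (x + (- sqrt t) *\<^sub>R z)) \<partial>lborel)"
      by (simp only: integral_scaleR_right)
    also have "\<dots> = (\<integral>z. (\<bar>- sqrt t\<bar> ^ DIM('a) * rho t ((- sqrt t) *\<^sub>R z)) *\<^sub>R f (x - sqrt t *\<^sub>R z) \<partial>lborel)"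
      by (simp add: rho_def)
    finally show ?thesis unfolding rho_scaled[OF that] .
  qed
  have "(\<lambda>n. \<integral>z. rho 1 z *\<^sub>R f (x - sqrt (T n) *\<^sub>R z) \<partial>lborel) \<longlonglongrightarrow> (\<integral>(z::'a). rho 1 z *\<^sub>R f x \<partial>lborel)"
  proof (rule integral_dominated_convergence[where w = "\<lambda>z::'a. rho 1 z * M"])
    show "AE z in lborel. (\<lambda>n. rho 1 z *\<^sub>R f (x - sqrt (T n) *\<^sub>R z)) \<longlonglongrightarrow> rho 1 z *\<^sub>R f x"
    proof (intro AE_I2 tendsto_scaleR tendsto_const)
      fix z
      have "(\<lambda>n. x - sqrt (T n) *\<^sub>R z) \<longlonglongrightarrow> x - sqrt 0 *\<^sub>R z" by (intro tendsto_intros T(1))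
      then show "(\<lambda>n. f (x - sqrt (T n) *\<^sub>R z)) \<longlonglongrightarrow> f x" using isCont_tendsto_compose[OF x] by simp
    qed
    show "AE z in lborel. norm (rho 1 z *\<^sub>R f (x - sqrt (T n) *\<^sub>R z)) \<le> rho 1 z * M" for n
      using f(3) by (intro AE_I2) (simp add: mult_left_mono abs_of_nonneg rho_nonneg)
  qed (use integrable_rho in auto)
  moreover have "(\<integral>(z::'a). rho 1 z *\<^sub>R f x \<partial>lborel) = sphere_const TYPE('a) *\<^sub>R f x"
    unfolding sphere_const_def by (rule integral_scaleR_left) (use integrable_rho in auto)
  ultimately show ?thesis using T(2) by (simp add: eq)
qed

lemma smooth_on_rho: "t > 0 \<Longrightarrow> smooth_on UNIV (rho t)"
  unfolding rho_def[abs_def]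
  by (intro smooth_on_mult smooth_on_powr smooth_on_inner smooth_on_add smooth_on_id smooth_on_const open_UNIV inner_self_plus_pos)

section \<open>Potentials of densities cut off along a hypersurface\<close>

lemma conv_tendsto:
  fixes F :: "nat \<Rightarrow> 'a::euclidean_space \<Rightarrow> 'b::euclidean_space"
  assumes k: "locally_integrable k" and G: "compact_density G"
    and F: "\<And>n y. norm (F n y) \<le> norm (G y)" "\<And>n. F n \<in> borel_measurable borel"
    and lim: "\<And>y. (\<lambda>n. F n y) \<longlonglongrightarrow> f y"
  shows "(\<lambda>n. conv k (F n) x) \<longlonglongrightarrow> conv k f x"
proof -
  have [measurable]: "k \<in> borel_measurable borel" "F n \<in> borel_measurable borel" for n
    using k F(2) by (auto simp: locally_integrable_def)
  have fm [measurable]: "f \<in> borel_measurable borel"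
    by (rule borel_measurable_LIMSEQ_metric[OF F(2) lim])
  show ?thesis unfolding conv_def
  proof (rule integral_dominated_convergence[where w = "\<lambda>y. norm (k (x - y) *\<^sub>R G y)"])
    show "integrable lborel (\<lambda>y. norm (k (x - y) *\<^sub>R G y))"
      by (rule integrable_norm[OF conv_integrable[OF k G]])
    show "AE y in lborel. (\<lambda>n. k (x - y) *\<^sub>R F n y) \<longlonglongrightarrow> k (x - y) *\<^sub>R f y"
      by (intro AE_I2 tendsto_scaleR tendsto_const lim)
    show "AE y in lborel. norm (k (x - y) *\<^sub>R F n y) \<le> norm (k (x - y) *\<^sub>R G y)" for n
      using F(1)[of n] by (intro AE_I2) (simp add: mult_left_mono)
    show "(\<lambda>y. k (x - y) *\<^sub>R f y) \<in> borel_measurable lborel"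
      "\<And>n. (\<lambda>y. k (x - y) *\<^sub>R F n y) \<in> borel_measurable lborel" by measurable
  qed
qed

text \<open>A continuously differentiable approximation of \<open>min s 0\<close> that is zero for
  \<open>s \<ge> 0\<close> and tends to it as \<open>\<delta>\<close> tends to 0. Composed with a
  defining function of the domain it smooths functions truncated at the boundary; its derivative
  \<open>dpsi \<delta>\<close> vanishes at 0 and so gives the right limit even on the boundary
  itself.\<close>

definition psi :: "real \<Rightarrow> real \<Rightarrow> real" where
  "psi \<delta> s = (min s 0)\<^sup>2 / (min s 0 - \<delta>)"

definition dpsi :: "real \<Rightarrow> real \<Rightarrow> real" where
  "dpsi \<delta> s = ((min s 0)\<^sup>2 - 2 * \<delta> * min s 0) / (min s 0 - \<delta>)\<^sup>2"

lemma psi_has_derivative: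
  assumes "\<delta> > 0"
  shows "(psi \<delta> has_real_derivative dpsi \<delta> s) (at s)"
proof -
  consider "s < 0" | "s > 0" | "s = 0" by linarith
  then show ?thesis
  proof cases
    case 1
    have "((\<lambda>s. s\<^sup>2 / (s - \<delta>)) has_real_derivative (2 * s * (s - \<delta>) - s\<^sup>2) / ((s - \<delta>) * (s - \<delta>))) (at s)"
      using 1 assms by (auto intro!: derivative_eq_intros)
    moreover have "(2 * s * (s - \<delta>) - s\<^sup>2) / ((s - \<delta>) * (s - \<delta>)) = dpsi \<delta> s"
      using 1 by (simp add: dpsi_def min_def power2_eq_square algebra_simps)
    ultimately have "((\<lambda>s. s\<^sup>2 / (s - \<delta>)) has_real_derivative dpsi \<delta> s) (at s)" by simp
    then show ?thesis
      by (rule has_field_derivative_transform_within_open[where S = "{..<0}"])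
        (use 1 in \<open>auto simp: psi_def min_def\<close>)
  next
    case 2
    have "((\<lambda>s. 0) has_real_derivative dpsi \<delta> s) (at s)" using 2 by (simp add: dpsi_def min_def)
    then show ?thesis
      by (rule has_field_derivative_transform_within_open[where S = "{0<..}"])
        (use 2 in \<open>auto simp: psi_def min_def\<close>)
  next
    case 3
    have "((\<lambda>h. (psi \<delta> h - psi \<delta> 0) / (h - 0)) \<longlongrightarrow> 0) (at 0)"
    proof (rule Lim_null_comparison)
      show "((\<lambda>h. \<bar>h\<bar> / \<delta>) \<longlongrightarrow> 0) (at (0::real))"
        using assms by (auto intro!: tendsto_eq_intros)
      have "norm ((psi \<delta> h - psi \<delta> 0) / (h - 0)) \<le> \<bar>h\<bar> / \<delta>" for h
      proof (cases "h < 0")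
        case True
        then have "norm ((psi \<delta> h - psi \<delta> 0) / (h - 0)) = \<bar>h\<bar> / (\<delta> - h)"
          using assms by (simp add: psi_def min_def power2_eq_square abs_mult)
        also have "\<dots> \<le> \<bar>h\<bar> / \<delta>" using True assms by (intro divide_left_mono) auto
        finally show ?thesis .
      next
        case False
        then show ?thesis using assms by (simp add: psi_def min_def)
      qed
      then show "\<forall>\<^sub>F h in at 0. norm ((psi \<delta> h - psi \<delta> 0) / (h - 0)) \<le> \<bar>h\<bar> / \<delta>" by simp
    qed
    then show ?thesis using 3 by (simp add: has_field_derivative_iff dpsi_def)
  qed
qed

lemma dpsi_bounds: "\<delta> > 0 \<Longrightarrow> \<bar>dpsi \<delta> s\<bar> \<le> 1" and psi_bounds: "\<delta> > 0 \<Longrightarrow> \<bar>psi \<delta> s\<bar> \<le> \<bar>s\<bar>"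
proof -
  assume d: "\<delta> > 0"
  define m where "m = min s 0"
  have m: "m \<le> 0" "\<bar>m\<bar> \<le> \<bar>s\<bar>" by (auto simp: m_def)
  have p: "(m - \<delta>)\<^sup>2 > 0" using d m by simp
  have "0 \<le> m\<^sup>2 - 2 * \<delta> * m" using d m mult_nonneg_nonpos[of "2 * \<delta>" m] zero_le_power2[of m] by linarith
  moreover have "m\<^sup>2 - 2 * \<delta> * m \<le> (m - \<delta>)\<^sup>2" by (simp add: power2_eq_square algebra_simps)
  ultimately show "\<bar>dpsi \<delta> s\<bar> \<le> 1" unfolding dpsi_def m_def[symmetric] using p by (simp add: abs_mult)
  have "\<bar>psi \<delta> s\<bar> = \<bar>m\<bar> * (\<bar>m\<bar> / (\<delta> - m))"
    unfolding psi_def m_def[symmetric] using d m by (simp add: abs_mult power2_eq_square)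
  also have "\<bar>m\<bar> / (\<delta> - m) \<le> 1" using d m by (subst divide_le_eq_1_pos) auto
  then have "\<bar>m\<bar> * (\<bar>m\<bar> / (\<delta> - m)) \<le> \<bar>m\<bar> * 1" by (rule mult_left_mono) simp
  finally show "\<bar>psi \<delta> s\<bar> \<le> \<bar>s\<bar>" using m by simp
qed

lemma psi_tendsto:
  assumes "D \<longlonglongrightarrow> 0" "\<And>n. D n > 0"
  shows "(\<lambda>n. psi (D n) s) \<longlonglongrightarrow> min s 0" "(\<lambda>n. dpsi (D n) s) \<longlonglongrightarrow> (if s < 0 then 1 else 0)"
proof -
  have "(\<lambda>n. s\<^sup>2 / (s - D n)) \<longlonglongrightarrow> s\<^sup>2 / (s - 0)" "(\<lambda>n. (s\<^sup>2 - 2 * D n * s) / (s - D n)\<^sup>2) \<longlonglongrightarrow> (s\<^sup>2 - 2 * 0 * s) / (s - 0)\<^sup>2" if "s < 0"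
    using that by (intro tendsto_intros assms(1); simp)+
  then show "(\<lambda>n. psi (D n) s) \<longlonglongrightarrow> min s 0" "(\<lambda>n. dpsi (D n) s) \<longlonglongrightarrow> (if s < 0 then 1 else 0)"
    by (cases "s < 0"; simp add: psi_def dpsi_def min_def power2_eq_square)+
qed

text \<open>The power \<open>(min s 0)\<^sup>m\<^sup>+\<^sup>1\<close> gains one derivative at 0
  with each factor.\<close>

lemma Cm_on_min_power: "Cm_on m UNIV (\<lambda>s::real. c * (min s 0) ^ Suc m)"
proof (induction m arbitrary: c)
  case 0
  then show ?case by (simp add: continuous_intros)
next
  case (Suc m)
  have d: "((\<lambda>s::real. c * (min s 0) ^ Suc (Suc m)) has_real_derivative c * (real (Suc (Suc m)) * (min s 0) ^ Suc m)) (at s)" for s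
  proof -
    consider "s < 0" | "s > 0" | "s = 0" by linarith
    then have "((\<lambda>s::real. (min s 0) ^ Suc (Suc m)) has_real_derivative real (Suc (Suc m)) * (min s 0) ^ Suc m) (at s)"
    proof cases
      case 1
      have "((\<lambda>s::real. s ^ Suc (Suc m)) has_real_derivative real (Suc (Suc m)) * (min s 0) ^ Suc m) (at s)"
        using 1 DERIV_pow[of "Suc (Suc m)" s] by (simp add: min_def)
      then show ?thesis
        by (rule has_field_derivative_transform_within_open[where S = "{..<0}"]) (use 1 in auto)
    next
      case 2
      have "((\<lambda>s::real. 0) has_real_derivative real (Suc (Suc m)) * (min s 0) ^ Suc m) (at s)" using 2 by simp
      then show ?thesis
        by (rule has_field_derivative_transform_within_open[where S = "{0<..}"]) (use 2 in auto)
    next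
      case 3
      have "((\<lambda>h::real. ((min h 0) ^ Suc (Suc m) - (min 0 0) ^ Suc (Suc m)) / (h - 0)) \<longlongrightarrow> 0) (at 0)"
      proof (rule Lim_null_comparison)
        have "((\<lambda>h::real. \<bar>h\<bar> ^ Suc m) \<longlongrightarrow> \<bar>0\<bar> ^ Suc m) (at 0)" by (intro tendsto_intros)
        then show "((\<lambda>h::real. \<bar>h\<bar> ^ Suc m) \<longlongrightarrow> 0) (at 0)" by simp
        have "norm (((min h 0) ^ Suc (Suc m) - (min 0 0) ^ Suc (Suc m)) / (h - 0)) \<le> \<bar>h\<bar> ^ Suc m" for h :: real
          by (cases "h < 0") (auto simp: power_abs abs_mult min_def)
        then show "\<forall>\<^sub>F h in at 0. norm (((min h 0) ^ Suc (Suc m) - (min 0 0) ^ Suc (Suc m)) / (h - 0)) \<le> \<bar>h::real\<bar> ^ Suc m" by simp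
      qed
      then show ?thesis using 3 by (simp add: has_field_derivative_iff)
    qed
    then show ?thesis by (rule DERIV_cmult)
  qed
  show ?case
  proof (rule Cm_on_SucI[OF open_UNIV])
    show "((\<lambda>s::real. c * (min s 0) ^ Suc (Suc m)) has_derivative (\<lambda>v. (c * (real (Suc (Suc m)) * (min s 0) ^ Suc m)) * v)) (at s)" for s
      using d[of s] unfolding has_field_derivative_def .
    show "Cm_on m UNIV (\<lambda>s. (c * (real (Suc (Suc m)) * (min s 0) ^ Suc m)) * v)" for v
      using Suc.IH[of "c * real (Suc (Suc m)) * v"] by (simp only: mult_ac)
  qed
qed

definition laplacian :: "('a::euclidean_space \<Rightarrow> 'b::euclidean_space) \<Rightarrow> 'a \<Rightarrow> 'b" where
  "laplacian w x = (\<Sum>i\<in>Basis. dderiv i (dderiv i w) x)"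

lemma dderiv_add:
  "f differentiable (at x) \<Longrightarrow> g differentiable (at x) \<Longrightarrow> dderiv v (\<lambda>y. f y + g y) x = dderiv v f x + dderiv v g x"
  by (rule dderiv_eqI) (intro has_derivative_add has_derivative_dderiv)

lemma dderiv_scaleR:
  "a differentiable (at x) \<Longrightarrow> b differentiable (at x) \<Longrightarrow>
    dderiv v (\<lambda>y. a y *\<^sub>R b y) x = a x *\<^sub>R dderiv v b x + dderiv v a x *\<^sub>R b x"
  by (rule dderiv_eqI[OF bounded_bilinear.FDERIV[OF bounded_bilinear_scaleR]]) (rule has_derivative_dderiv, assumption)+

lemma dderiv_sum:
  "(\<And>i. i \<in> I \<Longrightarrow> f i differentiable (at x)) \<Longrightarrow> dderiv v (\<lambda>y. \<Sum>i\<in>I. f i y) x = (\<Sum>i\<in>I. dderiv v (f i) x)"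
  by (rule dderiv_eqI) (intro has_derivative_sum has_derivative_dderiv)

lemma laplacian_add:
  assumes "smooth_on UNIV f" "smooth_on UNIV g"
  shows "laplacian (\<lambda>x. f x + g x) x = laplacian f x + laplacian g x"
proof -
  have "dderiv i (\<lambda>x. f x + g x) = (\<lambda>x. dderiv i f x + dderiv i g x)" for i
    by (rule ext) (intro dderiv_add smooth_on_differentiable[OF assms(1)] smooth_on_differentiable[OF assms(2)] UNIV_I)
  moreover have "dderiv i (\<lambda>x. dderiv i f x + dderiv i g x) x = dderiv i (dderiv i f) x + dderiv i (dderiv i g) x" for i
    by (intro dderiv_add smooth_on_differentiable[OF smooth_on_dderiv[OF assms(1)]]
        smooth_on_differentiable[OF smooth_on_dderiv[OF assms(2)]] UNIV_I)
  ultimately show ?thesis by (simp add: laplacian_def sum.distrib)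
qed

lemma dderiv_power_scaleR:
  fixes \<phi> :: "'a::euclidean_space \<Rightarrow> real"
  assumes "smooth_on UNIV \<phi>" "smooth_on UNIV a"
  shows "dderiv i (\<lambda>x. \<phi> x ^ Suc j *\<^sub>R a x) = (\<lambda>x. \<phi> x ^ j *\<^sub>R ((real (Suc j) * dderiv i \<phi> x) *\<^sub>R a x + \<phi> x *\<^sub>R dderiv i a x))"
proof
  fix x
  have 1: "((\<lambda>x. \<phi> x ^ Suc j) has_derivative (\<lambda>v. real (Suc j) * dderiv v \<phi> x * \<phi> x ^ (Suc j - 1))) (at x)"
    by (rule has_derivative_power[OF smooth_on_has_derivative[OF assms(1) UNIV_I]])
  show "dderiv i (\<lambda>x. \<phi> x ^ Suc j *\<^sub>R a x) x = \<phi> x ^ j *\<^sub>R ((real (Suc j) * dderiv i \<phi> x) *\<^sub>R a x + \<phi> x *\<^sub>R dderiv i a x)"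
    by (rule trans[OF dderiv_eqI[OF has_derivative_scaleR[OF 1 smooth_on_has_derivative[OF assms(2) UNIV_I]]]])
      (simp add: scaleR_add_right mult_ac)
qed

text \<open>A neighbourhood \<open>W\<close> of a boundary point with a defining function that is
  extended smoothly to the whole space, so that it can be differentiated and multiplied without
  reference to \<open>W\<close>.\<close>

locale boundary_patch =
  fixes \<Omega> W :: "'a::euclidean_space set" and \<phi> :: "'a \<Rightarrow> real"
  assumes open_W: "open W" and open_\<Omega>: "open \<Omega>" and smooth_\<phi>: "smooth_on UNIV \<phi>"
    and half: "\<And>x. x \<in> W \<Longrightarrow> x \<in> \<Omega> \<longleftrightarrow> \<phi> x < 0"
    and gradient: "\<And>x. x \<in> W \<Longrightarrow> \<exists>v. dderiv v \<phi> x \<noteq> 0"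
begin

lemma smooth_\<phi>_W: "smooth_on W \<phi>" using smooth_on_subset[OF smooth_\<phi>] by blast

lemma indicator_\<phi>:
  assumes "b \<in> test_functions W"
  shows "indicator \<Omega> x *\<^sub>R \<phi> x *\<^sub>R b x = min (\<phi> x) 0 *\<^sub>R b x"
proof (cases "x \<in> W")
  case False
  then have "b x = 0" using compact_sectionsE[OF assms] by (metis subsetD)
  then show ?thesis by simp
qed (auto simp: half min_def split: split_indicator)

lemma continuous_truncation:
  assumes "b \<in> test_functions W"
  shows "continuous_on UNIV (\<lambda>x. indicator \<Omega> x *\<^sub>R \<phi> x *\<^sub>R (b x :: 'b::euclidean_space))"
proof -
  have "smooth_on UNIV b" using compact_sectionsE[OF assms] by metis
  then show ?thesis unfolding indicator_\<phi>[OF assms]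
    by (intro continuous_intros smooth_on_continuous smooth_\<phi>)
qed

lemma density_truncation:
  fixes b :: "'a \<Rightarrow> 'b::euclidean_space"
  assumes "b \<in> test_functions W"
  shows "compact_density (\<lambda>x. indicator \<Omega> x *\<^sub>R b x)"
  by (rule compact_density_indicator[OF test_functions_density[OF assms] borel_open[OF open_\<Omega>]])

lemma test_\<phi>: "b \<in> test_functions W \<Longrightarrow> (\<lambda>x. \<phi> x *\<^sub>R b x) \<in> test_functions W"
  by (rule test_functions_scaleR[OF open_W smooth_\<phi>_W])

text \<open>A function that vanishes on the boundary may be truncated there and still be
  differentiated in the weak sense: no boundary term appears. The proof integrates by parts with
  \<open>psi \<delta> (\<phi> x)\<close> in place of the truncation and lets \<open>\<delta>\<close>
  tend to 0.\<close>

lemma weak_derivative: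
  fixes b :: "'a \<Rightarrow> 'b::euclidean_space"
  assumes b: "b \<in> test_functions W" and k: "smooth_on UNIV k"
  shows "conv k (\<lambda>x. indicator \<Omega> x *\<^sub>R dderiv v (\<lambda>x. \<phi> x *\<^sub>R b x) x) x
     = conv (dderiv v k) (\<lambda>x. indicator \<Omega> x *\<^sub>R \<phi> x *\<^sub>R b x) x"
proof -
  obtain K where K: "smooth_on UNIV b" "compact K" "K \<subseteq> W" "\<And>x. x \<notin> K \<Longrightarrow> b x = 0"
    using compact_sectionsE[OF b] by metis
  have z: "dderiv v b x = 0" if "x \<notin> K" for x
    by (rule dderiv_zero_outside[OF compact_imp_closed[OF K(2)] K(4) that])
  define D where "D n = inverse (real (Suc n))" for n
  have D: "D \<longlonglongrightarrow> 0" "\<And>n. D n > 0" unfolding D_def[abs_def] using inverse_Suc_seq by auto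
  define q where "q n x = psi (D n) (\<phi> x) *\<^sub>R b x" for n x
  define q' where "q' n v x = psi (D n) (\<phi> x) *\<^sub>R dderiv v b x + (dpsi (D n) (\<phi> x) * dderiv v \<phi> x) *\<^sub>R b x" for n v x
  have dq: "(q n has_derivative (\<lambda>v. q' n v x)) (at x)" for n x
  proof -
    have p: "(psi (D n) has_derivative (*) (dpsi (D n) (\<phi> x))) (at (\<phi> x))"
      using psi_has_derivative[OF D(2)] unfolding has_field_derivative_def .
    have 1: "((\<lambda>x. psi (D n) (\<phi> x)) has_derivative (\<lambda>v. dpsi (D n) (\<phi> x) * dderiv v \<phi> x)) (at x)"
      by (rule has_derivative_compose[OF smooth_on_has_derivative[OF smooth_\<phi> UNIV_I] p])
    show ?thesis unfolding q_def[abs_def] q'_def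
      by (rule has_derivative_scaleR[OF 1 smooth_on_has_derivative[OF K(1) UNIV_I]])
  qed
  have dq': "dderiv v (q n) = q' n v" for n by (rule ext) (rule dderiv_eqI[OF dq])
  have c0: "continuous_on UNIV \<phi>" "continuous_on UNIV b" "\<And>v. continuous_on UNIV (dderiv v \<phi>)" "\<And>v. continuous_on UNIV (dderiv v b)"
    by (intro smooth_on_continuous smooth_on_dderiv smooth_\<phi> K)+
  have cpsi: "continuous_on UNIV (\<lambda>x. psi (D n) (\<phi> x))" "continuous_on UNIV (\<lambda>x. dpsi (D n) (\<phi> x))" for n
  proof -
    have "min (\<phi> x) 0 - D n \<noteq> 0" for x using D(2)[of n] by (auto simp: min_def)
    then show "continuous_on UNIV (\<lambda>x. psi (D n) (\<phi> x))" "continuous_on UNIV (\<lambda>x. dpsi (D n) (\<phi> x))"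
      unfolding psi_def dpsi_def using c0(1) by (intro continuous_intros; simp)+
  qed
  have cq': "continuous_on UNIV (q' n v)" for n v
    unfolding q'_def[abs_def] by (intro continuous_intros cpsi c0)
  have C1: "Cm_on 1 UNIV (q n)" for n
    using Cm_on_SucI[OF open_UNIV dq, of 0 n] cq' by simp
  have qK: "q n x = 0" if "x \<notin> K" for n x using K(4)[OF that] by (simp add: q_def)
  have ibp: "conv k (q' n v) x = conv (dderiv v k) (q n) x" for n
    using conv_integration_by_parts[OF smooth_onD[OF k] C1 K(2) qK, where v = v and x = x] by (simp add: dq')
  have lk: "locally_integrable k" "locally_integrable (dderiv v k)"
    by (intro locally_integrable_continuous smooth_on_continuous smooth_on_dderiv k)+
  have pt: "(\<lambda>n. q n y) \<longlonglongrightarrow> indicator \<Omega> y *\<^sub>R \<phi> y *\<^sub>R b y" for y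
    unfolding q_def indicator_\<phi>[OF b] by (intro tendsto_scaleR tendsto_const psi_tendsto(1) D)
  have dphib: "dderiv v (\<lambda>x. \<phi> x *\<^sub>R b x) y = \<phi> y *\<^sub>R dderiv v b y + dderiv v \<phi> y *\<^sub>R b y" for y
    by (intro dderiv_scaleR smooth_on_differentiable[OF smooth_\<phi>] smooth_on_differentiable[OF K(1)] UNIV_I)
  have pt': "(\<lambda>n. q' n v y) \<longlonglongrightarrow> indicator \<Omega> y *\<^sub>R dderiv v (\<lambda>x. \<phi> x *\<^sub>R b x) y" for y
  proof (cases "y \<in> K")
    case True
    have "(\<lambda>n. q' n v y) \<longlonglongrightarrow> min (\<phi> y) 0 *\<^sub>R dderiv v b y + ((if \<phi> y < 0 then 1 else 0) * dderiv v \<phi> y) *\<^sub>R b y"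
      unfolding q'_def by (intro tendsto_intros psi_tendsto D)
    moreover have "y \<in> \<Omega> \<longleftrightarrow> \<phi> y < 0" using half True K(3) by blast
    moreover have "min (\<phi> y) 0 = (if \<phi> y < 0 then \<phi> y else 0)" by simp
    ultimately show ?thesis by (cases "\<phi> y < 0") (simp_all add: dphib)
  next
    case False
    then show ?thesis using z K(4) by (simp add: q'_def dphib)
  qed
  have "(\<lambda>n. conv k (q' n v) x) \<longlonglongrightarrow> conv k (\<lambda>x. indicator \<Omega> x *\<^sub>R dderiv v (\<lambda>x. \<phi> x *\<^sub>R b x) x) x"
  proof (rule conv_tendsto[OF lk(1)])
    show "compact_density (\<lambda>y. \<bar>\<phi> y\<bar> * norm (dderiv v b y) + \<bar>dderiv v \<phi> y\<bar> * norm (b y))"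
      by (rule compact_density_continuous[OF _ K(2)]) (use z K(4) c0 in \<open>auto intro!: continuous_intros\<close>)
    show "norm (q' n v y) \<le> norm (\<bar>\<phi> y\<bar> * norm (dderiv v b y) + \<bar>dderiv v \<phi> y\<bar> * norm (b y))" for n y
    proof -
      have "norm (q' n v y) \<le> \<bar>psi (D n) (\<phi> y)\<bar> * norm (dderiv v b y) + \<bar>dpsi (D n) (\<phi> y)\<bar> * \<bar>dderiv v \<phi> y\<bar> * norm (b y)"
        unfolding q'_def by (rule order_trans[OF norm_triangle_ineq]) (simp add: abs_mult)
      also have "\<dots> \<le> \<bar>\<phi> y\<bar> * norm (dderiv v b y) + 1 * \<bar>dderiv v \<phi> y\<bar> * norm (b y)"
        by (intro add_mono mult_right_mono psi_bounds dpsi_bounds D) auto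
      finally show ?thesis by simp
    qed
    show "q' n v \<in> borel_measurable borel" for n by (rule borel_measurable_continuous_onI[OF cq'])
  qed (rule pt')
  moreover have "(\<lambda>n. conv (dderiv v k) (q n) x) \<longlonglongrightarrow> conv (dderiv v k) (\<lambda>x. indicator \<Omega> x *\<^sub>R \<phi> x *\<^sub>R b x) x"
  proof (rule conv_tendsto[OF lk(2)])
    show "compact_density (\<lambda>y. \<phi> y *\<^sub>R b y)" by (rule test_functions_density[OF test_\<phi>[OF b]])
    show "norm (q n y) \<le> norm (\<phi> y *\<^sub>R b y)" for n y
      unfolding q_def using psi_bounds[OF D(2)[of n], of "\<phi> y"] by (simp add: mult_right_mono)
    show "q n \<in> borel_measurable borel" for n
      using Cm_on_continuous[OF C1] by (rule borel_measurable_continuous_onI)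
  qed (rule pt)
  ultimately show ?thesis using LIMSEQ_unique by (simp add: ibp) 
qed

text \<open>Since \<open>w\<close> vanishes to second order at the boundary, both \<open>w\<close>
  and its first derivatives can be truncated without boundary terms. For the regularised kernel all
  three derivatives can therefore be moved around until the Laplacian has hit the kernel, where it
  produces the approximate identity.\<close>

lemma conv_laplacian_flat:
  fixes b :: "'a \<Rightarrow> 'b::euclidean_space"
  assumes b: "b \<in> test_functions W"
  defines "w \<equiv> \<lambda>x. \<phi> x ^ 2 *\<^sub>R b x"
  shows "conv (kern 0 e) (\<lambda>x. indicator \<Omega> x *\<^sub>R laplacian w x) x
    = sphere_const TYPE('a) *\<^sub>R indicator \<Omega> x *\<^sub>R dderiv e w x"
proof -
  have smb: "smooth_on UNIV b" using compact_sectionsE[OF b] by metis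
  define c where "c i x = (2 * dderiv i \<phi> x) *\<^sub>R b x + \<phi> x *\<^sub>R dderiv i b x" for i x
  have c: "c i \<in> test_functions W" for i
    unfolding c_def[abs_def]
    by (intro test_functions_add test_functions_scaleR[OF open_W] test_functions_dderiv b smooth_on_mult
        smooth_on_const smooth_on_dderiv smooth_\<phi>_W open_W)
  have dw: "dderiv i w = (\<lambda>x. \<phi> x *\<^sub>R c i x)" for i
    unfolding w_def c_def numeral_2_eq_2 dderiv_power_scaleR[OF smooth_\<phi> smb] by simp
  have w2: "w = (\<lambda>x. \<phi> x *\<^sub>R \<phi> x *\<^sub>R b x)" by (simp add: w_def power2_eq_square)
  have ddens: "compact_density (\<lambda>x. indicator \<Omega> x *\<^sub>R dderiv i (dderiv i w) x)" for i
    unfolding dw by (intro density_truncation test_functions_dderiv test_\<phi> c)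
  have lapl: "(\<lambda>x. indicator \<Omega> x *\<^sub>R laplacian w x) = (\<lambda>x. \<Sum>i\<in>Basis. indicator \<Omega> x *\<^sub>R dderiv i (dderiv i w) x)"
    by (simp add: laplacian_def scaleR_sum_right)
  have main: "conv (kern t e) (\<lambda>x. indicator \<Omega> x *\<^sub>R laplacian w x) x = conv (rho t) (\<lambda>x. indicator \<Omega> x *\<^sub>R dderiv e w x) x"
    if t: "t > 0" for t
  proof -
    have sk: "smooth_on UNIV (kern t u)" for u :: 'a by (intro smooth_on_kern inner_self_plus_pos t open_UNIV)
    have sym: "dderiv u (kern t v) = dderiv v (kern t u)" for u v :: 'a
      by (rule ext) (rule dderiv_kern_symmetric[OF inner_self_plus_pos[OF t]])
    have lk: "locally_integrable k" if "smooth_on UNIV k" for k :: "'a \<Rightarrow> real"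
      by (rule locally_integrable_continuous[OF smooth_on_continuous[OF that]])
    have dens: "compact_density (\<lambda>x. indicator \<Omega> x *\<^sub>R w x)" unfolding w2 by (intro density_truncation test_\<phi> b)
    have "conv (kern t e) (\<lambda>x. indicator \<Omega> x *\<^sub>R laplacian w x) x
        = (\<Sum>i\<in>Basis. conv (kern t e) (\<lambda>x. indicator \<Omega> x *\<^sub>R dderiv i (dderiv i w) x) x)"
      unfolding lapl by (rule conv_sum[OF lk[OF sk] ddens])
    also have "\<dots> = (\<Sum>i\<in>Basis. conv (dderiv i (kern t e)) (\<lambda>x. indicator \<Omega> x *\<^sub>R dderiv i w x) x)"
      unfolding dw by (rule sum.cong[OF refl]) (rule weak_derivative[OF c sk])
    also have "\<dots> = (\<Sum>i\<in>Basis. conv (dderiv e (kern t i)) (\<lambda>x. indicator \<Omega> x *\<^sub>R dderiv i w x) x)"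
      by (simp only: sym[of e])
    also have "\<dots> = (\<Sum>i\<in>Basis. conv (dderiv i (dderiv e (kern t i))) (\<lambda>x. indicator \<Omega> x *\<^sub>R w x) x)"
      unfolding w2 by (rule sum.cong[OF refl]) (rule weak_derivative[OF test_\<phi>[OF b] smooth_on_dderiv[OF sk]])
    also have "\<dots> = conv (\<lambda>z. \<Sum>i\<in>Basis. dderiv i (dderiv e (kern t i)) z) (\<lambda>x. indicator \<Omega> x *\<^sub>R w x) x"
      by (rule conv_sum_kernel[symmetric]) (intro lk smooth_on_dderiv sk, rule dens)
    also have "(\<lambda>z. \<Sum>i\<in>Basis. dderiv i (dderiv e (kern t i)) z) = dderiv e (rho t)"
    proof
      fix z
      have "(\<Sum>i\<in>Basis. dderiv i (dderiv e (kern t i)) z) = (\<Sum>i\<in>Basis. dderiv e (dderiv i (kern t i)) z)"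
        by (intro sum.cong refl dderiv_symmetric[OF open_UNIV smooth_onD[OF sk]] UNIV_I)
      also have "\<dots> = dderiv e (\<lambda>z. \<Sum>i\<in>Basis. dderiv i (kern t i) z) z"
        by (rule dderiv_sum[symmetric]) (intro smooth_on_differentiable[OF smooth_on_dderiv[OF sk]] UNIV_I)
      also have "(\<lambda>z. \<Sum>i\<in>Basis. dderiv i (kern t i) z) = (rho t :: 'a \<Rightarrow> real)"
        by (rule ext) (rule sum_dderiv_kern[OF inner_self_plus_pos[OF t]])
      finally show "(\<Sum>i\<in>Basis. dderiv i (dderiv e (kern t i)) z) = dderiv e (rho t) z" .
    qed
    also have "conv (dderiv e (rho t)) (\<lambda>x. indicator \<Omega> x *\<^sub>R w x) x = conv (rho t) (\<lambda>x. indicator \<Omega> x *\<^sub>R dderiv e w x) x"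
      unfolding w2 by (rule weak_derivative[OF test_\<phi>[OF b] smooth_on_rho[OF t], symmetric])
    finally show ?thesis .
  qed
  define T where "T n = inverse (real (Suc n))" for n
  have T: "T \<longlonglongrightarrow> 0" "\<And>n. T n > 0" unfolding T_def[abs_def] using inverse_Suc_seq by auto
  have "compact_density (\<lambda>x. indicator \<Omega> x *\<^sub>R laplacian w x)"
    unfolding laplacian_def[abs_def] dw
    by (intro density_truncation test_functions_sum test_functions_dderiv test_\<phi> c)
  then have 1: "(\<lambda>n. conv (kern (T n) e) (\<lambda>x. indicator \<Omega> x *\<^sub>R laplacian w x) x)
      \<longlonglongrightarrow> conv (kern 0 e) (\<lambda>x. indicator \<Omega> x *\<^sub>R laplacian w x) x"
    by (rule conv_kern_tendsto[OF T])
  have 2: "(\<lambda>n. conv (rho (T n)) (\<lambda>x. indicator \<Omega> x *\<^sub>R dderiv e w x) x)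
      \<longlonglongrightarrow> sphere_const TYPE('a) *\<^sub>R indicator \<Omega> x *\<^sub>R dderiv e w x"
  proof (rule conv_rho_tendsto[OF T])
    show "compact_density (\<lambda>x. indicator \<Omega> x *\<^sub>R dderiv e w x)"
      unfolding dw by (intro density_truncation test_\<phi> c)
    show "isCont (\<lambda>x. indicator \<Omega> x *\<^sub>R dderiv e w x) x"
      unfolding dw using continuous_truncation[OF c] continuous_on_eq_continuous_at[OF open_UNIV] by blast
  qed
  show ?thesis by (rule LIMSEQ_unique[OF 1[unfolded main[OF T(2)]] 2])
qed

text \<open>Two derivatives of \<open>\<phi>\<^sup>m\<^sup>+\<^sup>2 a\<close> both have to hit the
  power of \<open>\<phi>\<close> to lower its order by two; the result is the leading term, and
  everything else keeps one more factor \<open>\<phi>\<close>.\<close>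

lemma laplacian_power:
  fixes a :: "'a \<Rightarrow> 'b::euclidean_space"
  assumes a: "a \<in> test_functions W"
  obtains r where "r \<in> test_functions W"
    "\<And>x. laplacian (\<lambda>x. \<phi> x ^ (m + 2) *\<^sub>R a x) x =
      \<phi> x ^ m *\<^sub>R (real (Suc m) * real (Suc (Suc m)) * (\<Sum>i\<in>Basis. (dderiv i \<phi> x)\<^sup>2)) *\<^sub>R a x + \<phi> x ^ Suc m *\<^sub>R r x"
proof -
  have sma: "smooth_on UNIV a" using compact_sectionsE[OF a] by metis
  define c where "c i x = (real (Suc (Suc m)) * dderiv i \<phi> x) *\<^sub>R a x + \<phi> x *\<^sub>R dderiv i a x" for i x
  have c: "c i \<in> test_functions W" for i
    unfolding c_def[abs_def]
    by (intro test_functions_add test_functions_scaleR[OF open_W] test_functions_dderiv a smooth_on_mult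
        smooth_on_const smooth_on_dderiv smooth_\<phi>_W open_W)
  have smc: "smooth_on UNIV (c i)" for i using compact_sectionsE[OF c[of i]] by metis
  define r where "r x = (\<Sum>i\<in>Basis. (real (Suc m) * dderiv i \<phi> x) *\<^sub>R dderiv i a x + dderiv i (c i) x)" for x
  show ?thesis
  proof (rule that[of r])
    show "r \<in> test_functions W" unfolding r_def[abs_def]
      by (intro test_functions_sum test_functions_add test_functions_scaleR[OF open_W] test_functions_dderiv a c smooth_on_mult
        smooth_on_const smooth_on_dderiv smooth_\<phi>_W open_W)
    fix x
    have dd: "dderiv i (dderiv i (\<lambda>x. \<phi> x ^ (m + 2) *\<^sub>R a x)) x
       = \<phi> x ^ m *\<^sub>R (real (Suc m) * real (Suc (Suc m)) * (dderiv i \<phi> x)\<^sup>2) *\<^sub>R a x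
         + \<phi> x ^ Suc m *\<^sub>R ((real (Suc m) * dderiv i \<phi> x) *\<^sub>R dderiv i a x + dderiv i (c i) x)" for i
    proof -
      have "m + 2 = Suc (Suc m)" by simp
      then have "dderiv i (\<lambda>x. \<phi> x ^ (m + 2) *\<^sub>R a x) = (\<lambda>x. \<phi> x ^ Suc m *\<^sub>R c i x)"
        unfolding c_def by (simp only: dderiv_power_scaleR[OF smooth_\<phi> sma])
      then have "dderiv i (dderiv i (\<lambda>x. \<phi> x ^ (m + 2) *\<^sub>R a x)) x
          = \<phi> x ^ m *\<^sub>R ((real (Suc m) * dderiv i \<phi> x) *\<^sub>R c i x + \<phi> x *\<^sub>R dderiv i (c i) x)"
        by (simp only: dderiv_power_scaleR[OF smooth_\<phi> smc])
      also have "(real (Suc m) * dderiv i \<phi> x) *\<^sub>R c i x = (real (Suc m) * real (Suc (Suc m)) * (dderiv i \<phi> x)\<^sup>2) *\<^sub>R a x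
          + \<phi> x *\<^sub>R (real (Suc m) * dderiv i \<phi> x) *\<^sub>R dderiv i a x"
        unfolding c_def by (simp only: scaleR_add_right scaleR_scaleR power2_eq_square mult_ac)
      finally show ?thesis by (simp only: scaleR_add_right scaleR_scaleR power_Suc add.assoc mult_ac)
    qed
    show "laplacian (\<lambda>x. \<phi> x ^ (m + 2) *\<^sub>R a x) x =
      \<phi> x ^ m *\<^sub>R (real (Suc m) * real (Suc (Suc m)) * (\<Sum>i\<in>Basis. (dderiv i \<phi> x)\<^sup>2)) *\<^sub>R a x + \<phi> x ^ Suc m *\<^sub>R r x"
      unfolding laplacian_def dd r_def sum.distrib
      by (simp only: sum_distrib_left scaleR_sum_left scaleR_sum_right sum.distrib scaleR_add_right scaleR_scaleR)
  qed
qed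

text \<open>The error term \<open>\<phi>\<^sup>m r\<close> is removed by adding a multiple of
  \<open>\<phi>\<^sup>m\<^sup>+\<^sup>2 r\<close> to \<open>w\<close>, up to an error of the next
  order. The coefficient involves \<open>1 / |\<nabla>\<phi>|\<^sup>2\<close>, and this is where the
  gradient has to be nonzero.\<close>

lemma solve_laplacian_to_order:
  fixes h :: "'a \<Rightarrow> 'b::euclidean_space"
  assumes h: "h \<in> test_functions W"
  shows "\<exists>b\<in>test_functions W. \<exists>r\<in>test_functions W.
    \<forall>x. h x = laplacian (\<lambda>x. \<phi> x ^ 2 *\<^sub>R b x) x + \<phi> x ^ m *\<^sub>R r x"
proof (induction m)
  case 0
  have z: "(\<lambda>x::'a. 0::'b) \<in> test_functions W" by (rule compact_sectionsI[where K = "{}"]) auto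
  have d: "dderiv i (\<lambda>x::'a. 0::'b) = (\<lambda>x. 0)" for i by (rule ext) (rule dderiv_eqI, simp)
  show ?case
    by (rule bexI[OF _ z], rule bexI[OF _ h]) (simp add: laplacian_def d)
next
  case (Suc m)
  then obtain b r where br: "b \<in> test_functions W" "r \<in> test_functions W"
    "\<And>x. h x = laplacian (\<lambda>x. \<phi> x ^ 2 *\<^sub>R b x) x + \<phi> x ^ m *\<^sub>R r x" by blast
  define N where "N x = real (Suc m) * real (Suc (Suc m)) * (\<Sum>i\<in>Basis. (dderiv i \<phi> x)\<^sup>2)" for x
  have Npos: "N x > 0" if "x \<in> W" for x
  proof -
    obtain v where v: "dderiv v \<phi> x \<noteq> 0" using gradient[OF \<open>x \<in> W\<close>] by blast
    have lin: "linear (\<lambda>v. dderiv v \<phi> x)"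
      using has_derivative_linear[OF smooth_on_has_derivative[OF smooth_\<phi> UNIV_I]] .
    have "\<exists>i\<in>Basis. dderiv i \<phi> x \<noteq> 0"
    proof (rule ccontr)
      assume "\<not> ?thesis"
      then have "dderiv v \<phi> x = 0" if "v \<in> span Basis" for v
        using linear_eq_0_on_span[OF lin _ that] by blast
      then show False using v by simp
    qed
    then obtain i where i: "i \<in> Basis" "dderiv i \<phi> x \<noteq> 0" by blast
    have "(\<Sum>i\<in>Basis. (dderiv i \<phi> x)\<^sup>2) > 0"
      by (rule sum_pos2[OF finite_Basis i(1)]) (use i(2) in auto)
    then show ?thesis unfolding N_def by simp
  qed
  \<comment> \<open>chosen so that the leading term of the Laplacian of
    \<open>\<phi>\<^sup>m\<^sup>+\<^sup>2 a\<close> is \<open>\<phi>\<^sup>m r\<close>\<close>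
  define a where "a x = (1 / N x) *\<^sub>R r x" for x
  have a: "a \<in> test_functions W" unfolding a_def[abs_def]
  proof (rule test_functions_scaleR[OF open_W _ br(2)])
    show "smooth_on W (\<lambda>x. 1 / N x)"
      by (rule smooth_on_divide[OF open_W smooth_on_const _ Npos])
        (unfold N_def, intro smooth_on_mult smooth_on_const smooth_on_sum smooth_on_power smooth_on_dderiv smooth_\<phi>_W open_W)
  qed
  obtain r' where r': "r' \<in> test_functions W"
    "\<And>x. laplacian (\<lambda>x. \<phi> x ^ (m + 2) *\<^sub>R a x) x = \<phi> x ^ m *\<^sub>R N x *\<^sub>R a x + \<phi> x ^ Suc m *\<^sub>R r' x"
    by (rule laplacian_power[OF a, of m]) (rule that, assumption, unfold N_def, assumption)
  have Na: "N x *\<^sub>R a x = r x" for x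
  proof (cases "x \<in> W")
    case True
    then show ?thesis using Npos[OF True] by (simp add: a_def)
  next
    case False
    then have "r x = 0" using compact_sectionsE[OF br(2)] by (metis subsetD)
    then show ?thesis by (simp add: a_def)
  qed
  have pw: "(\<lambda>x. \<phi> x ^ m *\<^sub>R a x) \<in> test_functions W"
    by (intro test_functions_scaleR[OF open_W _ a] smooth_on_power smooth_\<phi>_W open_W)
  have sm: "smooth_on UNIV (\<lambda>x. \<phi> x ^ 2 *\<^sub>R b x)" "smooth_on UNIV (\<lambda>x. \<phi> x ^ (m + 2) *\<^sub>R a x)"
    using compact_sectionsE[OF br(1)] compact_sectionsE[OF a]
    by (metis smooth_on_scaleR smooth_on_power smooth_\<phi> open_UNIV)+
  show ?case
  proof (rule bexI[where x = "\<lambda>x. b x + \<phi> x ^ m *\<^sub>R a x"], rule bexI[where x = "\<lambda>x. (- 1) *\<^sub>R r' x"], rule allI)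
    fix x
    have "(\<lambda>x. \<phi> x ^ 2 *\<^sub>R (b x + \<phi> x ^ m *\<^sub>R a x)) = (\<lambda>x. \<phi> x ^ 2 *\<^sub>R b x + \<phi> x ^ (m + 2) *\<^sub>R a x)"
      by (simp add: scaleR_add_right power_add power2_eq_square mult_ac)
    then show "h x = laplacian (\<lambda>x. \<phi> x ^ 2 *\<^sub>R (b x + \<phi> x ^ m *\<^sub>R a x)) x + \<phi> x ^ Suc m *\<^sub>R (- 1) *\<^sub>R r' x"
      by (simp only: laplacian_add[OF sm] r'(2) Na br(3)) simp
    show "(\<lambda>x. (- 1) *\<^sub>R r' x) \<in> test_functions W"
      by (rule test_functions_scaleR[OF open_W smooth_on_const r'(1)])
    show "(\<lambda>x. b x + \<phi> x ^ m *\<^sub>R a x) \<in> test_functions W"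
      by (rule test_functions_add[OF br(1) pw])
  qed
qed

lemma Cm_on_truncation:
  fixes r :: "'a \<Rightarrow> 'b::euclidean_space"
  assumes r: "r \<in> test_functions W"
  shows "Cm_on m UNIV (\<lambda>x. indicator \<Omega> x *\<^sub>R \<phi> x ^ Suc m *\<^sub>R r x)"
proof -
  have smr: "smooth_on UNIV r" using compact_sectionsE[OF r] by metis
  have eq: "indicator \<Omega> x *\<^sub>R \<phi> x ^ Suc m *\<^sub>R r x = (1 * (min (\<phi> x) 0) ^ Suc m) *\<^sub>R r x" for x
  proof (cases "x \<in> W")
    case False
    then have "r x = 0" using compact_sectionsE[OF r] by (metis subsetD)
    then show ?thesis by simp
  qed (auto simp: half min_def split: split_indicator)
  have "Cm_on m UNIV (\<lambda>x. 1 * (min (\<phi> x) 0) ^ Suc m)"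
    by (rule Cm_on_real_compose[where f = \<phi> and g = "\<lambda>s. 1 * (min s 0) ^ Suc m", OF open_UNIV open_UNIV UNIV_I smooth_onD[OF smooth_\<phi>] Cm_on_min_power])
  then show ?thesis unfolding eq
    by (rule Cm_on_bilinear[OF bounded_bilinear_scaleR open_UNIV _ smooth_onD[OF smr]])
qed

lemma conv_boundary_regular_test:
  fixes h :: "'a \<Rightarrow> 'b::euclidean_space"
  assumes h: "h \<in> test_functions W"
  obtains H where "Cm_on m UNIV H" "\<And>x. x \<in> \<Omega> \<Longrightarrow> conv (kern 0 e) (\<lambda>x. indicator \<Omega> x *\<^sub>R h x) x = H x"
proof -
  obtain b r where br: "b \<in> test_functions W" "r \<in> test_functions W"
    "\<And>x. h x = laplacian (\<lambda>x. \<phi> x ^ 2 *\<^sub>R b x) x + \<phi> x ^ Suc m *\<^sub>R r x"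
    using solve_laplacian_to_order[OF h, of "Suc m"] by blast
  define w where "w x = \<phi> x ^ 2 *\<^sub>R b x" for x
  define g where "g x = indicator \<Omega> x *\<^sub>R \<phi> x ^ Suc m *\<^sub>R r x" for x
  have wt: "w \<in> test_functions W"
    unfolding w_def[abs_def] by (intro test_functions_scaleR[OF open_W _ br(1)] smooth_on_power smooth_\<phi>_W open_W)
  have lw: "laplacian w \<in> test_functions W"
    unfolding laplacian_def[abs_def] by (intro test_functions_sum test_functions_dderiv wt)
  obtain K where K: "compact K" "\<And>x. x \<notin> K \<Longrightarrow> r x = 0" using compact_sectionsE[OF br(2)] by metis
  have gm: "Cm_on m UNIV g" unfolding g_def[abs_def] by (rule Cm_on_truncation[OF br(2)])
  have gK: "g x = 0" if "x \<notin> K" for x using K(2)[OF that] by (simp add: g_def)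
  have gd: "compact_density g" by (rule compact_density_continuous[OF Cm_on_continuous[OF gm] K(1) gK])
  have l: "locally_integrable (kern 0 e)" by (rule locally_integrable_kern) simp
  show ?thesis
  proof (rule that[of "\<lambda>x. sphere_const TYPE('a) *\<^sub>R dderiv e w x + conv (kern 0 e) g x"])
    have "smooth_on UNIV w" using compact_sectionsE[OF wt] by metis
    then show "Cm_on m UNIV (\<lambda>x. sphere_const TYPE('a) *\<^sub>R dderiv e w x + conv (kern 0 e) g x)"
      by (intro Cm_on_add open_UNIV Cm_on_bilinear[OF bounded_bilinear_scaleR open_UNIV Cm_on_const]
          smooth_onD[OF smooth_on_dderiv] Cm_on_conv_density[OF l gm K(1) gK])
    fix x assume x: "x \<in> \<Omega>"
    have "(\<lambda>x. indicator \<Omega> x *\<^sub>R h x) = (\<lambda>x. indicator \<Omega> x *\<^sub>R laplacian w x + g x)"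
      by (simp add: br(3) g_def w_def[abs_def] scaleR_add_right)
    then have "conv (kern 0 e) (\<lambda>x. indicator \<Omega> x *\<^sub>R h x) x
        = conv (kern 0 e) (\<lambda>x. indicator \<Omega> x *\<^sub>R laplacian w x) x + conv (kern 0 e) g x"
      using conv_add[OF l density_truncation[OF lw] gd] by simp
    also have "conv (kern 0 e) (\<lambda>x. indicator \<Omega> x *\<^sub>R laplacian w x) x = sphere_const TYPE('a) *\<^sub>R dderiv e w x"
      using conv_laplacian_flat[OF br(1), of e x] x unfolding w_def[symmetric, abs_def] by simp
    finally show "conv (kern 0 e) (\<lambda>x. indicator \<Omega> x *\<^sub>R h x) x = sphere_const TYPE('a) *\<^sub>R dderiv e w x + conv (kern 0 e) g x" .
  qed
qed

end

lemma conv_kern_off_support: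
  fixes f :: "'a::euclidean_space \<Rightarrow> 'b::euclidean_space"
  assumes f: "compact_density f" and t: "t \<ge> 0" and U: "open U" "p \<in> U" "\<And>y. y \<in> U \<Longrightarrow> f y = 0"
  shows "(conv (kern t e) f has_derivative (\<lambda>v. conv (dderiv v (kern t e)) f p)) (at p)"
proof -
  obtain s where s: "s > 0" "ball p s \<subseteq> U" using openE[OF U(1,2)] .
  define r where "r = s / 2"
  have r: "r > 0" "ball p (2 * r) \<subseteq> U" using s by (auto simp: r_def)
  obtain R where R: "\<And>y. y \<notin> cball 0 R \<Longrightarrow> f y = 0" using compact_densityE[OF f] by metis
  define K where "K = {a - b |a b. a \<in> cball p r \<and> b \<in> cball 0 R} \<inter> - ball 0 r"
  show ?thesis
  proof (rule conv_has_derivative_kernel[where S = "- {0}" and K = K and r = r])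
    show "Cm_on 1 (- {0}) (kern t e)" by (rule smooth_onD[OF smooth_on_kern]) (use t in \<open>auto simp: add_pos_nonneg\<close>)
    show "compact K" unfolding K_def by (intro compact_Int_closed compact_differences closed_Compl) auto
    show "K \<subseteq> - {0}" using r(1) by (auto simp: K_def)
    fix x y assume xy: "x \<in> ball p r" "f y \<noteq> 0"
    then have "y \<notin> ball p (2 * r)" using U(3) r(2) by blast
    then have "norm (x - y) \<ge> r"
      using xy(1) dist_triangle[of p y x] by (simp add: dist_norm)
    moreover have "y \<in> cball 0 R" using R xy(2) by blast
    ultimately show "x - y \<in> K" unfolding K_def using xy(1) ball_subset_cball[of p r] by fastforce
  qed (use f r in auto)
qed

text \<open>Near \<open>p\<close> the potential does not see the kernel close to the origin, so the
  singularity can be cut out and a smooth kernel remains.\<close>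

lemma conv_kern_smooth_off_support:
  fixes f :: "'a::euclidean_space \<Rightarrow> 'b::euclidean_space"
  assumes f: "compact_density f" and U: "open U" "p \<in> U" "\<And>y. y \<in> U \<Longrightarrow> f y = 0"
  obtains B where "open B" "p \<in> B" "smooth_on B (conv (kern 0 e) f)"
proof -
  obtain s where s: "s > 0" "ball p s \<subseteq> U" using openE[OF U(1,2)] .
  define r where "r = s / 2"
  have r: "r > 0" "ball p (2 * r) \<subseteq> U" using s by (auto simp: r_def)
  obtain \<kappa> :: "'a \<Rightarrow> real" and V L where \<kappa>: "smooth_on UNIV \<kappa>" "open V" "{0} \<subseteq> V" "\<And>x. x \<in> V \<Longrightarrow> \<kappa> x = 1"
    "compact L" "L \<subseteq> ball 0 r" "\<And>x. x \<notin> L \<Longrightarrow> \<kappa> x = 0"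
    using exists_smooth_cutoff[of "{0}" "ball 0 r"] r(1) by auto
  define k where "k z = (1 - \<kappa> z) * kern 0 e z" for z
  have smk: "smooth_on UNIV k"
  proof (rule smooth_on_local)
    fix z :: 'a
    show "\<exists>W. open W \<and> z \<in> W \<and> smooth_on W k"
    proof (cases "z = 0")
      case True
      have "smooth_on V k" by (rule smooth_on_cong[OF \<kappa>(2) _ smooth_on_const[of _ 0]]) (simp add: k_def \<kappa>(4))
      then show ?thesis using True \<kappa>(2,3) by blast
    next
      case False
      have "smooth_on (- {0}) k" unfolding k_def[abs_def]
        by (intro smooth_on_mult smooth_on_diff smooth_on_const smooth_on_kern smooth_on_subset[OF \<kappa>(1)]) auto
      then show ?thesis using False by (intro exI[of _ "- {0}"]) auto
    qed
  qed
  have eq: "conv k f x = conv (kern 0 e) f x" if x: "x \<in> ball p r" for x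
    unfolding conv_def
  proof (rule Bochner_Integration.integral_cong[OF refl])
    fix y
    show "k (x - y) *\<^sub>R f y = kern 0 e (x - y) *\<^sub>R f y"
    proof (cases "f y = 0")
      case False
      then have "y \<notin> ball p (2 * r)" using U(3) r(2) by blast
      then have "norm (x - y) \<ge> r"
        using x dist_triangle[of p y x] by (simp add: dist_norm)
      then have "x - y \<notin> L" using \<kappa>(6) by auto
      then show ?thesis by (simp add: k_def \<kappa>(7))
    qed simp
  qed
  have "smooth_on (ball p r) (conv (kern 0 e) f)"
    by (rule smooth_on_cong[OF open_ball eq smooth_on_subset[OF smooth_on_conv_kernel[OF smk f]]]) auto
  then show ?thesis using that[of "ball p r"] r(1) by simp
qed

lemma exists_boundary_patch:
  fixes \<Omega> :: "'a::euclidean_space set"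
  assumes "smooth_boundary \<Omega>" "open \<Omega>" "p \<in> frontier \<Omega>"
  obtains W \<phi> where "boundary_patch \<Omega> W \<phi>" "p \<in> W" "\<phi> p = 0"
proof -
  from bspec[OF assms(1)[unfolded smooth_boundary_def] assms(3)]
  obtain W0 and \<phi>0 :: "'a \<Rightarrow> real" where *: "open W0 \<and> p \<in> W0 \<and> smooth_on W0 \<phi>0 \<and>
    (\<forall>x\<in>W0. \<exists>v. frechet_derivative \<phi>0 (at x) v \<noteq> 0) \<and>
    \<Omega> \<inter> W0 = {x\<in>W0. \<phi>0 x < 0} \<and> frontier \<Omega> \<inter> W0 = {x\<in>W0. \<phi>0 x = 0}"
    by (elim exE) (rule that)
  note W0 = conjunct1[OF *]
    conjunct1[OF conjunct2[OF *]]
    conjunct1[OF conjunct2[OF conjunct2[OF *]]]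
    conjunct1[OF conjunct2[OF conjunct2[OF conjunct2[OF *]]]]
    conjunct1[OF conjunct2[OF conjunct2[OF conjunct2[OF conjunct2[OF *]]]]]
    conjunct2[OF conjunct2[OF conjunct2[OF conjunct2[OF conjunct2[OF *]]]]]
  obtain \<kappa> :: "'a \<Rightarrow> real" and V L where \<kappa>: "smooth_on UNIV \<kappa>" "open V" "{p} \<subseteq> V" "\<And>x. x \<in> V \<Longrightarrow> \<kappa> x = 1"
    "compact L" "L \<subseteq> W0" "\<And>x. x \<notin> L \<Longrightarrow> \<kappa> x = 0"
    using exists_smooth_cutoff[of "{p}" W0] W0(1,2) by auto
  define \<phi> where "\<phi> x = \<phi>0 x *\<^sub>R \<kappa> x" for x
  have "\<kappa> \<in> test_functions W0" by (rule compact_sectionsI[OF \<kappa>(1) UNIV_I \<kappa>(5-7)])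
  then have "\<phi> \<in> test_functions W0" unfolding \<phi>_def[abs_def] by (rule test_functions_scaleR[OF W0(1,3)])
  then have sm: "smooth_on UNIV \<phi>" using compact_sectionsE by metis
  have eq: "\<phi> x = \<phi>0 x" if "x \<in> V \<inter> W0" for x using \<kappa>(4) that by (simp add: \<phi>_def)
  have "boundary_patch \<Omega> (V \<inter> W0) \<phi>"
  proof
    show o: "open (V \<inter> W0)" using \<kappa>(2) W0(1) by blast
    fix x assume x: "x \<in> V \<inter> W0"
    show "x \<in> \<Omega> \<longleftrightarrow> \<phi> x < 0" using eq[OF x] x W0(5) by auto
    obtain v where v: "frechet_derivative \<phi>0 (at x) v \<noteq> 0" using W0(4) x by blast
    have "dderiv v \<phi> x = dderiv v \<phi>0 x" by (rule dderiv_transform_open[OF o x eq])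
    then have "dderiv v \<phi> x \<noteq> 0" using v by (simp add: dderiv_def)
    then show "\<exists>v. dderiv v \<phi> x \<noteq> 0" by (rule exI)
  qed (use sm assms in auto)
  moreover have p: "p \<in> V \<inter> W0" using \<kappa>(3) W0(2) by simp
  moreover have "\<phi> p = 0"
  proof -
    have "p \<in> frontier \<Omega> \<inter> W0" using assms(3) W0(2) by simp
    then have "\<phi>0 p = 0" unfolding W0(6) by simp
    then show ?thesis by (simp add: eq[OF p])
  qed
  ultimately show ?thesis by (rule that)
qed

text \<open>Smoothness of a potential at \<open>p\<close> is decided by the density near
  \<open>p\<close>; the part that vanishes near \<open>p\<close> contributes a smooth
  function.\<close>

lemma split_density_at_point:
  fixes h :: "'a::euclidean_space \<Rightarrow> 'b::euclidean_space"
  assumes "open \<Omega>" "open W" "p \<in> W" "smooth_on UNIV h" "compact_density (\<lambda>x. indicator \<Omega> x *\<^sub>R h x)"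
  obtains h1 f2 U where "h1 \<in> test_functions W" "compact_density f2" "open U" "p \<in> U" "\<And>y. y \<in> U \<Longrightarrow> f2 y = 0"
    "(\<lambda>x. indicator \<Omega> x *\<^sub>R h x) = (\<lambda>x. indicator \<Omega> x *\<^sub>R h1 x + f2 x)"
proof -
  obtain \<kappa> :: "'a \<Rightarrow> real" and V L where \<kappa>: "smooth_on UNIV \<kappa>" "open V" "{p} \<subseteq> V" "\<And>x. x \<in> V \<Longrightarrow> \<kappa> x = 1"
    "compact L" "L \<subseteq> W" "\<And>x. x \<notin> L \<Longrightarrow> \<kappa> x = 0"
    using exists_smooth_cutoff[of "{p}" W] assms(2,3) by auto
  define h1 where "h1 x = \<kappa> x *\<^sub>R h x" for x
  define f2 where "f2 x = indicator \<Omega> x *\<^sub>R h x + (-1) *\<^sub>R (indicator \<Omega> x *\<^sub>R h1 x)" for x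
  show ?thesis
  proof (rule that[of h1 f2 V])
    show h1: "h1 \<in> test_functions W" unfolding h1_def[abs_def]
      by (rule compact_sectionsI[OF smooth_on_scaleR[OF open_UNIV \<kappa>(1) assms(4)] UNIV_I \<kappa>(5,6)]) (simp add: \<kappa>(7))
    have "compact_density (\<lambda>x. indicator \<Omega> x *\<^sub>R h1 x)"
      by (rule compact_density_indicator[OF test_functions_density[OF h1] borel_open[OF assms(1)]])
    then have "compact_density (\<lambda>x. (-1) *\<^sub>R (indicator \<Omega> x *\<^sub>R h1 x))"
      by (rule compact_density_bounded_linear[OF _ bounded_linear_scaleR_right])
    then show "compact_density f2" unfolding f2_def[abs_def] by (rule compact_density_add[OF assms(5)])
    show "f2 y = 0" if "y \<in> V" for y using \<kappa>(4)[OF that] by (simp add: f2_def h1_def)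
  qed (use \<kappa> in \<open>auto simp: f2_def\<close>)
qed

lemma conv_boundary_regular:
  fixes h :: "'a::euclidean_space \<Rightarrow> 'b::euclidean_space"
  assumes "smooth_boundary \<Omega>" "open \<Omega>" "p \<in> frontier \<Omega>" "smooth_on UNIV h"
    and "compact_density (\<lambda>x. indicator \<Omega> x *\<^sub>R h x)"
  obtains B H where "open B" "p \<in> B" "Cm_on m B H"
    "\<And>x. x \<in> \<Omega> \<inter> B \<Longrightarrow> conv (kern 0 e) (\<lambda>x. indicator \<Omega> x *\<^sub>R h x) x = H x"
proof -
  obtain W \<phi> where W: "boundary_patch \<Omega> W \<phi>" "p \<in> W" using exists_boundary_patch[OF assms(1-3)] by metis
  then interpret boundary_patch \<Omega> W \<phi> by simp
  obtain h1 f2 U where s: "h1 \<in> test_functions W" "compact_density f2" "open U" "p \<in> U" "\<And>y. y \<in> U \<Longrightarrow> f2 y = 0"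
    "(\<lambda>x. indicator \<Omega> x *\<^sub>R h x) = (\<lambda>x. indicator \<Omega> x *\<^sub>R h1 x + f2 x)"
    using split_density_at_point[OF assms(2) open_W W(2) assms(4,5)] by metis
  obtain B where B: "open B" "p \<in> B" "smooth_on B (conv (kern 0 e) f2)"
    using conv_kern_smooth_off_support[OF s(2-5)] by blast
  obtain H1 where H1: "Cm_on m UNIV H1" "\<And>x. x \<in> \<Omega> \<Longrightarrow> conv (kern 0 e) (\<lambda>x. indicator \<Omega> x *\<^sub>R h1 x) x = H1 x"
    using conv_boundary_regular_test[OF s(1)] by metis
  show ?thesis
  proof (rule that[OF B(1,2), of "\<lambda>x. H1 x + conv (kern 0 e) f2 x"])
    show "Cm_on m B (\<lambda>x. H1 x + conv (kern 0 e) f2 x)"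
      by (intro Cm_on_add B(1) Cm_on_subset[OF H1(1)] smooth_onD[OF B(3)]) auto
    show "conv (kern 0 e) (\<lambda>x. indicator \<Omega> x *\<^sub>R h x) x = H1 x + conv (kern 0 e) f2 x" if "x \<in> \<Omega> \<inter> B" for x
      unfolding s(6) using that H1(2)
      by (subst conv_add[OF locally_integrable_kern[OF order_refl] density_truncation[OF s(1)] s(2)]) simp
  qed
qed

text \<open>Two facts that fail on the boundary: the potential is smooth at \<open>p\<close>, and
  the derivatives of the regularised potentials converge to its derivatives. On the smooth part
  \<open>f1\<close> the derivative is moved to the density, on \<open>f2\<close> to the
  kernel.\<close>

lemma conv_interior_regular:
  fixes f1 f2 :: "'a::euclidean_space \<Rightarrow> 'b::euclidean_space"
  assumes f1: "f1 \<in> test_functions UNIV" and f2: "compact_density f2"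
    and U: "open U" "p \<in> U" "\<And>y. y \<in> U \<Longrightarrow> f2 y = 0" and T: "T \<longlonglongrightarrow> 0" "\<And>n. T n > 0"
  shows "\<exists>B. open B \<and> p \<in> B \<and> smooth_on B (conv (kern 0 e) (\<lambda>x. f1 x + f2 x))"
    and "(\<lambda>n. dderiv v (conv (kern (T n) e) (\<lambda>x. f1 x + f2 x)) p) \<longlonglongrightarrow> dderiv v (conv (kern 0 e) (\<lambda>x. f1 x + f2 x)) p"
proof -
  obtain K where K: "smooth_on UNIV f1" "compact K" "\<And>x. x \<notin> K \<Longrightarrow> f1 x = 0" using compact_sectionsE[OF f1] by metis
  have f1d: "compact_density f1" by (rule test_functions_density[OF f1])
  have l: "locally_integrable (kern t e)" if "t \<ge> 0" for t using locally_integrable_kern[OF that] .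
  have split: "conv (kern t e) (\<lambda>x. f1 x + f2 x) = (\<lambda>x. conv (kern t e) f1 x + conv (kern t e) f2 x)" if "t \<ge> 0" for t
    by (rule ext) (rule conv_add[OF l[OF that] f1d f2])
  obtain B where B: "open B" "p \<in> B" "smooth_on B (conv (kern 0 e) f2)"
    using conv_kern_smooth_off_support[OF f2 U] by metis
  have sm1: "smooth_on UNIV (conv (kern 0 e) f1)"
    unfolding smooth_on_def by (intro allI Cm_on_conv_density[OF l[OF order_refl] smooth_onD[OF K(1)] K(2,3)])
  show "\<exists>B. open B \<and> p \<in> B \<and> smooth_on B (conv (kern 0 e) (\<lambda>x. f1 x + f2 x))"
    unfolding split[OF order_refl]
    by (intro exI[of _ B] conjI B smooth_on_add smooth_on_subset[OF sm1]) auto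
  have der: "dderiv v (conv (kern t e) (\<lambda>x. f1 x + f2 x)) p = conv (kern t e) (dderiv v f1) p + conv (dderiv v (kern t e)) f2 p"
    if t: "t \<ge> 0" for t
    unfolding split[OF t]
    by (rule dderiv_eqI[OF has_derivative_add[OF conv_has_derivative_density[OF l[OF t] smooth_onD[OF K(1)] K(2,3)]
            conv_kern_off_support[OF f2 t U]]])
  obtain r where r: "r > 0" "ball p r \<subseteq> U" using openE[OF U(1,2)] .
  obtain R where R: "\<And>y. y \<notin> cball 0 R \<Longrightarrow> f2 y = 0" using compact_densityE[OF f2] by metis
  have [measurable]: "f2 \<in> borel_measurable borel" using f2 by (simp add: compact_density_def)
  define M where "M = (1 + real DIM('a)) * norm v * norm e * r powr (- real DIM('a))"
  have far: "norm (p - y) \<ge> r" if "f2 y \<noteq> 0" for y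
    using that U(3)[of y] r(2) by (force simp: dist_norm)
  define d where "d t z = (v \<bullet> e) * (z \<bullet> z + t) powr (- real DIM('a) / 2)
     - real DIM('a) * (z \<bullet> e) * (z \<bullet> v) * (z \<bullet> z + t) powr (- real DIM('a) / 2 - 1)" for t and z :: 'a
  have [measurable]: "d t \<in> borel_measurable borel" for t unfolding d_def[abs_def] by measurable
  have d: "dderiv v (kern t e) (p - y) *\<^sub>R f2 y = d t (p - y) *\<^sub>R f2 y" if "t \<ge> 0" for t y
  proof (cases "f2 y = 0")
    case False
    then have "p - y \<noteq> 0" using far[OF False] r(1) by auto
    then show ?thesis using that by (simp add: dderiv_kern d_def add_pos_nonneg)
  qed simp
  have "(\<lambda>n. conv (dderiv v (kern (T n) e)) f2 p) \<longlonglongrightarrow> conv (dderiv v (kern 0 e)) f2 p"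
    unfolding conv_def
  proof (rule integral_dominated_convergence[where w = "\<lambda>y. M * norm (f2 y)"])
    show "integrable lborel (\<lambda>y. M * norm (f2 y))" using compact_density_integrable[OF f2] by simp
    show "AE y in lborel. (\<lambda>n. dderiv v (kern (T n) e) (p - y) *\<^sub>R f2 y) \<longlonglongrightarrow> dderiv v (kern 0 e) (p - y) *\<^sub>R f2 y"
    proof (intro AE_I2)
      fix y
      show "(\<lambda>n. dderiv v (kern (T n) e) (p - y) *\<^sub>R f2 y) \<longlonglongrightarrow> dderiv v (kern 0 e) (p - y) *\<^sub>R f2 y"
      proof (cases "f2 y = 0")
        case False
        then have "p - y \<noteq> 0" using far[OF False] r(1) by auto
        then show ?thesis by (intro tendsto_scaleR tendsto_const dderiv_kern_tendsto T)
      qed simp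
    qed
    show "AE y in lborel. norm (dderiv v (kern (T n) e) (p - y) *\<^sub>R f2 y) \<le> M * norm (f2 y)" for n
    proof (intro AE_I2)
      fix y
      show "norm (dderiv v (kern (T n) e) (p - y) *\<^sub>R f2 y) \<le> M * norm (f2 y)"
      proof (cases "f2 y = 0")
        case False
        then have py: "p - y \<noteq> 0" "norm (p - y) \<ge> r" using far[OF False] r(1) by auto
        have "norm (p - y) powr (- real DIM('a)) \<le> r powr (- real DIM('a))" using py r(1) by (intro powr_mono2') auto
        then have "\<bar>dderiv v (kern (T n) e) (p - y)\<bar> \<le> M" unfolding M_def
          by (intro order_trans[OF dderiv_kern_bound[OF less_imp_le[OF T(2)] py(1)]] mult_left_mono) auto
        then show ?thesis by (simp add: mult_right_mono)
      qed simp
    qed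
    have m: "(\<lambda>y. d t (p - y) *\<^sub>R f2 y) \<in> borel_measurable lborel" for t by measurable
    show "(\<lambda>y. dderiv v (kern 0 e) (p - y) *\<^sub>R f2 y) \<in> borel_measurable lborel" unfolding d[OF order_refl] by (rule m)
    show "(\<lambda>y. dderiv v (kern (T n) e) (p - y) *\<^sub>R f2 y) \<in> borel_measurable lborel" for n
      unfolding d[OF less_imp_le[OF T(2)]] by (rule m)
  qed
  moreover have "(\<lambda>n. conv (kern (T n) e) (dderiv v f1) p) \<longlonglongrightarrow> conv (kern 0 e) (dderiv v f1) p"
    by (rule conv_kern_tendsto[OF T test_functions_density[OF test_functions_dderiv[OF f1]]])
  ultimately show "(\<lambda>n. dderiv v (conv (kern (T n) e) (\<lambda>x. f1 x + f2 x)) p) \<longlonglongrightarrow> dderiv v (conv (kern 0 e) (\<lambda>x. f1 x + f2 x)) p"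
    using der T(2) by (simp add: less_imp_le tendsto_add)
qed

section \<open>Decaying functions that are harmonic on slices\<close>

lemma second_derivative_nonpos_at_max:
  fixes p :: "real \<Rightarrow> real"
  assumes r: "r > 0" and p: "\<And>t. \<bar>t\<bar> < r \<Longrightarrow> (p has_real_derivative p' t) (at t)"
    and p': "(p' has_real_derivative d) (at 0)" and mx: "\<And>t. \<bar>t\<bar> < r \<Longrightarrow> p t \<le> p 0"
  shows "d \<le> 0"
proof (rule ccontr)
  assume "\<not> d \<le> 0"
  then have d: "d > 0" by simp
  have p0: "p' 0 = 0"
    by (rule DERIV_local_max[OF p r]) (use r mx in \<open>auto simp: abs_minus_commute\<close>)
  obtain \<delta> where \<delta>: "\<delta> > 0" "\<And>h. h > 0 \<Longrightarrow> h < \<delta> \<Longrightarrow> p' 0 < p' (0 + h)"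
    using DERIV_pos_inc_right[OF p' d] by blast
  define h where "h = min \<delta> r / 2"
  have h: "0 < h" "h < \<delta>" "h < r" using \<delta>(1) r by (auto simp: h_def)
  obtain z where z: "0 < z" "z < h" "p h - p 0 = (h - 0) * p' z"
    using MVT2[OF h(1), of p p'] p h by (metis abs_of_nonneg less_le_trans not_less order_le_less_trans)
  have "p' z > 0" using \<delta>(2)[of z] z h p0 by simp
  then have "p h > p 0" using z h by (metis diff_gt_0_iff_gt diff_zero mult_pos_pos)
  then show False using mx[of h] h by simp
qed

text \<open>Maximum principle on the affine slice through \<open>a\<close> in the directions
  \<open>S\<close>. A positive value at \<open>a\<close> together with decay forces a maximum of
  \<open>\<phi> + \<delta> |x|\<^sup>2\<close> in the interior of a large ball of the slice, where
  the Laplacian of that function in the slice is positive.\<close>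

lemma decaying_slice_harmonic_nonpos:
  fixes \<phi> :: "'a::euclidean_space \<Rightarrow> real"
  assumes S: "S \<subseteq> Basis" "S \<noteq> {}" and V: "open V" and \<phi>: "smooth_on V \<phi>"
    and sub: "\<And>x. (\<And>i. i \<in> Basis - S \<Longrightarrow> x \<bullet> i = a \<bullet> i) \<Longrightarrow> x \<in> V"
    and harm: "\<And>x. x \<in> V \<Longrightarrow> (\<Sum>i\<in>S. dderiv i (dderiv i \<phi>) x) = 0"
    and decay: "(\<phi> \<longlongrightarrow> 0) at_infinity"
  shows "\<phi> a \<le> 0"
proof (rule ccontr)
  assume "\<not> \<phi> a \<le> 0"
  define A where "A = \<phi> a"
  have A: "A > 0" using \<open>\<not> \<phi> a \<le> 0\<close> by (simp add: A_def)
  have "\<forall>\<^sub>F x in at_infinity. \<phi> x < A / 2" using order_tendstoD(2)[OF decay, of "A / 2"] A by simp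
  then obtain R0 where R0: "\<And>x. norm x \<ge> R0 \<Longrightarrow> \<phi> x < A / 2" unfolding eventually_at_infinity by blast
  define R where "R = max R0 (norm a + 1)"
  have R: "R > 0" "norm a < R" "\<And>x. norm x \<ge> R \<Longrightarrow> \<phi> x < A / 2"
    using R0 norm_ge_zero[of a] by (auto simp: R_def intro: add_nonneg_pos simp del: norm_ge_zero)
  \<comment> \<open>small enough for \<open>\<delta> |x|\<^sup>2\<close> to stay below \<open>A /
    4\<close> on the ball, so that the maximum is not on its boundary\<close>
  define \<delta> where "\<delta> = A / (4 * R\<^sup>2)"
  have \<delta>: "\<delta> > 0" "\<delta> * R\<^sup>2 = A / 4" using A R(1) by (auto simp: \<delta>_def)
  define L where "L = {x. \<forall>i\<in>Basis - S. x \<bullet> i = a \<bullet> i}"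
  have LV: "L \<subseteq> V" using sub by (auto simp: L_def)
  have "closed L"
  proof -
    have "L = (\<Inter>i\<in>Basis - S. {x. x \<bullet> i = a \<bullet> i})" by (auto simp: L_def)
    then show ?thesis by (auto intro!: closed_INT closed_Collect_eq continuous_intros)
  qed
  then have cpt: "compact (cball 0 R \<inter> L)" by (intro compact_Int_closed compact_cball)
  define \<psi> where "\<psi> x = \<phi> x + \<delta> * (x \<bullet> x)" for x
  have aC: "a \<in> cball 0 R \<inter> L" using R(2) by (auto simp: L_def)
  have "continuous_on (cball 0 R \<inter> L) \<psi>" unfolding \<psi>_def
    by (intro continuous_intros continuous_on_subset[OF smooth_on_continuous[OF \<phi>]]) (use LV in auto)
  then obtain z where z: "z \<in> cball 0 R \<inter> L" "\<And>x. x \<in> cball 0 R \<inter> L \<Longrightarrow> \<psi> x \<le> \<psi> z"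
    using continuous_attains_sup[OF cpt] aC by blast
  have "A \<le> \<psi> a" unfolding \<psi>_def A_def using \<delta>(1) by simp
  then have Az: "A \<le> \<psi> z" using z(2)[OF aC] by simp
  have zR: "norm z < R"
  proof (rule ccontr)
    assume "\<not> norm z < R"
    then have nz: "norm z = R" using z(1) by simp
    then have "\<psi> z < A / 2 + A / 4" unfolding \<psi>_def using R(3)[of z] \<delta>(2) by (simp add: dot_square_norm)
    then show False using Az A by simp
  qed
  have zV: "z \<in> V" using z(1) LV by blast
  have second: "dderiv i (dderiv i \<phi>) z + 2 * \<delta> \<le> 0" if i: "i \<in> S" for i
  proof -
    have iB: "i \<in> Basis" using i S(1) by blast
    have line: "z + t *\<^sub>R i \<in> L" for t
      using z(1) i iB by (auto simp: L_def inner_add_left inner_Basis)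
    have dl: "((\<lambda>t. z + t *\<^sub>R i) has_derivative (\<lambda>h. h *\<^sub>R i)) (at t)" for t
      by (auto intro!: derivative_eq_intros)
    have along: "((\<lambda>t. g (z + t *\<^sub>R i)) has_real_derivative dderiv i g (z + t *\<^sub>R i)) (at t)" if g: "smooth_on V g" for g t
    proof -
      have gd: "(g has_derivative (\<lambda>v. dderiv v g (z + t *\<^sub>R i))) (at (z + t *\<^sub>R i))"
        using smooth_on_has_derivative[OF g] line LV by blast
      show ?thesis
        by (rule has_derivative_imp_has_field_derivative[OF has_derivative_compose[OF dl gd]])
          (simp add: linear_scale[OF has_derivative_linear[OF gd]])
    qed
    have sq: "(z + t *\<^sub>R i) \<bullet> (z + t *\<^sub>R i) = z \<bullet> z + 2 * t * (z \<bullet> i) + t\<^sup>2" for t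
      using iB by (simp add: inner_add_left inner_add_right inner_commute power2_eq_square algebra_simps)
    define p where "p t = \<phi> (z + t *\<^sub>R i) + \<delta> * (z \<bullet> z + 2 * t * (z \<bullet> i) + t\<^sup>2)" for t
    define p' where "p' t = dderiv i \<phi> (z + t *\<^sub>R i) + \<delta> * (2 * (z \<bullet> i) + 2 * t)" for t
    have p: "p t = \<psi> (z + t *\<^sub>R i)" for t by (simp add: p_def \<psi>_def sq)
    show ?thesis
    proof (rule second_derivative_nonpos_at_max[where r = "R - norm z" and p = p and p' = p'])
      show "(p has_real_derivative p' t) (at t)" for t
        unfolding p_def[abs_def] p'_def
        by (intro DERIV_add along \<phi>) (auto intro!: derivative_eq_intros)
      have "((\<lambda>t. dderiv i \<phi> (z + t *\<^sub>R i) + \<delta> * (2 * (z \<bullet> i) + 2 * t)) has_real_derivative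
          dderiv i (dderiv i \<phi>) (z + 0 *\<^sub>R i) + \<delta> * 2) (at 0)"
        by (intro DERIV_add along smooth_on_dderiv \<phi>) (auto intro!: derivative_eq_intros)
      then show "(p' has_real_derivative dderiv i (dderiv i \<phi>) z + 2 * \<delta>) (at 0)"
        unfolding p'_def[abs_def] by (simp add: mult.commute)
      show "p t \<le> p 0" if "\<bar>t\<bar> < R - norm z" for t
      proof -
        have "norm (z + t *\<^sub>R i) \<le> R" using norm_triangle_ineq[of z "t *\<^sub>R i"] that iB by simp
        then show ?thesis using z(2)[of "z + t *\<^sub>R i"] line by (simp add: p)
      qed
    qed (use zR in simp)
  qed
  have fS: "finite S" using S(1) finite_Basis finite_subset by blast
  have "(\<Sum>i\<in>S. dderiv i (dderiv i \<phi>) z + 2 * \<delta>) \<le> 0" by (rule sum_nonpos) (rule second)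
  moreover have "(\<Sum>i\<in>S. dderiv i (dderiv i \<phi>) z + 2 * \<delta>) = real (card S) * (2 * \<delta>)"
    using harm[OF zV] by (simp add: sum.distrib)
  moreover have "real (card S) * (2 * \<delta>) > 0" using S(2) fS \<delta>(1) by (simp add: card_gt_0_iff)
  ultimately show False by simp
qed

lemma decaying_slice_harmonic_zero:
  fixes u :: "'a::euclidean_space \<Rightarrow> 'b::euclidean_space"
  assumes S: "S \<subseteq> Basis" "S \<noteq> {}" and V: "open V" and u: "smooth_on V u"
    and sub: "\<And>x. (\<And>i. i \<in> Basis - S \<Longrightarrow> x \<bullet> i = a \<bullet> i) \<Longrightarrow> x \<in> V"
    and harm: "\<And>x. x \<in> V \<Longrightarrow> (\<Sum>i\<in>S. dderiv i (dderiv i u) x) = 0"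
    and decay: "(u \<longlongrightarrow> 0) at_infinity"
  shows "u a = 0"
proof -
  have le: "u a \<bullet> b \<le> 0" for b
  proof -
    have bl: "bounded_linear (\<lambda>z. z \<bullet> b)" by (rule bounded_linear_inner_left)
    have d2: "dderiv i (dderiv i (\<lambda>x. u x \<bullet> b)) x = dderiv i (dderiv i u) x \<bullet> b" if "x \<in> V" for i x
    proof -
      have "dderiv i (dderiv i (\<lambda>x. u x \<bullet> b)) x = dderiv i (\<lambda>x. dderiv i u x \<bullet> b) x"
        by (rule dderiv_transform_open[OF V that]) (rule dderiv_bounded_linear[OF bl smooth_on_differentiable[OF u]])
      also have "\<dots> = dderiv i (dderiv i u) x \<bullet> b"
        by (rule dderiv_bounded_linear[OF bl smooth_on_differentiable[OF smooth_on_dderiv[OF u] that]])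
      finally show ?thesis .
    qed
    show ?thesis
    proof (rule decaying_slice_harmonic_nonpos[OF S V _ sub])
      show "smooth_on V (\<lambda>x. u x \<bullet> b)" by (rule smooth_on_bounded_linear_compose[OF bl V u])
      show "(\<Sum>i\<in>S. dderiv i (dderiv i (\<lambda>x. u x \<bullet> b)) x) = 0" if "x \<in> V" for x
        using harm[OF that] by (simp add: d2[OF that] inner_sum_left[symmetric])
      show "((\<lambda>x. u x \<bullet> b) \<longlongrightarrow> 0) at_infinity"
        using tendsto_inner[OF decay tendsto_const[of b]] by simp
    qed auto
  qed
  have "u a \<bullet> u a = 0" using le[of "u a"] inner_ge_zero[of "u a"] by (rule order_antisym)
  then show ?thesis by (simp only: inner_eq_zero_iff)
qed

section \<open>Unique continuation for potentials\<close>

lemma powr_complex_has_field_derivative: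
  fixes z a :: complex
  assumes "Re z > 0"
  shows "((\<lambda>z. z powr a) has_field_derivative a * z powr (a - 1)) (at z)"
  using assms by (intro has_field_derivative_powr) (auto simp: complex_nonpos_Reals_iff)

text \<open>The potential along the line \<open>q + s v\<close> for complex \<open>s\<close>: the
  factor raised to the power \<open>\<beta>\<close> is the complex quadratic polynomial in
  \<open>s\<close> that equals \<open>|q + s v - y|\<^sup>2\<close> for real \<open>s\<close>. As
  long as its real part is positive the principal branch of the power is holomorphic.\<close>

lemma holomorphic_segment_integral:
  fixes f :: "'a::euclidean_space \<Rightarrow> real" and q v e :: 'a
  assumes f: "compact_density f" and C: "compact C" "\<And>y. y \<notin> C \<Longrightarrow> f y = 0" and T: "open T"
    and pos: "\<And>s y. s \<in> T \<Longrightarrow> y \<in> C \<Longrightarrow>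
      Re (of_real ((q - y) \<bullet> (q - y)) + 2 * s * of_real (v \<bullet> (q - y)) + s\<^sup>2 * of_real (v \<bullet> v)) > 0"
  shows "(\<lambda>s. \<integral>y. ((of_real ((q - y) \<bullet> e) + s * of_real (v \<bullet> e)) *
      (of_real ((q - y) \<bullet> (q - y)) + 2 * s * of_real (v \<bullet> (q - y)) + s\<^sup>2 * of_real (v \<bullet> v)) powr of_real \<beta>)
      * of_real (f y) \<partial>lborel) holomorphic_on T"
proof -
  define Q where "Q s y = of_real ((q - y) \<bullet> (q - y)) + 2 * s * of_real (v \<bullet> (q - y)) + s\<^sup>2 * of_real (v \<bullet> v)" for s :: complex and y
  define l where "l s y = of_real ((q - y) \<bullet> e) + s * of_real (v \<bullet> e)" for s :: complex and y
  define \<kappa> where "\<kappa> s y = l s y * Q s y powr of_real \<beta>" for s y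
  define \<kappa>' where "\<kappa>' s y = of_real (v \<bullet> e) * Q s y powr of_real \<beta>
      + l s y * (of_real \<beta> * Q s y powr (of_real \<beta> - 1) * (2 * of_real (v \<bullet> (q - y)) + 2 * s * of_real (v \<bullet> v)))" for s y
  have Qpos: "Re (Q s y) > 0" if "s \<in> T" "y \<in> C" for s y using pos[OF that] by (simp add: Q_def)
  have Qnp: "Q s y \<notin> \<real>\<^sub>\<le>\<^sub>0" if "s \<in> T" "y \<in> C" for s y
    using Qpos[OF that] by (auto simp: complex_nonpos_Reals_iff)
  have dk: "((\<lambda>s. \<kappa> s y) has_field_derivative \<kappa>' s y) (at s)" if "s \<in> T" "y \<in> C" for s y
  proof -
    have dQ: "((\<lambda>s. Q s y) has_field_derivative (2 * of_real (v \<bullet> (q - y)) + 2 * s * of_real (v \<bullet> v))) (at s)"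
      unfolding Q_def by (auto intro!: derivative_eq_intros)
    have dP: "((\<lambda>s. Q s y powr of_real \<beta>) has_field_derivative
        of_real \<beta> * Q s y powr (of_real \<beta> - 1) * (2 * of_real (v \<bullet> (q - y)) + 2 * s * of_real (v \<bullet> v))) (at s)"
      using DERIV_chain2[OF powr_complex_has_field_derivative[OF Qpos[OF that]] dQ] .
    have dl: "((\<lambda>s. l s y) has_field_derivative of_real (v \<bullet> e)) (at s)"
      unfolding l_def by (auto intro!: derivative_eq_intros)
    show ?thesis unfolding \<kappa>_def \<kappa>'_def
      using DERIV_mult[OF dl dP] by (simp add: add.commute mult.commute)
  qed
  have cQ: "continuous_on A (\<lambda>z. Q (fst z) (snd z))" "continuous_on A (\<lambda>z. l (fst z) (snd z))" for A
    unfolding Q_def l_def by (intro continuous_intros)+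
  have ck: "continuous_on (T \<times> C) (\<lambda>z. \<kappa> (fst z) (snd z))" "continuous_on (T \<times> C) (\<lambda>z. \<kappa>' (fst z) (snd z))"
  proof -
    have P: "continuous_on (T \<times> C) (\<lambda>z. Q (fst z) (snd z) powr w)" for w
    proof (rule continuous_on_powr_complex[OF _ _ cQ(1) continuous_on_const])
      show "T \<times> C \<subseteq> {z. 0 \<le> Re (Q (fst z) (snd z)) \<or> Im (Q (fst z) (snd z)) \<noteq> 0}"
        using Qpos by (auto intro: less_imp_le)
      show "0 < Re w" if "z \<in> T \<times> C" "Q (fst z) (snd z) = 0" for z
        using Qpos[of "fst z" "snd z"] that by auto
    qed
    show "continuous_on (T \<times> C) (\<lambda>z. \<kappa> (fst z) (snd z))" "continuous_on (T \<times> C) (\<lambda>z. \<kappa>' (fst z) (snd z))"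
      unfolding \<kappa>_def \<kappa>'_def
      by (intro continuous_on_mult continuous_on_add P cQ continuous_on_const continuous_on_of_real continuous_on_inner
          continuous_on_diff continuous_on_fst continuous_on_snd continuous_on_id)+
  qed
  have cky: "continuous_on C (\<kappa> s)" "continuous_on C (\<kappa>' s)" if "s \<in> T" for s
  proof -
    have p: "continuous_on C (\<lambda>y. (s, y))" "(\<lambda>y. (s, y)) ` C \<subseteq> T \<times> C" using that by (auto intro!: continuous_intros)
    show "continuous_on C (\<kappa> s)" "continuous_on C (\<kappa>' s)"
      using continuous_on_compose2[OF ck(1) p] continuous_on_compose2[OF ck(2) p] by auto
  qed
  have Cb: "C \<in> sets borel" by (intro borel_closed compact_imp_closed C(1))
  have fm [measurable]: "f \<in> borel_measurable borel" using f by (simp add: compact_density_def)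
  have fi: "integrable lborel (\<lambda>y. \<bar>f y\<bar>)" using compact_density_integrable[OF f] by simp
  have meas: "(\<lambda>y. g y * of_real (f y)) \<in> borel_measurable lborel" if g: "continuous_on C g" for g :: "'a \<Rightarrow> complex"
  proof -
    have [measurable]: "(\<lambda>y. indicator C y *\<^sub>R g y) \<in> borel_measurable borel"
      by (rule borel_measurable_continuous_on_indicator[OF Cb g])
    have "g y * of_real (f y) = (indicator C y *\<^sub>R g y) * of_real (f y)" for y
      using C(2)[of y] by (cases "y \<in> C") auto
    then show ?thesis by (simp only:) measurable
  qed
  have "((\<lambda>s. \<integral>y. \<kappa> s y * of_real (f y) \<partial>lborel) has_field_derivative (\<integral>y. \<kappa>' s0 y * of_real (f y) \<partial>lborel)) (at s0)"
    if s0: "s0 \<in> T" for s0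
  proof -
    obtain r where r: "r > 0" "cball s0 r \<subseteq> T" using T s0 open_contains_cball by blast
    have "compact (cball s0 r \<times> C)" by (intro compact_Times compact_cball C(1))
    moreover have sub: "cball s0 r \<times> C \<subseteq> T \<times> C" using r(2) by auto
    ultimately have "bounded ((\<lambda>z. \<kappa> (fst z) (snd z)) ` (cball s0 r \<times> C))" "bounded ((\<lambda>z. \<kappa>' (fst z) (snd z)) ` (cball s0 r \<times> C))"
      by (intro compact_imp_bounded compact_continuous_image continuous_on_subset[OF ck(1)] continuous_on_subset[OF ck(2)]; simp)+
    then obtain M M' where M: "\<And>s y. s \<in> cball s0 r \<Longrightarrow> y \<in> C \<Longrightarrow> norm (\<kappa> s y) \<le> M"
      "\<And>s y. s \<in> cball s0 r \<Longrightarrow> y \<in> C \<Longrightarrow> norm (\<kappa>' s y) \<le> M'"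
      unfolding bounded_iff by (force simp del: mem_cball)
    have bd: "norm (g * of_real (f y)) \<le> M'' * \<bar>f y\<bar>" if "y \<in> C \<Longrightarrow> norm g \<le> M''" for g :: complex and M'' y
      using that C(2)[of y] by (cases "y \<in> C") (auto simp: norm_mult mult_right_mono)
    have sT: "s \<in> T" "s \<in> cball s0 r" if "s \<in> ball s0 r" for s using that r(2) ball_subset_cball by blast+
    have "((\<lambda>s. \<integral>y. \<kappa> s y * of_real (f y) \<partial>lborel) has_derivative (\<lambda>h. \<integral>y. \<kappa>' s0 y * of_real (f y) * h \<partial>lborel)) (at s0)"
    proof (rule has_derivative_integral[where r = r and w = "\<lambda>y. M' * \<bar>f y\<bar>" and f' = "\<lambda>s y h. \<kappa>' s y * of_real (f y) * h", OF r(1)])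
      fix s assume s: "s \<in> ball s0 r"
      show "integrable lborel (\<lambda>y. \<kappa> s y * of_real (f y))"
      proof (rule Bochner_Integration.integrable_bound[of _ "\<lambda>y. M * \<bar>f y\<bar>"])
        show "AE y in lborel. norm (\<kappa> s y * of_real (f y)) \<le> norm (M * \<bar>f y\<bar>)"
          using order_trans[OF bd[OF M(1)[OF sT(2)[OF s]]] abs_ge_self] by (intro AE_I2) simp
      qed (use fi meas[OF cky(1)[OF sT(1)[OF s]]] in auto)
      fix y
      show "((\<lambda>s. \<kappa> s y * of_real (f y)) has_derivative (\<lambda>h. \<kappa>' s y * of_real (f y) * h)) (at s)"
      proof (cases "y \<in> C")
        case True
        have "((\<lambda>s. \<kappa> s y * of_real (f y)) has_field_derivative \<kappa>' s y * of_real (f y)) (at s)"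
          by (rule DERIV_cmult_right[OF dk[OF sT(1)[OF s] True]])
        then show ?thesis unfolding has_field_derivative_def .
      qed (simp add: C(2))
      fix h
      show "norm (\<kappa>' s y * of_real (f y) * h) \<le> M' * \<bar>f y\<bar> * norm h"
        unfolding norm_mult[of _ h] by (intro mult_right_mono bd M(2)[OF sT(2)[OF s]]) auto
    next
      show "(\<lambda>y. \<kappa>' s0 y * of_real (f y) * h) \<in> borel_measurable lborel" for h
        using meas[OF cky(2)[OF s0]] by measurable
    qed (use fi in auto)
    moreover have "(\<integral>y. \<kappa>' s0 y * of_real (f y) * h \<partial>lborel) = (\<integral>y. \<kappa>' s0 y * of_real (f y) \<partial>lborel) * h" for h
      by simp
    ultimately show ?thesis unfolding has_field_derivative_def by simp
  qed
  then have "(\<lambda>s. \<integral>y. \<kappa> s y * of_real (f y) \<partial>lborel) holomorphic_on T"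
    unfolding holomorphic_on_open[OF T] by blast
  then show ?thesis unfolding \<kappa>_def l_def Q_def .
qed

text \<open>The identity theorem for the holomorphic extension of the potential to a neighbourhood
  of the segment.\<close>

lemma potential_zero_along_segment:
  fixes f :: "'a::euclidean_space \<Rightarrow> 'a \<Rightarrow> real" and q v :: 'a
  assumes f: "\<And>e. e \<in> Basis \<Longrightarrow> compact_density (f e)" and C: "compact C" "\<And>e y. e \<in> Basis \<Longrightarrow> y \<notin> C \<Longrightarrow> f e y = 0"
    and d: "d > 0" "\<And>s y. 0 \<le> s \<Longrightarrow> s \<le> 1 \<Longrightarrow> y \<in> C \<Longrightarrow> d \<le> norm (q + s *\<^sub>R v - y)"
    and \<eta>: "0 < \<eta>" "\<eta> \<le> 1" "\<And>s. 0 < s \<Longrightarrow> s < \<eta> \<Longrightarrow> (\<Sum>e\<in>Basis. conv (kern 0 e) (f e) (q + s *\<^sub>R v)) = 0"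
  shows "(\<Sum>e\<in>Basis. conv (kern 0 e) (f e) (q + v)) = 0"
proof -
  \<comment> \<open>in a strip of this width the real part of the parameter moves points by at most
    \<open>d / 4\<close>, and the imaginary part lowers the real part of the quadratic polynomial by
    at most \<open>(d / 4)\<^sup>2\<close>\<close>
  define \<sigma> where "\<sigma> = d / (4 * (norm v + 1))"
  have nv: "norm v + 1 > 0" by (simp add: add_nonneg_pos)
  have \<sigma>: "\<sigma> > 0" "\<sigma> * norm v \<le> d / 4"
  proof -
    show "\<sigma> > 0" using d(1) nv by (simp add: \<sigma>_def)
    then have "\<sigma> * norm v \<le> \<sigma> * (norm v + 1)" by simp
    also have "\<dots> = d / 4" using nonzero_mult_divide_mult_cancel_right[of "norm v + 1" d 4] nv by (simp add: \<sigma>_def)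
    finally show "\<sigma> * norm v \<le> d / 4" .
  qed
  define T where "T = {s. - \<sigma> < Re s} \<inter> {s. Re s < 1 + \<sigma>} \<inter> ({s. - \<sigma> < Im s} \<inter> {s. Im s < \<sigma>})"
  have oT: "open T" unfolding T_def
    by (intro open_Int open_halfspace_Re_gt open_halfspace_Re_lt open_halfspace_Im_gt open_halfspace_Im_lt)
  have cT: "connected T" unfolding T_def
    by (intro convex_connected convex_Int convex_halfspace_Re_gt convex_halfspace_Re_lt convex_halfspace_Im_gt convex_halfspace_Im_lt)
  define Q where "Q s y = of_real ((q - y) \<bullet> (q - y)) + 2 * s * of_real (v \<bullet> (q - y)) + s\<^sup>2 * of_real (v \<bullet> v)" for s :: complex and y
  have Re_Q: "Re (Q s y) = (norm (q + Re s *\<^sub>R v - y))\<^sup>2 - (Im s * norm v)\<^sup>2" for s y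
    unfolding Q_def power2_norm_eq_inner power_mult_distrib
    by (simp add: power2_eq_square algebra_simps inner_commute inner_add_left inner_add_right inner_diff_left inner_diff_right)
  have pos: "Re (Q s y) > 0" if s: "s \<in> T" and y: "y \<in> C" for s y
  proof -
    define a where "a = max 0 (min 1 (Re s))"
    have a: "0 \<le> a" "a \<le> 1" "\<bar>Re s - a\<bar> \<le> \<sigma>" using s by (auto simp: a_def T_def)
    have "norm (q + a *\<^sub>R v - y) \<le> norm (q + Re s *\<^sub>R v - y) + norm ((a - Re s) *\<^sub>R v)"
      using norm_triangle_ineq[of "q + Re s *\<^sub>R v - y" "(a - Re s) *\<^sub>R v"] by (simp add: algebra_simps)
    moreover have "norm ((a - Re s) *\<^sub>R v) \<le> \<sigma> * norm v" using a(3) by (simp add: mult_right_mono abs_minus_commute)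
    ultimately have 1: "norm (q + Re s *\<^sub>R v - y) \<ge> 3 * d / 4" using d(2)[OF a(1,2) y] \<sigma>(2) by linarith
    have "\<bar>Im s\<bar> \<le> \<sigma>" using s by (auto simp: T_def)
    then have "\<bar>Im s * norm v\<bar> \<le> \<sigma> * norm v" by (simp add: abs_mult mult_right_mono)
    then have 2: "\<bar>Im s * norm v\<bar> \<le> d / 4" using \<sigma>(2) by linarith
    have "(Im s * norm v)\<^sup>2 \<le> (d / 4)\<^sup>2" using power_mono[OF 2, of 2] by simp
    also have "\<dots> < (3 * d / 4)\<^sup>2" using d(1) by (intro power_strict_mono) auto
    also have "\<dots> \<le> (norm (q + Re s *\<^sub>R v - y))\<^sup>2" using 1 d(1) by (intro power_mono) auto
    finally show ?thesis by (simp add: Re_Q)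
  qed
  define \<beta> where "\<beta> = - real DIM('a) / 2"
  define H where "H s = (\<Sum>e\<in>Basis. \<integral>y. ((of_real ((q - y) \<bullet> e) + s * of_real (v \<bullet> e)) *
      Q s y powr of_real \<beta>) * of_real (f e y) \<partial>lborel)" for s
  have holo: "H holomorphic_on T" unfolding H_def Q_def
    by (intro holomorphic_on_sum holomorphic_segment_integral[OF f C(1) C(2) oT pos[unfolded Q_def]])
  have real: "H (of_real s) = of_real (\<Sum>e\<in>Basis. conv (kern 0 e) (f e) (q + s *\<^sub>R v))" for s
  proof -
    have "(of_real ((q - y) \<bullet> e) + of_real s * of_real (v \<bullet> e)) * Q (of_real s) y powr of_real \<beta>
        = complex_of_real (kern 0 e (q + s *\<^sub>R v - y))" for y e
    proof -
      have "Q (of_real s) y = of_real ((q + s *\<^sub>R v - y) \<bullet> (q + s *\<^sub>R v - y))"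
        unfolding Q_def by (simp add: power2_eq_square algebra_simps inner_commute inner_add_left inner_add_right inner_diff_left inner_diff_right)
      moreover have "complex_of_real ((q - y) \<bullet> e) + of_real s * of_real (v \<bullet> e) = of_real ((q + s *\<^sub>R v - y) \<bullet> e)"
        by (simp add: algebra_simps inner_add_left inner_diff_left)
      moreover have "complex_of_real ((q + s *\<^sub>R v - y) \<bullet> (q + s *\<^sub>R v - y)) powr of_real \<beta>
          = of_real (((q + s *\<^sub>R v - y) \<bullet> (q + s *\<^sub>R v - y)) powr \<beta>)"
        by (rule powr_of_real[OF inner_ge_zero])
      ultimately show ?thesis by (simp only: kern_def \<beta>_def add_0_right of_real_mult)
    qed
    then show ?thesis unfolding H_def conv_def by (simp flip: of_real_mult)
  qed
  have "H 1 = 0"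
  proof (rule analytic_continuation[OF holo oT cT])
    show "of_real ` {0<..<\<eta>} \<subseteq> T" using \<sigma>(1) \<eta>(2) by (auto simp: T_def)
    show "complex_of_real (\<eta> / 2) \<in> T" "1 \<in> T" using \<sigma>(1) \<eta>(1,2) by (auto simp: T_def)
    show "complex_of_real (\<eta> / 2) islimpt of_real ` {0<..<\<eta>}"
      unfolding islimpt_approachable
    proof (intro allI impI)
      fix \<epsilon> :: real assume \<epsilon>: "\<epsilon> > 0"
      define t where "t = \<eta> / 2 + min (\<epsilon> / 2) (\<eta> / 4)"
      have "t \<in> {0<..<\<eta>}" "t \<noteq> \<eta> / 2" "\<bar>t - \<eta> / 2\<bar> < \<epsilon>" using \<epsilon> \<eta>(1) by (auto simp: t_def min_def)
      moreover have "dist (complex_of_real t) (of_real (\<eta> / 2)) = \<bar>t - \<eta> / 2\<bar>"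
        by (simp only: dist_of_real dist_real_def)
      ultimately show "\<exists>x'\<in>complex_of_real ` {0<..<\<eta>}. x' \<noteq> of_real (\<eta> / 2) \<and> dist x' (of_real (\<eta> / 2)) < \<epsilon>"
        by (intro bexI[of _ "of_real t"]) (auto simp only: of_real_eq_iff imageI)
    qed
    show "H z = 0" if z: "z \<in> of_real ` {0<..<\<eta>}" for z
    proof -
      obtain s where "z = of_real s" "0 < s" "s < \<eta>" using z by auto
      then show ?thesis by (simp only: real \<eta>(3) of_real_0)
    qed
  qed
  then have "complex_of_real (\<Sum>e\<in>Basis. conv (kern 0 e) (f e) (q + 1 *\<^sub>R v)) = 0" using real[of 1] by simp
  then show ?thesis by (simp only: of_real_eq_0_iff scaleR_one)
qed

text \<open>The interior of the zero set is relatively closed: each ball whose concentric double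
  lies in \<open>V\<close> is swept by segments that start in that interior and keep their distance
  from the support.\<close>

lemma potential_unique_continuation:
  fixes f :: "'a::euclidean_space \<Rightarrow> 'a \<Rightarrow> 'b::euclidean_space"
  assumes f: "\<And>e. e \<in> Basis \<Longrightarrow> compact_density (f e)" and C: "compact C" "\<And>e y. e \<in> Basis \<Longrightarrow> y \<notin> C \<Longrightarrow> f e y = 0"
    and V: "open V" "connected V" "V \<inter> C = {}" and O: "open O'" "O' \<noteq> {}" "O' \<subseteq> V"
    and zero: "\<And>x. x \<in> O' \<Longrightarrow> (\<Sum>e\<in>Basis. conv (kern 0 e) (f e) x) = 0" and x: "x \<in> V"
  shows "(\<Sum>e\<in>Basis. conv (kern 0 e) (f e) x) = 0"
proof -
  define u where "u x = (\<Sum>e\<in>Basis. conv (kern 0 e) (f e) x)" for x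
  have ub: "u x \<bullet> b = (\<Sum>e\<in>Basis. conv (kern 0 e) (\<lambda>y. f e y \<bullet> b) x)" for x b
    unfolding u_def inner_sum_left
    by (intro sum.cong refl conv_bounded_linear[symmetric] bounded_linear_inner_left f locally_integrable_kern) auto
  define Z where "Z = interior {x. u x = 0} \<inter> V"
  have spread: "ball p r \<subseteq> {x. u x = 0}" if pr: "r > 0" "ball p (2 * r) \<subseteq> V" "ball p r \<inter> Z \<noteq> {}" for p r
  proof
    fix x assume x: "x \<in> ball p r"
    obtain q where q: "q \<in> ball p r" "q \<in> interior {x. u x = 0}" using pr(3) by (auto simp: Z_def)
    obtain \<epsilon> where \<epsilon>: "\<epsilon> > 0" "ball q \<epsilon> \<subseteq> {x. u x = 0}" using q(2) by (auto simp: mem_interior)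
    define v where "v = x - q"
    define \<eta> where "\<eta> = min 1 (\<epsilon> / (norm v + 1))"
    have nv: "norm v + 1 > 0" by (simp add: add_nonneg_pos)
    have \<eta>: "\<eta> > 0" "\<eta> \<le> 1" "\<eta> * norm v < \<epsilon>"
    proof -
      show p: "\<eta> > 0" "\<eta> \<le> 1" using \<epsilon>(1) nv by (auto simp: \<eta>_def)
      have "\<eta> * norm v < \<eta> * (norm v + 1)" using p by simp
      also have "\<dots> \<le> \<epsilon> / (norm v + 1) * (norm v + 1)" unfolding \<eta>_def using nv by (intro mult_right_mono) auto
      finally show "\<eta> * norm v < \<epsilon>" using nv by simp
    qed
    have "u x \<bullet> b = 0" for b
    proof -
      have "(\<Sum>e\<in>Basis. conv (kern 0 e) (\<lambda>y. f e y \<bullet> b) (q + v)) = 0"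
      proof (rule potential_zero_along_segment[OF _ C(1) _ pr(1) _ \<eta>(1,2)])
        show "compact_density (\<lambda>y. f e y \<bullet> b)" if "e \<in> Basis" for e
          by (rule compact_density_bounded_linear[OF f[OF that] bounded_linear_inner_left])
        show "f e y \<bullet> b = 0" if "e \<in> Basis" "y \<notin> C" for e y using C(2)[OF that] by simp
        show "r \<le> norm (q + s *\<^sub>R v - y)" if s: "0 \<le> s" "s \<le> 1" and y: "y \<in> C" for s y
        proof -
          have "q + s *\<^sub>R v = (1 - s) *\<^sub>R q + s *\<^sub>R x" by (simp add: v_def algebra_simps)
          then have "q + s *\<^sub>R v \<in> ball p r"
            using convexD[OF convex_ball q(1) x, of "1 - s" s] s by simp
          moreover have "y \<notin> ball p (2 * r)" using pr(2) V(3) y by blast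
          ultimately show ?thesis using dist_triangle[of p y "q + s *\<^sub>R v"] by (simp add: dist_norm)
        qed
        show "(\<Sum>e\<in>Basis. conv (kern 0 e) (\<lambda>y. f e y \<bullet> b) (q + s *\<^sub>R v)) = 0" if s: "0 < s" "s < \<eta>" for s
        proof -
          have "s * norm v \<le> \<eta> * norm v" using s by (intro mult_right_mono) auto
          then have "q + s *\<^sub>R v \<in> ball q \<epsilon>" using s \<eta>(3) by (simp add: dist_norm)
          then show ?thesis using \<epsilon>(2) ub[of "q + s *\<^sub>R v" b] by auto
        qed
      qed
      then show ?thesis by (simp add: ub v_def)
    qed
    from this[of "u x"] show "x \<in> {x. u x = 0}" by simp
  qed
  have near: "\<exists>r>0. ball p (2 * r) \<subseteq> V" if "p \<in> V" for p
  proof -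
    obtain s where "s > 0" "ball p s \<subseteq> V" using openE[OF V(1) \<open>p \<in> V\<close>] .
    then show ?thesis by (intro exI[of _ "s / 2"]) auto
  qed
  have oZ: "open Z" unfolding Z_def using V(1) by (intro open_Int open_interior)
  have oVZ: "open (V - Z)"
  proof (rule openI)
    fix p assume p: "p \<in> V - Z"
    then obtain r where r: "r > 0" "ball p (2 * r) \<subseteq> V" using near by blast
    have sub: "ball p r \<subseteq> ball p (2 * r)" using r(1) by (intro subset_ball) simp
    have "ball p r \<inter> Z = {}"
    proof (rule ccontr)
      assume "ball p r \<inter> Z \<noteq> {}"
      then have "ball p r \<subseteq> {x. u x = 0}" by (rule spread[OF r])
      then have "p \<in> interior {x. u x = 0}" using r(1) interiorI[OF open_ball, of p p r] by simp
      then show False using p by (simp add: Z_def)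
    qed
    then have "ball p r \<subseteq> V - Z" using sub r(2) by blast
    then show "\<exists>e>0. ball p e \<subseteq> V - Z" using r(1) by blast
  qed
  have "O' \<subseteq> Z" unfolding Z_def using O zero by (auto intro!: interiorI[OF O(1)] simp: u_def)
  then have "Z \<inter> V \<noteq> {}" using O by blast
  then have "(V - Z) \<inter> V = {}"
    using connectedD[OF V(2) oZ oVZ] by blast
  then have "x \<in> Z" using x by blast
  then have "u x = 0" unfolding Z_def using interior_subset by blast
  then show ?thesis by (simp add: u_def)
qed

section \<open>Spinors and Clifford multiplication\<close>

abbreviation coord :: "'k::finite \<Rightarrow> 'n::finite \<Rightarrow> real^'n^'k" where
  "coord A j \<equiv> axis A (axis j 1)"

lemma pd_eq_dderiv: "pd A j f = dderiv (coord A j) f"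
  unfolding pd_def[abs_def] dderiv_def[abs_def] by simp

lemma sum_Basis_coord:
  fixes g :: "real^'n::finite^'k::finite \<Rightarrow> 'c::comm_monoid_add"
  shows "(\<Sum>e\<in>Basis. g e) = (\<Sum>A\<in>UNIV. \<Sum>j\<in>UNIV. g (coord A j))"
proof -
  have B: "(Basis :: (real^'n^'k) set) = (\<lambda>(A, j). coord A j) ` UNIV"
    unfolding Basis_vec_def by (auto simp: Basis_vec_def)
  have inj: "inj (\<lambda>(A, j). coord A j :: real^'n^'k)"
    by (auto simp: inj_on_def axis_eq_axis)
  have "(\<Sum>e\<in>Basis. g e) = (\<Sum>(A, j)\<in>UNIV. g (coord A j))"
    unfolding B by (subst sum.reindex[OF inj]) (simp add: o_def case_prod_beta)
  also have "\<dots> = (\<Sum>A\<in>UNIV. \<Sum>j\<in>UNIV. g (coord A j))"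
    by (subst sum.cartesian_product) (simp add: UNIV_Times_UNIV)
  finally show ?thesis .
qed

lemma coord_in_Basis: "coord A j \<in> Basis"
  unfolding Basis_vec_def by auto

lemma inner_coord: "x \<bullet> coord A j = x $ A $ j"
  by (simp add: inner_axis)

lemma smooth_on_vec_lambda:
  fixes f :: "'k::finite \<Rightarrow> 'a::real_normed_vector \<Rightarrow> 'b::euclidean_space"
  assumes "open U" "\<And>i. smooth_on U (f i)"
  shows "smooth_on U (\<lambda>x. vec_lambda (\<lambda>i. f i x))"
proof -
  have eq: "vec_lambda (\<lambda>i. f i x) = (\<Sum>i\<in>UNIV. axis i (f i x))" for x
    by (simp add: vec_eq_iff axis_def)
  have bl: "bounded_linear (axis i :: 'b \<Rightarrow> 'b^'k)" for i
    unfolding linear_conv_bounded_linear[symmetric] by (rule linearI) (auto simp: vec_eq_iff axis_def)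
  show ?thesis unfolding eq
    by (intro smooth_on_sum smooth_on_bounded_linear_compose[OF bl] assms)
qed

lemma smooth_on_nth: "open U \<Longrightarrow> smooth_on U f \<Longrightarrow> smooth_on U (\<lambda>x. f x $ i)"
  by (rule smooth_on_bounded_linear_compose[OF bounded_linear_vec_nth])

lemma bounded_bilinear_cinner: "bounded_bilinear (cinner :: complex^'s \<Rightarrow> complex^'s \<Rightarrow> complex)"
proof (rule bilinear_conv_bounded_bilinear[THEN iffD1])
  show "bilinear (cinner :: complex^'s \<Rightarrow> complex^'s \<Rightarrow> complex)"
    unfolding bilinear_def cinner_def
    by (auto intro!: linearI simp: sum.distrib scaleR_sum_right complex_cnj_scaleR distrib_left distrib_right)
qed

interpretation cinner: bounded_bilinear "cinner :: complex^'s \<Rightarrow> complex^'s \<Rightarrow> complex"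
  by (rule bounded_bilinear_cinner)

lemma cinner_self: "cinner u u = of_real ((norm u)\<^sup>2)"
proof -
  have "cinner u u = (\<Sum>i\<in>UNIV. of_real ((norm (u $ i))\<^sup>2))"
    unfolding cinner_def by (intro sum.cong refl) (metis complex_norm_square)
  also have "\<dots> = of_real (\<Sum>i\<in>UNIV. (norm (u $ i))\<^sup>2)" by simp
  also have "(\<Sum>i\<in>UNIV. (norm (u $ i))\<^sup>2) = (norm u)\<^sup>2"
    by (simp add: norm_vec_def L2_set_def sum_nonneg)
  finally show ?thesis .
qed

lemma cinner_self_eq_0: "cinner u u = 0 \<longleftrightarrow> u = 0"
  by (simp add: cinner_self)

lemma spinor_minus_0: "0 \<in> spinor_minus \<gamma>"
  by (simp add: spinor_minus_def chirality_def)

lemma chirality_add: "chirality \<gamma> (u + v) = chirality \<gamma> u + chirality \<gamma> v"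
  by (simp add: chirality_def matrix_vector_right_distrib vector_add_ldistrib)

lemma chirality_scaleR: "chirality \<gamma> (r *\<^sub>R u) = r *\<^sub>R chirality \<gamma> u"
proof -
  let ?M = "foldr (\<lambda>j M. \<gamma> j ** M) (sorted_list_of_set UNIV) (mat 1)"
  have "?M *v (r *\<^sub>R u) = r *\<^sub>R (?M *v u)"
    using linear_scale[OF bounded_linear.linear[OF matrix_vector_mul_bounded_linear[of ?M]], of r u] .
  then show ?thesis by (simp add: chirality_def vec_eq_iff)
qed

lemma bounded_linear_chirality: "bounded_linear (chirality \<gamma>)"
  by (simp add: linear_conv_bounded_linear[symmetric] linearI chirality_add chirality_scaleR)

text \<open>The anticommutation relations turn Dirac operators into square roots of Laplacians, and
  skewness makes them formally self-adjoint.\<close>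

locale clifford_module =
  fixes \<gamma> :: "'n::{finite,linorder} \<Rightarrow> complex^'s^'s"
  assumes clifford: "\<gamma> i ** \<gamma> j + \<gamma> j ** \<gamma> i = (if i = j then - 2 else 0) *\<^sub>R mat 1"
    and skew: "cinner (\<gamma> j *v u) v = - cinner u (\<gamma> j *v v)"
begin

lemma bl_\<gamma>: "bounded_linear ((*v) (\<gamma> j))"
  by (rule matrix_vector_mul_bounded_linear)

lemma \<gamma>_scaleR: "\<gamma> j *v (r *\<^sub>R u) = r *\<^sub>R (\<gamma> j *v u)"
  using linear_scale[OF bounded_linear.linear[OF bl_\<gamma>]] .

lemma \<gamma>_sum: "\<gamma> j *v (\<Sum>i\<in>I. f i) = (\<Sum>i\<in>I. \<gamma> j *v f i)"
  using linear_sum[OF bounded_linear.linear[OF bl_\<gamma>]] .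

lemma \<gamma>_diff: "\<gamma> j *v (u - v) = \<gamma> j *v u - \<gamma> j *v v"
  using linear_diff[OF bounded_linear.linear[OF bl_\<gamma>]] .

lemma clifford_vec: "\<gamma> i *v (\<gamma> j *v u) + \<gamma> j *v (\<gamma> i *v u) = (if i = j then - 2 else 0) *\<^sub>R u"
proof -
  have "(c *\<^sub>R mat 1) *v u = c *\<^sub>R u" for c :: real
    by (simp add: vec_eq_iff matrix_vector_mult_def mat_def if_distrib if_distribR cong: if_cong)
  then show ?thesis
    by (simp only: matrix_vector_mul_assoc matrix_vector_mult_add_rdistrib[symmetric] clifford)
qed

text \<open>Symmetric coefficients only see the scalar part of the products of generators.\<close>

lemma clifford_symmetric_sum:
  fixes h :: "'n \<Rightarrow> 'n \<Rightarrow> real"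
  assumes sym: "\<And>i j. h i j = h j i"
  shows "(\<Sum>i\<in>UNIV. \<Sum>j\<in>UNIV. h i j *\<^sub>R (\<gamma> i *v (\<gamma> j *v u))) = - (\<Sum>i\<in>UNIV. h i i) *\<^sub>R u"
proof -
  let ?S = "\<Sum>i\<in>UNIV. \<Sum>j\<in>UNIV. h i j *\<^sub>R (\<gamma> i *v (\<gamma> j *v u))"
  have "?S = (\<Sum>i\<in>UNIV. \<Sum>j\<in>UNIV. h i j *\<^sub>R (\<gamma> j *v (\<gamma> i *v u)))"
    by (subst sum.swap) (simp add: sym)
  then have "?S + ?S = (\<Sum>i\<in>UNIV. \<Sum>j\<in>UNIV. h i j *\<^sub>R (\<gamma> i *v (\<gamma> j *v u) + \<gamma> j *v (\<gamma> i *v u)))"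
    by (simp only: scaleR_add_right sum.distrib)
  also have "\<dots> = (\<Sum>i\<in>UNIV. \<Sum>j\<in>UNIV. if i = j then (- 2 * h i j) *\<^sub>R u else 0)"
    unfolding clifford_vec by (intro sum.cong refl) auto
  also have "\<dots> = (\<Sum>i\<in>UNIV. (- 2 * h i i) *\<^sub>R u)" by simp
  also have "\<dots> = (- 2 * (\<Sum>i\<in>UNIV. h i i)) *\<^sub>R u"
    by (simp only: scaleR_sum_left[symmetric] sum_distrib_left)
  finally have "2 *\<^sub>R ?S = 2 *\<^sub>R (- (\<Sum>i\<in>UNIV. h i i) *\<^sub>R u)" by (simp add: scaleR_2[symmetric])
  then show ?thesis by (simp only: scaleR_cancel_left) simp
qed

text \<open>The vector-valued version, with the Hessian of a spinor field as coefficient.\<close>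

lemma clifford_symmetric_sum_vec:
  fixes h :: "'n \<Rightarrow> 'n \<Rightarrow> complex^'s"
  assumes sym: "\<And>i j. h i j = h j i"
  shows "(\<Sum>i\<in>UNIV. \<Sum>j\<in>UNIV. \<gamma> i *v (\<gamma> j *v h i j)) = - (\<Sum>i\<in>UNIV. h i i)"
proof -
  let ?S = "\<Sum>i\<in>UNIV. \<Sum>j\<in>UNIV. \<gamma> i *v (\<gamma> j *v h i j)"
  have "?S = (\<Sum>i\<in>UNIV. \<Sum>j\<in>UNIV. \<gamma> j *v (\<gamma> i *v h i j))"
    by (subst sum.swap) (simp add: sym)
  then have "?S + ?S = (\<Sum>i\<in>UNIV. \<Sum>j\<in>UNIV. \<gamma> i *v (\<gamma> j *v h i j) + \<gamma> j *v (\<gamma> i *v h i j))"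
    by (simp only: sum.distrib)
  also have "\<dots> = (\<Sum>i\<in>UNIV. \<Sum>j\<in>UNIV. if i = j then (- 2) *\<^sub>R h i j else 0)"
    unfolding clifford_vec by (intro sum.cong refl) auto
  also have "\<dots> = (\<Sum>i\<in>UNIV. (- 2) *\<^sub>R h i i)" by simp
  also have "\<dots> = (- 2) *\<^sub>R (\<Sum>i\<in>UNIV. h i i)"
    by (simp only: scaleR_sum_right)
  finally have "2 *\<^sub>R ?S = 2 *\<^sub>R (- (\<Sum>i\<in>UNIV. h i i))" by (simp add: scaleR_2[symmetric])
  then show ?thesis by (simp only: scaleR_cancel_left) simp
qed

text \<open>Moving a generator through a product of distinct generators costs one sign for each
  factor different from it.\<close>

lemma foldr_anticommute:
  assumes "distinct l"
  shows "foldr (\<lambda>j M. \<gamma> j ** M) l (mat 1) *v (\<gamma> i *v u)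
    = (- 1) ^ (length l + (if i \<in> set l then 1 else 0)) *\<^sub>R (\<gamma> i *v (foldr (\<lambda>j M. \<gamma> j ** M) l (mat 1) *v u))"
  using assms
proof (induction l)
  case (Cons a l)
  let ?P = "foldr (\<lambda>j M. \<gamma> j ** M) l (mat 1)"
  have swap: "\<gamma> a *v (\<gamma> i *v w) = (if a = i then 1 else - 1) *\<^sub>R (\<gamma> i *v (\<gamma> a *v w))" for w
    using clifford_vec[of a i w] by (auto simp: eq_neg_iff_add_eq_0)
  have "foldr (\<lambda>j M. \<gamma> j ** M) (a # l) (mat 1) *v (\<gamma> i *v u) = \<gamma> a *v (?P *v (\<gamma> i *v u))"
    by (simp add: matrix_vector_mul_assoc[symmetric])
  also have "\<dots> = (- 1) ^ (length l + (if i \<in> set l then 1 else 0)) *\<^sub>R (\<gamma> a *v (\<gamma> i *v (?P *v u)))"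
    using Cons by (simp add: \<gamma>_scaleR)
  also have "\<dots> = (- 1) ^ (length (a # l) + (if i \<in> set (a # l) then 1 else 0)) *\<^sub>R (\<gamma> i *v (\<gamma> a *v (?P *v u)))"
    unfolding swap using Cons.prems by auto
  finally show ?case by (simp add: matrix_vector_mul_assoc[symmetric])
qed simp

text \<open>There is an even number of generators, and an odd number of them differ from
  \<open>\<gamma> i\<close>.\<close>

lemma chirality_\<gamma>:
  assumes "even CARD('n)"
  shows "chirality \<gamma> (\<gamma> i *v u) = - (\<gamma> i *v chirality \<gamma> u)"
proof -
  let ?l = "sorted_list_of_set (UNIV :: 'n set)"
  let ?M = "foldr (\<lambda>j M. \<gamma> j ** M) ?l (mat 1)"
  have "length ?l = CARD('n)" by simp
  then have "(- 1 :: real) ^ (length ?l + (if i \<in> set ?l then 1 else 0)) = - 1" using assms by simp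
  then have "?M *v (\<gamma> i *v u) = - (\<gamma> i *v (?M *v u))"
    using foldr_anticommute[of ?l i u] by simp
  then have "chirality \<gamma> (\<gamma> i *v u) = (\<i> ^ (CARD('n) div 2)) *s (- (\<gamma> i *v (?M *v u)))"
    by (simp only: chirality_def)
  also have "\<dots> = - (\<gamma> i *v ((\<i> ^ (CARD('n) div 2)) *s (?M *v u)))"
    by (simp add: vec.scale_minus_right vector_scalar_commute)
  finally show ?thesis by (simp only: chirality_def)
qed

lemma \<gamma>_plus: "u \<in> spinor_plus \<gamma> \<Longrightarrow> \<gamma> i *v u \<in> spinor_minus \<gamma>"
  and \<gamma>_minus: "u \<in> spinor_minus \<gamma> \<Longrightarrow> \<gamma> i *v u \<in> spinor_plus \<gamma>"
  by (auto simp: spinor_plus_def spinor_minus_def chirality_\<gamma> linear_neg[OF bounded_linear.linear[OF bl_\<gamma>]] split: if_splits)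

end

text \<open>Half-spinor spaces enter the analysis only as kernels of real-linear maps: values in
  them survive differentiation and integration.\<close>

lemma spinor_plus_linear:
  fixes \<gamma> :: "'n::{finite,linorder} \<Rightarrow> complex^'s^'s"
  obtains L :: "complex^'s \<Rightarrow> complex^'s" where "bounded_linear L" "spinor_plus \<gamma> = {u. L u = 0}"
proof (cases "even CARD('n)")
  case True
  have "bounded_linear (\<lambda>u. chirality \<gamma> u - u)"
    by (intro bounded_linear_sub bounded_linear_chirality bounded_linear_ident)
  then show thesis using that[of "\<lambda>u. chirality \<gamma> u - u"] True by (simp add: spinor_plus_def)
next
  case False
  then show thesis using that[of "\<lambda>u. 0"] by (simp add: spinor_plus_def)
qed

lemma spinor_minus_linear:
  fixes \<gamma> :: "'n::{finite,linorder} \<Rightarrow> complex^'s^'s"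
  obtains L :: "complex^'s \<Rightarrow> complex^'s" where "bounded_linear L" "spinor_minus \<gamma> = {u. L u = 0}"
proof (cases "even CARD('n)")
  case True
  have "bounded_linear (\<lambda>u. chirality \<gamma> u + u)"
    by (intro bounded_linear_add bounded_linear_chirality bounded_linear_ident)
  then show thesis using that[of "\<lambda>u. chirality \<gamma> u + u"] True
    by (simp add: spinor_minus_def eq_neg_iff_add_eq_0)
next
  case False
  then show thesis using that[of "\<lambda>u. 0"] by (simp add: spinor_minus_def)
qed

section \<open>The weak compatibility condition\<close>

text \<open>The Laplacian in the variable \<open>x\<^sub>B\<close> alone.\<close>

definition plap :: "'k::finite \<Rightarrow> (real^'n::finite^'k \<Rightarrow> 'b::euclidean_space) \<Rightarrow> real^'n^'k \<Rightarrow> 'b" where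
  "plap B f x = (\<Sum>j\<in>UNIV. dderiv (coord B j) (dderiv (coord B j) f) x)"

lemma nabla_dderiv: "nabla \<gamma> A F x = (\<Sum>j\<in>UNIV. \<gamma> j *v dderiv (coord A j) F x)"
  by (simp add: nabla_def pd_eq_dderiv)

lemma nabla_transform_open:
  assumes "open U" "x \<in> U" "\<And>y. y \<in> U \<Longrightarrow> F y = G y"
  shows "nabla \<gamma> A F x = nabla \<gamma> A G x"
proof -
  have "dderiv v F x = dderiv v G x" for v by (rule dderiv_transform_open[OF assms])
  then show ?thesis by (simp add: nabla_dderiv)
qed

lemma integral_by_parts_twice:
  fixes \<eta> :: "'a::euclidean_space \<Rightarrow> real" and G :: "'a \<Rightarrow> 'b::euclidean_space"
  assumes \<eta>: "\<eta> \<in> test_functions UNIV" and G: "smooth_on UNIV G"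
  shows "(\<integral>y. dderiv v (dderiv w \<eta>) y *\<^sub>R G y \<partial>lborel) = (\<integral>y. \<eta> y *\<^sub>R dderiv w (dderiv v G) y \<partial>lborel)"
proof -
  obtain K where K: "smooth_on UNIV \<eta>" "compact K" "\<And>x. x \<notin> K \<Longrightarrow> \<eta> x = 0" using compact_sectionsE[OF \<eta>] by metis
  have z: "dderiv w \<eta> x = 0" if "x \<notin> K" for x
    by (rule dderiv_zero_outside[OF compact_imp_closed[OF K(2)] K(3) that])
  have "(\<integral>y. dderiv v (dderiv w \<eta>) y *\<^sub>R G y \<partial>lborel) = - (\<integral>y. dderiv w \<eta> y *\<^sub>R dderiv v G y \<partial>lborel)"
    by (rule integral_by_parts_bilinear[OF bounded_bilinear_scaleR smooth_on_dderiv[OF K(1)] G K(2)]) (simp add: z)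
  also have "(\<integral>y. dderiv w \<eta> y *\<^sub>R dderiv v G y \<partial>lborel) = - (\<integral>y. \<eta> y *\<^sub>R dderiv w (dderiv v G) y \<partial>lborel)"
    by (rule integral_by_parts_bilinear[OF bounded_bilinear_scaleR K(1) smooth_on_dderiv[OF G] K(2)]) (simp add: K(3))
  finally show ?thesis by simp
qed

lemma test_functions_integrable:
  fixes f :: "'a::euclidean_space \<Rightarrow> 'b::euclidean_space"
  shows "f \<in> compact_sections W E \<Longrightarrow> integrable lborel f"
  by (rule compact_density_integrable[OF test_functions_density])

lemma test_functions_linear:
  fixes f :: "'a::euclidean_space \<Rightarrow> 'b::euclidean_space"
  assumes "bounded_linear L" "f \<in> test_functions W"
  shows "(\<lambda>x. L (f x)) \<in> test_functions W"
proof -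
  obtain K where K: "smooth_on UNIV f" "compact K" "K \<subseteq> W" "\<And>x. x \<notin> K \<Longrightarrow> f x = 0" using compact_sectionsE[OF assms(2)] by metis
  show ?thesis
    by (rule compact_sectionsI[OF smooth_on_bounded_linear_compose[OF assms(1) open_UNIV K(1)] UNIV_I K(2,3)])
      (simp add: K(4) linear_0[OF bounded_linear.linear[OF assms(1)]])
qed

lemma dderiv_scaleR_const:
  assumes "\<eta> differentiable (at x)"
  shows "dderiv v (\<lambda>x. \<eta> x *\<^sub>R s) x = dderiv v \<eta> x *\<^sub>R s"
  by (rule dderiv_bounded_linear[OF bounded_linear_scaleR_left assms])

lemma dderiv_in_kernel:
  assumes "bounded_linear L" "open U" "x \<in> U" "F differentiable (at x)" "\<And>y. y \<in> U \<Longrightarrow> L (F y) = 0"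
  shows "L (dderiv v F x) = 0"
proof -
  have "L (dderiv v F x) = dderiv v (\<lambda>y. L (F y)) x" by (rule dderiv_bounded_linear[OF assms(1,4), symmetric])
  also have "\<dots> = dderiv v (\<lambda>y. 0) x" by (rule dderiv_transform_open[OF assms(2,3,5)])
  also have "\<dots> = 0" by (rule dderiv_eqI) simp
  finally show ?thesis .
qed

text \<open>The tensor \<open>e\<^sub>A \<otimes> e\<^sub>B \<otimes> e\<^sub>B\<close> with spinor
  coefficient \<open>s\<close>. Its image under \<open>C21\<close> is the test tensor that isolates
  one component of \<open>D1\<close>.\<close>

definition elementary_tensor :: "'k::finite \<Rightarrow> 'k \<Rightarrow> complex^'s \<Rightarrow> complex^'s^'k^'k^'k" where
  "elementary_tensor A B s = (\<chi> P Q R. if P = A \<and> Q = B \<and> R = B then s else 0)"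

lemma sum_cinner_delta:
  fixes X :: "complex^'s^'k::finite^'k^'k"
  shows "(\<Sum>P\<in>UNIV. \<Sum>Q\<in>UNIV. \<Sum>R\<in>UNIV. cinner (X $ P $ Q $ R) (if P = a \<and> Q = b \<and> R = c then s else 0)) = cinner (X $ a $ b $ c) s"
proof -
  have r: "(\<Sum>R\<in>UNIV. cinner (X $ P $ Q $ R) (if P = a \<and> Q = b \<and> R = c then s else 0))
     = (if Q = b then if P = a then cinner (X $ P $ Q $ c) s else 0 else 0)" for P Q
  proof (cases "P = a \<and> Q = b")
    case True
    then have "(\<Sum>R\<in>UNIV. cinner (X $ P $ Q $ R) (if P = a \<and> Q = b \<and> R = c then s else 0))
      = (\<Sum>R\<in>UNIV. if R = c then cinner (X $ P $ Q $ c) s else 0)"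
      by (intro sum.cong refl) (simp add: cinner.zero_right)
    then show ?thesis using True by simp
  qed (auto simp: cinner.zero_right)
  show ?thesis unfolding r by simp
qed

text \<open>\<open>C21 (e\<^sub>A \<otimes> e\<^sub>B \<otimes> e\<^sub>B)\<close> has the
  coefficients 2/3 at \<open>ABB\<close> and -1/3 at \<open>BBA\<close> and \<open>BAB\<close>. The
  symmetry of \<open>X\<close> makes the three contributions add up to one copy of the component
  \<open>X\<^sub>A\<^sub>B\<^sub>B\<close>.\<close>

lemma cinner3_C21:
  fixes X :: "complex^'s^'k::finite^'k^'k"
  assumes "X $ B $ B $ A = (- 1 / 2) *\<^sub>R X $ A $ B $ B" "X $ B $ A $ B = (- 1 / 2) *\<^sub>R X $ A $ B $ B"
  shows "cinner3 X (r *\<^sub>R C21 (elementary_tensor A B s)) = cinner (X $ A $ B $ B) (r *\<^sub>R s)"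
proof -
  have et: "elementary_tensor A B s $ P $ Q $ R = (if P = A \<and> Q = B \<and> R = B then s else 0)"
    "elementary_tensor A B s $ P $ R $ Q = (if P = A \<and> Q = B \<and> R = B then s else 0)"
    "elementary_tensor A B s $ R $ Q $ P = (if P = B \<and> Q = B \<and> R = A then s else 0)"
    "elementary_tensor A B s $ Q $ R $ P = (if P = B \<and> Q = A \<and> R = B then s else 0)" for P Q R :: 'k
    by (auto simp: elementary_tensor_def)
  have comp: "(r *\<^sub>R C21 (elementary_tensor A B s)) $ P $ Q $ R = (r / 3) *\<^sub>R
     ((if P = A \<and> Q = B \<and> R = B then s else 0) + (if P = A \<and> Q = B \<and> R = B then s else 0)
      - (if P = B \<and> Q = B \<and> R = A then s else 0) - (if P = B \<and> Q = A \<and> R = B then s else 0))" for P Q R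
    by (simp only: C21_def vector_scaleR_component vec_lambda_beta et[where P = P and Q = Q and R = R] scaleR_scaleR times_divide_eq_right mult_1_right)
  have "cinner3 X (r *\<^sub>R C21 (elementary_tensor A B s)) = (r / 3) *\<^sub>R
     ((\<Sum>P\<in>UNIV. \<Sum>Q\<in>UNIV. \<Sum>R\<in>UNIV. cinner (X $ P $ Q $ R) (if P = A \<and> Q = B \<and> R = B then s else 0))
    + (\<Sum>P\<in>UNIV. \<Sum>Q\<in>UNIV. \<Sum>R\<in>UNIV. cinner (X $ P $ Q $ R) (if P = A \<and> Q = B \<and> R = B then s else 0))
    - (\<Sum>P\<in>UNIV. \<Sum>Q\<in>UNIV. \<Sum>R\<in>UNIV. cinner (X $ P $ Q $ R) (if P = B \<and> Q = B \<and> R = A then s else 0))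
    - (\<Sum>P\<in>UNIV. \<Sum>Q\<in>UNIV. \<Sum>R\<in>UNIV. cinner (X $ P $ Q $ R) (if P = B \<and> Q = A \<and> R = B then s else 0)))"
    unfolding cinner3_def comp
    by (simp only: cinner.scaleR_right cinner.diff_right cinner.add_right sum_subtractf sum.distrib scaleR_sum_right[symmetric])
  also have "\<dots> = (r / 3) *\<^sub>R (3 *\<^sub>R cinner (X $ A $ B $ B) s)"
    unfolding sum_cinner_delta assms cinner.scaleR_left by (simp add: scaleR_conv_of_real algebra_simps)
  also have "\<dots> = cinner (X $ A $ B $ B) (r *\<^sub>R s)" by (simp add: cinner.scaleR_right)
  finally show ?thesis .
qed

lemma cinner3_zero: "cinner3 X 0 = 0"
  by (simp add: cinner3_def cinner.zero_right)

lemma half_of_differences: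
  fixes u w z :: "'a::real_vector"
  shows "(1 / 2 :: real) *\<^sub>R (u + u - (w + w)) = u - w"
    "(1 / 2 :: real) *\<^sub>R (w + z - (z + u)) = (- 1 / 2) *\<^sub>R (u - w)"
    "(1 / 2 :: real) *\<^sub>R (z + w - (u + z)) = (- 1 / 2) *\<^sub>R (u - w)"
  by (simp_all add: scaleR_diff_right scaleR_add_right scaleR_add_left[symmetric])

lemma D1_component:
  "D1 \<gamma> F x $ A $ B $ B = nabla \<gamma> A (nabla \<gamma> B (\<lambda>y. F y $ B)) x - nabla \<gamma> B (nabla \<gamma> B (\<lambda>y. F y $ A)) x"
  "D1 \<gamma> F x $ B $ B $ A = (- 1 / 2) *\<^sub>R (D1 \<gamma> F x $ A $ B $ B)"
  "D1 \<gamma> F x $ B $ A $ B = (- 1 / 2) *\<^sub>R (D1 \<gamma> F x $ A $ B $ B)"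
proof -
  show c: "D1 \<gamma> F x $ A $ B $ B = nabla \<gamma> A (nabla \<gamma> B (\<lambda>y. F y $ B)) x - nabla \<gamma> B (nabla \<gamma> B (\<lambda>y. F y $ A)) x"
    by (simp only: D1_def vec_lambda_beta half_of_differences)
  show "D1 \<gamma> F x $ B $ B $ A = (- 1 / 2) *\<^sub>R (D1 \<gamma> F x $ A $ B $ B)"
    unfolding c by (simp only: D1_def vec_lambda_beta half_of_differences)
  show "D1 \<gamma> F x $ B $ A $ B = (- 1 / 2) *\<^sub>R (D1 \<gamma> F x $ A $ B $ B)"
    unfolding c by (simp only: D1_def vec_lambda_beta half_of_differences)
qed

lemma cinner3_D1:
  "cinner3 (D1 \<gamma> F x) (r *\<^sub>R C21 (elementary_tensor A B s)) =
    cinner (nabla \<gamma> A (nabla \<gamma> B (\<lambda>y. F y $ B)) x - nabla \<gamma> B (nabla \<gamma> B (\<lambda>y. F y $ A)) x) (r *\<^sub>R s)"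
  using cinner3_C21[OF D1_component(2,3)[of \<gamma> F x B A]] by (simp only: D1_component(1))

lemma cinner1_self: "cinner1 d d = of_real ((norm d)\<^sup>2)"
proof -
  have "(norm d)\<^sup>2 = (\<Sum>A\<in>UNIV. (norm (d $ A))\<^sup>2)" by (simp add: norm_vec_def L2_set_def sum_nonneg)
  then show ?thesis by (simp add: cinner1_def cinner_self)
qed

lemma bounded_bilinear_cinner1: "bounded_bilinear (cinner1 :: complex^'s^'k::finite \<Rightarrow> complex^'s^'k \<Rightarrow> complex)"
proof (rule bilinear_conv_bounded_bilinear[THEN iffD1])
  show "bilinear (cinner1 :: complex^'s^'k \<Rightarrow> complex^'s^'k \<Rightarrow> complex)"
    unfolding bilinear_def cinner1_def
    by (auto intro!: linearI simp: sum.distrib scaleR_sum_right cinner.add_left cinner.add_right cinner.scaleR_left cinner.scaleR_right)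
qed

interpretation cinner1: bounded_bilinear "cinner1 :: complex^'s^'k::finite \<Rightarrow> complex^'s^'k \<Rightarrow> complex"
  by (rule bounded_bilinear_cinner1)

text \<open>The set where \<open>f\<close> is nonzero is open and a null set.\<close>

lemma continuous_integral_zero_imp_zero:
  fixes f :: "'a::euclidean_space \<Rightarrow> real"
  assumes f: "continuous_on UNIV f" "integrable lborel f" "\<And>x. f x \<ge> 0" and z: "(\<integral>x. f x \<partial>lborel) = 0"
  shows "f x = 0"
proof (rule ccontr)
  assume "f x \<noteq> 0"
  have o: "open {x. f x \<noteq> 0}" using f(1) by (intro open_Collect_neq) auto
  have "AE x in lborel. f x = 0" using integral_nonneg_eq_0_iff_AE[OF f(2)] f(3) z by simp
  then obtain N where N: "N \<in> null_sets lborel" "{x \<in> space lborel. \<not> f x = 0} \<subseteq> N"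
    unfolding eventually_ae_filter by blast
  have "N \<in> null_sets lebesgue" using N(1) by (rule null_sets_completionI)
  then have "negligible {x. f x \<noteq> 0}"
    using N(2) negligible_subset[of N "{x. f x \<noteq> 0}"] by (auto simp: negligible_iff_null_sets)
  then show False using open_not_negligible[OF o] \<open>f x \<noteq> 0\<close> by blast
qed

text \<open>Uniqueness of the formal adjoint: the difference of two candidates, localised by a
  cut-off function, is an admissible test section.\<close>

lemma sections_eq_of_weak_eq:
  fixes g g' :: "real^'n::{finite,linorder}^'k::finite \<Rightarrow> complex^'s^'k"
    and \<gamma> :: "'n::{finite,linorder} \<Rightarrow> complex^'s^'s"
  assumes g: "g \<in> sections UNIV (V1 \<gamma>)" "g' \<in> sections UNIV (V1 \<gamma>)"
    and eq: "\<And>F. F \<in> compact_sections UNIV (V1 \<gamma>) \<Longrightarrow>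
      (LINT x|lborel. cinner1 (F x) (g x)) = (LINT x|lborel. cinner1 (F x) (g' x))"
  shows "g = g'"
proof
  fix p
  obtain L :: "complex^'s \<Rightarrow> complex^'s" where L: "bounded_linear L" "spinor_minus \<gamma> = {u. L u = 0}"
    using spinor_minus_linear[of \<gamma>] by blast
  define d where "d x = g x - g' x" for x
  have sg: "smooth_on UNIV g" "smooth_on UNIV g'" using g by (auto simp: sections_def)
  have sd: "smooth_on UNIV d" unfolding d_def[abs_def] by (rule smooth_on_diff[OF open_UNIV sg])
  obtain \<kappa> :: "real^'n::{finite,linorder}^'k \<Rightarrow> real" and V K where \<kappa>: "smooth_on UNIV \<kappa>" "open V" "{p} \<subseteq> V" "\<And>x. x \<in> V \<Longrightarrow> \<kappa> x = 1"
    "compact K" "K \<subseteq> UNIV" "\<And>x. x \<notin> K \<Longrightarrow> \<kappa> x = 0"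
    by (rule exists_smooth_cutoff[of "{p}" UNIV]) auto
  \<comment> \<open>the square makes the weight nonnegative\<close>
  define F where "F x = (\<kappa> x)\<^sup>2 *\<^sub>R d x" for x
  have dV: "d x \<in> V1 \<gamma>" for x
    using g by (auto simp: d_def sections_def V1_def L(2) linear_diff[OF bounded_linear.linear[OF L(1)]])
  have FV: "F x \<in> V1 \<gamma>" for x
    using dV[of x] by (auto simp: F_def V1_def L(2) linear_scale[OF bounded_linear.linear[OF L(1)]])
  have sF: "smooth_on UNIV F" unfolding F_def[abs_def]
    by (intro smooth_on_scaleR smooth_on_power \<kappa>(1) sd open_UNIV)
  have F: "F \<in> compact_sections UNIV (V1 \<gamma>)"
    by (rule compact_sectionsI[OF sF FV \<kappa>(5,6)]) (simp add: F_def \<kappa>(7))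
  have int: "integrable lborel (\<lambda>x. cinner1 (F x) (w x))" if w: "smooth_on UNIV w" for w
    by (rule compact_density_integrable[OF compact_density_continuous[OF
          cinner1.continuous_on[OF smooth_on_continuous[OF sF] smooth_on_continuous[OF w]] \<kappa>(5)]])
      (simp add: F_def \<kappa>(7) cinner1.zero_left)
  have pt: "cinner1 (F x) (g x) - cinner1 (F x) (g' x) = complex_of_real ((\<kappa> x)\<^sup>2 * (norm (d x))\<^sup>2)" for x
  proof -
    have "cinner1 (F x) (g x) - cinner1 (F x) (g' x) = (\<kappa> x)\<^sup>2 *\<^sub>R (cinner1 (d x) (g x) - cinner1 (d x) (g' x))"
      by (simp only: F_def cinner1.scaleR_left scaleR_diff_right)
    also have "cinner1 (d x) (g x) - cinner1 (d x) (g' x) = cinner1 (d x) (d x)"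
      by (simp only: cinner1.diff_right[symmetric] d_def)
    finally have "cinner1 (F x) (g x) - cinner1 (F x) (g' x) = (\<kappa> x)\<^sup>2 *\<^sub>R cinner1 (d x) (d x)" .
    then show ?thesis by (simp add: cinner1_self scaleR_conv_of_real)
  qed
  have "(\<integral>x. cinner1 (F x) (g x) - cinner1 (F x) (g' x) \<partial>lborel) = 0"
    using eq[OF F] by (simp add: Bochner_Integration.integral_diff[OF int[OF sg(1)] int[OF sg(2)]])
  then have z: "(\<integral>x. (\<kappa> x)\<^sup>2 * (norm (d x))\<^sup>2 \<partial>lborel) = 0"
    unfolding pt by (simp only: integral_complex_of_real of_real_eq_0_iff)
  have c: "continuous_on UNIV (\<lambda>x. (\<kappa> x)\<^sup>2 * (norm (d x))\<^sup>2)"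
    by (intro continuous_intros smooth_on_continuous \<kappa>(1) sd)
  have i: "integrable lborel (\<lambda>x. (\<kappa> x)\<^sup>2 * (norm (d x))\<^sup>2)"
    by (rule compact_density_integrable[OF compact_density_continuous[OF c \<kappa>(5)]]) (simp add: \<kappa>(7))
  have "(\<kappa> p)\<^sup>2 * (norm (d p))\<^sup>2 = 0"
    by (rule continuous_integral_zero_imp_zero[OF c i _ z]) simp
  then show "g p = g' p" using \<kappa>(3,4) by (simp add: d_def)
qed

context clifford_module
begin

lemma smooth_on_nabla: "open U \<Longrightarrow> smooth_on U F \<Longrightarrow> smooth_on U (nabla \<gamma> A F)"
  unfolding nabla_dderiv[abs_def]
  by (intro smooth_on_sum smooth_on_bounded_linear_compose[OF bl_\<gamma>] smooth_on_dderiv)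

lemma nabla_test_functions: "F \<in> test_functions W \<Longrightarrow> nabla \<gamma> A F \<in> test_functions W"
  unfolding nabla_dderiv[abs_def]
  by (intro test_functions_sum test_functions_linear[OF bl_\<gamma>] test_functions_dderiv)

lemma dderiv_nabla:
  assumes "smooth_on U F" "x \<in> U"
  shows "dderiv v (nabla \<gamma> A F) x = (\<Sum>j\<in>UNIV. \<gamma> j *v dderiv v (dderiv (coord A j) F) x)"
  unfolding nabla_dderiv[abs_def]
  by (rule dderiv_eqI) (intro has_derivative_sum bounded_linear.has_derivative[OF bl_\<gamma>]
      smooth_on_has_derivative[OF smooth_on_dderiv[OF assms(1)] assms(2)])

lemma nabla_nabla:
  assumes "smooth_on U F" "x \<in> U"
  shows "nabla \<gamma> A (nabla \<gamma> B F) x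
    = (\<Sum>i\<in>UNIV. \<Sum>j\<in>UNIV. \<gamma> i *v (\<gamma> j *v dderiv (coord A i) (dderiv (coord B j) F) x))"
  unfolding nabla_dderiv[of \<gamma> A] dderiv_nabla[OF assms] \<gamma>_sum ..

text \<open>The Hessian is symmetric, so only the scalar part of \<open>\<gamma> i \<gamma>
  j\<close> contributes.\<close>

lemma nabla_square:
  assumes "open U" "smooth_on U F" "x \<in> U"
  shows "nabla \<gamma> B (nabla \<gamma> B F) x = - plap B F x"
  unfolding nabla_nabla[OF assms(2,3)] plap_def
  by (rule clifford_symmetric_sum_vec) (rule dderiv_symmetric[OF assms(1) smooth_onD[OF assms(2)] assms(3)])

text \<open>The square of a Dirac operator is a scalar operator with constant coefficients. This is
  the identity behind \<open>D1 (D0 F) = 0\<close>.\<close>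

lemma nabla_square_commute:
  assumes U: "open U" and F: "smooth_on U F" and x: "x \<in> U"
  shows "nabla \<gamma> A (nabla \<gamma> B (nabla \<gamma> B F)) x = nabla \<gamma> B (nabla \<gamma> B (nabla \<gamma> A F)) x"
proof -
  have third: "dderiv (coord A i) (dderiv w (dderiv w F)) x = dderiv w (dderiv w (dderiv (coord A i) F)) x" for i w
  proof -
    have "dderiv (coord A i) (dderiv w (dderiv w F)) x = dderiv w (dderiv (coord A i) (dderiv w F)) x"
      by (rule dderiv_symmetric[OF U smooth_onD[OF smooth_on_dderiv[OF F]] x])
    also have "\<dots> = dderiv w (dderiv w (dderiv (coord A i) F)) x"
      by (rule dderiv_transform_open[OF U x]) (rule dderiv_symmetric[OF U smooth_onD[OF F]])
    finally show ?thesis .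
  qed
  have "nabla \<gamma> A (nabla \<gamma> B (nabla \<gamma> B F)) x = nabla \<gamma> A (\<lambda>y. - plap B F y) x"
    by (rule nabla_transform_open[OF U x nabla_square[OF U F]])
  also have "\<dots> = (\<Sum>i\<in>UNIV. \<gamma> i *v (- (\<Sum>j\<in>UNIV. dderiv (coord A i) (dderiv (coord B j) (dderiv (coord B j) F)) x)))"
  proof -
    have "dderiv v (\<lambda>y. - plap B F y) x = - (\<Sum>j\<in>UNIV. dderiv v (dderiv (coord B j) (dderiv (coord B j) F)) x)" for v
      unfolding plap_def
      by (rule dderiv_eqI) (intro has_derivative_minus has_derivative_sum
          smooth_on_has_derivative[OF smooth_on_dderiv[OF smooth_on_dderiv[OF F]] x])
    then show ?thesis by (simp add: nabla_dderiv)
  qed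
  also have "\<dots> = - (\<Sum>j\<in>UNIV. \<Sum>i\<in>UNIV. \<gamma> i *v dderiv (coord B j) (dderiv (coord B j) (dderiv (coord A i) F)) x)"
    unfolding third linear_neg[OF bounded_linear.linear[OF bl_\<gamma>]] \<gamma>_sum sum_negf
    by (subst sum.swap) (rule refl)
  also have "\<dots> = - plap B (nabla \<gamma> A F) x"
  proof -
    have "dderiv w (dderiv w (nabla \<gamma> A F)) x = (\<Sum>i\<in>UNIV. \<gamma> i *v dderiv w (dderiv w (dderiv (coord A i) F)) x)" for w
    proof -
      have "dderiv w (dderiv w (nabla \<gamma> A F)) x = dderiv w (\<lambda>y. \<Sum>i\<in>UNIV. \<gamma> i *v dderiv w (dderiv (coord A i) F) y) x"
        by (rule dderiv_transform_open[OF U x dderiv_nabla[OF F]])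
      also have "\<dots> = (\<Sum>i\<in>UNIV. \<gamma> i *v dderiv w (dderiv w (dderiv (coord A i) F)) x)"
        by (rule dderiv_eqI) (intro has_derivative_sum bounded_linear.has_derivative[OF bl_\<gamma>]
          smooth_on_has_derivative[OF smooth_on_dderiv[OF smooth_on_dderiv[OF F]] x])
      finally show ?thesis .
    qed
    then show ?thesis by (simp add: plap_def)
  qed
  also have "\<dots> = nabla \<gamma> B (nabla \<gamma> B (nabla \<gamma> A F)) x"
    by (rule nabla_square[OF U smooth_on_nabla[OF U F] x, symmetric])
  finally show ?thesis .
qed

lemma nabla_in_minus:
  assumes "open U" "x \<in> U" "smooth_on U F" "\<And>y. y \<in> U \<Longrightarrow> F y \<in> spinor_plus \<gamma>"
  shows "nabla \<gamma> A F x \<in> spinor_minus \<gamma>"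
proof -
  obtain L :: "complex^'s \<Rightarrow> complex^'s" where L: "bounded_linear L" "spinor_plus \<gamma> = {u. L u = 0}"
    using spinor_plus_linear[of \<gamma>] by blast
  obtain M :: "complex^'s \<Rightarrow> complex^'s" where M: "bounded_linear M" "spinor_minus \<gamma> = {u. M u = 0}"
    using spinor_minus_linear[of \<gamma>] by blast
  have "dderiv v F x \<in> spinor_plus \<gamma>" for v
    unfolding L(2) using dderiv_in_kernel[OF L(1) assms(1,2) smooth_on_differentiable[OF assms(3,2)]] assms(4) L(2) by simp
  then have "M (\<gamma> j *v dderiv v F x) = 0" for j v using \<gamma>_plus M(2) by blast
  then show ?thesis unfolding M(2) nabla_dderiv by (simp add: linear_sum[OF bounded_linear.linear[OF M(1)]])
qed

text \<open>The sign from integration by parts cancels the sign from the skewness of \<open>\<gamma>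
  j\<close>.\<close>

lemma nabla_by_parts:
  assumes F: "F \<in> test_functions UNIV" and \<psi>: "smooth_on UNIV \<psi>"
  shows "(\<integral>x. cinner (nabla \<gamma> A F x) (\<psi> x) \<partial>lborel) = (\<integral>x. cinner (F x) (nabla \<gamma> A \<psi> x) \<partial>lborel)"
proof -
  obtain K where K: "smooth_on UNIV F" "compact K" "\<And>x. x \<notin> K \<Longrightarrow> F x = 0" using compact_sectionsE[OF F] by metis
  have z: "dderiv v F x = 0" if "x \<notin> K" for x v
    by (rule dderiv_zero_outside[OF compact_imp_closed[OF K(2)] K(3) that])
  have int: "integrable lborel (\<lambda>x. cinner (p x) (q x))"
    if "smooth_on UNIV p" "smooth_on UNIV q" "\<And>x. x \<notin> K \<Longrightarrow> p x = 0" for p q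
    by (rule compact_density_integrable[OF compact_density_continuous[OF
          cinner.continuous_on[OF smooth_on_continuous[OF that(1)] smooth_on_continuous[OF that(2)]] K(2)]])
      (simp add: that(3) cinner.zero_left)
  have s1: "smooth_on UNIV (\<lambda>x. \<gamma> j *v dderiv v f x)" if "smooth_on UNIV f" for j v f
    by (intro smooth_on_bounded_linear_compose[OF bl_\<gamma>] smooth_on_dderiv that open_UNIV)
  have s2: "smooth_on UNIV (\<lambda>x. \<gamma> j *v \<psi> x)" for j
    by (intro smooth_on_bounded_linear_compose[OF bl_\<gamma>] \<psi> open_UNIV)
  have j: "(\<integral>x. cinner (\<gamma> j *v dderiv v F x) (\<psi> x) \<partial>lborel) = (\<integral>x. cinner (F x) (\<gamma> j *v dderiv v \<psi> x) \<partial>lborel)" for j v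
  proof -
    have "(\<integral>x. cinner (\<gamma> j *v dderiv v F x) (\<psi> x) \<partial>lborel) = - (\<integral>x. cinner (dderiv v F x) (\<gamma> j *v \<psi> x) \<partial>lborel)"
      by (simp add: skew)
    also have "(\<integral>x. cinner (dderiv v F x) (\<gamma> j *v \<psi> x) \<partial>lborel) = - (\<integral>x. cinner (F x) (dderiv v (\<lambda>x. \<gamma> j *v \<psi> x) x) \<partial>lborel)"
      by (rule integral_by_parts_bilinear[OF bounded_bilinear_cinner K(1) s2 K(2)]) (simp add: K(3))
    also have "dderiv v (\<lambda>x. \<gamma> j *v \<psi> x) = (\<lambda>x. \<gamma> j *v dderiv v \<psi> x)"
      by (rule ext) (rule dderiv_bounded_linear[OF bl_\<gamma> smooth_on_differentiable[OF \<psi> UNIV_I]])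
    finally show ?thesis by simp
  qed
  have "(\<integral>x. cinner (nabla \<gamma> A F x) (\<psi> x) \<partial>lborel) = (\<Sum>j\<in>UNIV. \<integral>x. cinner (\<gamma> j *v dderiv (coord A j) F x) (\<psi> x) \<partial>lborel)"
    unfolding nabla_dderiv cinner.sum_left
    by (rule Bochner_Integration.integral_sum) (rule int[OF s1[OF K(1)] \<psi>], simp add: z)
  also have "\<dots> = (\<Sum>j\<in>UNIV. \<integral>x. cinner (F x) (\<gamma> j *v dderiv (coord A j) \<psi> x) \<partial>lborel)"
    by (simp only: j)
  also have "\<dots> = (\<integral>x. cinner (F x) (nabla \<gamma> A \<psi> x) \<partial>lborel)"
    unfolding nabla_dderiv cinner.sum_right
    by (rule Bochner_Integration.integral_sum[symmetric]) (rule int[OF K(1) s1[OF \<psi>] K(3)])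
  finally show ?thesis .
qed

text \<open>The formal adjoint of \<open>D1\<close> applied to \<open>C21 (e\<^sub>A \<otimes>
  e\<^sub>B \<otimes> e\<^sub>B) \<psi>\<close>, read off from the component \<open>\<nabla>\<^sub>A
  \<nabla>\<^sub>B F\<^sub>B - \<nabla>\<^sub>B \<nabla>\<^sub>B F\<^sub>A\<close> that this section
  selects.\<close>

definition D1_test_adjoint ::
    "'k::finite \<Rightarrow> 'k \<Rightarrow> (real^'n::{finite,linorder}^'k \<Rightarrow> complex^'s) \<Rightarrow> real^'n::{finite,linorder}^'k \<Rightarrow> complex^'s^'k" where
  "D1_test_adjoint A B \<psi> x = (\<chi> C. if C = B then nabla \<gamma> B (nabla \<gamma> A \<psi>) x
     else if C = A then - nabla \<gamma> B (nabla \<gamma> B \<psi>) x else 0)"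

lemma cinner1_D1_test_adjoint:
  assumes "A \<noteq> B"
  shows "cinner1 G (D1_test_adjoint A B \<psi> x)
    = cinner (G $ B) (nabla \<gamma> B (nabla \<gamma> A \<psi>) x) - cinner (G $ A) (nabla \<gamma> B (nabla \<gamma> B \<psi>) x)"
proof -
  have "cinner1 G (D1_test_adjoint A B \<psi> x) = (\<Sum>C\<in>UNIV. (if C = B then cinner (G $ C) (nabla \<gamma> B (nabla \<gamma> A \<psi>) x) else 0)
     + (if C = A then - cinner (G $ C) (nabla \<gamma> B (nabla \<gamma> B \<psi>) x) else 0))"
    unfolding cinner1_def D1_test_adjoint_def
    using assms by (intro sum.cong refl) (auto simp: cinner.zero_right cinner.minus_right)
  then show ?thesis by (simp add: sum.distrib)
qed

text \<open>The description that defines the adjoint is met by the explicit formula and by nothing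
  else.\<close>

lemma D1_adjoint_elementary:
  fixes \<eta> :: "real^'n::{finite,linorder}^'k::finite \<Rightarrow> real"
  assumes AB: "A \<noteq> B" and \<eta>: "\<eta> \<in> test_functions UNIV" and s: "s \<in> spinor_minus \<gamma>"
  shows "D1_adjoint \<gamma> (\<lambda>x. \<eta> x *\<^sub>R C21 (elementary_tensor A B s)) = D1_test_adjoint A B (\<lambda>x. \<eta> x *\<^sub>R s)"
proof -
  define \<psi> where "\<psi> x = \<eta> x *\<^sub>R s" for x
  obtain K where K: "smooth_on UNIV \<eta>" using compact_sectionsE[OF \<eta>] by metis
  have s\<psi>: "smooth_on UNIV \<psi>" unfolding \<psi>_def[abs_def] by (intro smooth_on_scaleR K open_UNIV smooth_on_const)
  obtain M :: "complex^'s \<Rightarrow> complex^'s" where M: "bounded_linear M" "spinor_minus \<gamma> = {u. M u = 0}"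
    using spinor_minus_linear[of \<gamma>] by blast
  note Ml = bounded_linear.linear[OF M(1)]
  have D\<psi>: "dderiv v \<psi> = (\<lambda>x. dderiv v \<eta> x *\<^sub>R s)" for v
    unfolding \<psi>_def by (rule ext) (rule dderiv_scaleR_const[OF smooth_on_differentiable[OF K UNIV_I]])
  have DD\<psi>: "dderiv v (dderiv w \<psi>) x = dderiv v (dderiv w \<eta>) x *\<^sub>R s" for v w x
    unfolding D\<psi> by (rule dderiv_scaleR_const[OF smooth_on_differentiable[OF smooth_on_dderiv[OF K] UNIV_I]])
  have inS: "nabla \<gamma> P (nabla \<gamma> Q \<psi>) x \<in> spinor_minus \<gamma>" for P Q x
  proof -
    have "M (\<gamma> i *v (\<gamma> j *v (r *\<^sub>R s))) = 0" for i j r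
      using \<gamma>_plus[OF \<gamma>_minus[OF s, of j], of i] M(2) by (simp add: \<gamma>_scaleR linear_scale[OF Ml])
    then show ?thesis unfolding M(2) nabla_nabla[OF s\<psi> UNIV_I] DD\<psi> by (simp add: linear_sum[OF Ml])
  qed
  have sec: "D1_test_adjoint A B \<psi> \<in> sections UNIV (V1 \<gamma>)"
  proof -
    have "smooth_on UNIV (\<lambda>x. if C = B then nabla \<gamma> B (nabla \<gamma> A \<psi>) x
       else if C = A then - nabla \<gamma> B (nabla \<gamma> B \<psi>) x else 0)" for C
      by (cases "C = B"; cases "C = A")
        (simp_all add: smooth_on_uminus smooth_on_nabla s\<psi>)
    then have "smooth_on UNIV (D1_test_adjoint A B \<psi>)"
      unfolding D1_test_adjoint_def[abs_def] by (rule smooth_on_vec_lambda[OF open_UNIV])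
    moreover have "D1_test_adjoint A B \<psi> x \<in> V1 \<gamma>" for x
      using inS M(2) spinor_minus_0[of \<gamma>] by (auto simp: V1_def D1_test_adjoint_def linear_neg[OF Ml])
    ultimately show ?thesis by (simp add: sections_def)
  qed
  have adj: "(LINT x|lborel. cinner3 (D1 \<gamma> F x) (\<eta> x *\<^sub>R C21 (elementary_tensor A B s)))
      = (LINT x|lborel. cinner1 (F x) (D1_test_adjoint A B \<psi> x))" if F: "F \<in> compact_sections UNIV (V1 \<gamma>)" for F
  proof -
    obtain L where L: "smooth_on UNIV F" "compact L" "\<And>x. x \<notin> L \<Longrightarrow> F x = 0" using compact_sectionsE[OF F] by metis
    have FC: "(\<lambda>x. F x $ C) \<in> test_functions UNIV" for C
      by (rule compact_sectionsI[OF smooth_on_nth[OF open_UNIV L(1)] UNIV_I L(2)]) (auto simp: L(3))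
    have int: "integrable lborel (\<lambda>x. cinner (p x) (q x))" if p: "p \<in> test_functions UNIV" and q: "smooth_on UNIV q" for p q
    proof -
      obtain K where K: "smooth_on UNIV p" "compact K" "\<And>x. x \<notin> K \<Longrightarrow> p x = 0" using compact_sectionsE[OF p] by metis
      show ?thesis
        by (rule compact_density_integrable[OF compact_density_continuous[OF
              cinner.continuous_on[OF smooth_on_continuous[OF K(1)] smooth_on_continuous[OF q]] K(2)]])
          (simp add: K(3) cinner.zero_left)
    qed
    have n2: "(\<integral>x. cinner (nabla \<gamma> P (nabla \<gamma> Q (\<lambda>y. F y $ C)) x) (\<psi> x) \<partial>lborel)
        = (\<integral>x. cinner (F x $ C) (nabla \<gamma> Q (nabla \<gamma> P \<psi>) x) \<partial>lborel)" for P Q C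
      using nabla_by_parts[OF nabla_test_functions[OF FC] s\<psi>] nabla_by_parts[OF FC smooth_on_nabla[OF open_UNIV s\<psi>]]
      by simp
    have "(LINT x|lborel. cinner3 (D1 \<gamma> F x) (\<eta> x *\<^sub>R C21 (elementary_tensor A B s)))
       = (\<integral>x. cinner (nabla \<gamma> A (nabla \<gamma> B (\<lambda>y. F y $ B)) x) (\<psi> x) - cinner (nabla \<gamma> B (nabla \<gamma> B (\<lambda>y. F y $ A)) x) (\<psi> x) \<partial>lborel)"
      by (simp only: cinner3_D1 cinner.diff_left \<psi>_def)
    also have "\<dots> = (\<integral>x. cinner (nabla \<gamma> A (nabla \<gamma> B (\<lambda>y. F y $ B)) x) (\<psi> x) \<partial>lborel) - (\<integral>x. cinner (nabla \<gamma> B (nabla \<gamma> B (\<lambda>y. F y $ A)) x) (\<psi> x) \<partial>lborel)"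
      by (intro Bochner_Integration.integral_diff int nabla_test_functions FC s\<psi>)
    also have "\<dots> = (\<integral>x. cinner (F x $ B) (nabla \<gamma> B (nabla \<gamma> A \<psi>) x) \<partial>lborel) - (\<integral>x. cinner (F x $ A) (nabla \<gamma> B (nabla \<gamma> B \<psi>) x) \<partial>lborel)"
      by (simp only: n2)
    also have "\<dots> = (\<integral>x. cinner (F x $ B) (nabla \<gamma> B (nabla \<gamma> A \<psi>) x) - cinner (F x $ A) (nabla \<gamma> B (nabla \<gamma> B \<psi>) x) \<partial>lborel)"
      by (intro Bochner_Integration.integral_diff[symmetric] int FC smooth_on_nabla s\<psi> open_UNIV)
    finally show ?thesis by (simp only: cinner1_D1_test_adjoint[OF AB])
  qed
  show ?thesis unfolding D1_adjoint_def \<psi>_def[abs_def, symmetric]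
  proof (rule the_equality)
    show "D1_test_adjoint A B \<psi> \<in> sections UNIV (V1 \<gamma>) \<and> (\<forall>F\<in>compact_sections UNIV (V1 \<gamma>).
        (LINT x|lborel. cinner3 (D1 \<gamma> F x) (\<eta> x *\<^sub>R C21 (elementary_tensor A B s)))
        = (LINT x|lborel. cinner1 (F x) (D1_test_adjoint A B \<psi> x)))"
      using sec adj by blast
    fix g assume g: "g \<in> sections UNIV (V1 \<gamma>) \<and> (\<forall>F\<in>compact_sections UNIV (V1 \<gamma>).
        (LINT x|lborel. cinner3 (D1 \<gamma> F x) (\<eta> x *\<^sub>R C21 (elementary_tensor A B s)))
        = (LINT x|lborel. cinner1 (F x) (g x)))"
    show "g = D1_test_adjoint A B \<psi>"
      by (rule sections_eq_of_weak_eq[OF conjunct1[OF g] sec]) (use g adj in simp)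
  qed
qed

text \<open>The integrand of the weak form of \<open>\<nabla>\<^sub>A \<nabla>\<^sub>B g\<^sub>B +
  \<Delta>\<^sub>B g\<^sub>A = 0\<close> with \<open>g = D0 F\<close>: all derivatives sit on the
  scalar test function \<open>\<eta>\<close>.\<close>

definition compat :: "(real^'n::{finite,linorder}^'k::finite \<Rightarrow> complex^'s) \<Rightarrow> 'k \<Rightarrow> 'k \<Rightarrow> (real^'n::{finite,linorder}^'k \<Rightarrow> real) \<Rightarrow> real^'n::{finite,linorder}^'k \<Rightarrow> complex^'s" where
  "compat F A B \<eta> x = (\<Sum>i\<in>UNIV. \<Sum>j\<in>UNIV. dderiv (coord A i) (dderiv (coord B j) \<eta>) x *\<^sub>R (\<gamma> i *v (\<gamma> j *v nabla \<gamma> B F x)))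
     + plap B \<eta> x *\<^sub>R nabla \<gamma> A F x"

lemma cinner_compat:
  fixes \<eta> :: "real^'n::{finite,linorder}^'k::finite \<Rightarrow> real"
  assumes AB: "A \<noteq> B" and \<eta>: "smooth_on UNIV \<eta>"
  shows "cinner (compat F A B \<eta> x) s = cinner1 (D0 \<gamma> F x) (D1_test_adjoint A B (\<lambda>x. \<eta> x *\<^sub>R s) x)"
proof -
  define \<psi> where "\<psi> x = \<eta> x *\<^sub>R s" for x
  have s\<psi>: "smooth_on UNIV \<psi>" unfolding \<psi>_def[abs_def] by (intro smooth_on_scaleR \<eta> open_UNIV smooth_on_const)
  have D\<psi>: "dderiv v \<psi> = (\<lambda>x. dderiv v \<eta> x *\<^sub>R s)" for v
    unfolding \<psi>_def by (rule ext) (rule dderiv_scaleR_const[OF smooth_on_differentiable[OF \<eta> UNIV_I]])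
  have DD\<psi>: "dderiv v (dderiv w \<psi>) x = dderiv v (dderiv w \<eta>) x *\<^sub>R s" for v w x
    unfolding D\<psi> by (rule dderiv_scaleR_const[OF smooth_on_differentiable[OF smooth_on_dderiv[OF \<eta>] UNIV_I]])
  have sw: "cinner (\<gamma> i *v (\<gamma> j *v u)) s = cinner u (\<gamma> j *v (\<gamma> i *v s))" for i j u
    by (simp add: skew)
  have "cinner (nabla \<gamma> B F x) (nabla \<gamma> B (nabla \<gamma> A \<psi>) x)
      = (\<Sum>j\<in>UNIV. \<Sum>i\<in>UNIV. dderiv (coord B j) (dderiv (coord A i) \<eta>) x *\<^sub>R cinner (nabla \<gamma> B F x) (\<gamma> j *v (\<gamma> i *v s)))"
    unfolding nabla_nabla[OF s\<psi> UNIV_I] DD\<psi> \<gamma>_scaleR cinner.sum_right cinner.scaleR_right ..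
  also have "\<dots> = (\<Sum>i\<in>UNIV. \<Sum>j\<in>UNIV. dderiv (coord A i) (dderiv (coord B j) \<eta>) x *\<^sub>R cinner (\<gamma> i *v (\<gamma> j *v nabla \<gamma> B F x)) s)"
    unfolding sw by (subst sum.swap)
      (intro sum.cong refl arg_cong2[where f = scaleR] dderiv_symmetric[OF open_UNIV smooth_onD[OF \<eta>] UNIV_I])
  finally have 1: "cinner (nabla \<gamma> B F x) (nabla \<gamma> B (nabla \<gamma> A \<psi>) x) =
      (\<Sum>i\<in>UNIV. \<Sum>j\<in>UNIV. dderiv (coord A i) (dderiv (coord B j) \<eta>) x *\<^sub>R cinner (\<gamma> i *v (\<gamma> j *v nabla \<gamma> B F x)) s)" .
  have "plap B \<psi> x = plap B \<eta> x *\<^sub>R s" unfolding plap_def DD\<psi> scaleR_sum_left ..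
  then have 2: "cinner (nabla \<gamma> A F x) (nabla \<gamma> B (nabla \<gamma> B \<psi>) x) = - (plap B \<eta> x *\<^sub>R cinner (nabla \<gamma> A F x) s)"
    unfolding nabla_square[OF open_UNIV s\<psi> UNIV_I] by (simp add: cinner.minus_right cinner.scaleR_right)
  have "D0 \<gamma> F x $ C = nabla \<gamma> C F x" for C by (simp add: D0_def)
  then have "cinner1 (D0 \<gamma> F x) (D1_test_adjoint A B \<psi> x) =
      cinner (nabla \<gamma> B F x) (nabla \<gamma> B (nabla \<gamma> A \<psi>) x) - cinner (nabla \<gamma> A F x) (nabla \<gamma> B (nabla \<gamma> B \<psi>) x)"
    by (simp only: cinner1_D1_test_adjoint[OF AB])
  then show ?thesis unfolding compat_def \<psi>_def[abs_def, symmetric] 1 2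
    by (simp only: cinner.add_left cinner.sum_left cinner.scaleR_left diff_minus_eq_add)
qed

lemma compat_test_function:
  fixes F :: "real^'n::{finite,linorder}^'k::finite \<Rightarrow> complex^'s"
  assumes W: "open W" and F: "smooth_on W F" and \<eta>: "\<eta> \<in> test_functions W"
  shows "compat F A B \<eta> \<in> test_functions W"
proof -
  have m: "(\<lambda>x. b x *\<^sub>R a x) \<in> test_functions W" if "smooth_on W a" "b \<in> test_functions W"
    for a :: "real^'n::{finite,linorder}^'k::finite \<Rightarrow> complex^'s" and b :: "real^'n::{finite,linorder}^'k \<Rightarrow> real"
    using test_functions_bilinear[OF bounded_bilinear.flip[OF bounded_bilinear_scaleR] W that] .
  show ?thesis unfolding compat_def[abs_def] plap_def[abs_def]
    by (intro test_functions_add test_functions_sum m test_functions_dderiv \<eta> smooth_on_nabla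
        smooth_on_bounded_linear_compose[OF bl_\<gamma>] F W)
qed

text \<open>Testing the \<open>J1\<close> condition with \<open>h = \<eta> C21 (e\<^sub>A \<otimes>
  e\<^sub>B \<otimes> e\<^sub>B) s\<close>. The left side vanishes because \<open>D1 (D0 F) =
  0\<close>. The right side is the pairing of the integral with \<open>s\<close>; as
  \<open>s\<close> ranges over \<open>S\<^sup>-\<close> only, one uses that the integral itself lies
  in \<open>S\<^sup>-\<close> and takes it for \<open>s\<close>.\<close>

lemma weak_compat_near_boundary:
  fixes F :: "real^'n::{finite,linorder}^'k::finite \<Rightarrow> complex^'s"
  assumes AB: "A \<noteq> B" and U: "open U" and \<Omega>: "open \<Omega>" and F: "F \<in> sections U (spinor_plus \<gamma>)"
    and J: "D0 \<gamma> F \<in> J1 \<gamma> \<Omega> U" and \<eta>: "\<eta> \<in> test_functions U"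
  shows "(\<integral>x. indicator \<Omega> x *\<^sub>R compat F A B \<eta> x \<partial>lborel) = 0"
proof -
  obtain K where K: "smooth_on UNIV \<eta>" "compact K" "K \<subseteq> U" "\<And>x. x \<notin> K \<Longrightarrow> \<eta> x = 0" using compact_sectionsE[OF \<eta>] by metis
  have sF: "smooth_on U F" "\<And>x. x \<in> U \<Longrightarrow> F x \<in> spinor_plus \<gamma>" using F by (auto simp: sections_def)
  obtain M :: "complex^'s \<Rightarrow> complex^'s" where M: "bounded_linear M" "spinor_minus \<gamma> = {u. M u = 0}"
    using spinor_minus_linear[of \<gamma>] by blast
  note Ml = bounded_linear.linear[OF M(1)]
  have ct: "compat F A B \<eta> \<in> test_functions U" by (rule compat_test_function[OF U sF(1) \<eta>])
  have int: "integrable lborel (\<lambda>x. indicator \<Omega> x *\<^sub>R compat F A B \<eta> x)"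
    by (rule compact_density_integrable[OF compact_density_indicator[OF test_functions_density[OF ct] borel_open[OF \<Omega>]]])
  define I where "I = (\<integral>x. indicator \<Omega> x *\<^sub>R compat F A B \<eta> x \<partial>lborel)"
  have inS: "M (compat F A B \<eta> x) = 0" for x
  proof (cases "x \<in> U")
    case True
    have n: "nabla \<gamma> C F x \<in> spinor_minus \<gamma>" for C by (rule nabla_in_minus[OF U True sF])
    then have "M (nabla \<gamma> C F x) = 0" "M (\<gamma> i *v (\<gamma> j *v nabla \<gamma> C F x)) = 0" for C i j
      using \<gamma>_plus[OF \<gamma>_minus[OF n]] M(2) by blast+
    then show ?thesis unfolding compat_def
      by (simp add: linear_add[OF Ml] linear_sum[OF Ml] linear_scale[OF Ml])
  next
    case False
    then have "compat F A B \<eta> x = 0" using compact_sectionsE[OF ct] by (metis subsetD)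
    then show ?thesis by (simp add: linear_0[OF Ml])
  qed
  have "M I = (\<integral>x. M (indicator \<Omega> x *\<^sub>R compat F A B \<eta> x) \<partial>lborel)"
    unfolding I_def by (rule integral_bounded_linear[OF M(1) int, symmetric])
  then have IS: "I \<in> spinor_minus \<gamma>" unfolding M(2) by (simp add: linear_scale[OF Ml] inS)
  have "cinner I s = 0" if s: "s \<in> spinor_minus \<gamma>" for s
  proof -
    define h where "h x = \<eta> x *\<^sub>R C21 (elementary_tensor A B s)" for x
    have hV: "h x \<in> V2 \<gamma>" for x
    proof -
      have "h x = C21 (\<eta> x *\<^sub>R elementary_tensor A B s)"
        by (simp add: h_def C21_def vec_eq_iff algebra_simps)
      moreover have "(\<eta> x *\<^sub>R elementary_tensor A B s) $ P $ Q $ R \<in> spinor_minus \<gamma>" for P Q R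
        using s spinor_minus_0[of \<gamma>] by (auto simp: elementary_tensor_def M(2) linear_scale[OF Ml])
      ultimately show ?thesis unfolding V2_def by blast
    qed
    have "h \<in> compact_sections U (V2 \<gamma>)"
    proof (rule compact_sectionsI[OF _ hV K(2,3)])
      show "smooth_on UNIV h" unfolding h_def[abs_def] by (intro smooth_on_scaleR K(1) open_UNIV smooth_on_const)
    qed (simp add: h_def K(4))
    then have eq: "(LINT x:\<Omega>|lborel. cinner3 (D1 \<gamma> (D0 \<gamma> F) x) (h x)) = (LINT x:\<Omega>|lborel. cinner1 (D0 \<gamma> F x) (D1_adjoint \<gamma> h x))"
      using J unfolding J1_def by blast
    have "cinner3 (D1 \<gamma> (D0 \<gamma> F) x) (h x) = 0" for x
    proof (cases "x \<in> U")
      case True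
      have "(\<lambda>y. D0 \<gamma> F y $ C) = nabla \<gamma> C F" for C by (rule ext) (simp add: D0_def)
      then show ?thesis unfolding h_def cinner3_D1
        using nabla_square_commute[OF U sF(1) True, of A B] by (simp add: cinner.zero_left)
    next
      case False
      then have "h x = 0" using K(3,4) by (auto simp: h_def)
      then show ?thesis by (simp only: cinner3_zero)
    qed
    then have 0: "(LINT x:\<Omega>|lborel. cinner1 (D0 \<gamma> F x) (D1_adjoint \<gamma> h x)) = 0" using eq by (simp add: set_lebesgue_integral_def)
    have adj: "D1_adjoint \<gamma> h = D1_test_adjoint A B (\<lambda>x. \<eta> x *\<^sub>R s)"
      unfolding h_def[abs_def] by (rule D1_adjoint_elementary[OF AB test_functions_mono[OF \<eta>] s]) simp
    have "cinner I s = (\<integral>x. cinner (indicator \<Omega> x *\<^sub>R compat F A B \<eta> x) s \<partial>lborel)"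
      unfolding I_def by (rule integral_bounded_linear[OF cinner.bounded_linear_left int, symmetric])
    also have "\<dots> = (LINT x:\<Omega>|lborel. cinner1 (D0 \<gamma> F x) (D1_adjoint \<gamma> h x))"
      unfolding set_lebesgue_integral_def adj cinner.scaleR_left cinner_compat[OF AB K(1)] ..
    finally show ?thesis using 0 by simp
  qed
  \<comment> \<open>the integral is tested against itself\<close>
  from this[OF IS] have "I = 0" by (simp only: cinner_self_eq_0)
  then show ?thesis by (simp only: I_def)
qed

text \<open>Without a jump the derivatives can be moved back to \<open>F\<close>, where they
  cancel.\<close>

lemma integral_compat_eq_0:
  fixes F :: "real^'n::{finite,linorder}^'k::finite \<Rightarrow> complex^'s"
  assumes F: "smooth_on UNIV F" and \<eta>: "\<eta> \<in> test_functions UNIV"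
  shows "(\<integral>x. compat F A B \<eta> x \<partial>lborel) = 0"
proof -
  have sn: "smooth_on UNIV (nabla \<gamma> C F)" for C by (rule smooth_on_nabla[OF open_UNIV F])
  have m: "(\<lambda>x. b x *\<^sub>R a x) \<in> test_functions UNIV" if "smooth_on UNIV a" "b \<in> test_functions UNIV"
    for a :: "real^'n::{finite,linorder}^'k::finite \<Rightarrow> complex^'s" and b :: "real^'n::{finite,linorder}^'k \<Rightarrow> real"
    using test_functions_bilinear[OF bounded_bilinear.flip[OF bounded_bilinear_scaleR] open_UNIV that] .
  have sg: "smooth_on UNIV (\<lambda>x. \<gamma> i *v (\<gamma> j *v G x))" if "smooth_on UNIV G" for i j and G :: "real^'n::{finite,linorder}^'k \<Rightarrow> complex^'s"
    by (intro smooth_on_bounded_linear_compose[OF bl_\<gamma>] that open_UNIV)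
  have bl2: "bounded_linear (\<lambda>u. \<gamma> i *v (\<gamma> j *v u))" for i j by (rule bounded_linear_compose[OF bl_\<gamma> bl_\<gamma>])
  have dg: "dderiv w (dderiv v (\<lambda>x. \<gamma> i *v (\<gamma> j *v G x))) x = \<gamma> i *v (\<gamma> j *v dderiv w (dderiv v G) x)"
    if G: "smooth_on UNIV G" for v w i j x and G :: "real^'n::{finite,linorder}^'k \<Rightarrow> complex^'s"
  proof -
    have "dderiv v (\<lambda>x. \<gamma> i *v (\<gamma> j *v G x)) = (\<lambda>x. \<gamma> i *v (\<gamma> j *v dderiv v G x))"
      by (rule ext) (rule dderiv_bounded_linear[OF bl2 smooth_on_differentiable[OF G UNIV_I]])
    then show ?thesis
      using dderiv_bounded_linear[OF bl2 smooth_on_differentiable[OF smooth_on_dderiv[OF G] UNIV_I]] by simp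
  qed
  have i1: "integrable lborel (\<lambda>x. dderiv v (dderiv w \<eta>) x *\<^sub>R G x)" if "smooth_on UNIV G" for v w and G :: "real^'n::{finite,linorder}^'k \<Rightarrow> complex^'s"
    by (intro test_functions_integrable[where W = UNIV and E = UNIV] m that test_functions_dderiv \<eta>)
  have i2: "integrable lborel (\<lambda>x. \<eta> x *\<^sub>R G x)" if "smooth_on UNIV G" for G :: "real^'n::{finite,linorder}^'k \<Rightarrow> complex^'s"
    by (intro test_functions_integrable[where W = UNIV and E = UNIV] m that \<eta>)
  have a: "(\<integral>x. (\<Sum>i\<in>UNIV. \<Sum>j\<in>UNIV. dderiv (coord A i) (dderiv (coord B j) \<eta>) x *\<^sub>R (\<gamma> i *v (\<gamma> j *v nabla \<gamma> B F x))) \<partial>lborel)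
      = (\<integral>x. \<eta> x *\<^sub>R nabla \<gamma> A (nabla \<gamma> B (nabla \<gamma> B F)) x \<partial>lborel)"
  proof -
    have "(\<integral>x. (\<Sum>i\<in>UNIV. \<Sum>j\<in>UNIV. dderiv (coord A i) (dderiv (coord B j) \<eta>) x *\<^sub>R (\<gamma> i *v (\<gamma> j *v nabla \<gamma> B F x))) \<partial>lborel)
      = (\<Sum>i\<in>UNIV. \<Sum>j\<in>UNIV. \<integral>x. dderiv (coord A i) (dderiv (coord B j) \<eta>) x *\<^sub>R (\<gamma> i *v (\<gamma> j *v nabla \<gamma> B F x)) \<partial>lborel)"
      by (subst Bochner_Integration.integral_sum, intro Bochner_Integration.integrable_sum i1 sg sn,
          intro sum.cong refl Bochner_Integration.integral_sum i1 sg sn)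
    also have "\<dots> = (\<Sum>i\<in>UNIV. \<Sum>j\<in>UNIV. \<integral>x. \<eta> x *\<^sub>R (\<gamma> i *v (\<gamma> j *v dderiv (coord A i) (dderiv (coord B j) (nabla \<gamma> B F)) x)) \<partial>lborel)"
    proof (intro sum.cong refl)
      fix i j
      have "(\<integral>x. dderiv (coord A i) (dderiv (coord B j) \<eta>) x *\<^sub>R (\<gamma> i *v (\<gamma> j *v nabla \<gamma> B F x)) \<partial>lborel)
          = (\<integral>x. \<eta> x *\<^sub>R (\<gamma> i *v (\<gamma> j *v dderiv (coord B j) (dderiv (coord A i) (nabla \<gamma> B F)) x)) \<partial>lborel)"
        by (simp only: integral_by_parts_twice[OF \<eta> sg[OF sn]] dg[OF sn])
      then show "(\<integral>x. dderiv (coord A i) (dderiv (coord B j) \<eta>) x *\<^sub>R (\<gamma> i *v (\<gamma> j *v nabla \<gamma> B F x)) \<partial>lborel)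
          = (\<integral>x. \<eta> x *\<^sub>R (\<gamma> i *v (\<gamma> j *v dderiv (coord A i) (dderiv (coord B j) (nabla \<gamma> B F)) x)) \<partial>lborel)"
        by (simp only: dderiv_symmetric[OF open_UNIV smooth_onD[OF sn] UNIV_I, of "coord A i"])
    qed
    also have "\<dots> = (\<integral>x. (\<Sum>i\<in>UNIV. \<Sum>j\<in>UNIV. \<eta> x *\<^sub>R (\<gamma> i *v (\<gamma> j *v dderiv (coord A i) (dderiv (coord B j) (nabla \<gamma> B F)) x))) \<partial>lborel)"
      by (subst Bochner_Integration.integral_sum, intro Bochner_Integration.integrable_sum i2 sg smooth_on_dderiv sn,
          intro sum.cong refl Bochner_Integration.integral_sum[symmetric] i2 sg smooth_on_dderiv sn)
    finally show ?thesis by (simp only: nabla_nabla[OF sn UNIV_I] scaleR_sum_right)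
  qed
  have b: "(\<integral>x. plap B \<eta> x *\<^sub>R nabla \<gamma> A F x \<partial>lborel) = (\<integral>x. \<eta> x *\<^sub>R plap B (nabla \<gamma> A F) x \<partial>lborel)"
  proof -
    have "(\<integral>x. plap B \<eta> x *\<^sub>R nabla \<gamma> A F x \<partial>lborel) = (\<Sum>j\<in>UNIV. \<integral>x. dderiv (coord B j) (dderiv (coord B j) \<eta>) x *\<^sub>R nabla \<gamma> A F x \<partial>lborel)"
      unfolding plap_def scaleR_sum_left by (intro Bochner_Integration.integral_sum i1 sn)
    also have "\<dots> = (\<Sum>j\<in>UNIV. \<integral>x. \<eta> x *\<^sub>R dderiv (coord B j) (dderiv (coord B j) (nabla \<gamma> A F)) x \<partial>lborel)"
      by (simp only: integral_by_parts_twice[OF \<eta> sn])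
    also have "\<dots> = (\<integral>x. \<eta> x *\<^sub>R plap B (nabla \<gamma> A F) x \<partial>lborel)"
      unfolding plap_def scaleR_sum_right by (intro Bochner_Integration.integral_sum[symmetric] i2 smooth_on_dderiv sn)
    finally show ?thesis .
  qed
  have "(\<integral>x. compat F A B \<eta> x \<partial>lborel)
     = (\<integral>x. (\<Sum>i\<in>UNIV. \<Sum>j\<in>UNIV. dderiv (coord A i) (dderiv (coord B j) \<eta>) x *\<^sub>R (\<gamma> i *v (\<gamma> j *v nabla \<gamma> B F x))) \<partial>lborel)
      + (\<integral>x. plap B \<eta> x *\<^sub>R nabla \<gamma> A F x \<partial>lborel)"
    unfolding compat_def
  proof (rule Bochner_Integration.integral_add)
    show "integrable lborel (\<lambda>x. \<Sum>i\<in>UNIV. \<Sum>j\<in>UNIV. dderiv (coord A i) (dderiv (coord B j) \<eta>) x *\<^sub>R (\<gamma> i *v (\<gamma> j *v nabla \<gamma> B F x)))"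
      by (intro Bochner_Integration.integrable_sum i1 sg sn)
    show "integrable lborel (\<lambda>x. plap B \<eta> x *\<^sub>R nabla \<gamma> A F x)"
      unfolding plap_def scaleR_sum_left by (intro Bochner_Integration.integrable_sum i1 sn)
  qed
  also have "\<dots> = (\<integral>x. \<eta> x *\<^sub>R nabla \<gamma> B (nabla \<gamma> B (nabla \<gamma> A F)) x \<partial>lborel) + (\<integral>x. \<eta> x *\<^sub>R plap B (nabla \<gamma> A F) x \<partial>lborel)"
    unfolding a b by (simp only: nabla_square_commute[OF open_UNIV F UNIV_I, where A = A and B = B])
  also have "\<dots> = 0" by (simp add: nabla_square[OF open_UNIV sn UNIV_I])
  finally show ?thesis .
qed

text \<open>A test function is split into a part supported near the boundary, where the hypothesis
  applies, and a part vanishing near the boundary. The latter, restricted to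
  \<open>\<Omega>\<close>, is a test function on the whole space.\<close>

lemma weak_compat:
  fixes F F1 :: "real^'n::{finite,linorder}^'k::finite \<Rightarrow> complex^'s"
  assumes U: "open U" and \<Omega>: "open \<Omega>" "bounded \<Omega>" and F: "F \<in> sections U (spinor_plus \<gamma>)"
    and J: "D0 \<gamma> F \<in> J1 \<gamma> \<Omega> U"
    and F1: "smooth_on UNIV F1" and U': "open U'" "frontier \<Omega> \<subseteq> U'" "U' \<subseteq> U" "\<And>x. x \<in> U' \<Longrightarrow> F1 x = F x"
    and \<eta>: "\<eta> \<in> test_functions UNIV"
  shows "(\<integral>x. indicator \<Omega> x *\<^sub>R compat F1 A B \<eta> x \<partial>lborel) = 0"
proof (cases "A = B")
  case True
  obtain K where K: "smooth_on UNIV \<eta>" using compact_sectionsE[OF \<eta>] by metis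
  have "compat F1 A B \<eta> x = 0" for x
    unfolding compat_def True plap_def
    by (subst clifford_symmetric_sum) (rule dderiv_symmetric[OF open_UNIV smooth_onD[OF K] UNIV_I], simp)
  then show ?thesis by simp
next
  case AB: False
  obtain K where K: "smooth_on UNIV \<eta>" "compact K" "\<And>x. x \<notin> K \<Longrightarrow> \<eta> x = 0" using compact_sectionsE[OF \<eta>] by metis
  have cf: "compact (frontier \<Omega>)" using \<Omega>(2) by (rule compact_frontier_bounded)
  obtain \<kappa> :: "real^'n::{finite,linorder}^'k \<Rightarrow> real" and V L where \<kappa>: "smooth_on UNIV \<kappa>" "open V" "frontier \<Omega> \<subseteq> V" "\<And>x. x \<in> V \<Longrightarrow> \<kappa> x = 1"
    "compact L" "L \<subseteq> U'" "\<And>x. x \<notin> L \<Longrightarrow> \<kappa> x = 0"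
    by (rule exists_smooth_cutoff[OF cf U'(1,2)]) (rule that; assumption)
  define \<eta>1 where "\<eta>1 x = \<kappa> x * \<eta> x" for x
  define \<eta>2 where "\<eta>2 x = (1 - \<kappa> x) * \<eta> x" for x
  \<comment> \<open>restricting \<open>\<eta>2\<close> to \<open>\<Omega>\<close> keeps it smooth,
    because it vanishes near the boundary\<close>
  define \<eta>3 where "\<eta>3 x = indicator \<Omega> x * \<eta>2 x" for x
  have s1: "smooth_on UNIV \<eta>1" unfolding \<eta>1_def[abs_def] by (intro smooth_on_mult \<kappa>(1) K(1) open_UNIV)
  have s2: "smooth_on UNIV \<eta>2" unfolding \<eta>2_def[abs_def] by (intro smooth_on_mult smooth_on_diff smooth_on_const \<kappa>(1) K(1) open_UNIV)
  have t1: "\<eta>1 \<in> test_functions U'" by (rule compact_sectionsI[OF s1 UNIV_I \<kappa>(5,6)]) (simp add: \<eta>1_def \<kappa>(7))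
  have t2: "\<eta>2 \<in> test_functions UNIV" by (rule compact_sectionsI[OF s2 UNIV_I K(2)]) (auto simp: \<eta>2_def K(3))
  have out: "open (V \<union> - closure \<Omega>)" using \<kappa>(2) by (intro open_Un open_Compl) auto
  have z3: "\<eta>3 x = 0" if "x \<in> V \<union> - closure \<Omega>" for x
    using that \<kappa>(4) closure_subset[of \<Omega>] by (auto simp: \<eta>3_def \<eta>2_def indicator_def)
  have cover: "x \<in> V \<union> - closure \<Omega>" if "x \<notin> \<Omega>" for x
    using that \<kappa>(3) \<Omega>(1) by (auto simp: frontier_def interior_open)
  have s3: "smooth_on UNIV \<eta>3"
  proof (rule smooth_on_local)
    fix p :: "real^'n::{finite,linorder}^'k"
    show "\<exists>W. open W \<and> p \<in> W \<and> smooth_on W \<eta>3"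
    proof (cases "p \<in> \<Omega>")
      case True
      have "smooth_on \<Omega> \<eta>3"
        by (rule smooth_on_cong[OF \<Omega>(1) _ smooth_on_subset[OF s2 subset_UNIV]]) (simp add: \<eta>3_def)
      then show ?thesis using True \<Omega>(1) by blast
    next
      case False
      have "smooth_on (V \<union> - closure \<Omega>) \<eta>3"
        by (rule smooth_on_cong[OF out _ smooth_on_const[of _ 0]]) (simp add: z3)
      then show ?thesis using cover[OF False] out by blast
    qed
  qed
  have t3: "\<eta>3 \<in> test_functions UNIV"
    by (rule compact_sectionsI[OF s3 UNIV_I K(2)]) (auto simp: \<eta>3_def \<eta>2_def K(3))
  have dd: "dderiv v (dderiv w \<eta>) x = dderiv v (dderiv w \<eta>1) x + dderiv v (dderiv w \<eta>2) x" for v w x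
  proof -
    have "\<eta> = (\<lambda>x. \<eta>1 x + \<eta>2 x)" by (rule ext) (simp add: \<eta>1_def \<eta>2_def algebra_simps)
    then have "dderiv w \<eta> = (\<lambda>x. dderiv w \<eta>1 x + dderiv w \<eta>2 x)"
      using dderiv_add[OF smooth_on_differentiable[OF s1 UNIV_I] smooth_on_differentiable[OF s2 UNIV_I]] by auto
    then show ?thesis
      using dderiv_add[OF smooth_on_differentiable[OF smooth_on_dderiv[OF s1] UNIV_I] smooth_on_differentiable[OF smooth_on_dderiv[OF s2] UNIV_I]] by simp
  qed
  have split: "compat F1 A B \<eta> x = compat F1 A B \<eta>1 x + compat F1 A B \<eta>2 x" for x
    unfolding compat_def plap_def dd by (simp add: scaleR_add_left sum.distrib)
  have c1: "compat F1 A B \<eta>1 x = compat F A B \<eta>1 x" for x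
  proof (cases "x \<in> U'")
    case True
    have "nabla \<gamma> C F1 x = nabla \<gamma> C F x" for C by (rule nabla_transform_open[OF U'(1) True U'(4)])
    then show ?thesis by (simp add: compat_def)
  next
    case False
    have dz: "dderiv v (dderiv w \<eta>1) x = 0" for v w
      using compact_sectionsE[OF test_functions_dderiv[OF test_functions_dderiv[OF t1]]] False by (metis subsetD)
    show ?thesis by (simp add: compat_def plap_def dz)
  qed
  have c2: "indicator \<Omega> x *\<^sub>R compat F1 A B \<eta>2 x = compat F1 A B \<eta>3 x" for x
  proof (cases "x \<in> \<Omega>")
    case True
    have "dderiv v (dderiv w \<eta>2) x = dderiv v (dderiv w \<eta>3) x" for v w
      by (intro dderiv_transform_open[OF \<Omega>(1) True] dderiv_transform_open[OF \<Omega>(1)]) (auto simp: \<eta>3_def)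
    then show ?thesis using True by (simp add: compat_def plap_def)
  next
    case False
    have "dderiv v (dderiv w \<eta>3) x = 0" for v w
    proof -
      have cl: "closed (- (V \<union> - closure \<Omega>))" using out by (rule closed_Compl)
      have "dderiv w \<eta>3 y = 0" if "y \<notin> - (V \<union> - closure \<Omega>)" for y
        by (rule dderiv_zero_outside[OF cl _ that]) (simp add: z3)
      then show ?thesis by (rule dderiv_zero_outside[OF cl]) (use cover[OF False] in auto)
    qed
    then show ?thesis using False by (simp add: compat_def plap_def)
  qed
  have i: "integrable lborel (\<lambda>x. indicator \<Omega> x *\<^sub>R compat F1 A B e x)" if "e \<in> test_functions UNIV" for e
    by (rule compact_density_integrable[OF compact_density_indicator[OF
        test_functions_density[OF compat_test_function[OF open_UNIV F1 that]] borel_open[OF \<Omega>(1)]]])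
  have "(\<integral>x. indicator \<Omega> x *\<^sub>R compat F1 A B \<eta> x \<partial>lborel)
      = (\<integral>x. indicator \<Omega> x *\<^sub>R compat F1 A B \<eta>1 x \<partial>lborel) + (\<integral>x. indicator \<Omega> x *\<^sub>R compat F1 A B \<eta>2 x \<partial>lborel)"
    unfolding split scaleR_add_right
    by (intro Bochner_Integration.integral_add i t2 test_functions_mono[OF t1]) simp
  also have "(\<integral>x. indicator \<Omega> x *\<^sub>R compat F1 A B \<eta>1 x \<partial>lborel) = 0"
    unfolding c1 by (rule weak_compat_near_boundary[OF AB U \<Omega>(1) F J test_functions_mono[OF t1 U'(3)]])
  also have "(\<integral>x. indicator \<Omega> x *\<^sub>R compat F1 A B \<eta>2 x \<partial>lborel) = 0"
    unfolding c2 by (rule integral_compat_eq_0[OF F1 t3])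
  finally show ?thesis by simp
qed

end

section \<open>Smoothness up to the boundary\<close>

lemma choice2: "(\<And>a b. \<exists>x. P a b x) \<Longrightarrow> \<exists>f. \<forall>a b. P a b (f a b)"
  by metis

lemma iterated_deriv_eq:
  fixes f :: "'a::real_normed_vector \<Rightarrow> 'b::real_normed_vector"
  shows "iterated_deriv vs f = foldr dderiv vs f"
proof -
  have "(\<lambda>v (g :: 'a \<Rightarrow> 'b) x. frechet_derivative g (at x) v) = dderiv" by (intro ext) (simp add: dderiv_def)
  then show ?thesis unfolding iterated_deriv_def by (rule arg_cong)
qed

lemma Cm_on_foldr_dderiv: "Cm_on (m + length vs) U f \<Longrightarrow> Cm_on m U (foldr dderiv vs f)"
proof (induction vs arbitrary: m)
  case (Cons v vs)
  have "Cm_on (Suc m) U (foldr dderiv vs f)" by (rule Cons.IH) (use Cons.prems in simp)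
  then show ?case by (simp add: Cm_on_Suc_iff)
qed simp

lemma foldr_dderiv_transform:
  assumes "open U" "x \<in> U" "\<And>y. y \<in> U \<Longrightarrow> f y = g y"
  shows "foldr dderiv vs f x = foldr dderiv vs g x"
  using assms(2)
proof (induction vs arbitrary: x)
  case (Cons v vs)
  show ?case using dderiv_transform_open[OF assms(1) Cons.prems Cons.IH] by simp
qed (use assms in auto)

text \<open>The extension is given by limits from inside; near each boundary point it must agree
  with the local extension that exists there.\<close>

lemma continuous_extension_to_closure:
  fixes D :: "'a::euclidean_space \<Rightarrow> 'b::euclidean_space"
  assumes \<Omega>: "open \<Omega>" and D: "continuous_on \<Omega> D"
    and loc: "\<And>p. p \<in> frontier \<Omega> \<Longrightarrow> \<exists>B H. open B \<and> p \<in> B \<and> continuous_on B H \<and> (\<forall>x\<in>\<Omega> \<inter> B. D x = H x)"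
  shows "\<exists>G. continuous_on (closure \<Omega>) G \<and> (\<forall>x\<in>\<Omega>. G x = D x)"
proof -
  have loc': "\<exists>B H. open B \<and> p \<in> B \<and> continuous_on B H \<and> (\<forall>x\<in>\<Omega> \<inter> B. D x = H x)" if "p \<in> closure \<Omega>" for p
  proof (cases "p \<in> \<Omega>")
    case True
    then show ?thesis using \<Omega> D by (intro exI[of _ \<Omega>] exI[of _ D]) auto
  next
    case False
    then show ?thesis using loc[of p] that \<Omega> by (simp add: frontier_def interior_open)
  qed
  define G where "G x = Lim (at x within \<Omega>) D" for x
  have GH: "G x = H x" if B: "open B" "continuous_on B H" "\<forall>x\<in>\<Omega> \<inter> B. D x = H x" and x: "x \<in> closure \<Omega>" "x \<in> B" for B H x
  proof -
    have nt: "at x within \<Omega> \<noteq> bot"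
    proof (cases "x \<in> \<Omega>")
      case True
      then show ?thesis using at_within_open[OF True \<Omega>] by simp
    next
      case False
      then have "x islimpt \<Omega>" using x(1) by (auto simp: closure_def)
      then show ?thesis by (simp add: trivial_limit_within)
    qed
    have "isCont H x" using B(1,2) x(2) continuous_on_eq_continuous_at by blast
    then have "(H \<longlongrightarrow> H x) (at x within \<Omega>)" by (meson isCont_def tendsto_within_subset subset_UNIV)
    moreover have "\<forall>\<^sub>F y in at x within \<Omega>. H y = D y"
      using eventually_at_topological B(1,3) x(2) by (smt (verit) IntI)
    ultimately have "(D \<longlongrightarrow> H x) (at x within \<Omega>)" by (rule Lim_transform_eventually)
    then show ?thesis unfolding G_def by (rule tendsto_Lim[OF nt])
  qed
  have "continuous_on (closure \<Omega>) G"
    unfolding continuous_on_eq_continuous_within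
  proof
    fix p assume p: "p \<in> closure \<Omega>"
    obtain B H where B: "open B" "p \<in> B" "continuous_on B H" "\<forall>x\<in>\<Omega> \<inter> B. D x = H x" using loc'[OF p] by blast
    have "isCont H p" using B(1-3) continuous_on_eq_continuous_at by blast
    then have "continuous (at p within closure \<Omega>) H" by (rule continuous_at_imp_continuous_at_within)
    moreover have "\<forall>\<^sub>F y in at p within closure \<Omega>. H y = G y"
      using eventually_at_topological[of "\<lambda>y. H y = G y" p "closure \<Omega>"] B(1,2) GH[OF B(1,3,4)] by metis
    ultimately show "continuous (at p within closure \<Omega>) G"
      unfolding continuous_within using GH[OF B(1,3,4) p B(2)] Lim_transform_eventually by fastforce
  qed
  moreover have "G x = D x" if "x \<in> \<Omega>" for x
    by (rule GH[OF \<Omega> D]) (use that closure_subset in auto)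
  ultimately show ?thesis by blast
qed

lemma smooth_up_to_boundaryI:
  fixes f :: "'a::euclidean_space \<Rightarrow> 'b::euclidean_space"
  assumes \<Omega>: "open \<Omega>" and f: "smooth_on \<Omega> f" and c: "continuous_on (closure \<Omega>) f"
    and loc: "\<And>p m. p \<in> frontier \<Omega> \<Longrightarrow> \<exists>B H. open B \<and> p \<in> B \<and> Cm_on m B H \<and> (\<forall>x\<in>\<Omega> \<inter> B. f x = H x)"
  shows "smooth_up_to_boundary \<Omega> f"
  unfolding smooth_up_to_boundary_def iterated_deriv_eq
proof (intro conjI allI f c)
  fix vs :: "'a list"
  show "\<exists>G. continuous_on (closure \<Omega>) G \<and> (\<forall>x\<in>\<Omega>. G x = foldr dderiv vs f x)"
  proof (rule continuous_extension_to_closure[OF \<Omega>])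
    show "continuous_on \<Omega> (foldr dderiv vs f)"
      using Cm_on_foldr_dderiv[of 0 vs \<Omega> f] smooth_onD[OF f] by simp
    fix p assume "p \<in> frontier \<Omega>"
    then obtain B H where B: "open B" "p \<in> B" "Cm_on (length vs) B H" "\<forall>x\<in>\<Omega> \<inter> B. f x = H x" using loc by blast
    have "continuous_on B (foldr dderiv vs H)" using Cm_on_foldr_dderiv[of 0 vs B H] B(3) by simp
    moreover have "foldr dderiv vs f x = foldr dderiv vs H x" if "x \<in> \<Omega> \<inter> B" for x
      by (rule foldr_dderiv_transform[OF open_Int[OF \<Omega> B(1)] that]) (use B(4) in blast)
    ultimately show "\<exists>B H. open B \<and> p \<in> B \<and> continuous_on B H \<and> (\<forall>x\<in>\<Omega> \<inter> B. foldr dderiv vs f x = H x)"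
      using B(1,2) by blast
  qed
qed

text \<open>Moving from \<open>p\<close> in a direction in which the defining function increases
  leads to exterior points at once.\<close>

lemma smooth_boundary_exterior:
  fixes \<Omega> :: "'a::euclidean_space set"
  assumes "smooth_boundary \<Omega>" "open \<Omega>" "p \<in> frontier \<Omega>"
  shows "p \<in> closure (- closure \<Omega>)"
proof -
  obtain W \<phi> where W: "boundary_patch \<Omega> W \<phi>" "p \<in> W" "\<phi> p = 0" using exists_boundary_patch[OF assms] by metis
  interpret boundary_patch \<Omega> W \<phi> by (rule W(1))
  obtain v0 where v0: "dderiv v0 \<phi> p \<noteq> 0" using gradient[OF W(2)] by blast
  have d: "(\<phi> has_derivative (\<lambda>v. dderiv v \<phi> p)) (at p)" by (rule smooth_on_has_derivative[OF smooth_\<phi> UNIV_I])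
  note lin = has_derivative_linear[OF d]
  define v where "v = (if dderiv v0 \<phi> p > 0 then v0 else - v0)"
  have v: "dderiv v \<phi> p > 0" using v0 linear_neg[OF lin, of v0] by (auto simp: v_def)
  have dl: "((\<lambda>t. p + t *\<^sub>R v) has_derivative (\<lambda>h. h *\<^sub>R v)) (at 0)" by (auto intro!: derivative_eq_intros)
  have "((\<lambda>t. \<phi> (p + t *\<^sub>R v)) has_real_derivative dderiv v \<phi> p) (at 0)"
  proof (rule has_derivative_imp_has_field_derivative)
    show "((\<lambda>t. \<phi> (p + t *\<^sub>R v)) has_derivative (\<lambda>h. dderiv (h *\<^sub>R v) \<phi> p)) (at 0)"
      by (rule has_derivative_compose[where f = "\<lambda>t. p + t *\<^sub>R v" and g = \<phi>, OF dl]) (use d in simp)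
  qed (simp add: linear_scale[OF lin])
  then obtain \<delta> where \<delta>: "\<delta> > 0" "\<And>h. h > 0 \<Longrightarrow> h < \<delta> \<Longrightarrow> \<phi> (p + 0 *\<^sub>R v) < \<phi> (p + (0 + h) *\<^sub>R v)"
    using DERIV_pos_inc_right[OF _ v] by blast
  have ext: "x \<notin> closure \<Omega>" if x: "x \<in> W" "\<phi> x > 0" for x
  proof -
    have "open (W \<inter> {x. \<phi> x > 0})" using open_W smooth_on_continuous[OF smooth_\<phi>]
      by (intro open_Int open_Collect_less) (auto intro: continuous_intros)
    moreover have "W \<inter> {x. \<phi> x > 0} \<inter> \<Omega> = {}" using half by fastforce
    ultimately show ?thesis using x open_Int_closure_eq_empty by blast
  qed
  show ?thesis unfolding closure_approachable
  proof (intro allI impI)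
    fix e :: real assume e: "e > 0"
    obtain r where r: "r > 0" "ball p r \<subseteq> W" using openE[OF open_W W(2)] .
    \<comment> \<open>a step so short that it stays in \<open>W\<close>, within distance
      \<open>e\<close>, and where \<open>\<phi>\<close> is still increasing\<close>
    define h where "h = min (\<delta> / 2) (min e r / (2 * (norm v + 1)))"
    have nv: "norm v + 1 > 0" by (simp add: add_nonneg_pos)
    have "min e r / (2 * (norm v + 1)) > 0" using e r(1) nv by simp
    then have h: "h > 0" "h < \<delta>" using \<delta>(1) min.cobounded1[of "\<delta> / 2" "min e r / (2 * (norm v + 1))"]
      unfolding h_def by linarith+
    have "h * norm v \<le> (min e r / (2 * (norm v + 1))) * (norm v + 1)" using h(1) by (intro mult_mono) (auto simp: h_def)
    also have "\<dots> = min e r / 2"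
    proof -
      have "a / (2 * n) * n = a / 2" if "n > 0" for a n :: real using that by simp
      then show ?thesis using nv by blast
    qed
    also have "\<dots> < min e r" using e r(1) by (cases "e \<le> r") auto
    finally have hd: "dist (p + h *\<^sub>R v) p < min e r" using h(1) by (simp add: dist_norm)
    then have "p + h *\<^sub>R v \<in> W" using r(2) by (auto simp: dist_commute)
    moreover have "\<phi> (p + h *\<^sub>R v) > 0" using \<delta>(2)[OF h] W(3) by simp
    ultimately have "p + h *\<^sub>R v \<in> - closure \<Omega>" using ext by simp
    then show "\<exists>y\<in>- closure \<Omega>. dist y p < e" using hd by (intro bexI[of _ "p + h *\<^sub>R v"]) auto
  qed
qed

section \<open>The Dirac potential\<close>

text \<open>The situation reached once the boundary data are extended to a compactly supported
  function: tangential monogenicity has become the weak compatibility condition.\<close>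

locale dirac_extension_data = clifford_module \<gamma>
  for \<gamma> :: "'n::{finite,linorder} \<Rightarrow> complex^'s^'s" +
  fixes \<Omega> :: "(real^'n::{finite,linorder}^'k::finite) set" and F :: "real^'n::{finite,linorder}^'k \<Rightarrow> complex^'s"
  assumes k2: "CARD('k) \<ge> 2" and open_\<Omega>: "open \<Omega>" and bounded_\<Omega>: "bounded \<Omega>"
    and smooth_bd: "smooth_boundary \<Omega>" and connected_ext: "connected (- closure \<Omega>)"
    and F: "F \<in> compact_sections UNIV (spinor_plus \<gamma>)"
    and weak: "\<And>A B \<eta>. \<eta> \<in> test_functions UNIV \<Longrightarrow> (\<integral>x. indicator \<Omega> x *\<^sub>R compat F A B \<eta> x \<partial>lborel) = 0"
begin

lemma F_test: "F \<in> test_functions UNIV" using F by (simp add: compact_sections_def sections_def)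

lemma smooth_F: "smooth_on UNIV F" and F_plus: "F x \<in> spinor_plus \<gamma>"
  using F by (auto simp: compact_sections_def sections_def)

text \<open>The right-hand side \<open>g\<close> of the equation \<open>D0 u = g\<close>, with its
  jump at the boundary.\<close>

definition dens :: "'k \<Rightarrow> real^'n::{finite,linorder}^'k \<Rightarrow> complex^'s" where
  "dens A y = indicator \<Omega> y *\<^sub>R nabla \<gamma> A F y"

definition mass :: real where
  "mass = sphere_const TYPE(real^'n::{finite,linorder}^'k)"

text \<open>For \<open>t = 0\<close> the solution \<open>u\<close>; for \<open>t > 0\<close> its
  smooth approximation.\<close>

definition potential :: "real \<Rightarrow> real^'n::{finite,linorder}^'k \<Rightarrow> complex^'s" where
  "potential t x = (- 1 / mass) *\<^sub>R (\<Sum>A\<in>UNIV. \<Sum>i\<in>UNIV. \<gamma> i *v conv (kern t (coord A i)) (dens A) x)"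

lemma mass_pos: "mass > 0" unfolding mass_def by (rule sphere_const_pos)

lemma dens: "compact_density (dens A)"
  unfolding dens_def[abs_def]
  by (rule compact_density_indicator[OF test_functions_density[OF nabla_test_functions[OF F_test]] borel_open[OF open_\<Omega>]])

lemma dens_outside: "y \<in> - closure \<Omega> \<Longrightarrow> dens A y = 0"
  using closure_subset[of \<Omega>] by (cases "y \<in> \<Omega>") (auto simp: dens_def)

lemma has_derivative_potential:
  assumes "\<And>A i. (conv (kern t (coord A i)) (dens A) has_derivative D A i) (at x)"
  shows "(potential t has_derivative (\<lambda>v. (- 1 / mass) *\<^sub>R (\<Sum>A\<in>UNIV. \<Sum>i\<in>UNIV. \<gamma> i *v D A i v))) (at x)"
  unfolding potential_def[abs_def]
  by (intro has_derivative_scaleR_right has_derivative_sum bounded_linear.has_derivative[OF bl_\<gamma>] assms)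

text \<open>The weak compatibility condition for the test function \<open>y \<mapsto> pot t (x -
  y)\<close>, cut off outside \<open>closure \<Omega>\<close>. Two derivatives in \<open>y\<close>
  are two derivatives in \<open>x\<close>, since the signs cancel.\<close>

lemma compat_translated_pot:
  assumes t: "t > 0"
  shows "(\<Sum>j\<in>UNIV. \<Sum>i\<in>UNIV. \<gamma> j *v (\<gamma> i *v conv (dderiv (coord C j) (kern t (coord A i))) (dens A) x))
     = - (\<Sum>i\<in>UNIV. conv (dderiv (coord A i) (kern t (coord A i))) (dens C) x)"
proof -
  have cc: "compact (closure \<Omega>)" using bounded_\<Omega> by (simp add: compact_closure)
  obtain \<kappa> :: "real^'n::{finite,linorder}^'k \<Rightarrow> real" and V L where \<kappa>: "smooth_on UNIV \<kappa>" "open V" "closure \<Omega> \<subseteq> V" "\<And>x. x \<in> V \<Longrightarrow> \<kappa> x = 1"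
    "compact L" "L \<subseteq> UNIV" "\<And>x. x \<notin> L \<Longrightarrow> \<kappa> x = 0"
    by (rule exists_smooth_cutoff[OF cc open_UNIV subset_UNIV]) (rule that; assumption)
  define p where "p y = pot t (x - y)" for y
  have refl_smooth: "smooth_on UNIV (\<lambda>y. g (x - y))" if "smooth_on UNIV g" for g :: "real^'n::{finite,linorder}^'k \<Rightarrow> real"
    using smooth_on_affine_compose[OF bounded_linear_minus[OF bounded_linear_ident] open_UNIV that, of x] by simp
  have sp: "smooth_on UNIV p" unfolding p_def[abs_def] by (rule refl_smooth[OF smooth_on_pot[OF t]])
  have dre: "dderiv v (\<lambda>y. g (x - y)) = (\<lambda>y. - dderiv v g (x - y))" if g: "smooth_on UNIV g" for v and g :: "real^'n::{finite,linorder}^'k \<Rightarrow> real"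
  proof
    fix y
    have 1: "(g has_derivative (\<lambda>v. dderiv v g (x - y))) (at (x - y))" by (rule smooth_on_has_derivative[OF g UNIV_I])
    have 2: "((\<lambda>y. x - y) has_derivative (\<lambda>v. - v)) (at y)" by (auto intro!: derivative_eq_intros)
    have "dderiv v (\<lambda>y. g (x - y)) y = dderiv (- v) g (x - y)"
      by (rule dderiv_eqI[OF has_derivative_compose[where f = "\<lambda>y. x - y" and g = g, OF 2 1]])
    then show "dderiv v (\<lambda>y. g (x - y)) y = - dderiv v g (x - y)"
      by (simp add: linear_neg[OF has_derivative_linear[OF 1]])
  qed
  have sk: "smooth_on UNIV (kern t w)" for w :: "real^'n::{finite,linorder}^'k" by (intro smooth_on_kern inner_self_plus_pos t open_UNIV)
  have ddp: "dderiv v (dderiv w p) y = dderiv v (kern t w) (x - y)" for v w y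
  proof -
    have "dderiv w p = (\<lambda>y. - kern t w (x - y))"
      unfolding p_def[abs_def] dre[OF smooth_on_pot[OF t]] dderiv_pot[OF t] ..
    then have "dderiv v (dderiv w p) y = - dderiv v (\<lambda>y. kern t w (x - y)) y"
      using dderiv_bounded_linear[OF bounded_linear_minus[OF bounded_linear_ident] smooth_on_differentiable[OF refl_smooth[OF sk] UNIV_I]] by simp
    then show ?thesis by (simp add: dre[OF sk])
  qed
  define \<eta> where "\<eta> y = \<kappa> y * p y" for y
  have \<eta>: "\<eta> \<in> test_functions UNIV"
  proof (rule compact_sectionsI[OF _ UNIV_I \<kappa>(5,6)])
    show "smooth_on UNIV \<eta>" unfolding \<eta>_def[abs_def] by (intro smooth_on_mult \<kappa>(1) sp open_UNIV)
  qed (simp add: \<eta>_def \<kappa>(7))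
  have dd\<eta>: "dderiv v (dderiv w \<eta>) y = dderiv v (kern t w) (x - y)" if y: "y \<in> \<Omega>" for v w y
  proof -
    have eq: "\<eta> z = p z" if "z \<in> \<Omega>" for z using \<kappa>(3,4) that closure_subset[of \<Omega>] by (auto simp: \<eta>_def)
    have "dderiv v (dderiv w \<eta>) y = dderiv v (dderiv w p) y"
      by (intro dderiv_transform_open[OF open_\<Omega> y] dderiv_transform_open[OF open_\<Omega>] eq)
    then show ?thesis by (simp only: ddp)
  qed
  define k where "k i j = dderiv (coord C j) (kern t (coord A i))" for i j :: 'n
  define l where "l i = dderiv (coord A i) (kern t (coord A i))" for i :: 'n
  have pt: "indicator \<Omega> y *\<^sub>R compat F C A \<eta> y
      = (\<Sum>j\<in>UNIV. \<Sum>i\<in>UNIV. k i j (x - y) *\<^sub>R (\<gamma> j *v (\<gamma> i *v dens A y))) + (\<Sum>i\<in>UNIV. l i (x - y) *\<^sub>R dens C y)" for y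
  proof (cases "y \<in> \<Omega>")
    case True
    then show ?thesis unfolding compat_def plap_def dd\<eta>[OF True] k_def l_def
      by (simp add: dens_def scaleR_sum_left)
  qed (simp add: dens_def)
  have lk: "locally_integrable (dderiv v (kern t w))" for v w :: "real^'n::{finite,linorder}^'k"
    by (intro locally_integrable_continuous smooth_on_continuous smooth_on_dderiv sk)
  have bl2: "bounded_linear (\<lambda>u. \<gamma> j *v (\<gamma> i *v u))" for i j by (rule bounded_linear_compose[OF bl_\<gamma> bl_\<gamma>])
  have i1: "integrable lborel (\<lambda>y. k i j (x - y) *\<^sub>R (\<gamma> j *v (\<gamma> i *v dens A y)))" for i j
    unfolding k_def by (rule conv_integrable[OF lk compact_density_bounded_linear[OF dens bl2]])
  have i2: "integrable lborel (\<lambda>y. l i (x - y) *\<^sub>R dens C y)" for i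
    unfolding l_def by (rule conv_integrable[OF lk dens])
  have "0 = (\<integral>y. (\<Sum>j\<in>UNIV. \<Sum>i\<in>UNIV. k i j (x - y) *\<^sub>R (\<gamma> j *v (\<gamma> i *v dens A y))) + (\<Sum>i\<in>UNIV. l i (x - y) *\<^sub>R dens C y) \<partial>lborel)"
    using weak[OF \<eta>, of C A] by (simp only: pt)
  also have "\<dots> = (\<integral>y. (\<Sum>j\<in>UNIV. \<Sum>i\<in>UNIV. k i j (x - y) *\<^sub>R (\<gamma> j *v (\<gamma> i *v dens A y))) \<partial>lborel) + (\<integral>y. (\<Sum>i\<in>UNIV. l i (x - y) *\<^sub>R dens C y) \<partial>lborel)"
    by (intro Bochner_Integration.integral_add Bochner_Integration.integrable_sum i1 i2)
  also have "(\<integral>y. (\<Sum>j\<in>UNIV. \<Sum>i\<in>UNIV. k i j (x - y) *\<^sub>R (\<gamma> j *v (\<gamma> i *v dens A y))) \<partial>lborel)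
      = (\<Sum>j\<in>UNIV. \<Sum>i\<in>UNIV. conv (k i j) (\<lambda>y. \<gamma> j *v (\<gamma> i *v dens A y)) x)"
    unfolding conv_def
    by (subst Bochner_Integration.integral_sum, intro Bochner_Integration.integrable_sum i1,
        intro sum.cong refl Bochner_Integration.integral_sum i1)
  also have "\<dots> = (\<Sum>j\<in>UNIV. \<Sum>i\<in>UNIV. \<gamma> j *v (\<gamma> i *v conv (k i j) (dens A) x))"
    unfolding k_def by (intro sum.cong refl conv_bounded_linear[OF lk dens bl2])
  also have "(\<integral>y. (\<Sum>i\<in>UNIV. l i (x - y) *\<^sub>R dens C y) \<partial>lborel) = (\<Sum>i\<in>UNIV. conv (l i) (dens C) x)"
    unfolding conv_def by (intro Bochner_Integration.integral_sum i2)
  finally show ?thesis unfolding k_def l_def by (simp add: eq_neg_iff_add_eq_0)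
qed

lemma nabla_potential_pos:
  assumes t: "t > 0"
  shows "nabla \<gamma> C (potential t) x = (1 / mass) *\<^sub>R conv (rho t) (dens C) x"
proof -
  have sk: "smooth_on UNIV (kern t w)" for w :: "real^'n::{finite,linorder}^'k" by (intro smooth_on_kern inner_self_plus_pos t open_UNIV)
  have lk: "locally_integrable (dderiv v (kern t w))" for v w :: "real^'n::{finite,linorder}^'k"
    by (intro locally_integrable_continuous smooth_on_continuous smooth_on_dderiv sk)
  have d: "dderiv v (potential t) x = (- 1 / mass) *\<^sub>R (\<Sum>A\<in>UNIV. \<Sum>i\<in>UNIV. \<gamma> i *v conv (dderiv v (kern t (coord A i))) (dens A) x)" for v
    by (rule dderiv_eqI[OF has_derivative_potential[OF conv_has_derivative_smooth_kernel[OF smooth_onD[OF sk] dens]]])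
  have "nabla \<gamma> C (potential t) x = (- 1 / mass) *\<^sub>R
      (\<Sum>j\<in>UNIV. \<Sum>A\<in>UNIV. \<Sum>i\<in>UNIV. \<gamma> j *v (\<gamma> i *v conv (dderiv (coord C j) (kern t (coord A i))) (dens A) x))"
    unfolding nabla_dderiv d \<gamma>_scaleR \<gamma>_sum scaleR_sum_right ..
  also have "\<dots> = (- 1 / mass) *\<^sub>R
      (\<Sum>A\<in>UNIV. \<Sum>j\<in>UNIV. \<Sum>i\<in>UNIV. \<gamma> j *v (\<gamma> i *v conv (dderiv (coord C j) (kern t (coord A i))) (dens A) x))"
    by (subst sum.swap) (rule refl)
  also have "\<dots> = (- 1 / mass) *\<^sub>R (\<Sum>A\<in>UNIV. - (\<Sum>i\<in>UNIV. conv (dderiv (coord A i) (kern t (coord A i))) (dens C) x))"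
    by (simp only: compat_translated_pot[OF t])
  also have "\<dots> = (1 / mass) *\<^sub>R (\<Sum>A\<in>UNIV. \<Sum>i\<in>UNIV. conv (dderiv (coord A i) (kern t (coord A i))) (dens C) x)"
    by (simp add: sum_negf)
  also have "(\<Sum>A\<in>UNIV. \<Sum>i\<in>UNIV. conv (dderiv (coord A i) (kern t (coord A i))) (dens C) x)
      = (\<Sum>e\<in>Basis. conv (dderiv e (kern t e)) (dens C) x)"
    by (rule sum_Basis_coord[symmetric])
  also have "\<dots> = conv (\<lambda>z. \<Sum>e\<in>Basis. dderiv e (kern t e) z) (dens C) x"
    by (rule conv_sum_kernel[OF lk dens, symmetric])
  also have "(\<lambda>z. \<Sum>e\<in>Basis. dderiv e (kern t e) z) = (rho t :: real^'n::{finite,linorder}^'k \<Rightarrow> real)"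
    by (rule ext) (rule sum_dderiv_kern[OF inner_self_plus_pos[OF t]])
  finally show ?thesis .
qed

text \<open>Off the boundary the density is smooth near \<open>p\<close>: inside because
  \<open>F\<close> is, outside because it is zero.\<close>

lemma dens_split:
  assumes p: "p \<notin> frontier \<Omega>"
  obtains h1 f2 V where "h1 \<in> test_functions UNIV" "compact_density f2" "open V" "p \<in> V" "\<And>y. y \<in> V \<Longrightarrow> f2 y = 0"
    "dens A = (\<lambda>x. h1 x + f2 x)"
proof (cases "p \<in> \<Omega>")
  case True
  have sn: "smooth_on UNIV (nabla \<gamma> A F)" by (rule smooth_on_nabla[OF open_UNIV smooth_F])
  obtain h1 f2 V where s: "h1 \<in> test_functions \<Omega>" "compact_density f2" "open V" "p \<in> V" "\<And>y. y \<in> V \<Longrightarrow> f2 y = 0"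
    "(\<lambda>x. indicator \<Omega> x *\<^sub>R nabla \<gamma> A F x) = (\<lambda>x. indicator \<Omega> x *\<^sub>R h1 x + f2 x)"
    by (rule split_density_at_point[OF open_\<Omega> open_\<Omega> True sn dens[unfolded dens_def[abs_def]]]) (rule that; assumption)
  have "indicator \<Omega> x *\<^sub>R h1 x = h1 x" for x
  proof (cases "x \<in> \<Omega>")
    case False
    then have "h1 x = 0" using compact_sectionsE[OF s(1)] by (metis subsetD)
    then show ?thesis by simp
  qed simp
  then have "dens A = (\<lambda>x. h1 x + f2 x)" using s(6) by (simp add: dens_def[abs_def])
  then show ?thesis using that[OF test_functions_mono[OF s(1) subset_UNIV] s(2-5)] by blast
next
  case False
  then have "p \<in> - closure \<Omega>" using p open_\<Omega> by (simp add: frontier_def interior_open)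
  moreover have "dens A y = 0" if "y \<in> - closure \<Omega>" for y using that by (rule dens_outside)
  moreover have "(\<lambda>x::real^'n::{finite,linorder}^'k. 0::complex^'s) \<in> test_functions UNIV" by (rule compact_sectionsI[where K = "{}"]) auto
  ultimately show ?thesis using that[of "\<lambda>x. 0" "dens A" "- closure \<Omega>"] dens open_Compl[OF closed_closure[of \<Omega>]] by simp
qed

lemma potential_regular:
  assumes p: "p \<notin> frontier \<Omega>" and T: "T \<longlonglongrightarrow> 0" "\<And>n. T n > 0"
  shows "\<exists>B. open B \<and> p \<in> B \<and> smooth_on B (potential 0)"
    and "(\<lambda>n. dderiv v (potential (T n)) p) \<longlonglongrightarrow> dderiv v (potential 0) p"
proof -
  have r: "(\<exists>B. open B \<and> p \<in> B \<and> smooth_on B (conv (kern 0 e) (dens A))) \<and>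
     (\<forall>v. (\<lambda>n. dderiv v (conv (kern (T n) e) (dens A)) p) \<longlonglongrightarrow> dderiv v (conv (kern 0 e) (dens A)) p)" for e A
  proof -
    obtain h1 f2 V where s: "h1 \<in> test_functions UNIV" "compact_density f2" "open V" "p \<in> V" "\<And>y. y \<in> V \<Longrightarrow> f2 y = 0"
      "dens A = (\<lambda>x. h1 x + f2 x)"
      by (rule dens_split[OF p]) (rule that; assumption)
    show ?thesis unfolding s(6) using conv_interior_regular[OF s(1-5) T] by blast
  qed
  from choice2[of "\<lambda>A i B. open B \<and> p \<in> B \<and> smooth_on B (conv (kern 0 (coord A i)) (dens A))", OF conjunct1[OF r]]
  obtain B where "\<forall>A i. open (B A i) \<and> p \<in> B A i \<and> smooth_on (B A i) (conv (kern 0 (coord A i)) (dens A))" ..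
  then have B: "\<And>A i. open (B A i)" "\<And>A i. p \<in> B A i" "\<And>A i. smooth_on (B A i) (conv (kern 0 (coord A i)) (dens A))"
    by simp_all
  define B0 where "B0 = (\<Inter>A. \<Inter>i. B A i)"
  have B0: "open B0" "p \<in> B0" "B0 \<subseteq> B A i" for A i
    unfolding B0_def using B(1,2) by (auto intro!: open_INT)
  have "smooth_on B0 (potential 0)" unfolding potential_def[abs_def]
    by (intro smooth_on_scaleR smooth_on_const smooth_on_sum smooth_on_bounded_linear_compose[OF bl_\<gamma>]
        smooth_on_subset[OF B(3) B0(3)] B0(1))
  then show "\<exists>B. open B \<and> p \<in> B \<and> smooth_on B (potential 0)" using B0(1,2) by blast
  have d0: "dderiv v (potential 0) p = (- 1 / mass) *\<^sub>R (\<Sum>A\<in>UNIV. \<Sum>i\<in>UNIV. \<gamma> i *v dderiv v (conv (kern 0 (coord A i)) (dens A)) p)"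
    by (rule dderiv_eqI[OF has_derivative_potential[OF smooth_on_has_derivative[OF B(3) B(2)]]])
  have dn: "dderiv v (potential (T n)) p = (- 1 / mass) *\<^sub>R (\<Sum>A\<in>UNIV. \<Sum>i\<in>UNIV. \<gamma> i *v dderiv v (conv (kern (T n) (coord A i)) (dens A)) p)" for n
    by (rule dderiv_eqI[OF has_derivative_potential[OF smooth_on_has_derivative[OF smooth_on_conv_kern_pos[OF T(2) dens] UNIV_I]]])
  show "(\<lambda>n. dderiv v (potential (T n)) p) \<longlonglongrightarrow> dderiv v (potential 0) p"
    unfolding d0 dn
    by (intro tendsto_scaleR tendsto_const tendsto_sum bounded_linear.tendsto[OF bl_\<gamma>]) (rule conjunct2[OF r, THEN spec])
qed

text \<open>Both sides of the equation for \<open>t > 0\<close> converge at \<open>p\<close>: the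
  left one by regularity of potentials off the boundary, the right one because the density is
  continuous at \<open>p\<close>.\<close>

lemma nabla_potential:
  assumes p: "p \<notin> frontier \<Omega>"
  shows "nabla \<gamma> C (potential 0) p = dens C p"
proof -
  define T where "T n = inverse (real (Suc n))" for n
  have T: "T \<longlonglongrightarrow> 0" "\<And>n. T n > 0" unfolding T_def[abs_def] using inverse_Suc_seq by auto
  have "isCont (dens C) p"
  proof (cases "p \<in> \<Omega>")
    case True
    have "continuous_on \<Omega> (nabla \<gamma> C F)"
      by (rule continuous_on_subset[OF smooth_on_continuous[OF smooth_on_nabla[OF open_UNIV smooth_F]] subset_UNIV])
    then have "continuous_on \<Omega> (dens C)" by (rule continuous_on_eq) (simp add: dens_def)
    then show ?thesis using continuous_on_eq_continuous_at[OF open_\<Omega>] True by blast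
  next
    case False
    then have pe: "p \<in> - closure \<Omega>" using p open_\<Omega> by (simp add: frontier_def interior_open)
    have "continuous_on (- closure \<Omega>) (dens C)"
      by (rule continuous_on_eq[OF continuous_on_const[of _ 0]]) (simp add: dens_outside)
    then show ?thesis using continuous_on_eq_continuous_at[OF open_Compl[OF closed_closure]] pe by blast
  qed
  from tendsto_scaleR[OF tendsto_const conv_rho_tendsto[OF T dens this], of "1 / mass"]
  have 1: "(\<lambda>n. nabla \<gamma> C (potential (T n)) p) \<longlonglongrightarrow> dens C p"
    using mass_pos by (simp add: nabla_potential_pos[OF T(2)] mass_def)
  have 2: "(\<lambda>n. nabla \<gamma> C (potential (T n)) p) \<longlonglongrightarrow> nabla \<gamma> C (potential 0) p"
    unfolding nabla_dderiv by (intro tendsto_sum bounded_linear.tendsto[OF bl_\<gamma>] potential_regular(2)[OF p T])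
  show ?thesis by (rule LIMSEQ_unique[OF 2 1])
qed

lemma smooth_on_potential:
  assumes "S \<inter> frontier \<Omega> = {}"
  shows "smooth_on S (potential 0)"
proof (rule smooth_on_local)
  fix p assume "p \<in> S"
  then have "p \<notin> frontier \<Omega>" using assms by blast
  then show "\<exists>B. open B \<and> p \<in> B \<and> smooth_on B (potential 0)" by (rule potential_regular(1)[OF _ inverse_Suc_seq])
qed

lemma continuous_potential: "continuous_on UNIV (potential 0)"
  unfolding potential_def[abs_def]
  by (intro continuous_on_scaleR continuous_on_const continuous_on_sum bounded_linear.continuous_on[OF bl_\<gamma>]
      continuous_on_conv_kern dens)

lemma potential_decay: "(potential 0 \<longlongrightarrow> 0) at_infinity"
proof -
  have "DIM(real^'n::{finite,linorder}^'k) = CARD('k) * CARD('n)" by simp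
  moreover have "CARD('n) \<ge> 1" by (simp add: Suc_leI)
  ultimately have dim: "DIM(real^'n::{finite,linorder}^'k) \<ge> 2" using k2 mult_le_mono[of 2 "CARD('k)" 1 "CARD('n)"] by simp
  have "(potential 0 \<longlongrightarrow> (- 1 / mass) *\<^sub>R (\<Sum>A\<in>(UNIV :: 'k set). \<Sum>i\<in>(UNIV :: 'n set). \<gamma> i *v 0)) at_infinity"
    unfolding potential_def[abs_def]
    by (intro tendsto_scaleR tendsto_const tendsto_sum bounded_linear.tendsto[OF bl_\<gamma>] conv_kern_decay[OF dens dim])
  then show ?thesis by simp
qed

text \<open>With \<open>x\<^sub>A\<close> fixed outside the projection of \<open>\<Omega>\<close>,
  the whole slice in another variable \<open>x\<^sub>B\<close> lies in the exterior. There
  \<open>\<nabla>\<^sub>B u = 0\<close>, hence \<open>\<Delta>\<^sub>B u = 0\<close>.\<close>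

lemma potential_far: 
  assumes R: "closure \<Omega> \<subseteq> cball 0 R" and x: "norm (x $ A) > R"
  shows "potential 0 x = 0"
proof -
  obtain B :: 'k where B: "B \<noteq> A"
  proof -
    have "UNIV \<noteq> {A}" using k2 by (metis card_1_singleton_iff One_nat_def Suc_1 not_less_eq_eq order_refl)
    then show thesis using that by blast
  qed
  have ext: "nabla \<gamma> B (potential 0) y = 0" if "y \<in> - closure \<Omega>" for y
  proof -
    have "y \<notin> frontier \<Omega>" using that by (simp add: frontier_def)
    moreover have "dens B y = 0" using that by (rule dens_outside)
    ultimately show ?thesis using nabla_potential by simp
  qed
  have op: "open (- closure \<Omega>)" by (rule open_Compl[OF closed_closure])
  have sm: "smooth_on (- closure \<Omega>) (potential 0)" by (rule smooth_on_potential) (auto simp: frontier_def)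
  define S where "S = range (coord B :: 'n \<Rightarrow> real^'n::{finite,linorder}^'k)"
  show ?thesis
  proof (rule decaying_slice_harmonic_zero[OF _ _ op sm _ _ potential_decay])
    show "S \<subseteq> Basis" "S \<noteq> {}" unfolding S_def using coord_in_Basis by auto
    show "y \<in> - closure \<Omega>" if y: "\<And>i. i \<in> Basis - S \<Longrightarrow> y \<bullet> i = x \<bullet> i" for y
    proof -
      have "y $ A $ j = x $ A $ j" for j
      proof -
        have "coord A j \<notin> S" using B by (auto simp: S_def axis_eq_axis)
        then show ?thesis using y[of "coord A j"] coord_in_Basis[of A j] by (simp only: Diff_iff simp_thms inner_coord)
      qed
      then have "y $ A = x $ A" by (simp add: vec_eq_iff)
      then have "norm y > R" using x Finite_Cartesian_Product.norm_nth_le[of y A] by simp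
      then show ?thesis using R by auto
    qed
    show "(\<Sum>i\<in>S. dderiv i (dderiv i (potential 0)) y) = 0" if y: "y \<in> - closure \<Omega>" for y
    proof -
      have inj: "inj (coord B :: 'n \<Rightarrow> real^'n::{finite,linorder}^'k)" by (auto simp: inj_on_def axis_eq_axis)
      have "(\<Sum>i\<in>S. dderiv i (dderiv i (potential 0)) y) = plap B (potential 0) y"
        unfolding S_def plap_def by (subst sum.reindex[OF inj]) simp
      also have "\<dots> = - nabla \<gamma> B (nabla \<gamma> B (potential 0)) y" using nabla_square[OF op sm y] by simp
      also have "nabla \<gamma> B (nabla \<gamma> B (potential 0)) y = nabla \<gamma> B (\<lambda>_. 0) y" by (rule nabla_transform_open[OF op y ext])
      also have "\<dots> = 0"
      proof -
        have "dderiv v (\<lambda>_::real^'n::{finite,linorder}^'k. 0 :: complex^'s) y = 0" for v by (rule dderiv_eqI) simp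
        then show ?thesis by (simp add: nabla_dderiv)
      qed
      finally show ?thesis by simp
    qed
  qed
qed

lemma potential_exterior:
  assumes x: "x \<notin> \<Omega>"
  shows "potential 0 x = 0"
proof -
  obtain R where "\<forall>x\<in>closure \<Omega>. norm x \<le> R"
    using bounded_closure[OF bounded_\<Omega>] unfolding bounded_iff by blast
  then have R: "closure \<Omega> \<subseteq> cball 0 R" by auto
  \<comment> \<open>the coordinates of a basis vector, needed to index the densities by the basis as
    unique continuation demands\<close>
  define idx where "idx = inv (\<lambda>(A, i). coord A i :: real^'n::{finite,linorder}^'k)"
  have inj: "inj (\<lambda>(A, j). coord A j :: real^'n::{finite,linorder}^'k)" by (auto simp: inj_on_def axis_eq_axis)
  have idx: "idx (coord A i) = (A, i)" for A i
    unfolding idx_def using inv_f_f[OF inj, of "(A, i)"] by simp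
  define f where "f e y = (- 1 / mass) *\<^sub>R (\<gamma> (snd (idx e)) *v dens (fst (idx e)) y)" for e y
  have bl: "bounded_linear (\<lambda>u. (- 1 / mass) *\<^sub>R (\<gamma> i *v u))" for i
    by (rule bounded_linear_compose[OF bounded_linear_scaleR_right bl_\<gamma>])
  have fd: "compact_density (f e)" for e
    unfolding f_def[abs_def] by (rule compact_density_bounded_linear[OF dens bl])
  have pf: "potential 0 y = (\<Sum>e\<in>Basis. conv (kern 0 e) (f e) y)" for y
    unfolding potential_def sum_Basis_coord f_def idx fst_conv snd_conv scaleR_sum_right
    by (intro sum.cong refl conv_bounded_linear[OF locally_integrable_kern[OF order_refl] dens bl, symmetric])
  define A0 :: 'k where "A0 = undefined"
  define O' :: "(real^'n::{finite,linorder}^'k) set" where "O' = {y. norm (y $ A0) > R}"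
  have "open O'" unfolding O'_def by (intro open_Collect_less continuous_intros)
  moreover have "O' \<noteq> {}"
  proof -
    have "R < norm (axis (undefined :: 'n) (\<bar>R\<bar> + 1) :: real^'n::{finite,linorder})"
      using Finite_Cartesian_Product.norm_nth_le[of "axis (undefined :: 'n) (\<bar>R\<bar> + 1) :: real^'n::{finite,linorder}" undefined]
      by (simp add: axis_nth)
    then have "axis A0 (axis undefined (\<bar>R\<bar> + 1)) \<in> O'" by (simp add: O'_def axis_nth)
    then show ?thesis by blast
  qed
  moreover have "O' \<subseteq> - closure \<Omega>"
  proof
    fix y assume "y \<in> O'"
    then have "norm y > R" using Finite_Cartesian_Product.norm_nth_le[of y A0] by (simp add: O'_def)
    then show "y \<in> - closure \<Omega>" using R by auto
  qed
  moreover have fz: "f e z = 0" if "z \<notin> closure \<Omega>" for e z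
    using dens_outside[of z] that linear_0[OF bounded_linear.linear[OF bl]] by (simp add: f_def)
  moreover have far: "(\<Sum>e\<in>Basis. conv (kern 0 e) (f e) z) = 0" if "z \<in> O'" for z
    using potential_far[OF R, of z A0] that unfolding pf O'_def by simp
  moreover have cc: "compact (closure \<Omega>)" using bounded_\<Omega> by (simp add: compact_closure)
  ultimately have ext: "potential 0 y = 0" if y: "y \<in> - closure \<Omega>" for y
    unfolding pf
    by (intro potential_unique_continuation[OF fd cc fz open_Compl[OF closed_closure] connected_ext _ _ _ _ far y]) auto
  show ?thesis
  proof (cases "x \<in> closure \<Omega>")
    case False
    then show ?thesis using ext by simp
  next
    case True
    then have "x \<in> frontier \<Omega>" using x open_\<Omega> by (simp add: frontier_def interior_open)
    then have "x \<in> closure (- closure \<Omega>)" by (rule smooth_boundary_exterior[OF smooth_bd open_\<Omega>])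
    then show ?thesis
      using continuous_constant_on_closure[OF continuous_on_subset[OF continuous_potential subset_UNIV] ext] by blast
  qed
qed

lemma potential_boundary_regular:
  assumes p: "p \<in> frontier \<Omega>"
  shows "\<exists>B H. open B \<and> p \<in> B \<and> Cm_on m B H \<and> (\<forall>x\<in>\<Omega> \<inter> B. potential 0 x = H x)"
proof -
  have ex: "\<exists>z. open (fst z) \<and> p \<in> fst z \<and> Cm_on m (fst z) (snd z) \<and>
      (\<forall>x\<in>\<Omega> \<inter> fst z. conv (kern 0 (coord A i)) (dens A) x = snd z x)" for A i
  proof -
    obtain B H where "open B" "p \<in> B" "Cm_on m B H"
      "\<And>x. x \<in> \<Omega> \<inter> B \<Longrightarrow> conv (kern 0 (coord A i)) (\<lambda>x. indicator \<Omega> x *\<^sub>R nabla \<gamma> A F x) x = H x"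
      by (rule conv_boundary_regular[OF smooth_bd open_\<Omega> p smooth_on_nabla[OF open_UNIV smooth_F] dens[unfolded dens_def[abs_def]]])
        (rule that; assumption)
    then show ?thesis unfolding dens_def[abs_def] by (intro exI[of _ "(B, H)"]) simp
  qed
  from choice2[of "\<lambda>A i z. open (fst z) \<and> p \<in> fst z \<and> Cm_on m (fst z) (snd z) \<and>
      (\<forall>x\<in>\<Omega> \<inter> fst z. conv (kern 0 (coord A i)) (dens A) x = snd z x)", OF ex]
  obtain Z where Z: "\<forall>A i. open (fst (Z A i)) \<and> p \<in> fst (Z A i) \<and> Cm_on m (fst (Z A i)) (snd (Z A i)) \<and>
      (\<forall>x\<in>\<Omega> \<inter> fst (Z A i). conv (kern 0 (coord A i)) (dens A) x = snd (Z A i) x)" ..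
  define B where "B A i = fst (Z A i)" for A i
  define H where "H A i = snd (Z A i)" for A i
  have B: "\<And>A i. open (B A i)" "\<And>A i. p \<in> B A i" "\<And>A i. Cm_on m (B A i) (H A i)"
    "\<And>A i x. x \<in> \<Omega> \<inter> B A i \<Longrightarrow> conv (kern 0 (coord A i)) (dens A) x = H A i x"
    using Z by (simp_all add: B_def H_def)
  define B0 where "B0 = (\<Inter>A. \<Inter>i. B A i)"
  have B0: "open B0" "p \<in> B0" "B0 \<subseteq> B A i" for A i
    unfolding B0_def using B(1,2) by (auto intro!: open_INT)
  define H0 where "H0 x = (- 1 / mass) *\<^sub>R (\<Sum>A\<in>UNIV. \<Sum>i\<in>UNIV. \<gamma> i *v H A i x)" for x
  have "Cm_on m B0 H0" unfolding H0_def[abs_def]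
    by (intro Cm_on_bilinear[OF bounded_bilinear_scaleR] Cm_on_const Cm_on_sum Cm_on_bounded_linear_compose[OF bl_\<gamma>]
        Cm_on_subset[OF B(3) B0(3)] B0(1))
  moreover have "potential 0 x = H0 x" if x: "x \<in> \<Omega> \<inter> B0" for x
  proof -
    have "conv (kern 0 (coord A i)) (dens A) x = H A i x" for A i using B(4)[of x A i] x B0(3) by blast
    then show ?thesis by (simp only: potential_def H0_def)
  qed
  ultimately show ?thesis using B0(1,2) by blast
qed

lemma monogenic_extension:
  "\<exists>G \<in> monogenic \<gamma> \<Omega>. smooth_up_to_boundary \<Omega> G \<and> (\<forall>x\<in>frontier \<Omega>. G x = F x)"
proof -
  define G where "G x = F x - potential 0 x" for x
  have disj: "\<Omega> \<inter> frontier \<Omega> = {}" using open_\<Omega> by (auto simp: frontier_def interior_open)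
  have sF: "smooth_on \<Omega> F" by (rule smooth_on_subset[OF smooth_F subset_UNIV])
  have sP: "smooth_on \<Omega> (potential 0)" by (rule smooth_on_potential[OF disj])
  have sG: "smooth_on \<Omega> G" unfolding G_def[abs_def] by (rule smooth_on_diff[OF open_\<Omega> sF sP])
  obtain L :: "complex^'s \<Rightarrow> complex^'s" where L: "bounded_linear L" "spinor_plus \<gamma> = {u. L u = 0}"
    using spinor_plus_linear[of \<gamma>] by blast
  note Ll = bounded_linear.linear[OF L(1)]
  have Ld: "L (\<gamma> i *v dens A y) = 0" for i A y
  proof -
    have "nabla \<gamma> A F y \<in> spinor_minus \<gamma>" by (rule nabla_in_minus[OF open_UNIV UNIV_I smooth_F F_plus])
    then have "L (\<gamma> i *v nabla \<gamma> A F y) = 0" using \<gamma>_minus L(2) by blast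
    then show ?thesis by (simp add: dens_def \<gamma>_scaleR linear_scale[OF Ll])
  qed
  have LP: "L (potential 0 x) = 0" for x
  proof -
    have "L (\<gamma> i *v conv (kern 0 e) (dens A) x) = conv (kern 0 e) (\<lambda>y. L (\<gamma> i *v dens A y)) x" for i e A
      by (rule conv_bounded_linear[OF locally_integrable_kern[OF order_refl] dens bounded_linear_compose[OF L(1) bl_\<gamma>], symmetric])
    then have "L (\<gamma> i *v conv (kern 0 e) (dens A) x) = 0" for i e A by (simp add: Ld conv_def)
    then show ?thesis unfolding potential_def by (simp only: linear_scale[OF Ll] linear_sum[OF Ll] sum.neutral_const scaleR_zero_right)
  qed
  have plus: "G x \<in> spinor_plus \<gamma>" for x
    using F_plus[of x] LP[of x] unfolding L(2) G_def by (simp add: linear_diff[OF Ll])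
  have "D0 \<gamma> G x = 0" if x: "x \<in> \<Omega>" for x
  proof -
    have "nabla \<gamma> A G x = 0" for A
    proof -
      have "dderiv v G x = dderiv v F x - dderiv v (potential 0) x" for v
        unfolding G_def[abs_def]
        by (rule dderiv_eqI[OF has_derivative_diff[OF smooth_on_has_derivative[OF sF x] smooth_on_has_derivative[OF sP x]]])
      then have "nabla \<gamma> A G x = nabla \<gamma> A F x - nabla \<gamma> A (potential 0) x"
        by (simp only: nabla_dderiv \<gamma>_diff sum_subtractf)
      also have "nabla \<gamma> A (potential 0) x = nabla \<gamma> A F x"
        using nabla_potential[of x A] disj x by (auto simp: dens_def)
      finally show ?thesis by simp
    qed
    then show ?thesis by (simp add: D0_def vec_eq_iff)
  qed
  then have mono: "G \<in> monogenic \<gamma> \<Omega>" using sG plus by (simp add: monogenic_def sections_def)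
  have bd: "G x = F x" if "x \<in> frontier \<Omega>" for x
    using potential_exterior[of x] that disj by (auto simp: G_def)
  have "smooth_up_to_boundary \<Omega> G"
  proof (rule smooth_up_to_boundaryI[OF open_\<Omega> sG])
    show "continuous_on (closure \<Omega>) G" unfolding G_def[abs_def]
      by (intro continuous_on_diff continuous_on_subset[OF continuous_potential] continuous_on_subset[OF smooth_on_continuous[OF smooth_F]] subset_UNIV)
    fix p m assume "p \<in> frontier \<Omega>"
    then obtain B H where B: "open B" "p \<in> B" "Cm_on m B H" "\<forall>x\<in>\<Omega> \<inter> B. potential 0 x = H x"
      using potential_boundary_regular by blast
    have "Cm_on m B (\<lambda>x. F x + (- 1) *\<^sub>R H x)"
      by (intro Cm_on_add Cm_on_bilinear[OF bounded_bilinear_scaleR] Cm_on_const B(1,3) Cm_on_subset[OF smooth_onD[OF smooth_F]] subset_UNIV)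
    moreover have "G x = F x + (- 1) *\<^sub>R H x" if "x \<in> \<Omega> \<inter> B" for x using B(4) that by (simp add: G_def)
    ultimately show "\<exists>B H. open B \<and> p \<in> B \<and> Cm_on m B H \<and> (\<forall>x\<in>\<Omega> \<inter> B. G x = H x)"
      using B(1,2) by blast
  qed
  then show ?thesis using mono bd by blast
qed

end

section \<open>The extension theorem\<close>

theorem theorem1p2:
  fixes \<gamma> :: "'n::{finite,linorder} \<Rightarrow> complex^'s^'s"
    and \<Omega> :: "(real^'n::{finite,linorder}^'k::finite) set"
    and f :: "real^'n::{finite,linorder}^'k \<Rightarrow> complex^'s"
  assumes "CARD('k) \<ge> 2"
    and "spinor_module \<gamma>"
    and "open \<Omega>" and "connected \<Omega>" and "\<Omega> \<noteq> {}" and "bounded \<Omega>"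
    and "smooth_boundary \<Omega>"
    and "connected (- closure \<Omega>)"
    and "f \<in> hypersurface_sections (frontier \<Omega>) (spinor_plus \<gamma>)"
    and "tangentially_monogenic \<gamma> \<Omega> f"
  shows "\<exists>F \<in> monogenic \<gamma> \<Omega>. smooth_up_to_boundary \<Omega> F \<and> (\<forall>x\<in>frontier \<Omega>. F x = f x)"
proof -
  interpret clifford_module \<gamma>
    using assms(2) unfolding spinor_module_def by unfold_locales blast+
  obtain U F where U: "open U" "frontier \<Omega> \<subseteq> U" and Fs: "F \<in> sections U (spinor_plus \<gamma>)"
    "\<And>x. x \<in> frontier \<Omega> \<Longrightarrow> F x = f x" "D0 \<gamma> F \<in> J1 \<gamma> \<Omega> U"
    using assms(10) unfolding tangentially_monogenic_def by blast
  have cf: "compact (frontier \<Omega>)" using assms(6) by (rule compact_frontier_bounded)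
  obtain \<kappa> :: "real^'n::{finite,linorder}^'k \<Rightarrow> real" and V L where \<kappa>: "smooth_on UNIV \<kappa>" "open V" "frontier \<Omega> \<subseteq> V" "\<And>x. x \<in> V \<Longrightarrow> \<kappa> x = 1"
    "compact L" "L \<subseteq> U" "\<And>x. x \<notin> L \<Longrightarrow> \<kappa> x = 0"
    by (rule exists_smooth_cutoff[OF cf U]) (rule that; assumption)
  define F1 where "F1 x = \<kappa> x *\<^sub>R F x" for x
  have sF: "smooth_on U F" "\<And>x. x \<in> U \<Longrightarrow> F x \<in> spinor_plus \<gamma>" using Fs(1) by (auto simp: sections_def)
  have \<kappa>t: "\<kappa> \<in> test_functions U" by (rule compact_sectionsI[OF \<kappa>(1) UNIV_I \<kappa>(5-7)])
  have F1t: "F1 \<in> test_functions U" unfolding F1_def[abs_def]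
    using test_functions_bilinear[OF bounded_bilinear.flip[OF bounded_bilinear_scaleR] U(1) sF(1) \<kappa>t] .
  obtain M :: "complex^'s \<Rightarrow> complex^'s" where M: "bounded_linear M" "spinor_plus \<gamma> = {u. M u = 0}"
    using spinor_plus_linear[of \<gamma>] by blast
  note Ml = bounded_linear.linear[OF M(1)]
  have F1S: "F1 x \<in> spinor_plus \<gamma>" for x
  proof (cases "x \<in> U")
    case True
    then show ?thesis using sF(2)[OF True] by (simp add: F1_def M(2) linear_scale[OF Ml])
  next
    case False
    then have "x \<notin> L" using \<kappa>(6) by blast
    then show ?thesis by (simp add: F1_def \<kappa>(7) M(2) linear_0[OF Ml])
  qed
  have sF1: "smooth_on UNIV F1" using F1t by (simp add: compact_sections_def sections_def)
  have F1c: "F1 \<in> compact_sections UNIV (spinor_plus \<gamma>)"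
    using F1t F1S by (simp add: compact_sections_def sections_def)
  have F1F: "F1 x = F x" if "x \<in> V \<inter> U" for x using \<kappa>(4) that by (simp add: F1_def)
  interpret dirac_extension_data \<gamma> \<Omega> F1
  proof (unfold_locales)
    show "(\<integral>x. indicator \<Omega> x *\<^sub>R compat F1 A B \<eta> x \<partial>lborel) = 0" if "\<eta> \<in> test_functions UNIV" for A B \<eta>
      by (rule weak_compat[OF U(1) assms(3,6) Fs(1,3) sF1 open_Int[OF \<kappa>(2) U(1)] _ _ F1F that]) (use \<kappa>(3) U(2) in auto)
  qed (fact assms F1c)+
  have F1f: "F1 x = f x" if "x \<in> frontier \<Omega>" for x
  proof -
    have "x \<in> V \<inter> U" using that \<kappa>(3) U(2) by blast
    then show ?thesis using F1F Fs(2)[OF that] by simp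
  qed
  obtain G where G: "G \<in> monogenic \<gamma> \<Omega>" "smooth_up_to_boundary \<Omega> G" "\<forall>x\<in>frontier \<Omega>. G x = F1 x"
    using monogenic_extension by (elim bexE conjE) (rule that)
  show ?thesis by (rule bexI[OF _ G(1)]) (simp add: G(2,3) F1f)
qed

end
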